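(* Let $G=\mathrm{SL}_2(\mathbb Q_p)$ with $p\ne2,3$ and $\pi=p$. Let $w\in\widetilde W$ and $(c^-,c^0,c^+)_w\in h^1(w)$. Then $\tau_{s_0}\cdot(c^-,c^0,c^+)_w$ equals - $(0,-c^0,-c^-)_{s_0w}$ if $w\in\widetilde W^0$, $\ell(w)\ge1$; - $e_1\cdot(-c^-,-c^0,-c^+)_w+e_{\mathrm{id}}\cdot(0,-2c^-\iota,0)_w+(0,0,-c^-)_{s_0w}$ if $w\in\widetilde W^1$, $\ell(w)\ge2$; - $e_1\cdot(-c^-,-c^0,-c^+)_w+e_{\mathrm{id}}\cdot(0,-2c^-\iota,c^0\iota^{-1})_w+e_{\mathrm{id}^2}\cdot(0,0,c^-)_w+(0,0,-c^-)_{s_0w}$ if $w\in\widetilde W^1$, $\ell(w)=1$; and $\tau_{s_1}\cdot(c^-,c^0,c^+)_w$ equals - $(-c^+,-c^0,0)_{s_1w}$ if $w\in\widetilde W^1$, $\ell(w)\ge1$; - $e_1\cdot(-c^-,-c^0,-c^+)_w+e_{\mathrm{id}^{-1}}\cdot(0,2c^+\iota,0)_w+(-c^+,0,0)_{s_1w}$ if $w\in\widetilde W^0$, $\ell(w)\ge2$; - $e_1\cdot(-c^-,-c^0,-c^+)_w+e_{\mathrm{id}^{-1}}\cdot(-c^0\iota^{-1},2c^+\iota,0)_w+e_{\mathrm{id}^{-2}}\cdot(c^+,0,0)_w+(-c^+,0,0)_{s_1w}$ if $w\in\widetilde W^0$, $\ell(w)=1$. Moreover, for $\omega\in\Omega$: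 $\tau_{s_0}\cdot(c^-,0,c^+)_\omega=(0,0,-c^-)_{s_0\omega}$ and $\tau_{s_1}\cdot(c^-,0,c^+)_\omega=(-c^+,0,0)_{s_1\omega}$.
   Context: $k$ is a field of characteristic $p$; $I=\begin{pmatrix}1+p\mathbb Z_p&\mathbb Z_p\\ p\mathbb Z_p&1+p\mathbb Z_p\end{pmatrix}\cap G$; $\mathbf X=k[G/I]$ is the space of compactly supported functions $G\to k$ constant on the cosets $gI$. $E^*=\mathrm{Ext}^*_{\mathrm{Mod}(G)}(\mathbf X,\mathbf X)^{\mathrm{op}}=H^*(I,\mathbf X)$ (smooth $k$-representations of $G$; product $\cdot$ is the opposite of the Yoneda product). $H=E^0=\mathrm{End}_{k[G]}(\mathbf X)^{\mathrm{op}}$, identified with $\mathbf X^I$ via $h\mapsto(\mathrm{char}_I)h$; $E^1$ is an $H$-bimodule. $T$ is the diagonal torus, $T^0$ its maximal compact subgroup, $T^1$ the pro-$p$ Sylow subgroup of $T^0$, $\widetilde W=N(T)/T^1$, $\Omega=T^0/T^1$, $\tau_w=\mathrm{char}_{IwI}\in H$ ($w\in\widetilde W$); $s_0=\begin{pmatrix}0&1\\ -1&0\end{pmatrix}$, $s_1=\begin{pmatrix}0&-p^{-1}\\ p&0\end{pmatrix}$ (also their classes in $\widetilde W$); $\ell$ is the length function on $\widetilde W$ pulled back from the Coxeter group $N(T)/T^0$ generated by the images of $s_0,s_1$; $\widetilde W^\epsilon=\{w:\ell(s_\epsilon w)=\ell(w)+1\}$ for $\epsilon=0,1$. For $u\in\mathbb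 F_p^\times$, $\omega_u=\mathrm{diag}([u]^{-1},[u])T^1\in\Omega$ ($[u]$ the Teichmüller lift); $e_{\mathrm{id}^m}=-\sum_{u\in\mathbb F_p^\times}u^{-m}\tau_{\omega_u}$ for $m\in\mathbb Z$, and $e_1=e_{\mathrm{id}^0}=-\sum_{\omega\in\Omega}\tau_\omega$. Triples: let $\mathbf X(w)\subseteq\mathbf X$ be the functions supported on $IwI$, $h^1(w)=H^1(I,\mathbf X(w))$, so $E^1=\bigoplus_wh^1(w)$; $I_w=I\cap wIw^{-1}$; $\mathrm{Sh}_w:h^1(w)\cong H^1(I_w,k)=\mathrm{Hom}(I_w,k)$ is restriction to $I_w$ followed by evaluation $f\mapsto f(w)$. For $c^\pm\in\mathrm{Hom}(\mathbb Z_p/p\mathbb Z_p,k)$, $c^0\in\mathrm{Hom}((1+p\mathbb Z_p)/(1+p^2\mathbb Z_p),k)$ (with $c^0=0$ if $\ell(w)=0$), $(c^-,c^0,c^+)_w\in h^1(w)$ is the element whose image under $\mathrm{Sh}_w$ sends $\begin{pmatrix}1+px&y\\ p^{\ell(w)+1}z&1+pt\end{pmatrix}$ if $w\in\widetilde W^0$, resp. $\begin{pmatrix}1+px&p^{\ell(w)}y\\ pz&1+pt\end{pmatrix}$ if $w\in\widetilde W^1$, to $c^-(z)+c^0(1+px)+c^+(y)$; every element of $h^1(w)$ is of this form. $\iota:(1+p\mathbb Z_p)/(1+p^2\mathbb Z_p)\cong\mathbb Z_p/p\mathbb Z_p$ is $1+px\mapsto x$, and $c^\pm\iota=c^\pm\circ\iota$,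 $c^0\iota^{-1}=c^0\circ\iota^{-1}$. *)

theory Defs
  imports
    "HOL-Analysis.Analysis"
    "HOL-Algebra.Coset"
    "HOL-Algebra.Group_Action"
    "HOL-Computational_Algebra.Fraction_Field"
    "HOL-Computational_Algebra.Primes"
    "HOL-Computational_Algebra.Field_as_Ring"
    "HOL-Library.Function_Algebras"
    "HOL-Library.Indicator_Function"
begin

section \<open>The \<open>p\<close>-adic numbers\<close>

text \<open>The prime \<open>p\<close> is the cardinality of the type parameter \<open>'p\<close>.\<close>

class prime_card = finite +
  assumes prime_card: "prime CARD('a)"

text \<open>\<open>\<int>\<^sub>p\<close> is the inverse limit of the rings \<open>\<int>/p\<^sup>n\<close>; the \<open>n\<close>-th component of an element is the
  representative in \<open>{0..<p\<^sup>n}\<close>.\<close>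

typedef 'p padic_int =
  "{x :: nat \<Rightarrow> int. \<forall>n. x n = x (Suc n) mod int CARD('p::prime_card) ^ n}"
  by (rule exI[of _ "\<lambda>_. 0"]) simp

setup_lifting type_definition_padic_int

lemma mod_Suc_power: "(a :: int) mod q ^ Suc n mod q ^ n = a mod q ^ n"
  by (rule mod_mod_cancel) simp

lemma padic_int_mod:
  fixes q :: int
  assumes "\<forall>n. x n = x (Suc n) mod q ^ n"
  shows "x n mod q ^ n = x n"
proof -
  have "x n = x (Suc n) mod q ^ n" using assms by blast
  then show ?thesis by (simp only: mod_mod_trivial)
qed

lemma padic_int_closed:
  fixes q :: int
  assumes x: "\<forall>n. x n = x (Suc n) mod q ^ n" and y: "\<forall>n. y n = y (Suc n) mod q ^ n"
  shows "(x n + y n) mod q ^ n = (x (Suc n) + y (Suc n)) mod q ^ Suc n mod q ^ n"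
    and "(x n - y n) mod q ^ n = (x (Suc n) - y (Suc n)) mod q ^ Suc n mod q ^ n"
    and "(x n * y n) mod q ^ n = (x (Suc n) * y (Suc n)) mod q ^ Suc n mod q ^ n"
proof -
  have *: "x n = x (Suc n) mod q ^ n" "y n = y (Suc n) mod q ^ n"
    using x y by blast+
  show "(x n + y n) mod q ^ n = (x (Suc n) + y (Suc n)) mod q ^ Suc n mod q ^ n"
    by (simp only: * mod_Suc_power mod_add_eq)
  show "(x n - y n) mod q ^ n = (x (Suc n) - y (Suc n)) mod q ^ Suc n mod q ^ n"
    by (simp only: * mod_Suc_power mod_diff_eq)
  show "(x n * y n) mod q ^ n = (x (Suc n) * y (Suc n)) mod q ^ Suc n mod q ^ n"
    by (simp only: * mod_Suc_power mod_mult_eq)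
qed

lemma padic_int_closed_uminus:
  fixes q :: int
  assumes "\<forall>n. x n = x (Suc n) mod q ^ n"
  shows "(- x n) mod q ^ n = (- x (Suc n)) mod q ^ Suc n mod q ^ n"
proof -
  have *: "x n = x (Suc n) mod q ^ n" using assms by blast
  show ?thesis by (simp only: * mod_Suc_power mod_minus_eq)
qed

instantiation padic_int :: (prime_card) comm_ring_1
begin

lift_definition zero_padic_int :: "'a padic_int" is "\<lambda>_. 0" by simp

lift_definition one_padic_int :: "'a padic_int" is "\<lambda>n. 1 mod int CARD('a) ^ n"
  by (intro allI mod_Suc_power[symmetric])

lift_definition plus_padic_int :: "'a padic_int \<Rightarrow> 'a padic_int \<Rightarrow> 'a padic_int"
  is "\<lambda>x y n. (x n + y n) mod int CARD('a) ^ n"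
  by (intro allI padic_int_closed(1)) blast+

lift_definition minus_padic_int :: "'a padic_int \<Rightarrow> 'a padic_int \<Rightarrow> 'a padic_int"
  is "\<lambda>x y n. (x n - y n) mod int CARD('a) ^ n"
  by (intro allI padic_int_closed(2)) blast+

lift_definition uminus_padic_int :: "'a padic_int \<Rightarrow> 'a padic_int"
  is "\<lambda>x n. (- x n) mod int CARD('a) ^ n"
  by (intro allI padic_int_closed_uminus) blast

lift_definition times_padic_int :: "'a padic_int \<Rightarrow> 'a padic_int \<Rightarrow> 'a padic_int"
  is "\<lambda>x y n. (x n * y n) mod int CARD('a) ^ n"
  by (intro allI padic_int_closed(3)) blast+

lemma Rep_padic_int_mod:
  "Rep_padic_int x n mod int CARD('a) ^ n = Rep_padic_int (x :: 'a padic_int) n"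
  using Rep_padic_int[of x] by (intro padic_int_mod) blast

instance
proof
  note rep_eq = Rep_padic_int_inject[symmetric] fun_eq_iff zero_padic_int.rep_eq
    one_padic_int.rep_eq plus_padic_int.rep_eq minus_padic_int.rep_eq uminus_padic_int.rep_eq
    times_padic_int.rep_eq
  fix a b c :: "'a padic_int"
  show "a * b * c = a * (b * c)"
    by (simp only: rep_eq simp_thms mod_mult_left_eq mod_mult_right_eq mult.assoc)
  show "a * b = b * a" by (simp only: rep_eq simp_thms mult.commute)
  show "1 * a = a" by (simp only: rep_eq simp_thms mod_mult_left_eq mult_1_left Rep_padic_int_mod)
  show "a + b + c = a + (b + c)"
    by (simp only: rep_eq simp_thms mod_add_left_eq mod_add_right_eq add.assoc)
  show "a + b = b + a" by (simp only: rep_eq simp_thms add.commute)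
  show "0 + a = a" by (simp only: rep_eq simp_thms add_0_left Rep_padic_int_mod)
  show "- a + a = 0" by (simp only: rep_eq simp_thms mod_add_left_eq left_minus mod_0)
  show "a - b = a + - b" by (simp only: rep_eq simp_thms mod_add_right_eq diff_conv_add_uminus)
  show "(a + b) * c = a * c + b * c"
    by (simp only: rep_eq simp_thms mod_mult_left_eq mod_add_eq distrib_right)
  have "1 < int CARD('a)" using prime_card[where 'a='a] prime_gt_1_nat by fastforce
  then have "(1 :: int) mod int CARD('a) ^ 1 \<noteq> 0" by simp
  then show "(0::'a padic_int) \<noteq> 1" unfolding rep_eq by metis
qed

end

lemma padic_int_mod_le:
  fixes q :: int
  assumes "\<forall>n. x n = x (Suc n) mod q ^ n"
  shows "x (n + m) mod q ^ n = x n"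
proof (induction m)
  case 0
  then show ?case using padic_int_mod[OF assms] by simp
next
  case (Suc m)
  have "x (n + m) mod q ^ n = x (Suc (n + m)) mod q ^ (n + m) mod q ^ n"
    using assms by metis
  also have "\<dots> = x (Suc (n + m)) mod q ^ n"
    by (simp add: power_add mod_mod_cancel)
  finally show ?case using Suc by simp
qed

lemma prime_power_dvd_mult_split:
  fixes q :: int
  assumes "prime q" "q ^ (n + m) dvd a * b"
  shows "q ^ n dvd a \<or> q ^ m dvd b"
proof (cases "a = 0 \<or> b = 0")
  case False
  then have "n + m \<le> multiplicity q a + multiplicity q b"
    using assms by (metis multiplicity_geI mult_eq_0_iff not_prime_unit
        prime_elem_multiplicity_mult_distrib prime_imp_prime_elem)
  then have "n \<le> multiplicity q a \<or> m \<le> multiplicity q b" by linarith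
  then show ?thesis using multiplicity_dvd' by blast
qed auto

instance padic_int :: (prime_card) idom
proof
  fix a b :: "'a padic_int"
  have p: "prime (int CARD('a))" using prime_card[where 'a='a] by simp
  note rep_eq = Rep_padic_int_inject[symmetric] fun_eq_iff zero_padic_int.rep_eq
    times_padic_int.rep_eq
  assume "a \<noteq> 0" "b \<noteq> 0"
  then obtain n m where nm: "Rep_padic_int a n \<noteq> 0" "Rep_padic_int b m \<noteq> 0"
    unfolding rep_eq by blast
  have compat: "\<forall>n. Rep_padic_int x n = Rep_padic_int x (Suc n) mod int CARD('a) ^ n"
    for x :: "'a padic_int"
    using Rep_padic_int[of x] by blast
  have "Rep_padic_int a (n + m) mod int CARD('a) ^ n \<noteq> 0"
    using padic_int_mod_le[OF compat] nm(1) by metis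
  moreover have "Rep_padic_int b (n + m) mod int CARD('a) ^ m \<noteq> 0"
    using padic_int_mod_le[OF compat] nm(2) by (metis add.commute)
  ultimately have "\<not> int CARD('a) ^ (n + m) dvd Rep_padic_int a (n + m) * Rep_padic_int b (n + m)"
    using prime_power_dvd_mult_split[OF p] by (metis dvd_eq_mod_eq_0)
  then have "Rep_padic_int (a * b) (n + m) \<noteq> Rep_padic_int 0 (n + m)"
    by (simp add: zero_padic_int.rep_eq times_padic_int.rep_eq dvd_eq_mod_eq_0)
  then show "a * b \<noteq> 0" by metis
qed

text \<open>\<open>\<rat>\<^sub>p\<close> is a copy of the fraction field of \<open>\<int>\<^sub>p\<close>, so that it can carry its own topology.\<close>

typedef 'p padic = "UNIV :: 'p::prime_card padic_int fract set" ..

setup_lifting type_definition_padic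

instantiation padic :: (prime_card) field
begin

lift_definition zero_padic :: "'a padic" is 0 .
lift_definition one_padic :: "'a padic" is 1 .
lift_definition plus_padic :: "'a padic \<Rightarrow> 'a padic \<Rightarrow> 'a padic" is "(+)" .
lift_definition minus_padic :: "'a padic \<Rightarrow> 'a padic \<Rightarrow> 'a padic" is "(-)" .
lift_definition uminus_padic :: "'a padic \<Rightarrow> 'a padic" is uminus .
lift_definition times_padic :: "'a padic \<Rightarrow> 'a padic \<Rightarrow> 'a padic" is "(*)" .
lift_definition inverse_padic :: "'a padic \<Rightarrow> 'a padic" is inverse .
lift_definition divide_padic :: "'a padic \<Rightarrow> 'a padic \<Rightarrow> 'a padic" is "(/)" .

instance
  by standard (transfer; simp add: algebra_simps divide_inverse)+

end

definition of_Zp :: "'p::prime_card padic_int \<Rightarrow> 'p padic" where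
  "of_Zp x = Abs_padic (Fract x 1)"

instantiation padic :: (prime_card) topological_space
begin

definition open_padic :: "'a padic set \<Rightarrow> bool" where
  "open_padic U \<longleftrightarrow> (\<forall>x\<in>U. \<exists>n. \<forall>y. x + of_Zp (of_nat CARD('a) ^ n * y) \<in> U)"

instance
proof
  show "open (UNIV :: 'a padic set)" by (simp add: open_padic_def)
next
  fix S T :: "'a padic set"
  assume "open S" "open T"
  show "open (S \<inter> T)"
    unfolding open_padic_def
  proof
    fix x assume "x \<in> S \<inter> T"
    then obtain n m where
      n: "x + of_Zp (of_nat CARD('a) ^ n * y) \<in> S" and
      m: "x + of_Zp (of_nat CARD('a) ^ m * y) \<in> T" for y
      using \<open>open S\<close> \<open>open T\<close> unfolding open_padic_def by blast
    have "x + of_Zp (of_nat CARD('a) ^ (n + m) * y) \<in> S \<inter> T" for y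
      using n[of "of_nat CARD('a) ^ m * y"] m[of "of_nat CARD('a) ^ n * y"]
      by (simp add: power_add mult.assoc mult.left_commute)
    then show "\<exists>n. \<forall>y. x + of_Zp (of_nat CARD('a) ^ n * y) \<in> S \<inter> T" by blast
  qed
next
  fix K :: "'a padic set set"
  assume K: "\<forall>S\<in>K. open S"
  show "open (\<Union>K)"
    unfolding open_padic_def
  proof
    fix x assume "x \<in> \<Union>K"
    then obtain S where S: "S \<in> K" "x \<in> S" by blast
    then obtain n where "\<forall>y. x + of_Zp (of_nat CARD('a) ^ n * y) \<in> S"
      using K unfolding open_padic_def by blast
    with S show "\<exists>n. \<forall>y. x + of_Zp (of_nat CARD('a) ^ n * y) \<in> \<Union>K" by blast
  qed
qed

end

abbreviation pZ :: "'p::prime_card padic_int" where "pZ \<equiv> of_nat CARD('p)"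

abbreviation pQ :: "'p::prime_card padic" where "pQ \<equiv> of_nat CARD('p)"

text \<open>Nonzero residue classes mod \<open>p\<close> are represented by \<open>u \<in> {1..<p}\<close>.\<close>

definition teich :: "nat \<Rightarrow> 'p::prime_card padic_int" where
  "teich u = (THE x. x ^ (CARD('p) - 1) = 1 \<and> pZ dvd x - of_nat u)"


section \<open>The group and its pro-\<open>p\<close> Iwahori subgroup\<close>

type_synonym 'p mat = "'p padic ^ 2 ^ 2"

definition mat2 :: "'p::prime_card padic \<Rightarrow> 'p padic \<Rightarrow> 'p padic \<Rightarrow> 'p padic \<Rightarrow> 'p mat" where
  "mat2 a b c d = vector [vector [a, b], vector [c, d]]"

definition SL2 :: "'p::prime_card mat monoid" where
  "SL2 = \<lparr>carrier = {A. det A = 1}, monoid.mult = (**), one = mat 1\<rparr>"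

definition iwahori :: "'p::prime_card mat set" where
  "iwahori = carrier SL2 \<inter>
    {mat2 (of_Zp (1 + pZ * x)) (of_Zp y) (of_Zp (pZ * z)) (of_Zp (1 + pZ * t)) | x y z t. True}"

definition torus :: "'p::prime_card mat set" where
  "torus = carrier SL2 \<inter> {mat2 a 0 0 d | a d. True}"

text \<open>The maximal compact subgroup \<open>T\<^sup>0\<close> of \<open>T\<close> and its pro-\<open>p\<close> Sylow subgroup \<open>T\<^sup>1\<close>,
  in their explicit forms.\<close>

definition torus0 :: "'p::prime_card mat set" where
  "torus0 = carrier SL2 \<inter> {mat2 (of_Zp a) 0 0 (of_Zp d) | a d. True}"

definition torus1 :: "'p::prime_card mat set" where
  "torus1 = carrier SL2 \<inter> {mat2 (of_Zp (1 + pZ * x)) 0 0 (of_Zp (1 + pZ * t)) | x t. True}"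

text \<open>The groups \<open>N(T)/T\<^sup>1\<close> and \<open>N(T)/T\<^sup>0\<close>; their elements are cosets, as sets of matrices.\<close>

definition Wt :: "'p::prime_card mat set monoid" where
  "Wt = SL2\<lparr>carrier := normalizer SL2 torus\<rparr> Mod torus1"

definition W0 :: "'p::prime_card mat set monoid" where
  "W0 = SL2\<lparr>carrier := normalizer SL2 torus\<rparr> Mod torus0"

definition cls :: "'p::prime_card mat \<Rightarrow> 'p mat set" where
  "cls n = torus1 #>\<^bsub>SL2\<^esub> n"

definition \<Omega> :: "'p::prime_card mat set set" where
  "\<Omega> = cls ` torus0"

definition s0 :: "'p::prime_card mat" where "s0 = mat2 0 1 (-1) 0"

definition s1 :: "'p::prime_card mat" where "s1 = mat2 0 (- inverse pQ) pQ 0"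

definition omega :: "nat \<Rightarrow> 'p::prime_card mat set" where
  "omega u = cls (mat2 (inverse (of_Zp (teich u))) 0 0 (of_Zp (teich u)))"

definition len :: "'p::prime_card mat set \<Rightarrow> nat" where
  "len w = (LEAST n. \<exists>ss. length ss = n \<and>
     set ss \<subseteq> {torus0 #>\<^bsub>SL2\<^esub> s0, torus0 #>\<^bsub>SL2\<^esub> s1} \<and>
     foldr (\<lambda>s v. s \<otimes>\<^bsub>W0\<^esub> v) ss \<one>\<^bsub>W0\<^esub> = torus0 <#>\<^bsub>SL2\<^esub> w)"

definition Wt0 :: "'p::prime_card mat set set" where
  "Wt0 = {w \<in> carrier Wt. len (cls s0 \<otimes>\<^bsub>Wt\<^esub> w) = len w + 1}"

definition Wt1 :: "'p::prime_card mat set set" where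
  "Wt1 = {w \<in> carrier Wt. len (cls s1 \<otimes>\<^bsub>Wt\<^esub> w) = len w + 1}"

definition IwI :: "'p::prime_card mat set \<Rightarrow> 'p mat set" where
  "IwI w = iwahori <#>\<^bsub>SL2\<^esub> w <#>\<^bsub>SL2\<^esub> iwahori"

definition Iw :: "'p::prime_card mat set \<Rightarrow> 'p mat set" where
  "Iw w = iwahori \<inter> {n \<otimes>\<^bsub>SL2\<^esub> g \<otimes>\<^bsub>SL2\<^esub> inv\<^bsub>SL2\<^esub> n | n g. n \<in> w \<and> g \<in> iwahori}"


section \<open>Smooth representations and extensions\<close>

text \<open>A representation lives on a subset of a vector space type.\<close>

record ('p, 'k, 'v) rep =
  rspace :: "'v set"
  rscal :: "'k \<Rightarrow> 'v \<Rightarrow> 'v"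
  ract :: "'p mat \<Rightarrow> 'v \<Rightarrow> 'v"

definition smooth_rep :: "('p::prime_card, 'k::field, 'v::ab_group_add) rep \<Rightarrow> bool" where
  "smooth_rep V \<longleftrightarrow>
     vector_space (rscal V) \<and> module.subspace (rscal V) (rspace V) \<and>
     (\<forall>g\<in>carrier SL2. \<forall>v\<in>rspace V. ract V g v \<in> rspace V) \<and>
     (\<forall>g\<in>carrier SL2. \<forall>v\<in>rspace V. \<forall>v'\<in>rspace V. ract V g (v + v') = ract V g v + ract V g v') \<and>
     (\<forall>g\<in>carrier SL2. \<forall>a. \<forall>v\<in>rspace V. ract V g (rscal V a v) = rscal V a (ract V g v)) \<and>
     (\<forall>v\<in>rspace V. ract V \<one>\<^bsub>SL2\<^esub> v = v) \<and>
     (\<forall>g\<in>carrier SL2. \<forall>h\<in>carrier SL2. \<forall>v\<in>rspace V.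
        ract V (g \<otimes>\<^bsub>SL2\<^esub> h) v = ract V g (ract V h v)) \<and>
     (\<forall>v\<in>rspace V. openin (top_of_set (carrier SL2)) {g \<in> carrier SL2. ract V g v = v})"

definition rep_hom ::
  "('p::prime_card, 'k::field, 'v::ab_group_add) rep \<Rightarrow> ('p, 'k, 'w::ab_group_add) rep \<Rightarrow> ('v \<Rightarrow> 'w) set"
  where
  "rep_hom V W = {f. f ` rspace V \<subseteq> rspace W \<and>
     (\<forall>v\<in>rspace V. \<forall>v'\<in>rspace V. f (v + v') = f v + f v') \<and>
     (\<forall>a. \<forall>v\<in>rspace V. f (rscal V a v) = rscal W a (f v)) \<and>
     (\<forall>g\<in>carrier SL2. \<forall>v\<in>rspace V. f (ract V g v) = ract W g (f v))}"

text \<open>\<open>\<X> = k[G/I]\<close>; functions on \<open>G\<close> are extended by zero to all matrices.  Functions constant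
  on the cosets of the open subgroup \<open>I\<close> have clopen support.\<close>

definition \<X> :: "('p::prime_card, 'k::field, 'p mat \<Rightarrow> 'k) rep" where
  "\<X> = \<lparr>
     rspace = {f. (\<forall>g. g \<notin> carrier SL2 \<longrightarrow> f g = 0) \<and>
                 (\<forall>g\<in>carrier SL2. \<forall>i\<in>iwahori. f (g \<otimes>\<^bsub>SL2\<^esub> i) = f g) \<and>
                 compact {g. f g \<noteq> 0}},
     rscal = (\<lambda>a f x. a * f x),
     ract = (\<lambda>g f x. f (inv\<^bsub>SL2\<^esub> g \<otimes>\<^bsub>SL2\<^esub> x))\<rparr>"

definition charI :: "'p::prime_card mat \<Rightarrow> 'k::field" where
  "charI = indicator iwahori"

text \<open>Short exact sequences \<open>0 \<rightarrow> \<X> \<rightarrow> M \<rightarrow> \<X> \<rightarrow> 0\<close> of smooth representations.\<close>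

record ('p, 'k, 'v) extn =
  emid :: "('p, 'k, 'v) rep"
  eincl :: "('p mat \<Rightarrow> 'k) \<Rightarrow> 'v"
  eproj :: "'v \<Rightarrow> ('p mat \<Rightarrow> 'k)"

definition extension :: "('p::prime_card, 'k::field, 'v::ab_group_add) extn \<Rightarrow> bool" where
  "extension E \<longleftrightarrow> smooth_rep (emid E) \<and>
     eincl E \<in> rep_hom \<X> (emid E) \<and> eproj E \<in> rep_hom (emid E) \<X> \<and>
     inj_on (eincl E) (rspace \<X>) \<and> eproj E ` rspace (emid E) = rspace \<X> \<and>
     eincl E ` rspace \<X> = {m \<in> rspace (emid E). eproj E m = 0}"

text \<open>The fibre product \<open>M \<times>\<^sub>\<X> \<X>\<close>, i.e. the Yoneda product of the class of \<open>E\<close> with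
  \<open>h : \<X> \<rightarrow> \<X>\<close>.\<close>

definition pullback ::
  "((('p::prime_card) mat \<Rightarrow> 'k::field) \<Rightarrow> ('p mat \<Rightarrow> 'k)) \<Rightarrow> ('p, 'k, 'v::ab_group_add) extn
     \<Rightarrow> ('p, 'k, 'v \<times> ('p mat \<Rightarrow> 'k)) extn" where
  "pullback h E = \<lparr>
     emid = \<lparr>rspace = {(m, f). m \<in> rspace (emid E) \<and> f \<in> rspace \<X> \<and> eproj E m = h f},
            rscal = (\<lambda>a (m, f). (rscal (emid E) a m, rscal \<X> a f)),
            ract = (\<lambda>g (m, f). (ract (emid E) g m, ract \<X> g f))\<rparr>,
     eincl = (\<lambda>f. (eincl E f, 0)),
     eproj = snd\<rparr>"


section \<open>First cohomology of the pro-\<open>p\<close> Iwahori subgroup\<close>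

text \<open>\<open>V\<close> is an \<open>I\<close>-stable subspace of \<open>\<X>\<close>, with the discrete topology.\<close>

definition Z1 :: "(('p::prime_card) mat \<Rightarrow> 'k::field) set \<Rightarrow> ('p mat \<Rightarrow> ('p mat \<Rightarrow> 'k)) set" where
  "Z1 V = {c. continuous_map (top_of_set iwahori) (discrete_topology V) c \<and>
     (\<forall>g\<in>iwahori. \<forall>h\<in>iwahori. c (g \<otimes>\<^bsub>SL2\<^esub> h) = c g + ract \<X> g (c h))}"

definition cohomologous ::
  "(('p::prime_card) mat \<Rightarrow> 'k::field) set
     \<Rightarrow> (('p mat \<Rightarrow> ('p mat \<Rightarrow> 'k)) \<times> ('p mat \<Rightarrow> ('p mat \<Rightarrow> 'k))) set" where
  "cohomologous V = {(c, d). c \<in> Z1 V \<and> d \<in> Z1 V \<and>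
     (\<exists>f\<in>V. \<forall>g\<in>iwahori. d g = c g + (ract \<X> g f - f))}"

type_synonym ('p, 'k) coh = "('p mat \<Rightarrow> ('p mat \<Rightarrow> 'k)) set"

definition H1 :: "(('p::prime_card) mat \<Rightarrow> 'k::field) set \<Rightarrow> ('p, 'k) coh set" where
  "H1 V = Z1 V // cohomologous V"

definition E1 :: "('p::prime_card, 'k::field) coh set" where
  "E1 = H1 (rspace \<X>)"

definition E1_add :: "('p::prime_card, 'k::field) coh \<Rightarrow> ('p, 'k) coh \<Rightarrow> ('p, 'k) coh"
    (infixl "\<boxplus>" 65) where
  "\<alpha> \<boxplus> \<beta> = (\<Union>c\<in>\<alpha>. \<Union>d\<in>\<beta>. cohomologous (rspace \<X>) `` {c + d})"

text \<open>The identification of \<open>Ext\<^sup>1(\<X>, \<X>)\<close> with \<open>H\<^sup>1(I, \<X>)\<close> sends an extension to the image of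
  \<open>char\<^sub>I\<close> under the connecting homomorphism \<open>H\<^sup>0(I, \<X>) \<rightarrow> H\<^sup>1(I, \<X>)\<close>.\<close>

definition ext_class :: "('p::prime_card, 'k::field, 'v::ab_group_add) extn \<Rightarrow> ('p, 'k) coh" where
  "ext_class E = {c. \<exists>m\<in>rspace (emid E). eproj E m = charI \<and>
     (\<forall>g\<in>iwahori. c g \<in> rspace \<X> \<and> eincl E (c g) = ract (emid E) g m - m)}"


section \<open>The Hecke algebra and its left action on \<open>E\<^sup>1\<close>\<close>

text \<open>Endomorphisms of \<open>\<X>\<close> are extended by zero to all functions, so that sums and multiples of
  them can be formed pointwise.\<close>

type_synonym ('p, 'k) endo = "('p mat \<Rightarrow> 'k) \<Rightarrow> ('p mat \<Rightarrow> 'k)"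

definition hecke :: "('p::prime_card, 'k::field) endo set" where
  "hecke = {h \<in> rep_hom \<X> \<X>. \<forall>f. f \<notin> rspace \<X> \<longrightarrow> h f = 0}"

definition tau :: "'p::prime_card mat set \<Rightarrow> ('p, 'k::field) endo" (\<open>\<tau>\<close>) where
  "\<tau> w = (THE h. h \<in> hecke \<and> h charI = indicator (IwI w))"

definition e_id :: "int \<Rightarrow> ('p::prime_card, 'k::field) endo" where
  "e_id m = - (\<Sum>u\<in>{1..<CARD('p)}. (\<lambda>f. rscal \<X> (of_nat u powi (- m)) (\<tau> (omega u) f)))"

text \<open>The product \<open>h \<cdot> \<alpha>\<close> in \<open>Ext\<^sup>*(\<X>, \<X>)\<^sup>o\<^sup>p\<close> is the Yoneda product \<open>\<alpha> \<circ> h\<close>, the pullback of the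
  extension \<open>\<alpha>\<close> along \<open>h\<close>.  As every extension splits over \<open>k\<close>, it is enough to consider
  representations \<open>M\<close> on subsets of the type of pairs of functions.\<close>

definition hecke_act :: "('p::prime_card, 'k::field) endo \<Rightarrow> ('p, 'k) coh \<Rightarrow> ('p, 'k) coh"
    (infixr "\<cdot>" 70) where
  "h \<cdot> \<alpha> = (THE \<beta>. \<exists>E :: ('p, 'k, ('p mat \<Rightarrow> 'k) \<times> ('p mat \<Rightarrow> 'k)) extn.
      extension E \<and> ext_class E = \<alpha> \<and> ext_class (pullback h E) = \<beta>)"


section \<open>Triples\<close>

definition Xw :: "'p::prime_card mat set \<Rightarrow> ('p mat \<Rightarrow> 'k::field) set" where
  "Xw w = {f \<in> rspace \<X>. \<forall>g. f g \<noteq> 0 \<longrightarrow> g \<in> IwI w}"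

definition h1 :: "'p::prime_card mat set \<Rightarrow> ('p, 'k::field) coh set" where
  "h1 w = H1 (Xw w)"

definition h1_to_E1 :: "('p::prime_card, 'k::field) coh \<Rightarrow> ('p, 'k) coh" where
  "h1_to_E1 \<alpha> = cohomologous (rspace \<X>) `` \<alpha>"

text \<open>A function in \<open>\<X>\<close> is constant on the coset \<open>w\<close> of \<open>T\<^sup>1\<close>.\<close>

definition Sh :: "'p::prime_card mat set \<Rightarrow> ('p, 'k::field) coh \<Rightarrow> ('p mat \<Rightarrow> 'k)" where
  "Sh w \<alpha> = the_elem ((\<lambda>c. \<lambda>g\<in>Iw w. the_elem (c g ` w)) ` \<alpha>)"

text \<open>Homomorphisms on \<open>\<int>\<^sub>p/p\<int>\<^sub>p\<close> and on \<open>(1+p\<int>\<^sub>p)/(1+p\<^sup>2\<int>\<^sub>p)\<close> are represented by their inflations to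
  \<open>\<int>\<^sub>p\<close> and \<open>1+p\<int>\<^sub>p\<close>; the values of the latter outside \<open>1+p\<int>\<^sub>p\<close> are irrelevant.\<close>

definition Hom_add :: "('p::prime_card padic_int \<Rightarrow> 'k::field) set" where
  "Hom_add = {c. (\<forall>x y. c (x + y) = c x + c y) \<and> (\<forall>x. c (pZ * x) = 0)}"

definition Hom_mult :: "('p::prime_card padic_int \<Rightarrow> 'k::field) set" where
  "Hom_mult = {c. (\<forall>x y. c ((1 + pZ * x) * (1 + pZ * y)) = c (1 + pZ * x) + c (1 + pZ * y)) \<and>
     (\<forall>x. c (1 + pZ ^ 2 * x) = 0)}"

definition iota :: "'p::prime_card padic_int \<Rightarrow> 'p padic_int" (\<open>\<iota>\<close>) where
  "\<iota> u = (THE x. u = 1 + pZ * x)"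

definition iota_inv :: "'p::prime_card padic_int \<Rightarrow> 'p padic_int" (\<open>\<iota>\<^sub>i\<^sub>n\<^sub>v\<close>) where
  "\<iota>\<^sub>i\<^sub>n\<^sub>v x = 1 + pZ * x"

text \<open>The element \<open>(c\<^sup>-, c\<^sup>0, c\<^sup>+)\<^sub>w\<close>, as an element of \<open>E\<^sup>1\<close>.\<close>

definition triple ::
  "('p::prime_card padic_int \<Rightarrow> 'k::field) \<Rightarrow> ('p padic_int \<Rightarrow> 'k) \<Rightarrow> ('p padic_int \<Rightarrow> 'k)
     \<Rightarrow> 'p mat set \<Rightarrow> ('p, 'k) coh" where
  "triple cm c0 cp w = h1_to_E1 (THE \<alpha>. \<alpha> \<in> h1 w \<and>
     (\<forall>x y z t.
        let g = mat2 (of_Zp (1 + pZ * x)) (of_Zp y)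
                     (of_Zp (pZ ^ (len w + 1) * z)) (of_Zp (1 + pZ * t))
        in w \<in> Wt0 \<and> g \<in> Iw w \<longrightarrow> Sh w \<alpha> g = cm z + c0 (1 + pZ * x) + cp y) \<and>
     (\<forall>x y z t.
        let g = mat2 (of_Zp (1 + pZ * x)) (of_Zp (pZ ^ len w * y))
                     (of_Zp (pZ * z)) (of_Zp (1 + pZ * t))
        in w \<in> Wt1 \<and> g \<in> Iw w \<longrightarrow> Sh w \<alpha> g = cm z + c0 (1 + pZ * x) + cp y))"

end

theory Submission
  imports Defs "HOL-Number_Theory.Residues"
begin

text \<open>
  \<^bold>\<open>Products on cocycles.\<close> An extension of \<open>\<X>\<close> by \<open>\<X>\<close> whose class is represented by a cocycle \<open>c\<close> contains a
  lift \<open>m\<close> of \<open>char\<^sub>I\<close> with \<open>gm - m = c(g)\<close> for all \<open>g \<in> I\<close>.  If a Hecke operator \<open>h\<close> maps \<open>char\<^sub>I\<close> to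
  \<open>\<Sum>a\<^sub>jy\<^sub>j char\<^sub>I\<close>, then \<open>\<Sum>a\<^sub>jy\<^sub>jm\<close> is a lift of \<open>h char\<^sub>I\<close>, and the cocycle of this lift represents the product
  of \<open>h\<close> with the class of \<open>c\<close>; this is \<open>hecke_act_coh_class\<close>.  It applies to all classes, since every
  cocycle comes from an extension (\<open>extension_exists\<close>).

  \<^bold>\<open>Comparison of classes.\<close> By Shapiro's lemma, in the form of \<open>coboundary_criterion\<close>, a cocycle that is
  supported on double cosets \<open>InI\<close> with \<open>n \<in> S\<close> is a coboundary if \<open>c(g)(n) = 0\<close> for all \<open>n \<in> S\<close> and
  \<open>g \<in> I \<inter> nIn\<^sup>-\<^sup>1\<close>.  It implies that a triple is determined by its homomorphism on \<open>I \<inter> nIn\<^sup>-\<^sup>1\<close>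
  (\<open>triple_eq\<close>), and it reduces the proposition to the values of \<open>\<tau>\<^sub>s \<cdot> c\<close> at representatives of the
  double cosets in \<open>IsInI\<close>.

  \<^bold>\<open>The values.\<close> The double coset \<open>IsI\<close> consists of \<open>p\<close> left cosets of \<open>I\<close>, numbered by \<open>a < p\<close>.
  If \<open>sn\<close> is longer than \<open>n\<close>, then \<open>IsInI = IsnI\<close>, and only the coset with \<open>a = 0\<close> contributes to the value
  at \<open>sn\<close>.  Conjugation with \<open>s\<close> exchanges the diagonal entries, and the off-diagonal ones up to
  sign; the entry to which one of the homomorphisms is applied becomes divisible by \<open>p\<close>
  (\<open>tau_cocycle_up\<close>).  If \<open>sn\<close> is shorter than \<open>n\<close>, then \<open>IsInI\<close> is contained in the union of \<open>IsnI\<close> and the \<open>I\<omega>nI\<close> with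
  \<open>\<omega> \<in> \<Omega>\<close>.  At \<open>sn\<close>, all cosets contribute; since the sums of \<open>a\<close> and of \<open>a\<^sup>2\<close> over the residue classes
  vanish for \<open>p \<noteq> 2, 3\<close>, only a sum of carries remains (\<open>tau_cocycle_down_srefl\<close>).  At \<open>\<omega>\<^sub>un\<close>, a single
  coset contributes, and the argument of \<open>c\<close> is conjugated with a triangular matrix that depends on
  \<open>u\<close> (\<open>tau_cocycle_down_om\<close>).  Sorting the result by powers of \<open>u\<close> gives the terms with the idempotents for the characters
  \<open>1\<close>, \<open>id\<close> and \<open>id\<^sup>2\<close>, or their inverses in the case of \<open>s\<^sub>1\<close>.  The terms that are special to length \<open>1\<close> come from the
  off-diagonal entry that is divisible by \<open>p\<close> to the power of the length: its quotient by \<open>p\<close> vanishes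
  modulo \<open>p\<close> for larger lengths.

  \<^bold>\<open>Both reflections at once.\<close> Conjugation with the matrix with rows \<open>(0, 1)\<close> and \<open>(p, 0)\<close> exchanges
  \<open>s\<^sub>0\<close> and \<open>s\<^sub>1\<close>.  The computations use coordinates \<open>mt e\<close> that depend on a Boolean \<open>e\<close> and that are
  exchanged by this automorphism, and a signed length, the \<open>level\<close>.
\<close>

section \<open>Arithmetic of the \<open>p\<close>-adic integers\<close>

lemma prime_p: "prime (int CARD('p::prime_card))"
  using prime_card[where 'a='p] by simp

lemma p_gt_1: "1 < int CARD('p::prime_card)"
  using prime_p prime_gt_1_int by blast

lemma Rep_compat: "Rep_padic_int (x :: 'p::prime_card padic_int) n = Rep_padic_int x (Suc n) mod int CARD('p) ^ n"
  using Rep_padic_int[of x] by blast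

lemma Rep_mod_le: "n \<le> m \<Longrightarrow> Rep_padic_int (x :: 'p::prime_card padic_int) m mod int CARD('p) ^ n = Rep_padic_int x n"
proof -
  assume "n \<le> m"
  moreover have "Rep_padic_int x (n + (m - n)) mod int CARD('p) ^ n = Rep_padic_int x n"
    by (rule padic_int_mod_le) (use Rep_padic_int[of x] in blast)
  ultimately show ?thesis by simp
qed

lemma Rep_range: "0 \<le> Rep_padic_int (x :: 'p::prime_card padic_int) n" "Rep_padic_int x n < int CARD('p) ^ n"
proof -
  have "0 < int CARD('p) ^ n" using p_gt_1[where 'p='p] by simp
  then show "0 \<le> Rep_padic_int x n" "Rep_padic_int x n < int CARD('p) ^ n"
    using Rep_padic_int_mod[of x n] pos_mod_sign pos_mod_bound by metis+
qed

lemma Rep_at_0 [simp]: "Rep_padic_int (x :: 'p::prime_card padic_int) 0 = 0"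
  using Rep_range[of x 0] by simp

lemma padic_int_eqI: "(\<And>n. Rep_padic_int x n = Rep_padic_int y n) \<Longrightarrow> x = y"
  by (simp add: Rep_padic_int_inject[symmetric] fun_eq_iff)

lemma Rep_of_nat: "Rep_padic_int (of_nat k :: 'p::prime_card padic_int) n = int k mod int CARD('p) ^ n"
proof (induction k)
  case (Suc k)
  then show ?case
    by (simp add: plus_padic_int.rep_eq one_padic_int.rep_eq mod_add_eq)
qed (simp add: zero_padic_int.rep_eq)

lemma Rep_power: "Rep_padic_int (x ^ k :: 'p::prime_card padic_int) n = Rep_padic_int x n ^ k mod int CARD('p) ^ n"
proof (induction k)
  case (Suc k)
  then show ?case
    by (simp add: times_padic_int.rep_eq mod_mult_right_eq)
qed (simp add: one_padic_int.rep_eq)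

lemma pZ_neq_0 [simp]: "(pZ :: 'p::prime_card padic_int) \<noteq> 0"
proof
  assume "(pZ :: 'p::prime_card padic_int) = 0"
  then have "int CARD('p) mod int CARD('p) ^ 2 = 0"
    using Rep_of_nat[where 'p='p, of "CARD('p)" 2] by (simp add: zero_padic_int.rep_eq)
  moreover have "int CARD('p) < int CARD('p) ^ 2"
    using p_gt_1[where 'p='p] by (simp add: power2_eq_square)
  ultimately show False using p_gt_1[where 'p='p] by simp
qed

lemma pZ_dvd_iff: "pZ dvd (x :: 'p::prime_card padic_int) \<longleftrightarrow> Rep_padic_int x 1 = 0"
proof
  assume "pZ dvd x"
  then show "Rep_padic_int x 1 = 0"
    by (auto simp: dvd_def times_padic_int.rep_eq Rep_of_nat mod_mult_left_eq)
next
  let ?q = "int CARD('p)"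
  assume 0: "Rep_padic_int x 1 = 0"
  \<comment> \<open>The class of \<open>x/p\<close> modulo \<open>p\<^sup>m\<close> is determined by that of \<open>x\<close> modulo \<open>p\<^sup>m\<^sup>+\<^sup>1\<close>.\<close>
  define y where "y = (\<lambda>m. Rep_padic_int x (Suc m) div ?q)"
  have q: "?q > 0" using p_gt_1[where 'p='p] by simp
  have dvd: "Rep_padic_int x (Suc m) mod ?q = 0" for m
    using Rep_mod_le[of 1 "Suc m" x] 0 by simp
  have y: "y m = y (Suc m) mod ?q ^ m" for m
  proof -
    have "y m = (Rep_padic_int x (Suc (Suc m)) mod (?q * ?q ^ m)) div ?q"
      unfolding y_def using Rep_compat[of x "Suc m"] by simp
    also have "\<dots> = y (Suc m) mod ?q ^ m"
      unfolding y_def using q by (simp add: zmod_zmult2_eq)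
    finally show ?thesis .
  qed
  define z :: "'p padic_int" where "z = Abs_padic_int y"
  have z: "Rep_padic_int z = y"
    unfolding z_def using y by (intro Abs_padic_int_inverse) blast
  have "x = pZ * z"
  proof (rule padic_int_eqI)
    fix n
    have "Rep_padic_int (pZ * z) n = (?q * y n) mod ?q ^ n"
      by (simp add: times_padic_int.rep_eq Rep_of_nat z mod_mult_left_eq)
    also have "?q * y n = Rep_padic_int x (Suc n)"
      unfolding y_def using dvd[of n] by auto
    finally show "Rep_padic_int x n = Rep_padic_int (pZ * z) n"
      using Rep_compat[of x n] by simp
  qed
  then show "pZ dvd x" by simp
qed

text \<open>The inverses of \<open>x\<close> modulo the powers of \<open>p\<close> are unique and therefore compatible.\<close>

lemma padic_int_unit: "\<not> pZ dvd x \<Longrightarrow> \<exists>y. (x :: 'p::prime_card padic_int) * y = 1"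
proof -
  let ?q = "int CARD('p)"
  assume "\<not> pZ dvd x"
  then have x1: "Rep_padic_int x 1 \<noteq> 0" by (simp add: pZ_dvd_iff)
  have q: "?q > 0" using p_gt_1[where 'p='p] by simp
  have cop: "coprime (Rep_padic_int x n) (?q ^ n)" for n
  proof (cases "n = 0")
    case False
    have "\<not> ?q dvd Rep_padic_int x n"
      using x1 Rep_mod_le[of 1 n x] False by (auto simp: dvd_eq_mod_eq_0)
    then show ?thesis
      using prime_p[where 'p='p] by (metis coprime_commute coprime_power_left_iff prime_imp_coprime)
  qed simp
  have "\<exists>y. 0 \<le> y \<and> y < ?q ^ n \<and> (Rep_padic_int x n * y) mod ?q ^ n = 1 mod ?q ^ n" for n
  proof -
    obtain z where "[Rep_padic_int x n * z = 1] (mod ?q ^ n)"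
      using cong_solve_coprime_int[OF cop[of n]] by blast
    then have "(Rep_padic_int x n * (z mod ?q ^ n)) mod ?q ^ n = 1 mod ?q ^ n"
      by (simp add: cong_def mod_mult_right_eq)
    moreover have "0 \<le> z mod ?q ^ n" "z mod ?q ^ n < ?q ^ n" using q by simp_all
    ultimately show ?thesis by blast
  qed
  then obtain y where y: "0 \<le> y n" "y n < ?q ^ n"
      "(Rep_padic_int x n * y n) mod ?q ^ n = 1 mod ?q ^ n" for n
    by metis
  have "y n = y (Suc n) mod ?q ^ n" for n
  proof -
    have "(Rep_padic_int x n * y (Suc n)) mod ?q ^ n = (Rep_padic_int x (Suc n) * y (Suc n)) mod ?q ^ n"
      by (subst Rep_compat) (simp add: mod_mult_left_eq)
    also have "\<dots> = (Rep_padic_int x (Suc n) * y (Suc n)) mod ?q ^ Suc n mod ?q ^ n"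
      by (simp only: mod_Suc_power)
    also have "\<dots> = 1 mod ?q ^ n" by (simp only: y(3) mod_Suc_power)
    finally have "[Rep_padic_int x n * y (Suc n) = Rep_padic_int x n * y n] (mod ?q ^ n)"
      by (simp add: cong_def y(3))
    then have "[y (Suc n) = y n] (mod ?q ^ n)"
      using cop[of n] cong_mult_lcancel by blast
    then show ?thesis using y(1,2)[of n] by (simp add: cong_def)
  qed
  then have z: "Rep_padic_int (Abs_padic_int y :: 'p padic_int) = y"
    by (intro Abs_padic_int_inverse) blast
  have "x * Abs_padic_int y = 1"
    by (rule padic_int_eqI) (simp add: times_padic_int.rep_eq z one_padic_int.rep_eq y(3))
  then show ?thesis by blast
qed

lemma padic_int_unit_iff: "(x :: 'p::prime_card padic_int) dvd 1 \<longleftrightarrow> \<not> pZ dvd x"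
proof
  assume "x dvd 1"
  then obtain y where "1 = x * y" by (rule dvdE)
  then have y: "x * y = 1" by simp
  show "\<not> pZ dvd x"
  proof
    assume "pZ dvd x"
    then have "pZ dvd x * y" by (rule dvd_mult2)
    then have "pZ dvd (1 :: 'p padic_int)" by (simp only: y)
    then have "1 mod int CARD('p) = 0" by (simp add: pZ_dvd_iff one_padic_int.rep_eq)
    then show False using p_gt_1[where 'p='p] by simp
  qed
next
  assume "\<not> pZ dvd x"
  then obtain y where "x * y = 1" using padic_int_unit by blast
  then have "1 = x * y" by simp
  then show "x dvd 1" by (rule dvdI)
qed

lemma pZ_power_dvd: "Rep_padic_int (x :: 'p::prime_card padic_int) n = 0 \<Longrightarrow> pZ ^ n dvd x"
proof (induction n arbitrary: x)
  case (Suc n)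
  let ?q = "int CARD('p)"
  have q: "?q > 0" using p_gt_1[where 'p='p] by simp
  have "Rep_padic_int x 1 = 0" using Rep_mod_le[of 1 "Suc n" x] Suc.prems by simp
  then obtain y where y: "x = pZ * y" using pZ_dvd_iff by (metis dvdE)
  have "?q * ?q ^ n dvd ?q * Rep_padic_int y (Suc n)"
    using Suc.prems by (simp add: y times_padic_int.rep_eq Rep_of_nat mod_mult_left_eq dvd_eq_mod_eq_0)
  then have "?q ^ n dvd Rep_padic_int y (Suc n)" using q by simp
  then have "Rep_padic_int y n = 0" using Rep_compat[of y n] by (simp add: dvd_eq_mod_eq_0)
  then show ?case using Suc.IH[of y] y by (simp add: mult_dvd_mono)
qed simp

lemma Rep_pZ_power_mult: "Rep_padic_int (pZ ^ n * y :: 'p::prime_card padic_int) n = 0"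
  by (simp add: times_padic_int.rep_eq Rep_power Rep_of_nat power_mod mod_mult_left_eq)

lemma padic_int_zeroI: "(\<And>n. pZ ^ n dvd (x :: 'p::prime_card padic_int)) \<Longrightarrow> x = 0"
  by (rule padic_int_eqI) (metis Rep_pZ_power_mult dvdE zero_padic_int.rep_eq)

lemma padic_int_factor:
  assumes "(x :: 'p::prime_card padic_int) \<noteq> 0"
  shows "\<exists>k u. u dvd 1 \<and> x = pZ ^ k * u"
proof -
  have "\<exists>n. Rep_padic_int x n \<noteq> 0"
    using assms padic_int_zeroI pZ_power_dvd by blast
  then obtain n where "Rep_padic_int x n \<noteq> 0" ..
  then show ?thesis
  proof (induction n arbitrary: x)
    case (Suc n)
    show ?case
    proof (cases "pZ dvd x")
      case True
      then obtain y where y: "x = pZ * y" by blast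
      have "Rep_padic_int y n \<noteq> 0"
      proof
        assume "Rep_padic_int y n = 0"
        then have "pZ ^ Suc n dvd x" using pZ_power_dvd[of y n] y by (simp add: mult_dvd_mono)
        then show False using Suc.prems Rep_pZ_power_mult by (metis dvdE)
      qed
      from Suc.IH[OF this] obtain k u where "u dvd 1" "y = pZ ^ k * u" by blast
      then have "u dvd 1 \<and> x = pZ ^ Suc k * u" using y by (simp add: mult.assoc)
      then show ?thesis by blast
    next
      case False
      then have "x dvd 1 \<and> x = pZ ^ 0 * x" by (simp add: padic_int_unit_iff)
      then show ?thesis by blast
    qed
  qed simp
qed

lemma pZ_dvd_diff_iff: "pZ dvd (x - y :: 'p::prime_card padic_int) \<longleftrightarrow> Rep_padic_int x 1 = Rep_padic_int y 1"
proof -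
  have "Rep_padic_int (x - y) 1 = 0 \<longleftrightarrow> Rep_padic_int x 1 mod int CARD('p) = Rep_padic_int y 1 mod int CARD('p)"
    by (simp add: minus_padic_int.rep_eq mod_eq_dvd_iff mod_0_imp_dvd dvd_eq_mod_eq_0)
  then show ?thesis
    using Rep_padic_int_mod[of x 1] Rep_padic_int_mod[of y 1] by (simp add: pZ_dvd_iff)
qed

lemma padic_int_residue: "\<exists>a<CARD('p). \<exists>y. (x :: 'p::prime_card padic_int) = of_nat a + pZ * y"
proof -
  obtain a where a': "Rep_padic_int x 1 = int a"
    using Rep_range(1)[of x 1] nonneg_int_cases by blast
  then have a: "a < CARD('p)" using Rep_range(2)[of x 1] by simp
  then have "Rep_padic_int (of_nat a :: 'p padic_int) 1 = Rep_padic_int x 1"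
    by (simp add: Rep_of_nat a'[simplified])
  then have "pZ dvd x - of_nat a" by (simp add: pZ_dvd_diff_iff)
  then obtain y where "x - of_nat a = pZ * y" by blast
  then have "x = of_nat a + pZ * y" by (simp add: algebra_simps)
  then show ?thesis using a by blast
qed

lemma of_nat_dvd_diff_iff:
  assumes "a < CARD('p::prime_card)" "b < CARD('p)"
  shows "(pZ :: 'p padic_int) dvd of_nat a - of_nat b \<longleftrightarrow> a = b"
  using assms by (simp add: pZ_dvd_diff_iff Rep_of_nat)

subsection \<open>Teichmueller representatives\<close>

text \<open>The difference \<open>a\<^sup>q - b\<^sup>q\<close> is \<open>a - b\<close> times a sum of \<open>q\<close> terms that are all congruent to \<open>b\<^sup>q\<^sup>-\<^sup>1\<close>
  modulo \<open>q\<close>, so that one more power of \<open>q\<close> is gained.\<close>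

lemma power_cong_lift:
  fixes a b :: "'a::comm_ring_1"
  assumes "of_nat q ^ Suc k dvd a - b"
  shows "of_nat q ^ Suc (Suc k) dvd a ^ q - b ^ q"
proof -
  have qd: "of_nat q dvd a - b"
    using assms by (meson dvd_power dvd_trans zero_less_Suc)
  have *: "of_nat q dvd a ^ i - b ^ i" for i
    using qd power_diff_sumr2[of a i b] by (metis dvd_mult2)
  have "of_nat q dvd (\<Sum>i<q. b ^ (q - Suc i) * a ^ i)"
  proof -
    have "(\<Sum>i<q. b ^ (q - Suc i) * a ^ i) = (\<Sum>i<q. b ^ (q - Suc i) * (a ^ i - b ^ i)) + (\<Sum>i<q. b ^ (q - 1))"
      unfolding sum.distrib[symmetric]
      by (rule sum.cong) (simp_all add: algebra_simps power_add[symmetric])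
    also have "of_nat q dvd \<dots>"
    proof (rule dvd_add)
      show "of_nat q dvd (\<Sum>i<q. b ^ (q - Suc i) * (a ^ i - b ^ i))"
        by (rule dvd_sum) (simp add: *)
      show "of_nat q dvd (\<Sum>i<q. b ^ (q - 1))" by simp
    qed
    finally show ?thesis .
  qed
  then have "of_nat q ^ Suc k * of_nat q dvd (a - b) * (\<Sum>i<q. b ^ (q - Suc i) * a ^ i)"
    using assms by (intro mult_dvd_mono)
  then show ?thesis by (simp add: power_diff_sumr2 mult.commute)
qed

lemma power_cong_lift_iter:
  fixes a b :: "'a::comm_ring_1"
  assumes "of_nat q dvd a - b"
  shows "of_nat q ^ Suc k dvd a ^ (q ^ k) - b ^ (q ^ k)"
proof (induction k)
  case (Suc k)
  then have "of_nat q ^ Suc (Suc k) dvd (a ^ (q ^ k)) ^ q - (b ^ (q ^ k)) ^ q"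
    by (rule power_cong_lift)
  then show ?case by (simp add: power_mult[symmetric] mult.commute)
qed (use assms in simp)

lemma p_minus_1_Suc: "Suc (CARD('p::prime_card) - 1) = CARD('p)"
  using p_gt_1[where 'p='p] by simp

text \<open>A \<open>(p - 1)\<close>-th root of unity is its own \<open>p\<^sup>n\<close>-th power for every \<open>n\<close>, so that a congruence modulo \<open>p\<close>
  between two of them improves to a congruence modulo every power of \<open>p\<close>.\<close>

lemma roots_of_unity_eqI:
  fixes x y :: "'p::prime_card padic_int"
  assumes "x ^ (CARD('p) - 1) = 1" "y ^ (CARD('p) - 1) = 1" "pZ dvd x - y"
  shows "x = y"
proof -
  have P: "z ^ (CARD('p) ^ n) = z" if "z ^ (CARD('p) - 1) = 1" for z :: "'p padic_int" and n
  proof (induction n)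
    case (Suc n)
    have "z ^ CARD('p) = z" using that p_minus_1_Suc[where 'p='p] by (metis mult.right_neutral power_Suc)
    then show ?case using Suc by (simp add: power_mult)
  qed simp
  have "pZ ^ n dvd x - y" for n
    using power_cong_lift_iter[OF assms(3), of n] P[OF assms(1)] P[OF assms(2)]
    by (metis dvd_trans le_imp_power_dvd lessI less_imp_le)
  then show ?thesis using padic_int_zeroI[of "x - y"] by simp
qed

text \<open>Consecutive \<open>p\<^sup>n\<close>-th powers of \<open>u\<close> are congruent modulo increasing powers of \<open>p\<close>; their limit is
  fixed by the \<open>p\<close>-th power map.\<close>

lemma teich_exists:
  assumes "u \<in> {1..<CARD('p::prime_card)}"
  shows "\<exists>x :: 'p padic_int. x ^ (CARD('p) - 1) = 1 \<and> pZ dvd x - of_nat u"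
proof -
  let ?q = "int CARD('p)" and ?p = "CARD('p)"
  have fermat: "int ?p dvd int u ^ ?p - int u"
  proof -
    have "\<not> ?p dvd u" using assms by (auto dest: dvd_imp_le)
    then have "[u ^ (?p - 1) = 1] (mod ?p)" using fermat_theorem prime_card by blast
    then have "[u * u ^ (?p - 1) = u * 1] (mod ?p)" by (rule cong_mult[OF cong_refl])
    then have "[u ^ ?p = u] (mod ?p)" using p_minus_1_Suc[where 'p='p] by (metis mult.right_neutral power_Suc)
    then have "[int (u ^ ?p) = int u] (mod int ?p)" by (simp only: cong_int_iff)
    then show ?thesis by (simp add: cong_iff_dvd_diff)
  qed
  define y where "y = (\<lambda>n. int u ^ (?p ^ n) mod ?q ^ n)"
  have lift: "?q ^ Suc n dvd int u ^ (?p ^ Suc n) - int u ^ (?p ^ n)" for n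
    using power_cong_lift_iter[OF fermat, of n] by (simp only: power_mult power_Suc)
  have lift': "int u ^ (?p ^ Suc n) mod ?q ^ n = int u ^ (?p ^ n) mod ?q ^ n" for n
  proof -
    have "?q ^ n dvd int u ^ (?p ^ Suc n) - int u ^ (?p ^ n)"
      by (rule dvd_trans[OF le_imp_power_dvd lift]) simp
    then show ?thesis by (simp only: mod_eq_dvd_iff)
  qed
  have "y n = y (Suc n) mod ?q ^ n" for n
    unfolding y_def by (simp only: mod_Suc_power lift')
  then have z: "Rep_padic_int (Abs_padic_int y :: 'p padic_int) = y" (is "Rep_padic_int ?z = y")
    by (intro Abs_padic_int_inverse) blast
  have yn: "y n = int u ^ (?p ^ n) mod ?q ^ n" for n by (simp add: y_def)
  have zn: "Rep_padic_int ?z n = int u ^ (?p ^ n) mod ?q ^ n" for n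
    using fun_cong[OF z, of n] yn[of n] by (rule trans)
  have "?z ^ ?p = ?z"
  proof (rule padic_int_eqI)
    fix n
    have "Rep_padic_int (?z ^ ?p) n = int u ^ (?p ^ n * ?p) mod ?q ^ n"
      by (simp add: Rep_power zn power_mod power_mult)
    also have "\<dots> = Rep_padic_int ?z n"
      using lift'[of n] by (simp add: zn mult.commute)
    finally show "Rep_padic_int (?z ^ ?p) n = Rep_padic_int ?z n" .
  qed
  moreover have d: "pZ dvd ?z - of_nat u"
  proof -
    have "[int u ^ ?p = int u] (mod ?q)" using fermat by (simp add: cong_iff_dvd_diff)
    then have "Rep_padic_int ?z 1 = Rep_padic_int (of_nat u :: 'p padic_int) 1"
      by (simp add: zn[of "Suc 0"] Rep_of_nat cong_def)
    then show ?thesis by (simp add: pZ_dvd_diff_iff)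
  qed
  moreover have "?z \<noteq> 0"
  proof
    assume "?z = 0"
    then have "pZ dvd of_nat u - (of_nat 0 :: 'p padic_int)" using d by (simp add: dvd_minus_iff)
    then show False using of_nat_dvd_diff_iff[where 'p='p, of u 0] assms by simp
  qed
  ultimately have "?z * ?z ^ (?p - 1) = ?z * 1 \<and> pZ dvd ?z - of_nat u \<and> ?z \<noteq> 0"
    using p_minus_1_Suc[where 'p='p] by (metis mult.right_neutral power_Suc)
  then show ?thesis by (metis mult_cancel_left)
qed

definition roots_of_unity :: "'p::prime_card padic_int set" where
  "roots_of_unity = {x. x ^ (CARD('p) - 1) = 1}"

lemma teich:
  assumes "u \<in> {1..<CARD('p::prime_card)}"
  shows "(teich u :: 'p padic_int) \<in> roots_of_unity" "pZ dvd (teich u :: 'p padic_int) - of_nat u"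
proof -
  have "\<exists>!x :: 'p padic_int. x ^ (CARD('p) - 1) = 1 \<and> pZ dvd x - of_nat u"
  proof (rule ex_ex1I)
    show "\<exists>x :: 'p padic_int. x ^ (CARD('p) - 1) = 1 \<and> pZ dvd x - of_nat u" by (rule teich_exists[OF assms])
  next
    fix x y :: "'p padic_int"
    assume x: "x ^ (CARD('p) - 1) = 1 \<and> pZ dvd x - of_nat u"
      and y: "y ^ (CARD('p) - 1) = 1 \<and> pZ dvd y - of_nat u"
    have "pZ dvd (x - of_nat u) - (y - of_nat u)" by (rule dvd_diff) (use x y in blast)+
    then have "pZ dvd x - y" by simp
    then show "x = y" using x y roots_of_unity_eqI by blast
  qed
  from theI'[OF this] show "(teich u :: 'p padic_int) \<in> roots_of_unity" "pZ dvd (teich u :: 'p padic_int) - of_nat u"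
    unfolding teich_def roots_of_unity_def by auto
qed

lemma roots_of_unity_unit: "x \<in> roots_of_unity \<Longrightarrow> \<not> pZ dvd (x :: 'p::prime_card padic_int)"
proof -
  assume "x \<in> roots_of_unity"
  then have "x ^ (CARD('p) - 1) = 1" by (simp add: roots_of_unity_def)
  moreover have "CARD('p) - 1 \<noteq> 0" using p_gt_1[where 'p='p] by simp
  ultimately have "x dvd 1" by (metis dvd_power not_gr_zero)
  then show ?thesis by (simp add: padic_int_unit_iff)
qed

lemma roots_of_unity_representative:
  assumes "\<not> pZ dvd (x :: 'p::prime_card padic_int)"
  shows "\<exists>q\<in>roots_of_unity. pZ dvd x - q"
proof -
  obtain a y where a: "a < CARD('p)" "x = of_nat a + pZ * y" using padic_int_residue by blast
  then have "a \<in> {1..<CARD('p)}" using assms by (cases a) auto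
  note t = teich[OF this]
  have "pZ dvd pZ * y - (teich a - of_nat a)" by (rule dvd_diff[OF dvd_triv_left t(2)])
  then have "pZ dvd x - teich a" using a by (simp add: algebra_simps)
  then show ?thesis using t(1) by blast
qed

lemma teich_bij: "bij_betw teich {1..<CARD('p)} (roots_of_unity :: 'p::prime_card padic_int set)"
  unfolding bij_betw_def
proof
  show "inj_on (teich :: nat \<Rightarrow> 'p padic_int) {1..<CARD('p)}"
  proof (rule inj_onI)
    fix u v assume u: "u \<in> {1..<CARD('p)}" and v: "v \<in> {1..<CARD('p)}"
      and eq: "(teich u :: 'p padic_int) = teich v"
    have "pZ dvd (teich v - of_nat v) - (teich u - of_nat u :: 'p padic_int)"
      by (rule dvd_diff[OF teich(2)[OF v] teich(2)[OF u]])
    then have "(pZ :: 'p padic_int) dvd of_nat u - of_nat v" by (simp add: eq)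
    then show "u = v" using of_nat_dvd_diff_iff[where 'p='p] u v by simp
  qed
  show "teich ` {1..<CARD('p)} = (roots_of_unity :: 'p padic_int set)"
  proof
    show "teich ` {1..<CARD('p)} \<subseteq> (roots_of_unity :: 'p padic_int set)" using teich by blast
  next
    show "(roots_of_unity :: 'p padic_int set) \<subseteq> teich ` {1..<CARD('p)}"
    proof
      fix x :: "'p padic_int" assume x: "x \<in> roots_of_unity"
      obtain a y where a: "a < CARD('p)" "x = of_nat a + pZ * y" using padic_int_residue by blast
      then have a1: "a \<in> {1..<CARD('p)}" using roots_of_unity_unit[OF x] by (cases a) auto
      note t = teich[OF a1]
      have "pZ dvd pZ * y - (teich a - of_nat a)" by (rule dvd_diff[OF dvd_triv_left t(2)])
      then have "pZ dvd x - teich a" using a by (simp add: algebra_simps)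
      then have "x = teich a" using x t(1) roots_of_unity_eqI[of x "teich a"]
        unfolding roots_of_unity_def by blast
      then show "x \<in> teich ` {1..<CARD('p)}" using a1 by blast
    qed
  qed
qed

lemma finite_roots_of_unity: "finite (roots_of_unity :: 'p::prime_card padic_int set)"
  using teich_bij bij_betw_finite by blast

subsection \<open>Reduction to the residue field\<close>

definition red :: "'p::prime_card padic_int \<Rightarrow> 'k::field" where
  "red x = of_int (Rep_padic_int x 1)"

lemma of_int_mod_char:
  assumes "CHAR('k::field) = CARD('p::prime_card)"
  shows "(of_int (a mod int CARD('p)) :: 'k) = of_int a"
proof -
  have 0: "(of_int (int CARD('p)) :: 'k) = 0"
    using of_nat_CHAR[where 'a='k] unfolding assms by simp
  have "(of_int (a div int CARD('p) * int CARD('p) + a mod int CARD('p)) :: 'k) = of_int (a mod int CARD('p))"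
    by (simp only: of_int_add of_int_mult 0 mult_zero_right add_0_left)
  then show ?thesis by (simp only: div_mult_mod_eq)
qed

context
  assumes char: "CHAR('k::field) = CARD('p::prime_card)"
begin

lemma red_add: "red (x + y :: 'p padic_int) = (red x + red y :: 'k)"
  using of_int_mod_char[OF char] by (simp add: red_def plus_padic_int.rep_eq)

lemma red_mult: "red (x * y :: 'p padic_int) = (red x * red y :: 'k)"
  using of_int_mod_char[OF char] by (simp add: red_def times_padic_int.rep_eq)

lemma red_uminus: "red (- x :: 'p padic_int) = (- red x :: 'k)"
  using of_int_mod_char[OF char] by (simp add: red_def uminus_padic_int.rep_eq)

lemma red_diff: "red (x - y :: 'p padic_int) = (red x - red y :: 'k)"
  using of_int_mod_char[OF char] by (simp add: red_def minus_padic_int.rep_eq)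

lemma red_of_nat: "red (of_nat n :: 'p padic_int) = (of_nat n :: 'k)"
  using of_int_mod_char[OF char] by (simp add: red_def Rep_of_nat)

lemma red_1: "red (1 :: 'p padic_int) = (1 :: 'k)"
  using red_of_nat[of 1] by simp

lemma red_eq_0: "pZ dvd x \<Longrightarrow> red (x :: 'p padic_int) = (0 :: 'k)"
  by (simp add: red_def pZ_dvd_iff)

end

lemma Hom_add_red:
  assumes "CHAR('k::field) = CARD('p::prime_card)" and c: "c \<in> (Hom_add :: ('p padic_int \<Rightarrow> 'k) set)"
  shows "c x = c 1 * red x"
proof -
  have add: "c (x + y) = c x + c y" and p0: "c (pZ * x) = 0" for x y
    using c by (auto simp: Hom_add_def)
  have c0: "c 0 = 0" using p0[of 0] by simp
  have nat: "c (of_nat n) = c 1 * of_nat n" for n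
    by (induction n) (simp_all add: c0 add algebra_simps)
  obtain a y where a: "x = of_nat a + pZ * y" using padic_int_residue by blast
  show ?thesis
    unfolding a by (simp add: add p0 nat red_add[OF assms(1)] red_of_nat[OF assms(1)] red_eq_0[OF assms(1)])
qed

text \<open>As \<open>c\<close> is trivial on \<open>1 + p\<^sup>2\<int>\<^sub>p\<close>, the value \<open>c(1 + px)\<close> depends only on \<open>x\<close> modulo \<open>p\<close>, and it is additive in \<open>x\<close>
  because \<open>(1 + px)(1 + py)\<close> is congruent to \<open>1 + p(x + y)\<close> modulo \<open>p\<^sup>2\<close>.\<close>

lemma Hom_mult_red:
  assumes "CHAR('k::field) = CARD('p::prime_card)" and c: "c \<in> (Hom_mult :: ('p padic_int \<Rightarrow> 'k) set)"
  shows "c (1 + pZ * x) = c (1 + pZ) * red x"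
proof -
  have mult: "c ((1 + pZ * x) * (1 + pZ * y)) = c (1 + pZ * x) + c (1 + pZ * y)"
    and p0: "c (1 + pZ ^ 2 * x) = 0" for x y
    using c by (auto simp: Hom_mult_def)
  have indep: "c (1 + pZ * (x + pZ * y)) = c (1 + pZ * x)" for x y
  proof -
    obtain z where z: "(1 + pZ * x) * z = 1"
    proof -
      have "\<not> pZ dvd 1 + pZ * x"
        using padic_int_unit_iff[of "1 :: 'p padic_int"] by (metis dvd_add_left_iff dvd_triv_left dvd_refl)
      then show ?thesis using padic_int_unit that by blast
    qed
    have "1 + pZ * (x + pZ * y) = (1 + pZ * x) * (1 + pZ * (pZ * (y * z)))"
    proof -
      have "(1 + pZ * x) * (1 + pZ * (pZ * (y * z))) = 1 + pZ * x + pZ * pZ * y * ((1 + pZ * x) * z)"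
        by (simp add: algebra_simps)
      then show ?thesis unfolding z by (simp add: algebra_simps)
    qed
    moreover have "c (1 + pZ * (pZ * (y * z))) = 0"
      using p0[of "y * z"] by (simp add: power2_eq_square mult.assoc)
    ultimately show ?thesis using mult by simp
  qed
  have add: "c (1 + pZ * (x + y)) = c (1 + pZ * x) + c (1 + pZ * y)" for x y
  proof -
    have "(1 + pZ * x) * (1 + pZ * y) = 1 + pZ * ((x + y) + pZ * (x * y))"
      by (simp add: algebra_simps)
    then show ?thesis using mult[of x y] indep[of "x + y" "x * y"] by simp
  qed
  have c0: "c (1 + pZ * 0) = 0" using p0[of 0] by simp
  have nat: "c (1 + pZ * of_nat n) = c (1 + pZ) * of_nat n" for n
  proof (induction n)
    case (Suc n)
    then show ?case using add[of "of_nat n" 1] by (simp add: algebra_simps)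
  qed (use c0 in simp)
  obtain a y where a: "x = of_nat a + pZ * y" using padic_int_residue by blast
  show ?thesis
    unfolding a by (simp add: nat indep red_add[OF assms(1)] red_of_nat[OF assms(1)] red_eq_0[OF assms(1)])
qed


section \<open>The field of \<open>p\<close>-adic numbers\<close>

lemma Rep_of_Zp: "Rep_padic (of_Zp x) = Fract x 1"
  by (simp add: of_Zp_def Abs_padic_inverse)

lemma of_Zp_eq_iff [simp]: "of_Zp x = of_Zp y \<longleftrightarrow> x = y"
  by (simp add: Rep_padic_inject[symmetric] Rep_of_Zp eq_fract)

lemma of_Zp_0 [simp]: "of_Zp 0 = 0"
  by (simp add: Rep_padic_inject[symmetric] Rep_of_Zp zero_padic.rep_eq Zero_fract_def)

lemma of_Zp_1 [simp]: "of_Zp 1 = 1"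
  by (simp add: Rep_padic_inject[symmetric] Rep_of_Zp one_padic.rep_eq One_fract_def)

lemma of_Zp_add: "of_Zp (x + y) = of_Zp x + of_Zp y"
  by (simp add: Rep_padic_inject[symmetric] Rep_of_Zp plus_padic.rep_eq)

lemma of_Zp_mult: "of_Zp (x * y) = of_Zp x * of_Zp y"
  by (simp add: Rep_padic_inject[symmetric] Rep_of_Zp times_padic.rep_eq)

lemma of_Zp_uminus: "of_Zp (- x) = - of_Zp x"
  by (simp add: Rep_padic_inject[symmetric] Rep_of_Zp uminus_padic.rep_eq)

lemma of_Zp_diff: "of_Zp (x - y) = of_Zp x - of_Zp y"
  by (simp add: Rep_padic_inject[symmetric] Rep_of_Zp minus_padic.rep_eq)

lemma of_Zp_power: "of_Zp (x ^ n) = of_Zp x ^ n"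
  by (induction n) (simp_all add: of_Zp_mult)

lemma of_Zp_of_nat: "of_Zp (of_nat n) = of_nat n"
  by (induction n) (simp_all add: of_Zp_add)

lemma of_Zp_eq_0_iff [simp]: "of_Zp x = 0 \<longleftrightarrow> x = 0"
  using of_Zp_eq_iff[of x 0] by simp

lemma pQ_neq_0 [simp]: "(pQ :: 'p::prime_card padic) \<noteq> 0"
  using pZ_neq_0[where 'p='p] of_Zp_eq_0_iff[of "pZ :: 'p padic_int"] by (simp add: of_Zp_of_nat)

lemma padic_fraction: "\<exists>a b. b \<noteq> 0 \<and> (x :: 'p::prime_card padic) = of_Zp a / of_Zp b"
proof -
  obtain a b where "Rep_padic x = Fract a b" "b \<noteq> 0" by (cases "Rep_padic x") auto
  then have "b \<noteq> 0 \<and> x = of_Zp a / of_Zp b"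
    by (simp add: Rep_padic_inject[symmetric] divide_padic.rep_eq Rep_of_Zp)
  then show ?thesis by blast
qed

subsection \<open>Fractional ideals\<close>

definition pideal :: "int \<Rightarrow> 'p::prime_card padic set" where
  "pideal k = {pQ powi k * of_Zp y | y. True}"

lemma pideal_0_iff: "x \<in> pideal 0 \<longleftrightarrow> (\<exists>y. x = of_Zp y)"
  by (auto simp: pideal_def)

lemma pideal_of_nat_iff: "x \<in> pideal (int n) \<longleftrightarrow> (\<exists>y. x = of_Zp (pZ ^ n * y))"
  by (auto simp: pideal_def of_Zp_mult of_Zp_power of_Zp_of_nat)

lemma pideal_1_iff: "x \<in> pideal 1 \<longleftrightarrow> (\<exists>y. x = of_Zp (pZ * y))"
  using pideal_of_nat_iff[of x 1] by simp

lemma of_Zp_pideal [simp]: "of_Zp x \<in> pideal 0"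
  by (auto simp: pideal_0_iff)

lemma pideal_zero [simp]: "0 \<in> pideal k"
  unfolding pideal_def by (rule CollectI, rule exI[of _ 0]) simp

lemma pideal_add [intro]: "x \<in> pideal k \<Longrightarrow> y \<in> pideal k \<Longrightarrow> x + y \<in> pideal k"
  unfolding pideal_def by (auto simp: of_Zp_add[symmetric] distrib_left[symmetric])

lemma pideal_uminus [intro]: "x \<in> pideal k \<Longrightarrow> - x \<in> pideal k"
proof -
  assume "x \<in> pideal k"
  then obtain y where "x = pQ powi k * of_Zp y" by (auto simp: pideal_def)
  then have "- x = pQ powi k * of_Zp (- y)" by (simp add: of_Zp_uminus)
  then show ?thesis unfolding pideal_def by blast
qed

lemma pideal_uminus_iff [simp]: "- x \<in> pideal k \<longleftrightarrow> x \<in> pideal k"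
  using pideal_uminus[of x k] pideal_uminus[of "- x" k] by auto

lemma pideal_diff [intro]: "x \<in> pideal k \<Longrightarrow> y \<in> pideal k \<Longrightarrow> x - y \<in> pideal k"
  using pideal_add[of x k "- y"] by simp

lemma pideal_mult: "x \<in> pideal j \<Longrightarrow> y \<in> pideal k \<Longrightarrow> x * y \<in> pideal (j + k)"
proof -
  assume "x \<in> pideal j" "y \<in> pideal k"
  then obtain a b where "x = pQ powi j * of_Zp a" "y = pQ powi k * of_Zp b" by (auto simp: pideal_def)
  then have "x * y = pQ powi (j + k) * of_Zp (a * b)"
    by (simp add: power_int_add of_Zp_mult mult_ac)
  then show ?thesis unfolding pideal_def by blast
qed

lemma pQ_powi_pideal [simp]: "pQ powi k \<in> pideal k"
  unfolding pideal_def by (rule CollectI, rule exI[of _ 1]) simp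

lemma pideal_mono: "j \<le> k \<Longrightarrow> x \<in> pideal k \<Longrightarrow> x \<in> pideal j"
proof -
  assume jk: "j \<le> k" and "x \<in> pideal k"
  then obtain y where y: "x = pQ powi k * of_Zp y" by (auto simp: pideal_def)
  have "pQ powi k = pQ powi j * (pQ powi (k - j) :: 'a padic)"
    by (simp add: power_int_add[symmetric])
  also have "pQ powi (k - j) = (of_Zp (pZ ^ nat (k - j)) :: 'a padic)"
    using jk by (simp add: of_Zp_power of_Zp_of_nat power_int_def)
  finally have "x = pQ powi j * of_Zp (pZ ^ nat (k - j) * y)"
    using y by (simp add: of_Zp_mult)
  then show ?thesis unfolding pideal_def by blast
qed

lemma pideal_mult_le: "x \<in> pideal i \<Longrightarrow> y \<in> pideal j \<Longrightarrow> k \<le> i + j \<Longrightarrow> x * y \<in> pideal k"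
  using pideal_mult pideal_mono by blast

lemma pideal_one [simp]: "1 \<in> pideal 0"
  using of_Zp_pideal[of 1] by simp

lemma pideal_of_nat [simp]: "of_nat n \<in> pideal 0"
  using of_Zp_pideal[of "of_nat n"] by (simp add: of_Zp_of_nat)

lemma pideal_sum [intro]: "(\<And>a. a \<in> A \<Longrightarrow> f a \<in> pideal k) \<Longrightarrow> sum f A \<in> pideal k"
  by (induction A rule: infinite_finite_induct) auto

lemma pideal_shift: "pQ powi j * x \<in> pideal k \<longleftrightarrow> x \<in> pideal (k - j)"
proof
  assume "pQ powi j * x \<in> pideal k"
  then have "pQ powi (- j) * (pQ powi j * x) \<in> pideal (- j + k)" by (intro pideal_mult) simp
  then show "x \<in> pideal (k - j)" by (simp add: power_int_minus mult.assoc[symmetric])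
next
  assume "x \<in> pideal (k - j)"
  then have "pQ powi j * x \<in> pideal (j + (k - j))" by (intro pideal_mult) simp
  then show "pQ powi j * x \<in> pideal k" by simp
qed

definition punit :: "'p::prime_card padic \<Rightarrow> bool" where
  "punit u \<longleftrightarrow> u \<in> pideal 0 \<and> u \<notin> pideal 1"

lemma punit_of_Zp: "punit (of_Zp x) \<longleftrightarrow> \<not> pZ dvd x"
  by (auto simp: punit_def pideal_1_iff dvd_def)

lemma punit_inverse: "punit u \<Longrightarrow> punit (inverse u)" and punit_neq_0: "punit u \<Longrightarrow> u \<noteq> 0"
proof -
  assume u: "punit u"
  then obtain x where x: "u = of_Zp x" by (auto simp: punit_def pideal_0_iff)
  have "\<not> pZ dvd x" using u by (simp add: x punit_of_Zp)
  then obtain y where y: "x * y = 1" using padic_int_unit[of x] by blast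
  have "of_Zp (x * y) = 1" unfolding y by simp
  then have "u * of_Zp y = 1" by (simp only: x of_Zp_mult)
  then have "inverse u = of_Zp y" by (rule inverse_unique)
  moreover have "y dvd 1" using dvd_triv_right[of y x] by (simp only: y)
  ultimately show "punit (inverse u)" by (simp add: punit_of_Zp padic_int_unit_iff)
  show "u \<noteq> 0" using u by (auto simp: punit_def)
qed

lemma punit_iff: "punit u \<longleftrightarrow> u \<in> pideal 0 \<and> inverse u \<in> pideal 0 \<and> u \<noteq> 0"
proof (intro iffI conjI)
  assume u: "u \<in> pideal 0 \<and> inverse u \<in> pideal 0 \<and> u \<noteq> 0"
  have "u \<notin> pideal 1"
  proof
    assume "u \<in> pideal 1"
    then have "u * inverse u \<in> pideal (1 + 0)" by (rule pideal_mult) (use u in blast)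
    then have "1 \<in> (pideal 1 :: 'a padic set)" using u by simp
    then obtain y :: "'a padic_int" where "1 = of_Zp (pZ * y)" unfolding pideal_1_iff by blast
    then have "of_Zp 1 = of_Zp (pZ * y)" by simp
    then have "1 = pZ * y" by (simp only: of_Zp_eq_iff)
    then have "pZ dvd (1 :: 'a padic_int)" by (rule dvdI)
    then show False using padic_int_unit_iff[of "1 :: 'a padic_int"] by simp
  qed
  then show "punit u" using u by (simp add: punit_def)
qed (use punit_inverse[of u] punit_neq_0[of u] in \<open>auto simp: punit_def\<close>)

lemma punit_mult: "punit u \<Longrightarrow> punit v \<Longrightarrow> punit (u * v)"
  using pideal_mult[of u 0 v 0] pideal_mult[of "inverse u" 0 "inverse v" 0] by (auto simp: punit_iff)

lemma punit_uminus [simp]: "punit (- u) \<longleftrightarrow> punit u"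
  by (simp add: punit_def)

lemma punit_1 [simp]: "punit 1"
  by (simp add: punit_iff)

lemma one_notin_pideal [simp]: "1 \<notin> pideal 1"
  using punit_1 by (simp add: punit_def)

lemma punit_divide: "punit u \<Longrightarrow> punit v \<Longrightarrow> punit (u / v)"
  by (simp add: divide_inverse punit_mult punit_inverse)

lemma punit_cong: "x - y \<in> pideal 1 \<Longrightarrow> punit y \<Longrightarrow> punit x"
proof -
  assume xy: "x - y \<in> pideal 1" and y: "punit y"
  have "x - y \<in> pideal 0" using xy by (rule pideal_mono[rotated]) simp
  then have "(x - y) + y \<in> pideal 0" using y by (intro pideal_add) (auto simp: punit_def)
  moreover have "x \<notin> pideal 1"
  proof
    assume "x \<in> pideal 1"
    then have "x - (x - y) \<in> pideal 1" using xy by (rule pideal_diff)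
    then show False using y by (simp add: punit_def)
  qed
  ultimately show "punit x" by (simp add: punit_def)
qed

lemma punit_near_1: "x - 1 \<in> pideal 1 \<Longrightarrow> punit x"
  using punit_cong punit_1 by blast

lemma padic_factor:
  assumes "(x :: 'p::prime_card padic) \<noteq> 0"
  shows "\<exists>k u. punit u \<and> x = pQ powi k * u"
proof -
  obtain a b where ab: "b \<noteq> 0" "x = of_Zp a / of_Zp b" using padic_fraction by blast
  then have "a \<noteq> 0" using assms by auto
  then obtain k u where u: "u dvd 1" "a = pZ ^ k * u" using padic_int_factor by blast
  obtain l v where v: "v dvd 1" "b = pZ ^ l * v" using padic_int_factor ab(1) by blast
  have "x = pQ powi (int k - int l) * (of_Zp u / of_Zp v)"
    unfolding ab(2) u(2) v(2) by (simp add: of_Zp_mult of_Zp_power of_Zp_of_nat power_int_diff)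
  moreover have "punit (of_Zp u / of_Zp v)"
    using u v by (intro punit_divide) (simp_all add: punit_of_Zp padic_int_unit_iff)
  ultimately show ?thesis by blast
qed

lemma pideal_exists: "\<exists>k. x \<in> pideal k"
proof (cases "x = 0")
  case False
  then obtain k u where u: "punit u" "x = pQ powi k * u" using padic_factor by blast
  have "x \<in> pideal (k + 0)" unfolding u(2) by (rule pideal_mult) (use u(1) in \<open>simp_all add: punit_def\<close>)
  then show ?thesis by blast
qed auto

lemma punit_factor_pideal_iff: "punit u \<Longrightarrow> pQ powi k * u \<in> pideal j \<longleftrightarrow> j \<le> k"
proof
  assume u: "punit u"
  show "pQ powi k * u \<in> pideal j" if "j \<le> k"
    using pideal_mult[of "pQ powi k" k u 0] pideal_mono[OF that] u by (simp add: punit_def)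
  assume "pQ powi k * u \<in> pideal j"
  then have "u \<in> pideal (j - k)" by (simp add: pideal_shift)
  then show "j \<le> k" using u pideal_mono[of 1 "j - k" u] by (force simp: punit_def)
qed

lemma punit_factor_unique:
  assumes "punit u" "punit v" "pQ powi k * u = pQ powi j * v" shows "k = j"
proof (rule order_antisym)
  show "k \<le> j" using punit_factor_pideal_iff[OF assms(1), of k k] punit_factor_pideal_iff[OF assms(2), of j k] assms(3) by simp
  show "j \<le> k" using punit_factor_pideal_iff[OF assms(1), of k j] punit_factor_pideal_iff[OF assms(2), of j j] assms(3) by simp
qed

lemma punit_mult_pideal_iff: "punit u \<Longrightarrow> u * x \<in> pideal k \<longleftrightarrow> x \<in> pideal k"
proof
  assume u: "punit u"
  show "u * x \<in> pideal k" if "x \<in> pideal k"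
    using pideal_mult[of u 0 x k] that u by (simp add: punit_def)
  assume "u * x \<in> pideal k"
  then have "inverse u * (u * x) \<in> pideal (0 + k)" using u by (intro pideal_mult) (auto simp: punit_iff)
  moreover have "inverse u * (u * x) = x" using punit_neq_0[OF u] by (simp add: mult.assoc[symmetric])
  ultimately show "x \<in> pideal k" by simp
qed

subsection \<open>Residues\<close>

definition residue :: "'p::prime_card padic \<Rightarrow> 'k::field" where
  "residue x = red (THE y. x = of_Zp y)"

lemma residue_of_Zp [simp]: "residue (of_Zp x) = red x"
proof -
  have "(THE y. of_Zp x = of_Zp y) = x" by (rule the_equality) auto
  then show ?thesis by (simp add: residue_def)
qed

context
  assumes char: "CHAR('k::field) = CARD('p::prime_card)"
begin

lemma residue_add: "x \<in> pideal 0 \<Longrightarrow> y \<in> pideal 0 \<Longrightarrow> residue (x + y :: 'p padic) = (residue x + residue y :: 'k)"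
  by (auto simp: pideal_0_iff of_Zp_add[symmetric] red_add[OF char])

lemma residue_diff: "x \<in> pideal 0 \<Longrightarrow> y \<in> pideal 0 \<Longrightarrow> residue (x - y :: 'p padic) = (residue x - residue y :: 'k)"
  by (auto simp: pideal_0_iff of_Zp_diff[symmetric] red_diff[OF char])

lemma residue_mult: "x \<in> pideal 0 \<Longrightarrow> y \<in> pideal 0 \<Longrightarrow> residue (x * y :: 'p padic) = (residue x * residue y :: 'k)"
  by (auto simp: pideal_0_iff of_Zp_mult[symmetric] red_mult[OF char])

lemma residue_uminus: "x \<in> pideal 0 \<Longrightarrow> residue (- x :: 'p padic) = (- residue x :: 'k)"
  by (auto simp: pideal_0_iff of_Zp_uminus[symmetric] red_uminus[OF char])

lemma residue_of_nat: "residue (of_nat n :: 'p padic) = (of_nat n :: 'k)"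
  by (simp add: of_Zp_of_nat[symmetric] red_of_nat[OF char])

lemma residue_1: "residue (1 :: 'p padic) = (1 :: 'k)"
  using residue_of_nat[of 1] by simp

lemma residue_0: "residue (0 :: 'p padic) = (0 :: 'k)"
  using residue_of_nat[of 0] by simp

lemma residue_eq_0: "x \<in> pideal 1 \<Longrightarrow> residue (x :: 'p padic) = (0 :: 'k)"
  by (auto simp: pideal_1_iff red_eq_0[OF char])

lemma residue_cong:
  assumes "x - y \<in> pideal 1" "y \<in> pideal 0" shows "residue (x :: 'p padic) = (residue y :: 'k)"
proof -
  have "x - y \<in> pideal 0" using assms(1) by (rule pideal_mono[rotated]) simp
  then have "residue ((x - y) + y) = (residue (x - y) + residue y :: 'k)" using assms(2) by (rule residue_add)
  then show ?thesis using residue_eq_0[OF assms(1)] by simp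
qed

lemma residue_sum:
  "finite A \<Longrightarrow> (\<And>a. a \<in> A \<Longrightarrow> f a \<in> pideal 0) \<Longrightarrow> residue (\<Sum>a\<in>A. f a :: 'p padic) = (\<Sum>a\<in>A. residue (f a) :: 'k)"
proof (induction A rule: finite_induct)
  case (insert a A)
  have "sum f A \<in> pideal 0" using insert.prems by (intro pideal_sum) simp
  then show ?case using insert by (simp add: residue_add)
qed (simp add: residue_0)

lemma residue_inverse: "punit x \<Longrightarrow> residue (inverse x :: 'p padic) = (inverse (residue x) :: 'k)"
proof -
  assume x: "punit x"
  then have "residue (x * inverse x) = (residue x * residue (inverse x) :: 'k)"
    by (intro residue_mult) (simp_all add: punit_iff)
  then have "residue x * residue (inverse x) = (1 :: 'k)"
    using punit_neq_0[OF x] by (simp add: residue_1)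
  then show ?thesis by (simp add: inverse_unique)
qed

lemma residue_punit: "punit x \<Longrightarrow> residue (x :: 'p padic) \<noteq> (0 :: 'k)"
proof
  assume x: "punit x" and 0: "residue x = (0 :: 'k)"
  then have "residue (x * inverse x) = (residue x * residue (inverse x) :: 'k)"
    by (intro residue_mult) (simp_all add: punit_iff)
  then show False using punit_neq_0[OF x] 0 by (simp add: residue_1)
qed

end

subsection \<open>Topology\<close>

lemma open_padic_iff: "open (U :: 'p::prime_card padic set) \<longleftrightarrow> (\<forall>x\<in>U. \<exists>n. \<forall>y. y - x \<in> pideal (int n) \<longrightarrow> y \<in> U)"
proof -
  have "(\<forall>y. x + of_Zp (pZ ^ n * y) \<in> U) \<longleftrightarrow> (\<forall>y. y - x \<in> pideal (int n) \<longrightarrow> y \<in> U)" for x n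
  proof
    assume *: "\<forall>y. x + of_Zp (pZ ^ n * y) \<in> U"
    show "\<forall>y. y - x \<in> pideal (int n) \<longrightarrow> y \<in> U"
    proof (intro allI impI)
      fix y assume "y - x \<in> pideal (int n)"
      then obtain z where "y - x = of_Zp (pZ ^ n * z)" by (auto simp: pideal_of_nat_iff)
      then have "y = x + of_Zp (pZ ^ n * z)" by (metis add.commute diff_add_cancel)
      then show "y \<in> U" using * by simp
    qed
  next
    assume *: "\<forall>y. y - x \<in> pideal (int n) \<longrightarrow> y \<in> U"
    show "\<forall>y. x + of_Zp (pZ ^ n * y) \<in> U"
    proof
      fix y
      have "(x + of_Zp (pZ ^ n * y)) - x \<in> pideal (int n)" unfolding pideal_of_nat_iff by auto
      then show "x + of_Zp (pZ ^ n * y) \<in> U" using * by blast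
    qed
  qed
  then show ?thesis by (simp add: open_padic_def)
qed

lemma open_pideal_ball: "open {y. y - x \<in> pideal k}"
proof -
  have "\<exists>n. \<forall>z. z - y \<in> pideal (int n) \<longrightarrow> z - x \<in> pideal k" if "y - x \<in> pideal k" for y
  proof (intro exI allI impI)
    fix z assume "z - y \<in> pideal (int (nat k))"
    then have "z - y \<in> pideal k" by (rule pideal_mono[rotated]) simp
    then have "(z - y) + (y - x) \<in> pideal k" using that by (rule pideal_add)
    then show "z - x \<in> pideal k" by simp
  qed
  then show ?thesis unfolding open_padic_iff by blast
qed

text \<open>If the ball \<open>\<int>\<^sub>p\<close> had no finite subcover, then one of the finitely many balls of radius
  \<open>1/p\<close> in it would have none, and so on; the limit of these nested balls lies in a member of the
  cover, which contains one of the balls.\<close>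

lemma compact_Zp: "compact (range of_Zp :: 'p::prime_card padic set)"
proof (rule compactI)
  fix C :: "'p padic set set"
  assume C: "\<forall>T\<in>C. open T" "range of_Zp \<subseteq> \<Union>C"
  \<comment> \<open>\<open>bad n x\<close>: the ball \<open>x + p\<^sup>n\<int>\<^sub>p\<close> has no finite subcover.\<close>
  define bad where "bad = (\<lambda>n (x :: 'p padic_int). \<not> (\<exists>D\<subseteq>C. finite D \<and> {of_Zp (x + pZ ^ n * y) | y. True} \<subseteq> \<Union>D))"
  have step: "\<exists>x'. bad (Suc n) x' \<and> (\<exists>a. x' = x + pZ ^ n * a)" if "bad n x" for n x
  proof (rule ccontr)
    assume *: "\<not> ?thesis"
    have "\<forall>a. \<exists>D\<subseteq>C. finite D \<and> {of_Zp (x + pZ ^ n * of_nat a + pZ ^ Suc n * y) | y. True} \<subseteq> \<Union>D"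
    proof
      fix a :: nat
      have "\<not> bad (Suc n) (x + pZ ^ n * of_nat a)" using * by blast
      then show "\<exists>D\<subseteq>C. finite D \<and> {of_Zp (x + pZ ^ n * of_nat a + pZ ^ Suc n * y) | y. True} \<subseteq> \<Union>D"
        unfolding bad_def by blast
    qed
    then obtain D where D: "\<And>a. D a \<subseteq> C" "\<And>a. finite (D a)"
      "\<And>a. {of_Zp (x + pZ ^ n * of_nat a + pZ ^ Suc n * y) | y. True} \<subseteq> \<Union>(D a)" by metis
    have "{of_Zp (x + pZ ^ n * y) | y. True} \<subseteq> \<Union>(\<Union>a<CARD('p). D a)"
    proof clarify
      fix y :: "'p padic_int"
      obtain a z where a: "a < CARD('p)" "y = of_nat a + pZ * z" using padic_int_residue by blast
      have eq: "x + pZ ^ n * y = x + pZ ^ n * of_nat a + pZ ^ Suc n * z" by (simp add: a algebra_simps)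
      have "of_Zp (x + pZ ^ n * y) \<in> \<Union>(D a)" unfolding eq using D(3)[of a] by blast
      then show "of_Zp (x + pZ ^ n * y) \<in> \<Union>(\<Union>a<CARD('p). D a)" using a(1) by blast
    qed
    moreover have "(\<Union>a<CARD('p). D a) \<subseteq> C" "finite (\<Union>a<CARD('p). D a)" using D by auto
    ultimately show False using that unfolding bad_def by blast
  qed
  show "\<exists>D\<subseteq>C. finite D \<and> range of_Zp \<subseteq> \<Union>D"
  proof (rule ccontr)
    assume "\<not> ?thesis"
    then have "bad 0 0" by (auto simp: bad_def full_SetCompr_eq)
    with step obtain x where x: "\<And>n. bad n (x n)" "\<And>n. \<exists>a. x (Suc n) = x n + pZ ^ n * a"
      using dependent_nat_choice[of bad "\<lambda>n x x'. \<exists>a. x' = x + pZ ^ n * a"] by blast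
    define y where "y = (\<lambda>n. Rep_padic_int (x n) n)"
    have "y n = y (Suc n) mod int CARD('p) ^ n" for n
    proof -
      obtain a where "x (Suc n) = x n + pZ ^ n * a" using x(2) by blast
      then have "Rep_padic_int (x (Suc n)) n = y n"
        using Rep_pZ_power_mult[of n a] by (simp add: plus_padic_int.rep_eq y_def Rep_padic_int_mod)
      then show ?thesis unfolding y_def using Rep_compat[of "x (Suc n)" n] by simp
    qed
    then have z: "Rep_padic_int (Abs_padic_int y :: 'p padic_int) = y" (is "Rep_padic_int ?z = y")
      by (intro Abs_padic_int_inverse) blast
    obtain T where T: "T \<in> C" "of_Zp ?z \<in> T" using C(2) by blast
    then obtain n where n: "\<And>w. w - of_Zp ?z \<in> pideal (int n) \<Longrightarrow> w \<in> T"
      using C(1) unfolding open_padic_iff by blast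
    have "Rep_padic_int ?z n = Rep_padic_int (x n) n"
      using fun_cong[OF z, of n] by (rule trans) (simp add: y_def)
    then have "Rep_padic_int (x n - ?z) n = 0"
      by (simp add: minus_padic_int.rep_eq)
    then obtain b where b: "x n - ?z = pZ ^ n * b" using pZ_power_dvd by (metis dvdE)
    have "{of_Zp (x n + pZ ^ n * y) | y. True} \<subseteq> \<Union>{T}"
    proof clarify
      fix y
      have "x n + pZ ^ n * y - ?z = (x n - ?z) + pZ ^ n * y" by simp
      also have "\<dots> = pZ ^ n * (b + y)" unfolding b by (simp add: algebra_simps)
      finally have "of_Zp (x n + pZ ^ n * y) - of_Zp ?z = of_Zp (pZ ^ n * (b + y))"
        by (simp only: of_Zp_diff[symmetric])
      then have "of_Zp (x n + pZ ^ n * y) - of_Zp ?z \<in> pideal (int n)"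
        unfolding pideal_of_nat_iff by blast
      then show "of_Zp (x n + pZ ^ n * y) \<in> \<Union>{T}" using n by simp
    qed
    moreover have "{T} \<subseteq> C" using T by simp
    ultimately have "\<not> bad n (x n)" unfolding bad_def by blast
    then show False using x(1) by blast
  qed
qed


section \<open>Matrices and the Iwahori subgroup\<close>

lemma mat2_nth [simp]:
  "mat2 a b c d $ 1 $ 1 = a" "mat2 a b c d $ 1 $ 2 = b" "mat2 a b c d $ 2 $ 1 = c" "mat2 a b c d $ 2 $ 2 = d"
  by (simp_all add: mat2_def)

lemma mat_eq_iff: "A = B \<longleftrightarrow> A $ 1 $ 1 = B $ 1 $ 1 \<and> A $ 1 $ 2 = B $ 1 $ 2 \<and> A $ 2 $ 1 = B $ 2 $ 1 \<and> A $ 2 $ 2 = B $ 2 $ 2"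
  for A B :: "'p::prime_card mat"
  by (auto simp: vec_eq_iff forall_2)

lemma mat2_eq_iff [simp]: "mat2 a b c d = mat2 a' b' c' d' \<longleftrightarrow> a = a' \<and> b = b' \<and> c = c' \<and> d = d'"
  by (simp add: mat_eq_iff)

lemma mat2_cases: obtains a b c d where "A = mat2 a b c d"
  using that[of "A $ 1 $ 1" "A $ 1 $ 2" "A $ 2 $ 1" "A $ 2 $ 2"] by (simp add: mat_eq_iff)

lemma mat_mult_nth: "(A ** B) $ i $ j = A $ i $ 1 * B $ 1 $ j + A $ i $ 2 * B $ 2 $ j" for A B :: "'p::prime_card mat"
  by (simp add: matrix_matrix_mult_def sum_2)

lemma mat2_mult: "mat2 a b c d ** mat2 a' b' c' d' = mat2 (a*a'+b*c') (a*b'+b*d') (c*a'+d*c') (c*b'+d*d')"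
  by (simp add: mat_eq_iff mat_mult_nth)

lemma mat_1: "mat 1 = mat2 1 0 0 1"
  by (simp add: mat_eq_iff mat_def)

lemma det_mat2 [simp]: "det (mat2 a b c d) = a * d - b * c"
  by (simp add: det_2)

text \<open>The adjugate is an anti-multiplicative involution of all matrices that agrees with the
  inverse on the group.\<close>

definition adj :: "'p::prime_card mat \<Rightarrow> 'p mat" where
  "adj A = mat2 (A $ 2 $ 2) (- A $ 1 $ 2) (- A $ 2 $ 1) (A $ 1 $ 1)"

lemma adj_mat2 [simp]: "adj (mat2 a b c d) = mat2 d (- b) (- c) a"
  by (simp add: adj_def)

lemma adj_mult: "adj (A ** B) = adj B ** adj A"
  by (cases A rule: mat2_cases; cases B rule: mat2_cases) (simp add: mat2_mult algebra_simps)

lemma adj_adj [simp]: "adj (adj A) = A"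
  by (cases A rule: mat2_cases) simp

lemma adj_1 [simp]: "adj (mat 1) = mat 1"
  by (simp add: mat_1)

lemma SL2_iff: "A \<in> carrier SL2 \<longleftrightarrow> det A = 1"
  by (simp add: SL2_def)

lemma SL2_mult [simp]: "x \<otimes>\<^bsub>SL2\<^esub> y = x ** y"
  by (simp add: SL2_def)

lemma SL2_one [simp]: "\<one>\<^bsub>SL2\<^esub> = mat 1"
  by (simp add: SL2_def)

lemma mult_adj [simp]: "A \<in> carrier SL2 \<Longrightarrow> A ** adj A = mat 1"
  and adj_mult_self [simp]: "A \<in> carrier SL2 \<Longrightarrow> adj A ** A = mat 1"
  by (cases A rule: mat2_cases, simp add: SL2_iff mat2_mult mat_1 algebra_simps)+

lemma SL2_1 [simp]: "mat 1 \<in> carrier SL2"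
  by (simp add: SL2_iff mat_1)

lemma SL2_closed [simp, intro]: "A \<in> carrier SL2 \<Longrightarrow> B \<in> carrier SL2 \<Longrightarrow> A ** B \<in> carrier SL2"
  by (simp add: SL2_iff det_mul)

lemma SL2_adj_iff [simp]: "adj A \<in> carrier SL2 \<longleftrightarrow> A \<in> carrier SL2"
  by (cases A rule: mat2_cases) (simp add: SL2_iff algebra_simps)

lemma SL2_mult_iff: "A \<in> carrier SL2 \<Longrightarrow> A ** B \<in> carrier SL2 \<longleftrightarrow> B \<in> carrier SL2"
  by (simp add: SL2_iff det_mul)

lemma SL2_mult_iff': "B \<in> carrier SL2 \<Longrightarrow> A ** B \<in> carrier SL2 \<longleftrightarrow> A \<in> carrier SL2"
  by (simp add: SL2_iff det_mul)

lemma group_SL2: "group SL2"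
proof (rule groupI)
  show "x \<otimes>\<^bsub>SL2\<^esub> y \<otimes>\<^bsub>SL2\<^esub> z = x \<otimes>\<^bsub>SL2\<^esub> (y \<otimes>\<^bsub>SL2\<^esub> z)" for x y z
    by (simp add: matrix_mul_assoc)
  show "\<exists>y\<in>carrier SL2. y \<otimes>\<^bsub>SL2\<^esub> x = \<one>\<^bsub>SL2\<^esub>" if "x \<in> carrier SL2" for x
    using that by (intro bexI[of _ "adj x"]) simp_all
qed simp_all

lemma inv_SL2 [simp]: "x \<in> carrier SL2 \<Longrightarrow> inv\<^bsub>SL2\<^esub> x = adj x"
  by (rule group.inv_equality[OF group_SL2]) simp_all

lemma adj_cancel [simp]:
  "A \<in> carrier SL2 \<Longrightarrow> A ** (adj A ** B) = B" "A \<in> carrier SL2 \<Longrightarrow> adj A ** (A ** B) = B"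
  "A \<in> carrier SL2 \<Longrightarrow> (B ** A) ** adj A = B" "A \<in> carrier SL2 \<Longrightarrow> (B ** adj A) ** A = B"
  by (simp_all add: matrix_mul_assoc) (simp_all add: matrix_mul_assoc[symmetric])

subsection \<open>Coordinates that exchange the two simple reflections\<close>

text \<open>Conjugation by the matrix with rows \<open>(0, 1)\<close> and \<open>(p, 0)\<close> is an automorphism of \<open>G\<close> that
  preserves \<open>I\<close> and exchanges \<open>s\<^sub>0\<close> and \<open>s\<^sub>1\<close>.  For \<open>e = True\<close>, the entries below are those of the
  conjugate matrix; so a computation with these coordinates covers both reflections.\<close>

definition mt :: "bool \<Rightarrow> 'p::prime_card padic \<Rightarrow> 'p padic \<Rightarrow> 'p padic \<Rightarrow> 'p padic \<Rightarrow> 'p mat" where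
  "mt e a b c d = (if e then mat2 d (c / pQ) (pQ * b) a else mat2 a b c d)"

lemma mt_eq_iff [simp]: "mt e a b c d = mt e a' b' c' d' \<longleftrightarrow> a = a' \<and> b = b' \<and> c = c' \<and> d = d'"
  by (auto simp: mt_def)

lemma mt_mult: "mt e a b c d ** mt e a' b' c' d' = mt e (a*a'+b*c') (a*b'+b*d') (c*a'+d*c') (c*b'+d*d')"
  by (auto simp: mt_def mat2_mult field_simps)

lemma mt_1: "mat 1 = mt e 1 0 0 1"
  by (simp add: mt_def mat_1)

lemma det_mt [simp]: "det (mt e a b c d) = a * d - b * c"
  by (simp add: mt_def field_simps)

lemma adj_mt [simp]: "adj (mt e a b c d) = mt e d (- b) (- c) a"
  by (simp add: mt_def)

lemma mt_cases: obtains a b c d where "A = mt e a b c d"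
proof (cases A rule: mat2_cases)
  case (1 a b c d)
  show ?thesis
  proof (cases e)
    case True
    then show ?thesis using that[of d "c / pQ" "pQ * b" a] 1 by (simp add: mt_def)
  next
    case False
    then show ?thesis using that[of a b c d] 1 by (simp add: mt_def)
  qed
qed

lemma near_1_iff: "x - 1 \<in> pideal 1 \<longleftrightarrow> (\<exists>y. x = of_Zp (1 + pZ * y))"
proof -
  have "x - 1 = of_Zp (pZ * y) \<longleftrightarrow> x = of_Zp (1 + pZ * y)" for y
    by (auto simp: of_Zp_add algebra_simps)
  then show ?thesis by (simp add: pideal_1_iff)
qed

lemma mat2_iwahori_iff:
  "mat2 a b c d \<in> iwahori \<longleftrightarrow>
     a - 1 \<in> pideal 1 \<and> b \<in> pideal 0 \<and> c \<in> pideal 1 \<and> d - 1 \<in> pideal 1 \<and> a * d - b * c = 1"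
proof
  assume "mat2 a b c d \<in> iwahori"
  then obtain x y z t where "a = of_Zp (1 + pZ * x)" "b = of_Zp y" "c = of_Zp (pZ * z)" "d = of_Zp (1 + pZ * t)"
    and "a * d - b * c = 1"
    by (auto simp: iwahori_def SL2_iff)
  then show "a - 1 \<in> pideal 1 \<and> b \<in> pideal 0 \<and> c \<in> pideal 1 \<and> d - 1 \<in> pideal 1 \<and> a * d - b * c = 1"
    using near_1_iff[of a] near_1_iff[of d] pideal_0_iff[of b] pideal_1_iff[of c] by blast
next
  assume *: "a - 1 \<in> pideal 1 \<and> b \<in> pideal 0 \<and> c \<in> pideal 1 \<and> d - 1 \<in> pideal 1 \<and> a * d - b * c = 1"
  then obtain x y z t where "a = of_Zp (1 + pZ * x)" "b = of_Zp y" "c = of_Zp (pZ * z)" "d = of_Zp (1 + pZ * t)"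
    using near_1_iff[of a] near_1_iff[of d] pideal_0_iff[of b] pideal_1_iff[of c] by blast
  moreover have "mat2 a b c d \<in> carrier SL2" using * by (simp add: SL2_iff)
  ultimately show "mat2 a b c d \<in> iwahori" unfolding iwahori_def by blast
qed

lemma mt_iwahori_iff:
  "mt e a b c d \<in> iwahori \<longleftrightarrow>
     a - 1 \<in> pideal 1 \<and> b \<in> pideal 0 \<and> c \<in> pideal 1 \<and> d - 1 \<in> pideal 1 \<and> a * d - b * c = 1"
proof (cases e)
  case True
  have "c / pQ \<in> pideal 0 \<longleftrightarrow> c \<in> pideal 1" for c :: "'a padic"
    using pideal_shift[of "- 1" c 0] by (simp add: power_int_minus divide_inverse mult.commute)
  moreover have "pQ * b \<in> pideal 1 \<longleftrightarrow> b \<in> pideal 0" for b :: "'a padic"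
    using pideal_shift[of 1 b 1] by simp
  ultimately show ?thesis using True by (auto simp: mt_def mat2_iwahori_iff algebra_simps)
qed (simp add: mt_def mat2_iwahori_iff)

lemma iwahori_SL2: "g \<in> iwahori \<Longrightarrow> g \<in> carrier SL2"
  by (simp add: iwahori_def)

lemma iwahori_1 [simp]: "mat 1 \<in> iwahori"
  by (simp add: mat_1 mat2_iwahori_iff)

lemma near_1_mult: "x - 1 \<in> pideal 1 \<Longrightarrow> y - 1 \<in> pideal 1 \<Longrightarrow> x * y - 1 \<in> pideal 1"
proof -
  assume x: "x - 1 \<in> pideal 1" and y: "y - 1 \<in> pideal 1"
  have "x \<in> pideal 0" using punit_near_1[OF x] by (simp add: punit_def)
  then have "x * (y - 1) \<in> pideal 1" using y pideal_mult[of x 0 "y - 1" 1] by simp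
  then have "x * (y - 1) + (x - 1) \<in> pideal 1" using x by (rule pideal_add)
  then show ?thesis by (simp add: algebra_simps)
qed

lemma iwahori_mult [simp, intro]: "g \<in> iwahori \<Longrightarrow> h \<in> iwahori \<Longrightarrow> g ** h \<in> iwahori"
proof -
  assume g: "g \<in> iwahori" and h: "h \<in> iwahori"
  obtain a b c d where gg: "g = mat2 a b c d" by (rule mat2_cases)
  obtain a' b' c' d' where hh: "h = mat2 a' b' c' d'" by (rule mat2_cases)
  have 1: "a - 1 \<in> pideal 1" "b \<in> pideal 0" "c \<in> pideal 1" "d - 1 \<in> pideal 1"
    "a' - 1 \<in> pideal 1" "b' \<in> pideal 0" "c' \<in> pideal 1" "d' - 1 \<in> pideal 1"
    using g h by (simp_all add: gg hh mat2_iwahori_iff)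
  have 2: "a \<in> pideal 0" "d \<in> pideal 0" "a' \<in> pideal 0" "d' \<in> pideal 0"
    using 1 punit_near_1 by (auto simp: punit_def)
  have "(a * a' - 1) + b * c' \<in> pideal 1"
    using near_1_mult[OF 1(1) 1(5)] pideal_mult[OF 1(2) 1(7)] by (intro pideal_add) simp_all
  then have A: "a * a' + b * c' - 1 \<in> pideal 1" by (simp add: algebra_simps)
  have B: "a * b' + b * d' \<in> pideal 0"
    using pideal_mult[OF 2(1) 1(6)] pideal_mult[OF 1(2) 2(4)] by (intro pideal_add) simp_all
  have C: "c * a' + d * c' \<in> pideal 1"
    using pideal_mult[OF 1(3) 2(3)] pideal_mult[OF 2(2) 1(7)] by (intro pideal_add) simp_all
  have "(d * d' - 1) + c * b' \<in> pideal 1"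
    using near_1_mult[OF 1(4) 1(8)] pideal_mult[OF 1(3) 1(6)] by (intro pideal_add) simp_all
  then have D: "c * b' + d * d' - 1 \<in> pideal 1" by (simp add: algebra_simps)
  have "det (g ** h) = 1" using g h iwahori_SL2 by (metis SL2_iff SL2_closed)
  then show ?thesis using A B C D by (simp add: gg hh mat2_mult mat2_iwahori_iff)
qed

lemma iwahori_adj [simp]: "adj g \<in> iwahori \<longleftrightarrow> g \<in> iwahori"
  by (cases g rule: mat2_cases) (auto simp: mat2_iwahori_iff algebra_simps)

lemma iwahori_cancel: "g \<in> iwahori \<Longrightarrow> g ** h \<in> iwahori \<longleftrightarrow> h \<in> iwahori"
  using iwahori_mult[of "adj g" "g ** h"] iwahori_SL2[of g] by auto

lemma iwahori_cancel': "h \<in> iwahori \<Longrightarrow> g ** h \<in> iwahori \<longleftrightarrow> g \<in> iwahori"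
  using iwahori_mult[of "g ** h" "adj h"] iwahori_SL2[of h] by auto

subsection \<open>Congruence subgroups and topology\<close>

definition mcong :: "int \<Rightarrow> 'p::prime_card mat \<Rightarrow> 'p mat \<Rightarrow> bool" where
  "mcong k A B \<longleftrightarrow> (\<forall>i j. A $ i $ j - B $ i $ j \<in> pideal k)"

text \<open>The principal congruence subgroups, which form a basis of the neighbourhoods of \<open>1\<close>.\<close>

definition Gam :: "nat \<Rightarrow> 'p::prime_card mat set" where
  "Gam m = {A \<in> carrier SL2. mcong (int m) A (mat 1)}"

lemma mcong_refl [simp]: "mcong k A A"
  by (simp add: mcong_def)

lemma mcong_trans: "mcong k A B \<Longrightarrow> mcong k B C \<Longrightarrow> mcong k A C"
  unfolding mcong_def
proof (intro allI)
  fix i j assume "\<forall>i j. A $ i $ j - B $ i $ j \<in> pideal k" "\<forall>i j. B $ i $ j - C $ i $ j \<in> pideal k"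
  then have "(A $ i $ j - B $ i $ j) + (B $ i $ j - C $ i $ j) \<in> pideal k" by (intro pideal_add) blast+
  then show "A $ i $ j - C $ i $ j \<in> pideal k" by simp
qed

lemma mcong_mono: "j \<le> k \<Longrightarrow> mcong k A B \<Longrightarrow> mcong j A B"
  unfolding mcong_def using pideal_mono by blast

lemma mcong_mult_left:
  assumes "\<forall>i j. C $ i $ j \<in> pideal k" "mcong l A B"
  shows "mcong (k + l) (C ** A) (C ** B)"
  unfolding mcong_def
proof (intro allI)
  fix i j
  have "C $ i $ 1 * (A $ 1 $ j - B $ 1 $ j) + C $ i $ 2 * (A $ 2 $ j - B $ 2 $ j) \<in> pideal (k + l)"
    using assms unfolding mcong_def by (intro pideal_add pideal_mult) blast+
  then show "(C ** A) $ i $ j - (C ** B) $ i $ j \<in> pideal (k + l)"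
    by (simp add: mat_mult_nth algebra_simps)
qed

lemma mcong_mult_right:
  assumes "\<forall>i j. C $ i $ j \<in> pideal k" "mcong l A B"
  shows "mcong (l + k) (A ** C) (B ** C)"
  unfolding mcong_def
proof (intro allI)
  fix i j
  have "(A $ i $ 1 - B $ i $ 1) * C $ 1 $ j + (A $ i $ 2 - B $ i $ 2) * C $ 2 $ j \<in> pideal (l + k)"
    using assms unfolding mcong_def by (intro pideal_add pideal_mult) blast+
  then show "(A ** C) $ i $ j - (B ** C) $ i $ j \<in> pideal (l + k)"
    by (simp add: mat_mult_nth algebra_simps)
qed

lemma mat_entries_bounded: "\<exists>k::nat. \<forall>i j. (A :: 'p::prime_card mat) $ i $ j \<in> pideal (- int k)"
proof -
  have "\<exists>k::nat. x \<in> pideal (- int k)" for x :: "'p padic"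
  proof -
    obtain k where "x \<in> pideal k" using pideal_exists by blast
    then have "x \<in> pideal (- int (nat (- k)))" by (rule pideal_mono[rotated]) simp
    then show ?thesis by blast
  qed
  then have "\<forall>i j. \<exists>k::nat. A $ i $ j \<in> pideal (- int k)" by blast
  then obtain k where k: "\<And>i j. A $ i $ j \<in> pideal (- int (k i j))" by metis
  have "A $ i $ j \<in> pideal (- int (k 1 1 + k 1 2 + k 2 1 + k 2 2))" for i j
  proof (rule pideal_mono[OF _ k])
    show "- int (k 1 1 + k 1 2 + k 2 1 + k 2 2) \<le> - int (k i j)"
      using exhaust_2[of i] exhaust_2[of j] by auto
  qed
  then show ?thesis by blast
qed

lemma Gam_SL2: "g \<in> Gam m \<Longrightarrow> g \<in> carrier SL2"
  by (simp add: Gam_def)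

lemma Gam_mono: "m \<le> n \<Longrightarrow> g \<in> Gam n \<Longrightarrow> g \<in> Gam m"
  unfolding Gam_def using mcong_mono[of "int m" "int n"] by auto

lemma Gam_1_iwahori: "g \<in> Gam (Suc m) \<Longrightarrow> g \<in> iwahori"
proof -
  assume "g \<in> Gam (Suc m)"
  then have "g \<in> Gam 1" by (rule Gam_mono[rotated]) simp
  moreover obtain a b c d where "g = mat2 a b c d" by (rule mat2_cases)
  ultimately show ?thesis
    using pideal_mono[of 0 1 b] by (auto simp: Gam_def SL2_iff mcong_def mat_1 forall_2 mat2_iwahori_iff)
qed

lemma open_mat_iff: "open (U :: 'p::prime_card mat set) \<longleftrightarrow> (\<forall>x\<in>U. \<exists>n. \<forall>y. mcong (int n) y x \<longrightarrow> y \<in> U)"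
proof
  have row: "\<exists>n. \<forall>y. (\<forall>i. y $ i - x $ i \<in> pideal (int n)) \<longrightarrow> y \<in> S"
    if S: "open S" "x \<in> S" for S :: "('p padic ^ 2) set" and x
  proof -
    obtain A where A: "\<And>i. open (A i) \<and> x $ i \<in> A i" "\<And>y. (\<forall>i. y $ i \<in> A i) \<Longrightarrow> y \<in> S"
      using bspec[OF iffD1[OF open_vec_def S(1)] S(2)] by blast
    have "\<forall>i. \<exists>n. \<forall>y. y - x $ i \<in> pideal (int n) \<longrightarrow> y \<in> A i"
      using A(1) unfolding open_padic_iff by blast
    then obtain n where n: "\<And>i y. y - x $ i \<in> pideal (int (n i)) \<Longrightarrow> y \<in> A i" by metis
    have "y \<in> S" if "\<forall>i. y $ i - x $ i \<in> pideal (int (n 1 + n 2))" for y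
    proof (rule A(2), rule allI, rule n)
      fix i
      have "n i \<le> n 1 + n 2" using exhaust_2[of i] by auto
      then have "int (n i) \<le> int (n 1 + n 2)" by simp
      then show "y $ i - x $ i \<in> pideal (int (n i))"
        by (rule pideal_mono) (use that in blast)
    qed
    then show ?thesis by blast
  qed
  assume U: "open U"
  show "\<forall>x\<in>U. \<exists>n. \<forall>y. mcong (int n) y x \<longrightarrow> y \<in> U"
  proof
    fix x assume "x \<in> U"
    then obtain A where A: "\<And>i. open (A i) \<and> x $ i \<in> A i" "\<And>y. (\<forall>i. y $ i \<in> A i) \<Longrightarrow> y \<in> U"
      using bspec[OF iffD1[OF open_vec_def U]] by blast
    obtain n where n: "\<And>i y. (\<forall>j. y $ j - x $ i $ j \<in> pideal (int (n i))) \<Longrightarrow> y \<in> A i"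
    proof -
      have "\<forall>i. \<exists>n. \<forall>y. (\<forall>j. y $ j - x $ i $ j \<in> pideal (int n)) \<longrightarrow> y \<in> A i"
        using row A(1) by blast
      then show ?thesis using that by metis
    qed
    have "y \<in> U" if "mcong (int (n 1 + n 2)) y x" for y
    proof (rule A(2), rule allI, rule n, rule allI)
      fix i j
      have "n i \<le> n 1 + n 2" using exhaust_2[of i] by auto
      then have "int (n i) \<le> int (n 1 + n 2)" by simp
      then show "y $ i $ j - x $ i $ j \<in> pideal (int (n i))"
        by (rule pideal_mono) (use that in \<open>unfold mcong_def, blast\<close>)
    qed
    then show "\<exists>n. \<forall>y. mcong (int n) y x \<longrightarrow> y \<in> U" by blast
  qed
next
  assume *: "\<forall>x\<in>U. \<exists>n. \<forall>y. mcong (int n) y x \<longrightarrow> y \<in> U"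
  show "open U"
  proof (rule iffD2[OF open_vec_def], rule ballI)
    fix x assume "x \<in> U"
    then obtain n where n: "\<And>y. mcong (int n) y x \<Longrightarrow> y \<in> U" using * by blast
    let ?A = "\<lambda>i. {r :: 'p padic ^ 2. \<forall>j. r $ j - x $ i $ j \<in> pideal (int n)}"
    have "open (?A i)" for i
    proof (rule iffD2[OF open_vec_def], rule ballI)
      fix r assume r: "r \<in> ?A i"
      show "\<exists>B. (\<forall>j. open (B j) \<and> r $ j \<in> B j) \<and> (\<forall>y. (\<forall>j. y $ j \<in> B j) \<longrightarrow> y \<in> ?A i)"
        using r open_pideal_ball by (intro exI[of _ "\<lambda>j. {y. y - x $ i $ j \<in> pideal (int n)}"]) auto
    qed
    moreover have "x $ i \<in> ?A i" for i by simp
    moreover have "y \<in> U" if "\<forall>i. y $ i \<in> ?A i" for y using that n[of y] by (simp add: mcong_def)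
    ultimately show "\<exists>A. (\<forall>i. open (A i) \<and> x $ i \<in> A i) \<and> (\<forall>y. (\<forall>i. y $ i \<in> A i) \<longrightarrow> y \<in> U)"
      by (intro exI[of _ ?A]) blast
  qed
qed

lemma open_mcong: "open {y. mcong k y x}"
proof -
  have "mcong k z x" if "mcong (int (nat k)) z y" "mcong k y x" for y z
    by (rule mcong_trans[OF mcong_mono[OF _ that(1)] that(2)]) simp
  then show ?thesis unfolding open_mat_iff by blast
qed

lemma Gam_nbhd:
  assumes g: "g \<in> carrier SL2"
  obtains U where "open U" "g \<in> U" "\<And>y. y \<in> U \<Longrightarrow> y \<in> carrier SL2 \<Longrightarrow> adj g ** y \<in> Gam m"
proof -
  obtain k where k: "\<forall>i j. adj g $ i $ j \<in> pideal (- int k)" using mat_entries_bounded by blast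
  have "adj g ** y \<in> Gam m" if y: "mcong (int (m + k)) y g" "y \<in> carrier SL2" for y
  proof -
    have "mcong (- int k + int (m + k)) (adj g ** y) (adj g ** g)" by (rule mcong_mult_left[OF k y(1)])
    then show ?thesis using g y by (simp add: Gam_def)
  qed
  then show ?thesis using that[of "{y. mcong (int (m + k)) y g}"] open_mcong by auto
qed

text \<open>The cosets of congruence subgroups are a basis of the topology of \<open>G\<close>; this translates openness and
  continuity into statements about matrix products.\<close>

lemma openin_iff_Gam:
  assumes T: "T \<subseteq> carrier SL2"
  shows "openin (top_of_set T) S \<longleftrightarrow> S \<subseteq> T \<and> (\<forall>g\<in>S. \<exists>m. \<forall>\<gamma>\<in>Gam m. g ** \<gamma> \<in> T \<longrightarrow> g ** \<gamma> \<in> S)"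
proof
  assume "openin (top_of_set T) S"
  then obtain U where U: "open U" "S = T \<inter> U" by (auto simp: openin_open)
  have "\<exists>m. \<forall>\<gamma>\<in>Gam m. g ** \<gamma> \<in> T \<longrightarrow> g ** \<gamma> \<in> S" if "g \<in> S" for g
  proof -
    obtain n where n: "\<And>y. mcong (int n) y g \<Longrightarrow> y \<in> U" using U \<open>g \<in> S\<close> unfolding open_mat_iff by blast
    obtain k where k: "\<forall>i j. g $ i $ j \<in> pideal (- int k)" using mat_entries_bounded by blast
    have "g ** \<gamma> \<in> U" if "\<gamma> \<in> Gam (n + k)" for \<gamma>
    proof -
      have "mcong (- int k + int (n + k)) (g ** \<gamma>) (g ** mat 1)"
        using that by (intro mcong_mult_left[OF k]) (simp add: Gam_def)
      then show ?thesis using n by simp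
    qed
    then show ?thesis using U(2) by blast
  qed
  then show "S \<subseteq> T \<and> (\<forall>g\<in>S. \<exists>m. \<forall>\<gamma>\<in>Gam m. g ** \<gamma> \<in> T \<longrightarrow> g ** \<gamma> \<in> S)" using U by blast
next
  assume *: "S \<subseteq> T \<and> (\<forall>g\<in>S. \<exists>m. \<forall>\<gamma>\<in>Gam m. g ** \<gamma> \<in> T \<longrightarrow> g ** \<gamma> \<in> S)"
  have "\<exists>U. openin (top_of_set T) U \<and> g \<in> U \<and> U \<subseteq> S" if g: "g \<in> S" for g
  proof -
    obtain m where m: "\<And>\<gamma>. \<gamma> \<in> Gam m \<Longrightarrow> g ** \<gamma> \<in> T \<Longrightarrow> g ** \<gamma> \<in> S" using * g by blast
    have gS: "g \<in> carrier SL2" using g * T by blast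
    obtain U where U: "open U" "g \<in> U" "\<And>y. y \<in> U \<Longrightarrow> y \<in> carrier SL2 \<Longrightarrow> adj g ** y \<in> Gam m"
      by (rule Gam_nbhd[OF gS, of m]) blast
    have "T \<inter> U \<subseteq> S"
    proof
      fix y assume y: "y \<in> T \<inter> U"
      then have "adj g ** y \<in> Gam m" using U(3) T by blast
      then show "y \<in> S" using m[of "adj g ** y"] y gS by simp
    qed
    moreover have "openin (top_of_set T) (T \<inter> U)" using U by (auto simp: openin_open)
    ultimately show ?thesis using U(2) g * by blast
  qed
  then show "openin (top_of_set T) S" by (subst openin_subopen) blast
qed

lemma continuous_map_discrete_iff_Gam:
  assumes T: "T \<subseteq> carrier SL2"
  shows "continuous_map (top_of_set T) (discrete_topology V) c \<longleftrightarrow>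
    c ` T \<subseteq> V \<and> (\<forall>g\<in>T. \<exists>m. \<forall>\<gamma>\<in>Gam m. g ** \<gamma> \<in> T \<longrightarrow> c (g ** \<gamma>) = c g)" (is "?l \<longleftrightarrow> ?r")
proof
  assume c: ?l
  have "\<exists>m. \<forall>\<gamma>\<in>Gam m. g ** \<gamma> \<in> T \<longrightarrow> c (g ** \<gamma>) = c g" if g: "g \<in> T" for g
  proof -
    have "openin (top_of_set T) {x \<in> T. c x \<in> {c g}}"
      using c g openin_continuous_map_preimage[OF c, of "{c g}"] by (auto simp: continuous_map_def)
    then show ?thesis using g unfolding openin_iff_Gam[OF T] by auto
  qed
  then show ?r using c by (auto simp: continuous_map_def)
next
  assume r: ?r
  have "openin (top_of_set T) {x \<in> T. c x \<in> U}" for U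
    unfolding openin_iff_Gam[OF T] using r by fastforce
  then show ?l using r by (auto simp: continuous_map_def)
qed

text \<open>An element of \<open>I\<close> is determined by three of its entries, which can be prescribed arbitrarily in
  \<open>1 + p\<int>\<^sub>p\<close>, \<open>\<int>\<^sub>p\<close> and \<open>p\<int>\<^sub>p\<close>; so \<open>I\<close> is a continuous image of \<open>\<int>\<^sub>p\<^sup>3\<close>.\<close>

lemma compact_iwahori: "compact (iwahori :: 'p::prime_card mat set)"
proof -
  let ?Z = "range of_Zp :: 'p padic set"
  define F where "F = (\<lambda>(x, y, z). mat2 (1 + pQ * x) y (pQ * z) (inverse (1 + pQ * x) * (1 + pQ * y * z)) :: 'p mat)"
  have K: "compact (?Z \<times> ?Z \<times> ?Z)" by (intro compact_Times compact_Zp)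
  have Z: "x \<in> ?Z \<longleftrightarrow> x \<in> pideal 0" for x by (auto simp: pideal_0_iff)
  have p1: "pQ * x \<in> pideal 1 \<longleftrightarrow> x \<in> pideal 0" for x :: "'p padic" using pideal_shift[of 1 x 1] by simp
  have u: "punit (1 + pQ * x)" if "x \<in> ?Z" for x
    using that by (intro punit_near_1) (simp add: p1 Z)
  have "continuous_on (?Z \<times> ?Z \<times> ?Z) F"
    unfolding continuous_on_topological
  proof (intro ballI allI impI)
    fix w B assume w: "w \<in> ?Z \<times> ?Z \<times> ?Z" and B: "open B" "F w \<in> B"
    obtain x y z where wx: "w = (x, y, z)" "x \<in> ?Z" "y \<in> ?Z" "z \<in> ?Z" using w by auto
    obtain n where n: "\<And>A. mcong (int n) A (F w) \<Longrightarrow> A \<in> B" using B unfolding open_mat_iff by blast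
    let ?A = "{v. v - x \<in> pideal (int n)} \<times> {v. v - y \<in> pideal (int n)} \<times> {v. v - z \<in> pideal (int n)}"
    have "open ?A" by (intro open_Times open_pideal_ball)
    moreover have "w \<in> ?A" by (simp add: wx)
    moreover have "F v \<in> B" if v: "v \<in> ?Z \<times> ?Z \<times> ?Z" "v \<in> ?A" for v
    proof -
      obtain x' y' z' where v': "v = (x', y', z')" "x' \<in> ?Z" "y' \<in> ?Z" "z' \<in> ?Z" using v by auto
      have d: "x' - x \<in> pideal (int n)" "y' - y \<in> pideal (int n)" "z' - z \<in> pideal (int n)"
        using v(2) v'(1) by auto
      have 0: "x \<in> pideal 0" "y \<in> pideal 0" "z \<in> pideal 0" "x' \<in> pideal 0" "y' \<in> pideal 0" "z' \<in> pideal 0"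
        using wx v' Z by auto
      have p0: "pQ \<in> (pideal 0 :: 'p padic set)" by simp
      note m0 = pideal_mult_le[where i=0 and j="int n" and k="int n", simplified]
      note m00 = pideal_mult_le[where i=0 and j=0 and k=0, simplified]
      have px: "pQ * x' - pQ * x \<in> pideal (int n)" "pQ * z' - pQ * z \<in> pideal (int n)"
        using m0[OF p0 d(1)] m0[OF p0 d(3)] by (simp_all add: algebra_simps)
      define i where "i = inverse (1 + pQ * x)"
      define i' where "i' = inverse (1 + pQ * x')"
      have i: "i \<in> pideal 0" "i' \<in> pideal 0" "i * (1 + pQ * x) = 1" "i' * (1 + pQ * x') = 1"
        using u[OF wx(2)] u[OF v'(2)] punit_neq_0 by (auto simp: i_def i'_def punit_iff)
      have "i * i' * (pQ * x - pQ * x') = i' * (i * (1 + pQ * x)) - i * (i' * (1 + pQ * x'))"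
        by (simp only: algebra_simps)
      also have "\<dots> = i' - i" by (simp only: i mult_1_right)
      finally have ii: "i' - i = i * i' * (pQ * x - pQ * x')" ..
      have "pQ * x - pQ * x' \<in> pideal (int n)" using pideal_uminus[OF px(1)] by simp
      then have ii': "i' - i \<in> pideal (int n)"
        unfolding ii using i(1,2) by (intro m0 m00)
      have yz: "y' * z' - y * z \<in> pideal (int n)"
      proof -
        have "y' * (z' - z) + z * (y' - y) \<in> pideal (int n)" using d 0 by (intro pideal_add m0)
        then show ?thesis by (simp add: algebra_simps)
      qed
      have "i' * (pQ * (y' * z' - y * z)) + (1 + pQ * (y * z)) * (i' - i) \<in> pideal (int n)"
        using ii' yz i 0 p0 by (intro pideal_add m0 m00) auto
      then have "i' * (1 + pQ * y' * z') - i * (1 + pQ * y * z) \<in> pideal (int n)"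
        by (simp add: algebra_simps)
      then have "mcong (int n) (F v) (F w)"
        unfolding mcong_def forall_2 using d px by (simp add: F_def v'(1) wx(1) i_def i'_def)
      then show ?thesis by (rule n)
    qed
    ultimately show "\<exists>A. open A \<and> w \<in> A \<and> (\<forall>v\<in>?Z \<times> ?Z \<times> ?Z. v \<in> A \<longrightarrow> F v \<in> B)" by blast
  qed
  then have "compact (F ` (?Z \<times> ?Z \<times> ?Z))" using K by (rule compact_continuous_image)
  moreover have "F ` (?Z \<times> ?Z \<times> ?Z) = iwahori"
  proof
    show "F ` (?Z \<times> ?Z \<times> ?Z) \<subseteq> iwahori"
    proof clarify
      fix x y z :: "'p padic_int"
      let ?a = "1 + pQ * of_Zp x :: 'p padic"
      have a: "?a - 1 \<in> pideal 1" by (simp add: p1)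
      then have a': "punit ?a" by (rule punit_near_1)
      have "pQ * (of_Zp y * of_Zp z) \<in> (pideal 1 :: 'p padic set)" unfolding p1 by (simp add: of_Zp_mult[symmetric])
      then have "inverse ?a * (pQ * (of_Zp y * of_Zp z) - (?a - 1)) \<in> pideal 1"
        using a punit_mult_pideal_iff[OF punit_inverse[OF a']] by blast
      moreover have "inverse ?a * (pQ * (of_Zp y * of_Zp z) - (?a - 1)) = inverse ?a * (1 + pQ * of_Zp y * of_Zp z) - inverse ?a * ?a"
        by (simp only: algebra_simps)
      moreover have inv: "inverse ?a * ?a = 1" using punit_neq_0[OF a'] by (rule left_inverse)
      ultimately have 1: "inverse ?a * (1 + pQ * of_Zp y * of_Zp z) - 1 \<in> pideal 1"
        by (simp only:)
      have "?a * (inverse ?a * (1 + pQ * of_Zp y * of_Zp z)) = (inverse ?a * ?a) * (1 + pQ * of_Zp y * of_Zp z)"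
        by (simp only: mult_ac)
      then have "?a * (inverse ?a * (1 + pQ * of_Zp y * of_Zp z)) = 1 + pQ * of_Zp y * of_Zp z"
        by (simp only: inv mult_1_left)
      moreover have "1 + pQ * of_Zp y * of_Zp z - of_Zp y * (pQ * of_Zp z) = (1 :: 'p padic)"
        by (simp add: mult_ac)
      ultimately have "?a * (inverse ?a * (1 + pQ * of_Zp y * of_Zp z)) - of_Zp y * (pQ * of_Zp z) = 1"
        by (simp only:)
      then show "F (of_Zp x, of_Zp y, of_Zp z) \<in> iwahori"
        using a 1 by (simp only: F_def mat2_iwahori_iff p1 prod.case of_Zp_pideal simp_thms)
    qed
    show "iwahori \<subseteq> F ` (?Z \<times> ?Z \<times> ?Z)"
    proof
      fix g :: "'p mat" assume g: "g \<in> iwahori"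
      obtain a b c d where gg: "g = mat2 a b c d" by (rule mat2_cases)
      have 1: "a - 1 \<in> pideal 1" "b \<in> pideal 0" "c \<in> pideal 1" "a * d - b * c = 1"
        using g by (simp_all add: gg mat2_iwahori_iff)
      have a0: "a \<noteq> 0" using punit_near_1[OF 1(1)] punit_neq_0 by blast
      have "a * d = 1 + b * c" using 1(4) by (simp add: algebra_simps)
      then have d: "d = (1 + b * c) / a" using a0 by (simp add: field_simps)
      have "1 + pQ * ((a - 1) / pQ) = a" "pQ * (c / pQ) = c" by simp_all
      moreover have "1 + pQ * b * (c / pQ) = 1 + b * c" by simp
      ultimately have "g = F ((a - 1) / pQ, b, c / pQ)"
        by (simp only: gg F_def d divide_inverse mult.commute prod.case)
      moreover have "(a - 1) / pQ \<in> ?Z" "c / pQ \<in> ?Z" "b \<in> ?Z"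
        using 1 p1[of "(a - 1) / pQ"] p1[of "c / pQ"] Z by auto
      ultimately show "g \<in> F ` (?Z \<times> ?Z \<times> ?Z)" by blast
    qed
  qed
  ultimately show ?thesis by simp
qed

lemma continuous_on_mat_mult_left: "continuous_on S (\<lambda>x :: 'p::prime_card mat. A ** x :: 'p mat)"
  unfolding continuous_on_topological
proof (intro ballI allI impI)
  fix x :: "'p mat" and B assume B: "open B" "A ** x \<in> B"
  obtain n where n: "\<And>y. mcong (int n) y (A ** x) \<Longrightarrow> y \<in> B" using B unfolding open_mat_iff by blast
  obtain k where k: "\<forall>i j. A $ i $ j \<in> pideal (- int k)" using mat_entries_bounded by blast
  have AB: "A ** y \<in> B" if "mcong (int (n + k)) y x" for y
    using n[of "A ** y"] mcong_mult_left[OF k that] by simp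
  show "\<exists>U. open U \<and> x \<in> U \<and> (\<forall>y\<in>S. y \<in> U \<longrightarrow> A ** y \<in> B)"
  proof (intro exI conjI ballI impI)
    show "open {y. mcong (int (n + k)) y x}" by (rule open_mcong)
    show "x \<in> {y. mcong (int (n + k)) y x}" by simp
    show "A ** y \<in> B" if "y \<in> {y. mcong (int (n + k)) y x}" for y using that AB by blast
  qed
qed

lemma compact_SL2_finite_cover:
  assumes K: "compact K" "K \<subseteq> carrier SL2"
  obtains R where "finite R" "R \<subseteq> K" "\<And>g. g \<in> K \<Longrightarrow> \<exists>r\<in>R. adj r ** g \<in> Gam m"
proof -
  have "\<forall>g\<in>K. \<exists>U. open U \<and> g \<in> U \<and> (\<forall>y. y \<in> U \<longrightarrow> y \<in> carrier SL2 \<longrightarrow> adj g ** y \<in> Gam m)"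
  proof
    fix g assume "g \<in> K"
    then have "g \<in> carrier SL2" using K(2) by blast
    then obtain U where "open U" "g \<in> U" "\<And>y. y \<in> U \<Longrightarrow> y \<in> carrier SL2 \<Longrightarrow> adj g ** y \<in> Gam m"
      by (rule Gam_nbhd[where m=m]) blast
    then show "\<exists>U. open U \<and> g \<in> U \<and> (\<forall>y. y \<in> U \<longrightarrow> y \<in> carrier SL2 \<longrightarrow> adj g ** y \<in> Gam m)" by blast
  qed
  then obtain U where U: "\<And>g. g \<in> K \<Longrightarrow> open (U g)" "\<And>g. g \<in> K \<Longrightarrow> g \<in> U g"
      "\<And>g y. g \<in> K \<Longrightarrow> y \<in> U g \<Longrightarrow> y \<in> carrier SL2 \<Longrightarrow> adj g ** y \<in> Gam m"
    by metis
  obtain R where R: "R \<subseteq> K" "finite R" "K \<subseteq> (\<Union>g\<in>R. U g)"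
    using compactE_image[OF K(1), of K U] U by blast
  show ?thesis
  proof (rule that[OF R(2,1)])
    fix g assume g: "g \<in> K"
    then obtain r where r: "r \<in> R" "g \<in> U r" using R(3) by blast
    then have "adj r ** g \<in> Gam m" using U(3) R(1) K(2) g by blast
    then show "\<exists>r\<in>R. adj r ** g \<in> Gam m" using r by blast
  qed
qed

lemma iwahori_finite_Gam:
  obtains R where "finite R" "R \<subseteq> iwahori" "\<And>g. g \<in> iwahori \<Longrightarrow> \<exists>r\<in>R. adj r ** g \<in> Gam m"
proof (rule compact_SL2_finite_cover[OF compact_iwahori, of m])
  show "iwahori \<subseteq> carrier SL2" using iwahori_SL2 by blast
qed (use that in blast)

lemma Gam_conj:
  assumes x: "x \<in> carrier SL2"
  obtains m' where "\<And>\<gamma>. \<gamma> \<in> Gam m' \<Longrightarrow> adj x ** \<gamma> ** x \<in> Gam m"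
proof -
  obtain k where k: "\<forall>i j. x $ i $ j \<in> pideal (- int k)" using mat_entries_bounded by blast
  obtain l where l: "\<forall>i j. adj x $ i $ j \<in> pideal (- int l)" using mat_entries_bounded by blast
  have "adj x ** \<gamma> ** x \<in> Gam m" if g: "\<gamma> \<in> Gam (m + k + l)" for \<gamma>
  proof -
    have "mcong (- int l + int (m + k + l) + - int k) (adj x ** \<gamma> ** x) (adj x ** mat 1 ** x)"
      using g by (intro mcong_mult_right[OF k] mcong_mult_left[OF l]) (simp add: Gam_def)
    then show ?thesis using x g by (simp add: Gam_def)
  qed
  then show ?thesis using that by blast
qed

lemma iwahori_entries: "g \<in> iwahori \<Longrightarrow> g $ i $ j \<in> pideal 0"
proof -
  assume g: "g \<in> iwahori"
  obtain a b c d where gg: "g = mat2 a b c d" by (rule mat2_cases)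
  have "a \<in> pideal 0" "b \<in> pideal 0" "c \<in> pideal 0" "d \<in> pideal 0"
    using g punit_near_1[of a] punit_near_1[of d] pideal_mono[of 0 1 c] by (auto simp: gg mat2_iwahori_iff punit_def)
  then show ?thesis using exhaust_2[of i] exhaust_2[of j] gg by auto
qed

lemma Gam_conj_iwahori:
  assumes x: "x \<in> iwahori" and g: "\<gamma> \<in> Gam m"
  shows "adj x ** \<gamma> ** x \<in> Gam m"
proof -
  have "mcong (0 + int m + 0) (adj x ** \<gamma> ** x) (adj x ** mat 1 ** x)"
    using g by (intro mcong_mult_right mcong_mult_left allI iwahori_entries) (simp_all add: Gam_def x)
  then show ?thesis using iwahori_SL2[OF x] g by (simp add: Gam_def)
qed


section \<open>The representation \<open>\<X>\<close>\<close>

definition act :: "'p::prime_card mat \<Rightarrow> ('p mat \<Rightarrow> 'k::field) \<Rightarrow> ('p mat \<Rightarrow> 'k)" where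
  "act g f = (\<lambda>x. f (adj g ** x))"

definition fscale :: "'k::field \<Rightarrow> ('p::prime_card mat \<Rightarrow> 'k) \<Rightarrow> ('p mat \<Rightarrow> 'k)" where
  "fscale a f = (\<lambda>x. a * f x)"

lemma rscal_X [simp]: "rscal \<X> = fscale"
  by (simp add: \<X>_def fscale_def fun_eq_iff)

lemma ract_X: "g \<in> carrier SL2 \<Longrightarrow> ract \<X> g f = act g f"
  by (simp add: \<X>_def act_def)

lemma act_apply: "act g f x = f (adj g ** x)"
  by (simp add: act_def)

lemma fscale_apply: "fscale a f x = a * f x"
  by (simp add: fscale_def)

lemma act_mult: "act (g ** h) f = act g (act h f)"
  by (simp add: act_def adj_mult matrix_mul_assoc)

lemma act_1 [simp]: "act (mat 1) f = f"
  by (simp add: act_def)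

lemma act_0 [simp]: "act g 0 = 0"
  by (simp add: act_def fun_eq_iff)

lemma act_add: "act g (f + f') = act g f + act g f'"
  by (simp add: act_def fun_eq_iff)

lemma act_diff: "act g (f - f') = act g f - act g f'"
  by (simp add: act_def fun_eq_iff)

lemma act_uminus: "act g (- f) = - act g f"
  by (simp add: act_def fun_eq_iff)

lemma act_fscale: "act g (fscale a f) = fscale a (act g f)"
  by (simp add: act_def fscale_def)

lemma sum_fun_apply: "(\<Sum>a\<in>A. f a) x = (\<Sum>a\<in>A. f a x :: 'k::field)"
  by (induction A rule: infinite_finite_induct) simp_all

lemma act_sum: "act g (\<Sum>a\<in>A. f a) = (\<Sum>a\<in>A. act g (f a))"
  by (rule ext) (simp add: act_def sum_fun_apply)

lemma fscale_simps [simp]: "fscale a 0 = 0" "fscale 0 f = 0" "fscale 1 f = f"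
  by (simp_all add: fscale_def fun_eq_iff)

lemma fscale_add: "fscale a (f + f') = fscale a f + fscale a f'"
  by (simp add: fscale_def fun_eq_iff algebra_simps)

lemma fscale_add_left: "fscale (a + b) f = fscale a f + fscale b f"
  by (simp add: fscale_def fun_eq_iff algebra_simps)

lemma fscale_fscale: "fscale a (fscale b f) = fscale (a * b) f"
  by (simp add: fscale_def mult.assoc)

text \<open>The cosets \<open>gI\<close> are open and compact, so that a union of such cosets is compact iff it is a finite
  union.\<close>

lemma X_iff:
  "f \<in> rspace \<X> \<longleftrightarrow> (\<forall>g. g \<notin> carrier SL2 \<longrightarrow> f g = 0) \<and>
     (\<forall>g\<in>carrier SL2. \<forall>i\<in>iwahori. f (g ** i) = f g) \<and>
     (\<exists>R. finite R \<and> R \<subseteq> carrier SL2 \<and> (\<forall>g. f g \<noteq> 0 \<longrightarrow> (\<exists>r\<in>R. adj r ** g \<in> iwahori)))"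
proof -
  have "compact {g. f g \<noteq> 0} \<longleftrightarrow>
      (\<exists>R. finite R \<and> R \<subseteq> carrier SL2 \<and> (\<forall>g. f g \<noteq> 0 \<longrightarrow> (\<exists>r\<in>R. adj r ** g \<in> iwahori)))" (is "?l \<longleftrightarrow> ?r")
    if f: "\<forall>g. g \<notin> carrier SL2 \<longrightarrow> f g = 0" "\<forall>g\<in>carrier SL2. \<forall>i\<in>iwahori. f (g ** i) = f g"
  proof
    have S: "{g. f g \<noteq> 0} \<subseteq> carrier SL2" using f(1) by blast
    assume ?l
    then obtain R where R: "finite R" "R \<subseteq> {g. f g \<noteq> 0}" "\<And>g. g \<in> {g. f g \<noteq> 0} \<Longrightarrow> \<exists>r\<in>R. adj r ** g \<in> Gam (Suc 0)"
      using compact_SL2_finite_cover[OF _ S, of "Suc 0"] by metis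
    have "\<forall>g. f g \<noteq> 0 \<longrightarrow> (\<exists>r\<in>R. adj r ** g \<in> iwahori)" using R(3) Gam_1_iwahori by blast
    then show ?r using R(1,2) S by blast
  next
    assume ?r
    then obtain R where R: "finite R" "R \<subseteq> carrier SL2" "\<And>g. f g \<noteq> 0 \<Longrightarrow> \<exists>r\<in>R. adj r ** g \<in> iwahori" by blast
    have "{g. f g \<noteq> 0} = (\<Union>r\<in>{r \<in> R. f r \<noteq> 0}. (**) r ` iwahori)"
    proof (intro equalityI subsetI)
      fix g assume g: "g \<in> {g. f g \<noteq> 0}"
      then obtain r where r: "r \<in> R" "adj r ** g \<in> iwahori" using R(3) by blast
      then have rS: "r \<in> carrier SL2" using R(2) by blast
      have gr: "g = r ** (adj r ** g)" using rS by simp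
      have "f (r ** (adj r ** g)) = f r" using f(2) rS r(2) by blast
      then have "f r \<noteq> 0" using g gr by simp
      moreover have "g \<in> (**) r ` iwahori" by (rule image_eqI[where f = "(**) r", OF gr r(2)])
      ultimately show "g \<in> (\<Union>r\<in>{r \<in> R. f r \<noteq> 0}. (**) r ` iwahori)" using r(1) by blast
    next
      fix g assume "g \<in> (\<Union>r\<in>{r \<in> R. f r \<noteq> 0}. (**) r ` iwahori)"
      then obtain r i where "r \<in> R" "f r \<noteq> 0" "i \<in> iwahori" "g = r ** i" by blast
      then show "g \<in> {g. f g \<noteq> 0}" using f(2) R(2) by auto
    qed
    moreover have "compact (\<Union>r\<in>{r \<in> R. f r \<noteq> 0}. (**) r ` iwahori)"
      using R(1) by (intro compact_UN compact_continuous_image continuous_on_mat_mult_left compact_iwahori) simp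
    ultimately show ?l by simp
  qed
  then show ?thesis unfolding \<X>_def by auto
qed

lemma X_zero: "f \<in> rspace \<X> \<Longrightarrow> g \<notin> carrier SL2 \<Longrightarrow> f g = 0"
  by (simp add: X_iff)

lemma X_right: "f \<in> rspace \<X> \<Longrightarrow> i \<in> iwahori \<Longrightarrow> f (g ** i) = f g"
proof (cases "g \<in> carrier SL2")
  case False
  assume "f \<in> rspace \<X>" "i \<in> iwahori"
  then show ?thesis using False X_zero[of f] SL2_mult_iff'[OF iwahori_SL2, of i g] by simp
qed (simp add: X_iff)

lemma X_finite: "f \<in> rspace \<X> \<Longrightarrow> \<exists>R. finite R \<and> R \<subseteq> carrier SL2 \<and> (\<forall>g. f g \<noteq> 0 \<longrightarrow> (\<exists>r\<in>R. adj r ** g \<in> iwahori))"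
  by (simp add: X_iff)

lemma XI:
  assumes "\<And>g. g \<notin> carrier SL2 \<Longrightarrow> f g = 0" "\<And>g i. g \<in> carrier SL2 \<Longrightarrow> i \<in> iwahori \<Longrightarrow> f (g ** i) = f g"
    "finite R" "R \<subseteq> carrier SL2" "\<And>g. f g \<noteq> 0 \<Longrightarrow> \<exists>r\<in>R. adj r ** g \<in> iwahori"
  shows "f \<in> rspace \<X>"
  using assms unfolding X_iff by blast

lemma X_0 [simp]: "0 \<in> rspace \<X>"
  by (rule XI[of _ "{}"]) simp_all

lemma X_add [simp, intro]: "f \<in> rspace \<X> \<Longrightarrow> f' \<in> rspace \<X> \<Longrightarrow> f + f' \<in> rspace \<X>"
proof -
  assume f: "f \<in> rspace \<X>" and f': "f' \<in> rspace \<X>"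
  obtain R where R: "finite R" "R \<subseteq> carrier SL2" "\<forall>g. f g \<noteq> 0 \<longrightarrow> (\<exists>r\<in>R. adj r ** g \<in> iwahori)"
    using X_finite[OF f] by blast
  obtain R' where R': "finite R'" "R' \<subseteq> carrier SL2" "\<forall>g. f' g \<noteq> 0 \<longrightarrow> (\<exists>r\<in>R'. adj r ** g \<in> iwahori)"
    using X_finite[OF f'] by blast
  have "\<exists>r\<in>R \<union> R'. adj r ** g \<in> iwahori" if "(f + f') g \<noteq> 0" for g
  proof -
    have "f g \<noteq> 0 \<or> f' g \<noteq> 0" using that by auto
    then show ?thesis using R(3) R'(3) by blast
  qed
  then show ?thesis using f f' R R' by (intro XI[of _ "R \<union> R'"]) (auto simp: X_zero X_right)
qed

lemma X_fscale [simp, intro]: "f \<in> rspace \<X> \<Longrightarrow> fscale a f \<in> rspace \<X>"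
proof -
  assume f: "f \<in> rspace \<X>"
  obtain R where R: "finite R" "R \<subseteq> carrier SL2" "\<forall>g. f g \<noteq> 0 \<longrightarrow> (\<exists>r\<in>R. adj r ** g \<in> iwahori)"
    using X_finite[OF f] by blast
  then show ?thesis using f by (intro XI[of _ R]) (auto simp: X_zero X_right fscale_def)
qed

lemma X_uminus [simp, intro]: "f \<in> rspace \<X> \<Longrightarrow> - f \<in> rspace \<X>"
proof -
  assume "f \<in> rspace \<X>"
  then have "fscale (- 1) f \<in> rspace \<X>" by simp
  moreover have "fscale (- 1) f = - f" by (simp add: fscale_def fun_eq_iff)
  ultimately show ?thesis by simp
qed

lemma X_diff [simp, intro]: "f \<in> rspace \<X> \<Longrightarrow> f' \<in> rspace \<X> \<Longrightarrow> f - f' \<in> rspace \<X>"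
  using X_add[of f "- f'"] by simp

lemma X_sum [intro]: "(\<And>a. a \<in> A \<Longrightarrow> f a \<in> rspace \<X>) \<Longrightarrow> sum f A \<in> rspace \<X>"
  by (induction A rule: infinite_finite_induct) auto

lemma X_act [simp, intro]: "g \<in> carrier SL2 \<Longrightarrow> f \<in> rspace \<X> \<Longrightarrow> act g f \<in> rspace \<X>"
proof -
  assume g: "g \<in> carrier SL2" and f: "f \<in> rspace \<X>"
  obtain R where R: "finite R" "R \<subseteq> carrier SL2" "\<forall>g. f g \<noteq> 0 \<longrightarrow> (\<exists>r\<in>R. adj r ** g \<in> iwahori)"
    using X_finite[OF f] by blast
  show ?thesis
  proof (rule XI[of _ "(**) g ` R"])
    show "act g f x = 0" if "x \<notin> carrier SL2" for x
      using that g X_zero[OF f] by (simp add: act_def SL2_mult_iff)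
    show "act g f (x ** i) = act g f x" if "i \<in> iwahori" for x i
      using X_right[OF f that, of "adj g ** x"] by (simp add: act_def matrix_mul_assoc)
    show "\<exists>r\<in>(**) g ` R. adj r ** x \<in> iwahori" if "act g f x \<noteq> 0" for x
      using that R(3) by (force simp: act_def adj_mult matrix_mul_assoc[symmetric])
  qed (use R g in auto)
qed

lemma charI_apply: "charI g = (if g \<in> iwahori then 1 else 0)"
  by (simp add: charI_def indicator_def)

lemma charI_X [simp]: "charI \<in> rspace \<X>"
  by (rule XI[of _ "{mat 1}"]) (auto simp: charI_apply iwahori_cancel' iwahori_SL2 split: if_splits)

lemma act_charI_iwahori: "i \<in> iwahori \<Longrightarrow> act (g ** i) charI = act g charI"
  by (simp add: act_def charI_apply adj_mult matrix_mul_assoc[symmetric] iwahori_cancel)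

subsection \<open>The basis of translates of \<open>char\<^sub>I\<close>\<close>

definition rep :: "'p::prime_card mat \<Rightarrow> 'p mat" where
  "rep x = (SOME y. adj x ** y \<in> iwahori)"

lemma rep_iwahori: "x \<in> carrier SL2 \<Longrightarrow> adj x ** rep x \<in> iwahori"
  unfolding rep_def by (rule someI[of _ x]) simp

lemma rep_SL2 [simp]: "x \<in> carrier SL2 \<Longrightarrow> rep x \<in> carrier SL2"
  using iwahori_SL2[OF rep_iwahori, of x] by (simp add: SL2_mult_iff)

lemma rep_cong:
  assumes "x \<in> carrier SL2" "adj x ** y \<in> iwahori"
  shows "rep x = rep y"
proof -
  have "adj x ** z \<in> iwahori \<longleftrightarrow> adj y ** z \<in> iwahori" for z
  proof -
    have "adj (adj x ** y) ** (adj x ** z) = adj y ** z"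
      using assms(1) by (simp add: adj_mult matrix_mul_assoc[symmetric])
    then show ?thesis using iwahori_cancel[of "adj (adj x ** y)" "adj x ** z"] assms(2) by simp
  qed
  then show ?thesis by (simp add: rep_def)
qed

lemma rep_rep: "x \<in> carrier SL2 \<Longrightarrow> rep (rep x) = rep x"
  using rep_cong rep_iwahori by metis

lemma X_rep: "f \<in> rspace \<X> \<Longrightarrow> x \<in> carrier SL2 \<Longrightarrow> f (rep x) = f x"
  using X_right[of f "adj x ** rep x" x] rep_iwahori[of x] by simp

abbreviation reps :: "('p::prime_card mat \<Rightarrow> 'k::field) \<Rightarrow> 'p mat set" where
  "reps f \<equiv> rep ` {x. f x \<noteq> 0}"

lemma finite_reps: "f \<in> rspace \<X> \<Longrightarrow> finite (reps f)"
proof -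
  assume f: "f \<in> rspace \<X>"
  obtain R where R: "finite R" "R \<subseteq> carrier SL2" "\<forall>g. f g \<noteq> 0 \<longrightarrow> (\<exists>r\<in>R. adj r ** g \<in> iwahori)"
    using X_finite[OF f] by blast
  have "reps f \<subseteq> rep ` R"
  proof clarify
    fix x assume "f x \<noteq> 0"
    then obtain r where "r \<in> R" "adj r ** x \<in> iwahori" using R(3) by blast
    moreover from this have "rep r = rep x" using R(2) by (intro rep_cong) blast+
    ultimately show "rep x \<in> rep ` R" by (intro image_eqI[of _ _ r]) simp_all
  qed
  then show ?thesis using R(1) finite_surj by blast
qed

lemma reps_SL2: "f \<in> rspace \<X> \<Longrightarrow> reps f \<subseteq> rep ` carrier SL2"
  using X_zero by blast

lemma X_expand:
  assumes f: "f \<in> rspace \<X>"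
  shows "f = (\<Sum>x\<in>reps f. fscale (f x) (act x charI))"
proof
  fix y
  show "f y = (\<Sum>x\<in>reps f. fscale (f x) (act x charI)) y"
  proof (cases "y \<in> carrier SL2")
    case True
    have "fscale (f x) (act x charI) y = (if x = rep y then f y else 0)" if "x \<in> reps f" for x
    proof -
      have "x \<in> rep ` carrier SL2" using that by (rule subsetD[OF reps_SL2[OF f]])
      then obtain z where z: "z \<in> carrier SL2" "x = rep z" by (rule imageE)
      have "adj x ** y \<in> iwahori \<longleftrightarrow> x = rep y"
      proof
        assume "adj x ** y \<in> iwahori"
        then have "rep x = rep y" by (rule rep_cong[rotated]) (simp add: z)
        then show "x = rep y" using z rep_rep[OF z(1)] by simp
      next
        assume "x = rep y"
        then show "adj x ** y \<in> iwahori" using rep_iwahori[OF True] iwahori_adj[of "adj y ** rep y"]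
          by (simp add: adj_mult)
      qed
      then show ?thesis using X_rep[OF f True] by (simp add: fscale_def act_def charI_apply)
    qed
    then have "(\<Sum>x\<in>reps f. fscale (f x) (act x charI)) y = (\<Sum>x\<in>reps f. if x = rep y then f y else 0)"
      unfolding sum_fun_apply by (rule sum.cong[OF refl])
    also have "\<dots> = f y" using finite_reps[OF f] by auto
    finally show ?thesis by simp
  next
    case False
    have "fscale (f x) (act x charI) y = 0" if "x \<in> reps f" for x
    proof -
      have "x \<in> carrier SL2" using that reps_SL2[OF f] by auto
      then have "adj x ** y \<notin> iwahori" using False iwahori_SL2 SL2_mult_iff[of "adj x" y] by auto
      then show ?thesis by (simp add: fscale_def act_def charI_apply)
    qed
    then show ?thesis using False X_zero[OF f] by (simp add: sum_fun_apply)
  qed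
qed

lemma X_induct [consumes 1, case_names zero step]:
  assumes f: "f \<in> rspace \<X>" and 0: "P 0"
    and step: "\<And>f x a. f \<in> rspace \<X> \<Longrightarrow> P f \<Longrightarrow> x \<in> carrier SL2 \<Longrightarrow> P (f + fscale a (act x charI))"
  shows "P f"
proof -
  define S where "S = (\<lambda>F. \<Sum>x\<in>F. fscale (f x) (act x charI))"
  have S_insert: "S (insert x F) = S F + fscale (f x) (act x charI)" if "finite F" "x \<notin> F" for x F
    using that by (simp add: S_def add.commute)
  have S_empty: "S {} = 0" by (simp add: S_def)
  define Q where "Q = (\<lambda>F. F \<subseteq> carrier SL2 \<longrightarrow> P (S F) \<and> S F \<in> rspace \<X>)"
  have Q: "Q F" if "finite F" for F
    using that
  proof (induction F rule: finite_induct)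
    case empty
    show ?case using 0 by (simp add: Q_def S_empty)
  next
    case (insert x F)
    then show ?case unfolding Q_def S_insert[OF insert(1,2)] by (simp add: step)
  qed
  moreover have "reps f \<subseteq> carrier SL2"
  proof
    fix x assume "x \<in> reps f"
    then have "x \<in> rep ` carrier SL2" by (rule subsetD[OF reps_SL2[OF f]])
    then show "x \<in> carrier SL2" by auto
  qed
  ultimately have "P (S (reps f))" using Q[OF finite_reps[OF f]] by (simp add: Q_def)
  moreover have "S (reps f) = f" using X_expand[OF f] by (simp add: S_def)
  ultimately show ?thesis by simp
qed

text \<open>The translate \<open>x char\<^sub>I\<close> is fixed by \<open>xIx\<^sup>-\<^sup>1\<close>, which contains a congruence subgroup.\<close>

lemma X_smooth:
  assumes "f \<in> rspace \<X>"
  shows "\<exists>m. \<forall>\<gamma>\<in>Gam m. act \<gamma> f = f"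
  using assms
proof (rule X_induct)
  show "\<exists>m. \<forall>\<gamma>\<in>Gam m. act \<gamma> 0 = (0 :: 'a mat \<Rightarrow> 'b)" by simp
next
  fix f :: "'a mat \<Rightarrow> 'b" and x :: "'a mat" and a :: 'b
  assume "\<exists>m. \<forall>\<gamma>\<in>Gam m. act \<gamma> f = f" and x: "x \<in> carrier SL2"
  then obtain m where m: "\<forall>\<gamma>\<in>Gam m. act \<gamma> f = f" by blast
  obtain m' where m': "\<And>\<gamma>. \<gamma> \<in> Gam m' \<Longrightarrow> adj x ** \<gamma> ** x \<in> Gam (Suc 0)"
    using Gam_conj[OF x, of "Suc 0"] by metis
  have "act \<gamma> (f + fscale a (act x charI)) = f + fscale a (act x charI)" if \<gamma>: "\<gamma> \<in> Gam (m + m')" for \<gamma>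
  proof -
    have 1: "act \<gamma> f = f" using m Gam_mono[OF _ \<gamma>, of m] by simp
    have "adj x ** \<gamma> ** x \<in> iwahori" by (rule Gam_1_iwahori, rule m', rule Gam_mono[OF _ \<gamma>]) simp
    then have "act (x ** (adj x ** \<gamma> ** x)) charI = (act x charI :: _ \<Rightarrow> 'b)" by (rule act_charI_iwahori)
    moreover have "x ** (adj x ** \<gamma> ** x) = \<gamma> ** x" using x by (simp add: matrix_mul_assoc[symmetric])
    ultimately have "act \<gamma> (act x charI) = (act x charI :: _ \<Rightarrow> 'b)" by (simp add: act_mult)
    then show ?thesis using 1 by (simp add: act_add act_fscale)
  qed
  then show "\<exists>m. \<forall>\<gamma>\<in>Gam m. act \<gamma> (f + fscale a (act x charI)) = f + fscale a (act x charI)" by blast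
qed

text \<open>Linear extension of a function on \<open>G/I\<close>.\<close>

definition lin :: "('p::prime_card mat \<Rightarrow> 'p mat \<Rightarrow> 'k::field) \<Rightarrow> ('p mat \<Rightarrow> 'k) \<Rightarrow> ('p mat \<Rightarrow> 'k)" where
  "lin P f = (\<Sum>x\<in>reps f. fscale (f x) (P x))"

lemma lin_superset:
  assumes "f \<in> rspace \<X>" "finite F" "F \<subseteq> rep ` carrier SL2" "reps f \<subseteq> F"
  shows "lin P f = (\<Sum>x\<in>F. fscale (f x) (P x))"
  unfolding lin_def
proof (rule sum.mono_neutral_left[OF assms(2,4)], rule ballI)
  fix x assume x: "x \<in> F - reps f"
  then have "rep x = x" using assms(3) rep_rep by auto
  then have "f x = 0" using x by (metis (mono_tags, lifting) DiffD2 image_eqI mem_Collect_eq)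
  then show "fscale (f x) (P x) = 0" by simp
qed

lemma lin_add:
  assumes f: "f \<in> rspace \<X>" "f' \<in> rspace \<X>"
  shows "lin P (f + f') = lin P f + lin P f'"
proof -
  let ?F = "reps f \<union> reps f' \<union> reps (f + f')"
  have F: "finite ?F" "?F \<subseteq> rep ` carrier SL2"
    using finite_reps reps_SL2 f X_add[OF f] by blast+
  have "lin P f = (\<Sum>x\<in>?F. fscale (f x) (P x))" "lin P f' = (\<Sum>x\<in>?F. fscale (f' x) (P x))"
    "lin P (f + f') = (\<Sum>x\<in>?F. fscale ((f + f') x) (P x))"
    using f F by (intro lin_superset; auto)+
  then show ?thesis by (simp add: fscale_add_left sum.distrib)
qed

lemma fscale_sum: "fscale a (\<Sum>x\<in>F. f x) = (\<Sum>x\<in>F. fscale a (f x))"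
  by (rule ext) (simp add: fscale_def sum_fun_apply sum_distrib_left)

lemma lin_fscale:
  assumes f: "f \<in> rspace \<X>"
  shows "lin P (fscale a f) = fscale a (lin P f)"
proof -
  have "reps (fscale a f) \<subseteq> reps f" by (auto simp: fscale_def)
  then have "lin P (fscale a f) = (\<Sum>x\<in>reps f. fscale (fscale a f x) (P x))"
    by (rule lin_superset[OF X_fscale[OF f] finite_reps[OF f] reps_SL2[OF f]])
  then show ?thesis by (simp add: lin_def fscale_sum fscale_fscale fscale_apply)
qed

lemma lin_basis:
  assumes x: "x \<in> carrier SL2" and P: "\<And>y i. y \<in> carrier SL2 \<Longrightarrow> i \<in> iwahori \<Longrightarrow> P (y ** i) = P y"
  shows "lin P (act x charI) = P x"
proof -
  have "reps (act x charI :: _ \<Rightarrow> 'b) = {rep x}"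
  proof -
    have "act x charI x = (1 :: 'b)" using x by (simp add: act_def charI_apply)
    moreover have *: "rep y = rep x" if "act x charI y \<noteq> (0 :: 'b)" for y
    proof -
      have "adj x ** y \<in> iwahori" using that by (simp add: act_def charI_apply split: if_splits)
      then show ?thesis using rep_cong[OF x] by simp
    qed
    ultimately have "act x charI x \<noteq> (0 :: 'b)" by simp
    then have "rep x \<in> reps (act x charI :: _ \<Rightarrow> 'b)" by (intro imageI CollectI)
    moreover have "y = rep x" if "y \<in> reps (act x charI :: _ \<Rightarrow> 'b)" for y
      using that * by (elim imageE CollectE) metis
    ultimately show ?thesis by blast
  qed
  moreover have "act x charI (rep x) = (1 :: 'b)" using rep_iwahori[OF x] by (simp add: act_def charI_apply)
  moreover have "P (rep x) = P x" using P[OF x rep_iwahori[OF x]] x by simp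
  ultimately show ?thesis by (simp add: lin_def)
qed

lemma lin_X:
  assumes "f \<in> rspace \<X>" "\<And>x. x \<in> carrier SL2 \<Longrightarrow> P x \<in> rspace \<X>"
  shows "lin P f \<in> rspace \<X>"
  unfolding lin_def using assms(2) reps_SL2[OF assms(1)] by (intro X_sum X_fscale) auto

definition linear_on_X :: "(('p::prime_card mat \<Rightarrow> 'k::field) \<Rightarrow> ('p mat \<Rightarrow> 'k)) \<Rightarrow> bool" where
  "linear_on_X T \<longleftrightarrow> (\<forall>f\<in>rspace \<X>. \<forall>f'\<in>rspace \<X>. T (f + f') = T f + T f') \<and>
     (\<forall>a. \<forall>f\<in>rspace \<X>. T (fscale a f) = fscale a (T f))"

lemma linear_on_X_eqI:
  assumes T: "linear_on_X T" and T': "linear_on_X T'" and f: "f \<in> rspace \<X>"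
    and eq: "\<And>x. x \<in> carrier SL2 \<Longrightarrow> T (act x charI) = T' (act x charI)"
  shows "T f = T' f"
  using f
proof (rule X_induct)
  have "T (fscale 0 0) = fscale 0 (T 0)" "T' (fscale 0 0) = fscale 0 (T' 0)"
    using T T' X_0 unfolding linear_on_X_def by blast+
  then show "T 0 = T' 0" by simp
next
  fix f and x :: "'a mat" and a :: 'b assume "f \<in> rspace \<X>" "T f = T' f" "x \<in> carrier SL2"
  then show "T (f + fscale a (act x charI)) = T' (f + fscale a (act x charI))"
    using T T' eq[of x] by (simp add: linear_on_X_def)
qed

lemma linear_on_X_lin: "linear_on_X (lin P)"
  by (simp add: linear_on_X_def lin_add lin_fscale)

lemma linear_on_X_0: "linear_on_X T \<Longrightarrow> T 0 = 0"
proof -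
  assume "linear_on_X T"
  then have "T (fscale 0 0) = fscale 0 (T 0)" using X_0 unfolding linear_on_X_def by blast
  then show ?thesis by simp
qed

section \<open>Cocycles\<close>

definition submodule :: "(('p::prime_card) mat \<Rightarrow> 'k::field) set \<Rightarrow> bool" where
  "submodule V \<longleftrightarrow> V \<subseteq> rspace \<X> \<and> 0 \<in> V \<and> (\<forall>f\<in>V. \<forall>f'\<in>V. f - f' \<in> V) \<and> (\<forall>g\<in>iwahori. \<forall>f\<in>V. act g f \<in> V)"

lemma submodule_X: "submodule (rspace \<X>)"
  by (auto simp: submodule_def iwahori_SL2)

lemma submodule_add: "submodule V \<Longrightarrow> f \<in> V \<Longrightarrow> f' \<in> V \<Longrightarrow> f + f' \<in> V"
proof -
  assume V: "submodule V" "f \<in> V" "f' \<in> V"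
  then have "0 - f' \<in> V" unfolding submodule_def by blast
  then have "f - (0 - f') \<in> V" using V unfolding submodule_def by blast
  then show ?thesis by simp
qed

lemma Gam_Suc: "\<gamma> \<in> Gam (Suc m) \<Longrightarrow> \<gamma> \<in> Gam m"
  using Gam_mono[of m "Suc m" \<gamma>] by simp

text \<open>Since \<open>c(g\<gamma>) = c(g) + gc(\<gamma>)\<close>, a cocycle is continuous iff it vanishes on a congruence subgroup.  The index
  \<open>Suc m\<close> ensures that this subgroup lies in \<open>I\<close>.\<close>

lemma Z1_iff:
  fixes c :: "'p::prime_card mat \<Rightarrow> 'p mat \<Rightarrow> 'k::field"
  shows
  "c \<in> Z1 V \<longleftrightarrow> (\<forall>g\<in>iwahori. c g \<in> V) \<and> (\<exists>m. \<forall>\<gamma>\<in>Gam (Suc m). c \<gamma> = 0) \<and>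
     (\<forall>g\<in>iwahori. \<forall>h\<in>iwahori. c (g ** h) = c g + act g (c h))"
proof -
  have "(\<forall>g\<in>iwahori. \<exists>m. \<forall>\<gamma>\<in>Gam m. (g ** \<gamma> :: 'p mat) \<in> iwahori \<longrightarrow> c (g ** \<gamma>) = c g) \<longleftrightarrow> (\<exists>m. \<forall>\<gamma>\<in>Gam (Suc m). c \<gamma> = 0)"
    if coc: "\<forall>g\<in>iwahori. \<forall>h\<in>iwahori. c (g ** h) = c g + act g (c h)"
  proof
    have "c (mat 1 ** (mat 1 :: 'p mat)) = c (mat 1) + act (mat 1) (c (mat 1))" using coc iwahori_1 by blast
    then have c1: "c (mat 1) = 0" by simp
    assume "\<forall>g\<in>iwahori. \<exists>m. \<forall>\<gamma>\<in>Gam m. (g ** \<gamma> :: 'p mat) \<in> iwahori \<longrightarrow> c (g ** \<gamma>) = c g"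
    then obtain m where m: "\<forall>\<gamma>\<in>Gam m. (mat 1 ** \<gamma> :: 'p mat) \<in> iwahori \<longrightarrow> c (mat 1 ** \<gamma>) = c (mat 1)" using iwahori_1 by blast
    have "c \<gamma> = 0" if "\<gamma> \<in> Gam (Suc m)" for \<gamma>
      using bspec[OF m Gam_Suc[OF that]] Gam_1_iwahori[OF that] c1 by simp
    then show "\<exists>m. \<forall>\<gamma>\<in>Gam (Suc m). c \<gamma> = 0" by blast
  next
    assume "\<exists>m. \<forall>\<gamma>\<in>Gam (Suc m). c \<gamma> = 0"
    then obtain m where m: "\<forall>\<gamma>\<in>Gam (Suc m). c \<gamma> = 0" ..
    show "\<forall>g\<in>iwahori. \<exists>m. \<forall>\<gamma>\<in>Gam m. (g ** \<gamma> :: 'p mat) \<in> iwahori \<longrightarrow> c (g ** \<gamma>) = c g"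
    proof
      fix g :: "'p mat" assume g: "g \<in> iwahori"
      have "c (g ** \<gamma>) = c g" if "\<gamma> \<in> Gam (Suc m)" for \<gamma>
        using coc g m that Gam_1_iwahori[OF that] by simp
      then show "\<exists>m. \<forall>\<gamma>\<in>Gam m. (g ** \<gamma> :: 'p mat) \<in> iwahori \<longrightarrow> c (g ** \<gamma>) = c g" by blast
    qed
  qed
  moreover have "(iwahori :: 'p mat set) \<subseteq> carrier SL2" using iwahori_SL2 by blast
  ultimately show ?thesis
    unfolding Z1_def by (auto simp: continuous_map_discrete_iff_Gam image_subset_iff ract_X iwahori_SL2)
qed

lemma Z1_in: "c \<in> Z1 V \<Longrightarrow> g \<in> iwahori \<Longrightarrow> c g \<in> V"
  by (simp add: Z1_iff)

lemma Z1_mult: "c \<in> Z1 V \<Longrightarrow> g \<in> iwahori \<Longrightarrow> h \<in> iwahori \<Longrightarrow> c (g ** h) = c g + act g (c h)"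
  by (simp add: Z1_iff)

lemma Z1_1: "c \<in> Z1 V \<Longrightarrow> c (mat 1) = 0"
  using Z1_mult[of c V "mat 1" "mat 1"] by simp

lemma Z1_adj: "c \<in> Z1 V \<Longrightarrow> g \<in> iwahori \<Longrightarrow> c (adj g) = - act (adj g) (c g)"
proof -
  assume c: "c \<in> Z1 V" and g: "g \<in> iwahori"
  have "c (adj g ** g) = c (adj g) + act (adj g) (c g)" using c g by (intro Z1_mult) auto
  then have "c (adj g) + act (adj g) (c g) = 0" using Z1_1[OF c] iwahori_SL2[OF g] by simp
  then show ?thesis by (simp add: eq_neg_iff_add_eq_0)
qed

lemma Z1_subset: "c \<in> Z1 V \<Longrightarrow> (\<And>g. g \<in> iwahori \<Longrightarrow> c g \<in> V') \<Longrightarrow> c \<in> Z1 V'"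
  by (simp add: Z1_iff)

lemma Z1_cong:
  assumes "c \<in> Z1 V" and eq: "\<And>g. g \<in> iwahori \<Longrightarrow> d g = c g"
  shows "d \<in> Z1 V"
proof -
  obtain m where "\<forall>\<gamma>\<in>Gam (Suc m). c \<gamma> = 0" using assms(1) by (auto simp: Z1_iff)
  then have "\<forall>\<gamma>\<in>Gam (Suc m). d \<gamma> = 0" using eq Gam_1_iwahori by metis
  then show ?thesis using assms(1) eq unfolding Z1_iff by auto
qed

lemma Z1_0: "submodule V \<Longrightarrow> 0 \<in> Z1 V"
  by (auto simp: Z1_iff submodule_def)

lemma Z1_add: "submodule V \<Longrightarrow> c \<in> Z1 V \<Longrightarrow> d \<in> Z1 V \<Longrightarrow> c + d \<in> Z1 V"
proof -
  assume V: "submodule V" and c: "c \<in> Z1 V" and d: "d \<in> Z1 V"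
  obtain m where m: "\<forall>\<gamma>\<in>Gam (Suc m). c \<gamma> = 0" using c by (auto simp: Z1_iff)
  obtain n where n: "\<forall>\<gamma>\<in>Gam (Suc n). d \<gamma> = 0" using d by (auto simp: Z1_iff)
  have "\<forall>\<gamma>\<in>Gam (Suc (m + n)). (c + d) \<gamma> = 0"
  proof
    fix \<gamma> :: "'a mat" assume \<gamma>: "\<gamma> \<in> Gam (Suc (m + n))"
    have "\<gamma> \<in> Gam (Suc m)" "\<gamma> \<in> Gam (Suc n)" by (rule Gam_mono[OF _ \<gamma>], simp)+
    then show "(c + d) \<gamma> = 0" using m n by simp
  qed
  then show ?thesis using c d submodule_add[OF V]
    unfolding Z1_iff by (auto simp: act_add)
qed

lemma Z1_uminus: "submodule V \<Longrightarrow> c \<in> Z1 V \<Longrightarrow> - c \<in> Z1 V"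
proof -
  assume V: "submodule V" and c: "c \<in> Z1 V"
  have "- f \<in> V" if "f \<in> V" for f using V that unfolding submodule_def by (metis diff_0)
  then show ?thesis using c unfolding Z1_iff by (auto simp: act_uminus)
qed

lemma Z1_diff: "submodule V \<Longrightarrow> c \<in> Z1 V \<Longrightarrow> d \<in> Z1 V \<Longrightarrow> c - d \<in> Z1 V"
  using Z1_add[of V c "- d"] Z1_uminus[of V d] by simp

lemma coboundary_Z1: "submodule V \<Longrightarrow> f \<in> V \<Longrightarrow> (\<lambda>g. act g f - f) \<in> Z1 V"
proof -
  assume V: "submodule V" and f: "f \<in> V"
  then have "f \<in> rspace \<X>" unfolding submodule_def by blast
  from X_smooth[OF this] obtain m where "\<forall>\<gamma>\<in>Gam m. act \<gamma> f = f" by blast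
  then have "act \<gamma> f - f = 0" if "\<gamma> \<in> Gam (Suc m)" for \<gamma> using Gam_Suc[OF that] by simp
  then have "\<exists>m. \<forall>\<gamma>\<in>Gam (Suc m). act \<gamma> f - f = 0" by blast
  moreover have "act g f - f \<in> V" if "g \<in> iwahori" for g using V f that unfolding submodule_def by blast
  ultimately show ?thesis unfolding Z1_iff by (simp add: act_mult act_diff)
qed

lemma cohomologous_iff:
  "(c, d) \<in> cohomologous V \<longleftrightarrow> c \<in> Z1 V \<and> d \<in> Z1 V \<and> (\<exists>f\<in>V. \<forall>g\<in>iwahori. d g = c g + (act g f - f))"
  by (simp add: cohomologous_def ract_X iwahori_SL2 cong: ball_cong)

lemma cohomologousI:
  assumes V: "submodule V" and c: "c \<in> Z1 V" and f: "f \<in> V" and eq: "\<And>g. g \<in> iwahori \<Longrightarrow> d g = c g + (act g f - f)"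
  shows "(c, d) \<in> cohomologous V"
proof -
  have "c + (\<lambda>g. act g f - f) \<in> Z1 V" using V c f by (intro Z1_add coboundary_Z1)
  then have "d \<in> Z1 V" by (rule Z1_cong) (simp add: eq)
  then show ?thesis using assms unfolding cohomologous_iff by blast
qed

lemma equiv_cohomologous:
  assumes V: "submodule V"
  shows "equiv (Z1 V) (cohomologous V)"
proof (rule equivI)
  show "cohomologous V \<subseteq> Z1 V \<times> Z1 V" by (auto simp: cohomologous_iff)
  show "refl_on (Z1 V) (cohomologous V)"
    by (rule refl_onI) (use V in \<open>auto simp: cohomologous_iff submodule_def intro!: bexI[of _ 0]\<close>)
  show "sym (cohomologous V)"
  proof (rule symI)
    fix c d assume "(c, d) \<in> cohomologous V"
    then obtain f where f: "c \<in> Z1 V" "d \<in> Z1 V" "f \<in> V" "\<forall>g\<in>iwahori. d g = c g + (act g f - f)"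
      unfolding cohomologous_iff by blast
    have "0 - f \<in> V" using V f(3) unfolding submodule_def by blast
    moreover have "c g = d g + (act g (0 - f) - (0 - f))" if "g \<in> iwahori" for g
      using f(4) that by (simp add: act_uminus)
    ultimately show "(d, c) \<in> cohomologous V" using f unfolding cohomologous_iff by blast
  qed
  show "trans (cohomologous V)"
  proof (rule transI)
    fix c d e assume "(c, d) \<in> cohomologous V" "(d, e) \<in> cohomologous V"
    then obtain f f' where f: "c \<in> Z1 V" "e \<in> Z1 V" "f \<in> V" "f' \<in> V" "\<forall>g\<in>iwahori. d g = c g + (act g f - f)"
      "\<forall>g\<in>iwahori. e g = d g + (act g f' - f')"
      unfolding cohomologous_iff by blast
    have "e g = c g + (act g (f + f') - (f + f'))" if "g \<in> iwahori" for g
      using f(5,6) that by (simp add: act_add)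
    then show "(c, e) \<in> cohomologous V" using f submodule_add[OF V] unfolding cohomologous_iff by blast
  qed
qed

abbreviation coh_class :: "(('p::prime_card) mat \<Rightarrow> 'k::field) set \<Rightarrow> ('p mat \<Rightarrow> 'p mat \<Rightarrow> 'k) \<Rightarrow> ('p, 'k) coh" where
  "coh_class V c \<equiv> cohomologous V `` {c}"

lemma coh_class_eqI: "submodule V \<Longrightarrow> (c, d) \<in> cohomologous V \<Longrightarrow> coh_class V c = coh_class V d"
  using equiv_class_eq[OF equiv_cohomologous] .

lemma H1_cases: "\<alpha> \<in> H1 V \<Longrightarrow> \<exists>c\<in>Z1 V. \<alpha> = coh_class V c"
  unfolding H1_def by (auto elim: quotientE)

lemma coh_class_H1: "c \<in> Z1 V \<Longrightarrow> coh_class V c \<in> H1 V"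
  unfolding H1_def by (rule quotientI)

lemma coh_class_self: "submodule V \<Longrightarrow> c \<in> Z1 V \<Longrightarrow> c \<in> coh_class V c"
  using equiv_class_self[OF equiv_cohomologous] .

lemma E1_add_coh_class:
  assumes c: "c \<in> Z1 (rspace \<X>)" and d: "d \<in> Z1 (rspace \<X>)"
  shows "coh_class (rspace \<X>) c \<boxplus> coh_class (rspace \<X>) d = coh_class (rspace \<X>) (c + d)"
proof -
  have "coh_class (rspace \<X>) (c' + d') = coh_class (rspace \<X>) (c + d)"
    if c': "c' \<in> coh_class (rspace \<X>) c" and d': "d' \<in> coh_class (rspace \<X>) d" for c' d'
  proof -
    obtain f where f: "f \<in> rspace \<X>" "\<forall>g\<in>iwahori. c' g = c g + (act g f - f)" using c' by (auto simp: cohomologous_iff)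
    obtain f' where f': "f' \<in> rspace \<X>" "\<forall>g\<in>iwahori. d' g = d g + (act g f' - f')" using d' by (auto simp: cohomologous_iff)
    have "(c + d, c' + d') \<in> cohomologous (rspace \<X>)"
      using f f' by (intro cohomologousI[where f = "f + f'"] submodule_X Z1_add c d) (auto simp: act_add)
    then show ?thesis using coh_class_eqI[OF submodule_X] by blast
  qed
  then have "coh_class (rspace \<X>) c \<boxplus> coh_class (rspace \<X>) d =
    (\<Union>c'\<in>coh_class (rspace \<X>) c. \<Union>d'\<in>coh_class (rspace \<X>) d. coh_class (rspace \<X>) (c + d))"
    unfolding E1_add_def by simp
  also have "\<dots> = coh_class (rspace \<X>) (c + d)"
    using coh_class_self[OF submodule_X c] coh_class_self[OF submodule_X d] by blast
  finally show ?thesis .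
qed

lemma submodule_Xw: "submodule (Xw w)"
  unfolding submodule_def
proof (intro conjI ballI)
  show "Xw w \<subseteq> rspace \<X>" by (auto simp: Xw_def)
  show "0 \<in> Xw w" by (simp add: Xw_def)
  show "f - f' \<in> Xw w" if "f \<in> Xw w" "f' \<in> Xw w" for f f' :: "'a mat \<Rightarrow> 'b"
  proof -
    have "g \<in> IwI w" if "(f - f') g \<noteq> 0" for g
    proof -
      have "f g \<noteq> 0 \<or> f' g \<noteq> 0" using that by auto
      then show ?thesis using \<open>f \<in> Xw w\<close> \<open>f' \<in> Xw w\<close> by (auto simp: Xw_def)
    qed
    then show ?thesis using that by (auto simp: Xw_def)
  qed
  show "act g f \<in> Xw w" if g: "g \<in> iwahori" and f: "f \<in> Xw w" for g and f :: "'a mat \<Rightarrow> 'b"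
  proof -
    have "x \<in> IwI w" if "act g f x \<noteq> 0" for x
    proof -
      have "adj g ** x \<in> IwI w" using that f by (auto simp: Xw_def act_def)
      then obtain i n j where x: "adj g ** x = i ** n ** j" "i \<in> iwahori" "n \<in> w" "j \<in> iwahori"
        by (auto simp: IwI_def set_mult_def)
      have "x = g ** (adj g ** x)" using iwahori_SL2[OF g] by simp
      also have "\<dots> = g ** i ** n ** j" by (simp add: x matrix_mul_assoc)
      finally show ?thesis using x g by (auto simp: IwI_def set_mult_def)
    qed
    then show ?thesis using f g by (auto simp: Xw_def iwahori_SL2)
  qed
qed

lemma Xw_X: "f \<in> Xw w \<Longrightarrow> f \<in> rspace \<X>"
  by (simp add: Xw_def)

lemma Z1_Xw: "c \<in> Z1 (Xw w) \<Longrightarrow> c \<in> Z1 (rspace \<X>)"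
  using Z1_subset[of c "Xw w" "rspace \<X>"] Z1_in[of c "Xw w"] Xw_X by blast

lemma h1_to_E1_coh_class:
  assumes c: "c \<in> Z1 (Xw w)"
  shows "h1_to_E1 (coh_class (Xw w) c) = coh_class (rspace \<X>) c"
proof -
  have "coh_class (rspace \<X>) d = coh_class (rspace \<X>) c" if d: "d \<in> coh_class (Xw w) c" for d
  proof -
    have "(c, d) \<in> cohomologous (Xw w)" using d by simp
    then obtain f where "c \<in> Z1 (Xw w)" "d \<in> Z1 (Xw w)" "f \<in> Xw w" "\<forall>g\<in>iwahori. d g = c g + (act g f - f)"
      unfolding cohomologous_iff by blast
    then have "(c, d) \<in> cohomologous (rspace \<X>)" using Z1_Xw Xw_X unfolding cohomologous_iff by blast
    then show ?thesis using coh_class_eqI[OF submodule_X] by blast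
  qed
  moreover have "c \<in> coh_class (Xw w) c" by (rule coh_class_self[OF submodule_Xw c])
  ultimately show ?thesis unfolding h1_to_E1_def by blast
qed


section \<open>Extensions\<close>

context
  fixes V :: "('p::prime_card, 'k::field, 'v::ab_group_add) rep"
  assumes V: "smooth_rep V"
begin

lemma smooth_rep_vector_space: "vector_space (rscal V)"
  using V by (simp add: smooth_rep_def)

lemma smooth_rep_subspace: "module.subspace (rscal V) (rspace V)"
  using V by (simp add: smooth_rep_def)

lemma smooth_rep_closed: "g \<in> carrier SL2 \<Longrightarrow> v \<in> rspace V \<Longrightarrow> ract V g v \<in> rspace V"
  using V by (simp add: smooth_rep_def)

lemma smooth_rep_add:
  "g \<in> carrier SL2 \<Longrightarrow> v \<in> rspace V \<Longrightarrow> v' \<in> rspace V \<Longrightarrow> ract V g (v + v') = ract V g v + ract V g v'"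
  using V by (simp add: smooth_rep_def)

lemma smooth_rep_scal: "g \<in> carrier SL2 \<Longrightarrow> v \<in> rspace V \<Longrightarrow> ract V g (rscal V a v) = rscal V a (ract V g v)"
  using V by (simp add: smooth_rep_def)

lemma smooth_rep_one: "v \<in> rspace V \<Longrightarrow> ract V (mat 1) v = v"
  using V by (simp add: smooth_rep_def)

lemma smooth_rep_mult:
  "g \<in> carrier SL2 \<Longrightarrow> h \<in> carrier SL2 \<Longrightarrow> v \<in> rspace V \<Longrightarrow> ract V (g ** h) v = ract V g (ract V h v)"
  using V by (simp add: smooth_rep_def)

lemma smooth_rep_plus: "v \<in> rspace V \<Longrightarrow> v' \<in> rspace V \<Longrightarrow> v + v' \<in> rspace V"
proof -
  interpret vector_space "rscal V" by (rule smooth_rep_vector_space)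
  show "v \<in> rspace V \<Longrightarrow> v' \<in> rspace V \<Longrightarrow> v + v' \<in> rspace V"
    using subspace_add smooth_rep_subspace by blast
qed

lemma smooth_rep_minus: "v \<in> rspace V \<Longrightarrow> v' \<in> rspace V \<Longrightarrow> v - v' \<in> rspace V"
proof -
  interpret vector_space "rscal V" by (rule smooth_rep_vector_space)
  show "v \<in> rspace V \<Longrightarrow> v' \<in> rspace V \<Longrightarrow> v - v' \<in> rspace V"
    using subspace_diff smooth_rep_subspace by blast
qed

lemma smooth_rep_rscal: "v \<in> rspace V \<Longrightarrow> rscal V a v \<in> rspace V"
proof -
  interpret vector_space "rscal V" by (rule smooth_rep_vector_space)
  show "v \<in> rspace V \<Longrightarrow> rscal V a v \<in> rspace V"
    using subspace_scale smooth_rep_subspace by blast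
qed

lemma smooth_rep_zero: "0 \<in> rspace V"
proof -
  interpret vector_space "rscal V" by (rule smooth_rep_vector_space)
  show ?thesis using subspace_0 smooth_rep_subspace by blast
qed

lemma smooth_rep_diff:
  assumes g: "g \<in> carrier SL2" and v: "v \<in> rspace V" "v' \<in> rspace V"
  shows "ract V g (v - v') = ract V g v - ract V g v'"
proof -
  have "ract V g ((v - v') + v') = ract V g (v - v') + ract V g v'"
    using g v by (intro smooth_rep_add smooth_rep_minus)
  then show ?thesis by simp
qed

lemma smooth_rep_stabilizer:
  assumes v: "v \<in> rspace V"
  shows "\<exists>m. \<forall>\<gamma>\<in>Gam m. ract V \<gamma> v = v"
proof -
  let ?S = "{g \<in> carrier SL2. ract V g v = v}"
  have "openin (top_of_set (carrier SL2)) ?S" using V v by (simp add: smooth_rep_def)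
  then have *: "\<forall>g\<in>?S. \<exists>m. \<forall>\<gamma>\<in>Gam m. g ** \<gamma> \<in> carrier SL2 \<longrightarrow> g ** \<gamma> \<in> ?S"
    using openin_iff_Gam[OF subset_refl] by blast
  have "mat 1 \<in> ?S" using smooth_rep_one[OF v] by simp
  from bspec[OF * this] obtain m where m: "\<forall>\<gamma>\<in>Gam m. mat 1 ** \<gamma> \<in> carrier SL2 \<longrightarrow> mat 1 ** \<gamma> \<in> ?S" by blast
  have "ract V \<gamma> v = v" if "\<gamma> \<in> Gam m" for \<gamma>
    using bspec[OF m that] Gam_SL2[OF that] by simp
  then show ?thesis by blast
qed

end

lemma smooth_repI:
  fixes V :: "('p::prime_card, 'k::field, 'v::ab_group_add) rep"
  assumes vs: "vector_space (rscal V)"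
    and zero: "0 \<in> rspace V" and plus: "\<And>v v'. v \<in> rspace V \<Longrightarrow> v' \<in> rspace V \<Longrightarrow> v + v' \<in> rspace V"
    and scal: "\<And>a v. v \<in> rspace V \<Longrightarrow> rscal V a v \<in> rspace V"
    and closed: "\<And>g v. g \<in> carrier SL2 \<Longrightarrow> v \<in> rspace V \<Longrightarrow> ract V g v \<in> rspace V"
    and add: "\<And>g v v'. g \<in> carrier SL2 \<Longrightarrow> v \<in> rspace V \<Longrightarrow> v' \<in> rspace V \<Longrightarrow> ract V g (v + v') = ract V g v + ract V g v'"
    and actscal: "\<And>g a v. g \<in> carrier SL2 \<Longrightarrow> v \<in> rspace V \<Longrightarrow> ract V g (rscal V a v) = rscal V a (ract V g v)"
    and one: "\<And>v. v \<in> rspace V \<Longrightarrow> ract V (mat 1) v = v"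
    and mult: "\<And>g h v. g \<in> carrier SL2 \<Longrightarrow> h \<in> carrier SL2 \<Longrightarrow> v \<in> rspace V \<Longrightarrow> ract V (g ** h) v = ract V g (ract V h v)"
    and stab: "\<And>v. v \<in> rspace V \<Longrightarrow> \<exists>m. \<forall>\<gamma>\<in>Gam m. ract V \<gamma> v = v"
  shows "smooth_rep V"
proof -
  interpret vector_space "rscal V" by (rule vs)
  have sub: "subspace (rspace V)" by (rule subspaceI) (use zero plus scal in auto)
  have "openin (top_of_set (carrier SL2)) {g \<in> carrier SL2. ract V g v = v}" if v: "v \<in> rspace V" for v
    unfolding openin_iff_Gam[OF subset_refl]
  proof (intro conjI ballI)
    fix g assume g: "g \<in> {g \<in> carrier SL2. ract V g v = v}"
    obtain m where m: "\<forall>\<gamma>\<in>Gam m. ract V \<gamma> v = v" using stab[OF v] by blast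
    have "g ** \<gamma> \<in> {g \<in> carrier SL2. ract V g v = v}" if "\<gamma> \<in> Gam m" for \<gamma>
      using g m that Gam_SL2[OF that] mult[of g \<gamma> v] v by simp
    then show "\<exists>m. \<forall>\<gamma>\<in>Gam m. g ** \<gamma> \<in> carrier SL2 \<longrightarrow> g ** \<gamma> \<in> {g \<in> carrier SL2. ract V g v = v}" by blast
  qed auto
  then show ?thesis unfolding smooth_rep_def using vs sub closed add actscal one mult by simp
qed

context
  fixes E :: "('p::prime_card, 'k::field, 'v::ab_group_add) extn"
  assumes E: "extension E"
begin

lemma extension_smooth: "smooth_rep (emid E)"
  using E by (simp add: extension_def)

lemma eincl_in: "f \<in> rspace \<X> \<Longrightarrow> eincl E f \<in> rspace (emid E)"
  using E by (auto simp: extension_def rep_hom_def)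

lemma eincl_add: "f \<in> rspace \<X> \<Longrightarrow> f' \<in> rspace \<X> \<Longrightarrow> eincl E (f + f') = eincl E f + eincl E f'"
  using E by (auto simp: extension_def rep_hom_def)

lemma eincl_scal: "f \<in> rspace \<X> \<Longrightarrow> eincl E (fscale a f) = rscal (emid E) a (eincl E f)"
  using E by (auto simp: extension_def rep_hom_def)

lemma eincl_act: "g \<in> carrier SL2 \<Longrightarrow> f \<in> rspace \<X> \<Longrightarrow> eincl E (act g f) = ract (emid E) g (eincl E f)"
  using E by (auto simp: extension_def rep_hom_def ract_X)

lemma eincl_inj: "f \<in> rspace \<X> \<Longrightarrow> f' \<in> rspace \<X> \<Longrightarrow> eincl E f = eincl E f' \<Longrightarrow> f = f'"
  using E unfolding extension_def by (auto dest: inj_onD)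

lemma eincl_diff: "f \<in> rspace \<X> \<Longrightarrow> f' \<in> rspace \<X> \<Longrightarrow> eincl E (f - f') = eincl E f - eincl E f'"
  using eincl_add[of "f - f'" f'] by simp

lemma eproj_add: "m \<in> rspace (emid E) \<Longrightarrow> m' \<in> rspace (emid E) \<Longrightarrow> eproj E (m + m') = eproj E m + eproj E m'"
  using E by (auto simp: extension_def rep_hom_def)

lemma eproj_diff:
  assumes "m \<in> rspace (emid E)" "m' \<in> rspace (emid E)"
  shows "eproj E (m - m') = eproj E m - eproj E m'"
  using eproj_add[OF smooth_rep_minus[OF extension_smooth assms] assms(2)] by simp

lemma eproj_scal: "m \<in> rspace (emid E) \<Longrightarrow> eproj E (rscal (emid E) a m) = fscale a (eproj E m)"
  using E by (auto simp: extension_def rep_hom_def)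

lemma eproj_act: "g \<in> carrier SL2 \<Longrightarrow> m \<in> rspace (emid E) \<Longrightarrow> eproj E (ract (emid E) g m) = act g (eproj E m)"
  using E by (auto simp: extension_def rep_hom_def ract_X)

lemma eproj_surj: "f \<in> rspace \<X> \<Longrightarrow> \<exists>m\<in>rspace (emid E). eproj E m = f"
proof -
  assume "f \<in> rspace \<X>"
  then have "f \<in> eproj E ` rspace (emid E)" using E unfolding extension_def by blast
  then show ?thesis by auto
qed

lemma eproj_eq_0: "m \<in> rspace (emid E) \<Longrightarrow> eproj E m = 0 \<Longrightarrow> \<exists>f\<in>rspace \<X>. eincl E f = m"
proof -
  assume "m \<in> rspace (emid E)" "eproj E m = 0"
  then have "m \<in> eincl E ` rspace \<X>" using E unfolding extension_def by blast
  then show ?thesis by auto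
qed

lemma eproj_eincl: "f \<in> rspace \<X> \<Longrightarrow> eproj E (eincl E f) = 0"
proof -
  assume "f \<in> rspace \<X>"
  then have "eincl E f \<in> {m \<in> rspace (emid E). eproj E m = 0}" using E unfolding extension_def by blast
  then show ?thesis by simp
qed

lemma extension_cocycle:
  assumes m: "m \<in> rspace (emid E)"
    and c: "\<And>g. g \<in> iwahori \<Longrightarrow> c g \<in> rspace \<X>" "\<And>g. g \<in> iwahori \<Longrightarrow> eincl E (c g) = ract (emid E) g m - m"
  shows "c \<in> Z1 (rspace \<X>)"
  unfolding Z1_iff
proof (intro conjI ballI)
  fix g h :: "'p mat" assume g: "g \<in> iwahori" and h: "h \<in> iwahori"
  note SL = iwahori_SL2[OF g] iwahori_SL2[OF h]
  note sm = extension_smooth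
  have "eincl E (c g + act g (c h)) = ract (emid E) g m - m + ract (emid E) g (ract (emid E) h m - m)"
    using SL g h by (simp add: eincl_add eincl_act c)
  also have "\<dots> = ract (emid E) (g ** h) m - m"
    using SL m by (simp add: smooth_rep_diff[OF sm] smooth_rep_closed[OF sm] smooth_rep_mult[OF sm])
  also have "\<dots> = eincl E (c (g ** h))" using g h by (simp add: c)
  finally show "c (g ** h) = c g + act g (c h)"
    using SL g h by (intro eincl_inj) (auto simp: c)
next
  obtain k where k: "\<forall>\<gamma>\<in>Gam k. ract (emid E) \<gamma> m = m"
    using smooth_rep_stabilizer[OF extension_smooth m] by blast
  have "c \<gamma> = 0" if \<gamma>: "\<gamma> \<in> Gam (Suc k)" for \<gamma>
  proof (rule eincl_inj)
    have "eincl E (0 - 0) = 0" unfolding eincl_diff[OF X_0 X_0] by simp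
    then show "eincl E (c \<gamma>) = eincl E 0"
      using k Gam_Suc[OF \<gamma>] Gam_1_iwahori[OF \<gamma>] by (simp add: c)
  qed (use c(1)[OF Gam_1_iwahori[OF \<gamma>]] in auto)
  then show "\<exists>m. \<forall>\<gamma>\<in>Gam (Suc m). c \<gamma> = 0" by blast
qed (use c in auto)

text \<open>Two lifts of \<open>char\<^sub>I\<close> to an extension differ by an element of \<open>\<X>\<close>, which changes the cocycle \<open>g \<mapsto> gm - m\<close>
  by a coboundary; so the class can be computed from any lift \<open>m\<close>.\<close>

lemma ext_class_eq:
  assumes m: "m \<in> rspace (emid E)" "eproj E m = charI"
    and c: "\<And>g. g \<in> iwahori \<Longrightarrow> c g \<in> rspace \<X>" "\<And>g. g \<in> iwahori \<Longrightarrow> eincl E (c g) = ract (emid E) g m - m"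
  shows "ext_class E = coh_class (rspace \<X>) c"
proof (intro equalityI subsetI)
  note sm = extension_smooth
  fix d assume "d \<in> ext_class E"
  then obtain m' where m': "m' \<in> rspace (emid E)" "eproj E m' = charI"
    and d: "\<And>g. g \<in> iwahori \<Longrightarrow> d g \<in> rspace \<X>" "\<And>g. g \<in> iwahori \<Longrightarrow> eincl E (d g) = ract (emid E) g m' - m'"
    by (auto simp: ext_class_def)
  have "eproj E (m' - m) = 0" using m m' by (simp add: eproj_diff)
  then obtain f where f: "f \<in> rspace \<X>" "eincl E f = m' - m"
    using eproj_eq_0[OF smooth_rep_minus[OF sm m'(1) m(1)]] by blast
  have "d g = c g + (act g f - f)" if g: "g \<in> iwahori" for g
  proof (rule eincl_inj)
    show "d g \<in> rspace \<X>" "c g + (act g f - f) \<in> rspace \<X>"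
      using d(1) c(1) f(1) g iwahori_SL2[OF g] by auto
    have "eincl E (c g + (act g f - f)) = ract (emid E) g m - m + (ract (emid E) g (m' - m) - (m' - m))"
      using c g f iwahori_SL2[OF g] by (simp add: eincl_add eincl_diff eincl_act)
    also have "\<dots> = ract (emid E) g m' - m'"
      using m m' iwahori_SL2[OF g] by (simp add: smooth_rep_diff[OF sm])
    finally show "eincl E (d g) = eincl E (c g + (act g f - f))" using d g by simp
  qed
  then have "(c, d) \<in> cohomologous (rspace \<X>)"
    using extension_cocycle[OF m(1) c] f(1) by (intro cohomologousI[OF submodule_X])
  then show "d \<in> coh_class (rspace \<X>) c" by simp
next
  note sm = extension_smooth
  fix d assume "d \<in> coh_class (rspace \<X>) c"
  then obtain f where d: "d \<in> Z1 (rspace \<X>)" and f: "f \<in> rspace \<X>" "\<forall>g\<in>iwahori. d g = c g + (act g f - f)"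
    by (auto simp: cohomologous_iff)
  have "m + eincl E f \<in> rspace (emid E)" "eproj E (m + eincl E f) = charI"
    using m f eincl_in[OF f(1)] by (auto simp: eproj_add eproj_eincl intro: smooth_rep_plus[OF sm])
  moreover have "d g \<in> rspace \<X> \<and> eincl E (d g) = ract (emid E) g (m + eincl E f) - (m + eincl E f)"
    if g: "g \<in> iwahori" for g
  proof
    show "d g \<in> rspace \<X>" using d g Z1_in by blast
    have "eincl E (d g) = ract (emid E) g m - m + (ract (emid E) g (eincl E f) - eincl E f)"
      using c g f iwahori_SL2[OF g] by (simp add: eincl_add eincl_diff eincl_act)
    then show "eincl E (d g) = ract (emid E) g (m + eincl E f) - (m + eincl E f)"
      using m f eincl_in[OF f(1)] iwahori_SL2[OF g] by (simp add: smooth_rep_add[OF sm])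
  qed
  ultimately show "d \<in> ext_class E" unfolding ext_class_def by blast
qed

lemma ext_class_cocycle:
  assumes "ext_class E = coh_class (rspace \<X>) c" and c: "c \<in> Z1 (rspace \<X>)"
  obtains m where "m \<in> rspace (emid E)" "eproj E m = charI"
    "\<And>g. g \<in> iwahori \<Longrightarrow> eincl E (c g) = ract (emid E) g m - m"
proof -
  have "c \<in> ext_class E" using assms coh_class_self[OF submodule_X c] by simp
  then show ?thesis using that by (auto simp: ext_class_def)
qed

end

lemma heckeD:
  assumes "h \<in> hecke"
  shows hecke_in: "f \<in> rspace \<X> \<Longrightarrow> h f \<in> rspace \<X>"
    and hecke_linear: "linear_on_X h"
    and hecke_act_commute: "g \<in> carrier SL2 \<Longrightarrow> f \<in> rspace \<X> \<Longrightarrow> h (act g f) = act g (h f)"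
    and hecke_outside: "f \<notin> rspace \<X> \<Longrightarrow> h f = 0"
  using assms by (auto simp: hecke_def rep_hom_def linear_on_X_def ract_X)

lemma heckeI:
  assumes "\<And>f. f \<in> rspace \<X> \<Longrightarrow> h f \<in> rspace \<X>" "linear_on_X h"
    "\<And>g f. g \<in> carrier SL2 \<Longrightarrow> f \<in> rspace \<X> \<Longrightarrow> h (act g f) = act g (h f)"
    "\<And>f. f \<notin> rspace \<X> \<Longrightarrow> h f = 0"
  shows "h \<in> hecke"
  using assms by (auto simp: hecke_def rep_hom_def linear_on_X_def ract_X)

lemma hecke_eqI:
  assumes h: "h \<in> hecke" and h': "h' \<in> hecke" and eq: "h charI = h' charI"
  shows "h = h'"
proof
  fix f
  show "h f = h' f"
  proof (cases "f \<in> rspace \<X>")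
    case True
    show ?thesis
    proof (rule linear_on_X_eqI[OF hecke_linear[OF h] hecke_linear[OF h'] True])
      fix x :: "'a mat" assume "x \<in> carrier SL2"
      then show "h (act x charI) = h' (act x charI)"
        by (simp add: hecke_act_commute[OF h] hecke_act_commute[OF h'] eq)
    qed
  next
    case False
    then show ?thesis by (simp add: hecke_outside[OF h] hecke_outside[OF h'])
  qed
qed

lemma pullback_simps [simp]:
  "rspace (emid (pullback h E)) = {(m, f). m \<in> rspace (emid E) \<and> f \<in> rspace \<X> \<and> eproj E m = h f}"
  "rscal (emid (pullback h E)) a (m, f) = (rscal (emid E) a m, fscale a f)"
  "ract (emid (pullback h E)) g (m, f) = (ract (emid E) g m, ract \<X> g f)"
  "eincl (pullback h E) f = (eincl E f, 0)"
  "eproj (pullback h E) = snd"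
  by (simp_all add: pullback_def)

lemma pullback_extension:
  fixes E :: "('p::prime_card, 'k::field, 'v::ab_group_add) extn"
  assumes E: "extension E" and h: "h \<in> hecke"
  shows "extension (pullback h E)"
proof -
  note sm = extension_smooth[OF E]
  note hl = hecke_linear[OF h, unfolded linear_on_X_def]
  have h0: "h 0 = 0" by (rule linear_on_X_0[OF hecke_linear[OF h]])
  have vs: "vector_space (rscal (emid (pullback h E)))"
  proof -
    interpret M: vector_space "rscal (emid E)" by (rule smooth_rep_vector_space[OF sm])
    show ?thesis
      by unfold_locales
        (auto simp: M.scale_right_distrib M.scale_left_distrib fscale_add fscale_add_left fscale_fscale)
  qed
  have p0: "eproj E 0 = 0"
  proof -
    have z: "0 \<in> rspace (emid E)" by (rule smooth_rep_zero[OF sm])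
    show ?thesis using eproj_diff[OF E z z] by simp
  qed
  have "smooth_rep (emid (pullback h E))"
  proof (rule smooth_repI[OF vs])
    show "0 \<in> rspace (emid (pullback h E))"
      using smooth_rep_zero[OF sm] p0 h0 by (simp add: zero_prod_def)
  next
    fix v v' assume "v \<in> rspace (emid (pullback h E))" "v' \<in> rspace (emid (pullback h E))"
    then show "v + v' \<in> rspace (emid (pullback h E))"
      using hl by (auto simp: eproj_add[OF E] smooth_rep_plus[OF sm])
  next
    fix a v assume "v \<in> rspace (emid (pullback h E))"
    then show "rscal (emid (pullback h E)) a v \<in> rspace (emid (pullback h E))"
      using hl by (auto simp: eproj_scal[OF E] smooth_rep_rscal[OF sm])
  next
    fix g :: "'p mat" and v assume "g \<in> carrier SL2" "v \<in> rspace (emid (pullback h E))"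
    then show "ract (emid (pullback h E)) g v \<in> rspace (emid (pullback h E))"
      by (auto simp: eproj_act[OF E] smooth_rep_closed[OF sm] hecke_act_commute[OF h] ract_X)
  next
    fix g :: "'p mat" and v v' assume "g \<in> carrier SL2" "v \<in> rspace (emid (pullback h E))" "v' \<in> rspace (emid (pullback h E))"
    then show "ract (emid (pullback h E)) g (v + v') = ract (emid (pullback h E)) g v + ract (emid (pullback h E)) g v'"
      by (auto simp: smooth_rep_add[OF sm] act_add ract_X)
  next
    fix g :: "'p mat" and a v assume "g \<in> carrier SL2" "v \<in> rspace (emid (pullback h E))"
    then show "ract (emid (pullback h E)) g (rscal (emid (pullback h E)) a v) = rscal (emid (pullback h E)) a (ract (emid (pullback h E)) g v)"
      by (auto simp: smooth_rep_scal[OF sm] act_fscale ract_X)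
  next
    fix v assume "v \<in> rspace (emid (pullback h E))"
    then show "ract (emid (pullback h E)) (mat 1) v = v"
      by (auto simp: smooth_rep_one[OF sm] ract_X)
  next
    fix g h' :: "'p mat" and v assume "g \<in> carrier SL2" "h' \<in> carrier SL2" "v \<in> rspace (emid (pullback h E))"
    then show "ract (emid (pullback h E)) (g ** h') v = ract (emid (pullback h E)) g (ract (emid (pullback h E)) h' v)"
      by (auto simp: smooth_rep_mult[OF sm] act_mult ract_X)
  next
    fix v assume "v \<in> rspace (emid (pullback h E))"
    then obtain m f where v: "v = (m, f)" "m \<in> rspace (emid E)" "f \<in> rspace \<X>" by auto
    obtain i where i: "\<forall>\<gamma>\<in>Gam i. ract (emid E) \<gamma> m = m" using smooth_rep_stabilizer[OF sm v(2)] by blast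
    obtain j where j: "\<forall>\<gamma>\<in>Gam j. act \<gamma> f = f" using X_smooth[OF v(3)] by blast
    have "ract (emid (pullback h E)) \<gamma> v = v" if \<gamma>: "\<gamma> \<in> Gam (i + j)" for \<gamma>
    proof -
      have "\<gamma> \<in> Gam i" "\<gamma> \<in> Gam j" by (rule Gam_mono[OF _ \<gamma>], simp)+
      then show ?thesis using i j Gam_SL2[OF \<gamma>] by (simp add: v ract_X)
    qed
    then show "\<exists>m. \<forall>\<gamma>\<in>Gam m. ract (emid (pullback h E)) \<gamma> v = v" by blast
  qed
  moreover have "eincl (pullback h E) \<in> rep_hom \<X> (emid (pullback h E))"
    by (auto simp: rep_hom_def eincl_in[OF E] eproj_eincl[OF E] h0 eincl_add[OF E] eincl_scal[OF E] eincl_act[OF E] ract_X)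
  moreover have "eproj (pullback h E) \<in> rep_hom (emid (pullback h E)) \<X>"
    by (auto simp: rep_hom_def)
  moreover have "inj_on (eincl (pullback h E)) (rspace \<X>)"
    using eincl_inj[OF E] by (auto intro!: inj_onI)
  moreover have "eproj (pullback h E) ` rspace (emid (pullback h E)) = rspace \<X>"
  proof (intro equalityI subsetI)
    fix f :: "'p mat \<Rightarrow> 'k" assume f: "f \<in> rspace \<X>"
    then obtain m where "m \<in> rspace (emid E)" "eproj E m = h f"
      using eproj_surj[OF E hecke_in[OF h f]] by blast
    then have "(m, f) \<in> rspace (emid (pullback h E))" using f by simp
    then show "f \<in> eproj (pullback h E) ` rspace (emid (pullback h E))" by (intro image_eqI[of _ _ "(m, f)"]) simp_all
  qed auto
  moreover have "eincl (pullback h E) ` rspace \<X> = {m \<in> rspace (emid (pullback h E)). eproj (pullback h E) m = 0}"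
  proof (intro equalityI subsetI)
    fix v assume "v \<in> {m \<in> rspace (emid (pullback h E)). eproj (pullback h E) m = 0}"
    then obtain m where v: "v = (m, 0)" "m \<in> rspace (emid E)" "eproj E m = 0" using h0 by auto
    then obtain f where "f \<in> rspace \<X>" "eincl E f = m" using eproj_eq_0[OF E] by blast
    then show "v \<in> eincl (pullback h E) ` rspace \<X>" using v by auto
  qed (auto simp: eincl_in[OF E] eproj_eincl[OF E] h0)
  ultimately show ?thesis unfolding extension_def by blast
qed

subsection \<open>Every class comes from an extension\<close>

text \<open>A cocycle \<open>c\<close> of \<open>I\<close> is extended to a function \<open>K\<close> on \<open>G\<close> with \<open>K(gi) = K(g) + gc(i)\<close>; in the
  extension that is constructed from it, \<open>g\<close> maps the lift \<open>(K(1), char\<^sub>I)\<close> of \<open>char\<^sub>I\<close> to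
  \<open>(K(g), g char\<^sub>I)\<close>.\<close>

lemma cocycle_extends:
  fixes c :: "'p::prime_card mat \<Rightarrow> 'p mat \<Rightarrow> 'k::field"
  assumes c: "c \<in> Z1 (rspace \<X>)"
  shows "\<exists>K :: 'p mat \<Rightarrow> 'p mat \<Rightarrow> 'k.
    (\<forall>g\<in>carrier SL2. \<forall>i\<in>iwahori. K (g ** i) = K g + act g (c i)) \<and> (\<forall>g\<in>carrier SL2. K g \<in> rspace \<X>)"
proof -
  define K where "K = (\<lambda>g. act (rep g) (c (adj (rep g) ** g)))"
  have i: "adj (rep g) ** g \<in> iwahori" if "g \<in> carrier SL2" for g :: "'p mat"
    using rep_iwahori[OF that] iwahori_adj[of "adj g ** rep g"] by (simp add: adj_mult)
  have "K (g ** i) = K g + act g (c i)" if g: "g \<in> carrier SL2" and ii: "i \<in> iwahori" for g i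
  proof -
    have r: "rep g = rep (g ** i)" using g ii by (intro rep_cong) simp_all
    have "c (adj (rep g) ** g ** i) = c (adj (rep g) ** g) + act (adj (rep g) ** g) (c i)"
      using Z1_mult[OF c i[OF g] ii] .
    then have "act (rep g) (c (adj (rep g) ** g ** i)) = act (rep g) (c (adj (rep g) ** g)) + act (rep g ** (adj (rep g) ** g)) (c i)"
      by (simp only: act_add act_mult)
    then show ?thesis using g by (simp add: K_def r[symmetric] matrix_mul_assoc[symmetric])
  qed
  moreover have "K g \<in> rspace \<X>" if "g \<in> carrier SL2" for g
    unfolding K_def using Z1_in[OF c i[OF that]] that by simp
  ultimately show ?thesis by blast
qed

lemma extension_exists:
  fixes c :: "'p::prime_card mat \<Rightarrow> 'p mat \<Rightarrow> 'k::field"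
  assumes c: "c \<in> Z1 (rspace \<X>)"
  shows "\<exists>E :: ('p, 'k, ('p mat \<Rightarrow> 'k) \<times> ('p mat \<Rightarrow> 'k)) extn. extension E \<and> ext_class E = coh_class (rspace \<X>) c"
proof -
  obtain K :: "'p mat \<Rightarrow> 'p mat \<Rightarrow> 'k"
    where K: "\<And>g i. g \<in> carrier SL2 \<Longrightarrow> i \<in> iwahori \<Longrightarrow> K (g ** i) = K g + act g (c i)"
      and KX: "\<And>g. g \<in> carrier SL2 \<Longrightarrow> K g \<in> rspace \<X>"
    using cocycle_extends[OF c] by blast
  \<comment> \<open>\<open>g\<close> will act on pairs by \<open>(f, f') \<mapsto> (gf + b(g)f', gf')\<close>, where \<open>b\<close> is chosen such that \<open>(K(x), x char\<^sub>I)\<close> is mapped to \<open>(K(gx), gx char\<^sub>I)\<close>.\<close>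
  define b where "b = (\<lambda>g. lin (\<lambda>x. K (g ** x) - act g (K x)))"
  have b_basis: "b g (act x charI) = K (g ** x) - act g (K x)" if "g \<in> carrier SL2" "x \<in> carrier SL2" for g x
    unfolding b_def
  proof (rule lin_basis[OF that(2)])
    fix y i :: "'p mat" assume y: "y \<in> carrier SL2" and i: "i \<in> iwahori"
    show "K (g ** (y ** i)) - act g (K (y ** i)) = K (g ** y) - act g (K y)"
      using that(1) y i by (simp add: matrix_mul_assoc K act_add act_mult)
  qed
  have b_X: "b g f \<in> rspace \<X>" if "g \<in> carrier SL2" "f \<in> rspace \<X>" for g f
    unfolding b_def by (rule lin_X[OF that(2)]) (use that(1) in \<open>simp add: KX\<close>)
  have b_add: "b g (f + f') = b g f + b g f'" if "f \<in> rspace \<X>" "f' \<in> rspace \<X>" for g f f'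
    unfolding b_def by (rule lin_add[OF that])
  have b_scale: "b g (fscale a f) = fscale a (b g f)" if "f \<in> rspace \<X>" for g a f
    unfolding b_def by (rule lin_fscale[OF that])
  have b_0: "b g 0 = 0" for g
    unfolding b_def by (rule linear_on_X_0[OF linear_on_X_lin])
  have b_mult: "b (g ** h) f = act g (b h f) + b g (act h f)"
    if g: "g \<in> carrier SL2" and h: "h \<in> carrier SL2" and f: "f \<in> rspace \<X>" for g h f
  proof (rule linear_on_X_eqI[OF _ _ f, of "b (g ** h)" "\<lambda>f. act g (b h f) + b g (act h f)"])
    show "linear_on_X (b (g ** h))" unfolding b_def by (rule linear_on_X_lin)
    show "linear_on_X (\<lambda>f. act g (b h f) + b g (act h f))"
      using h by (auto simp: linear_on_X_def b_add b_scale act_add act_fscale fscale_add)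
    fix x :: "'p mat" assume x: "x \<in> carrier SL2"
    have "b g (act (h ** x) charI) = K (g ** (h ** x)) - act g (K (h ** x))"
      using g h x by (intro b_basis) auto
    then show "b (g ** h) (act x charI) = act g (b h (act x charI)) + b g (act h (act x charI))"
      using g h x by (simp add: b_basis act_diff act_mult[symmetric] matrix_mul_assoc)
  qed
  have b_1: "b (mat 1) f = 0" if "f \<in> rspace \<X>" for f
    using b_mult[of "mat 1" "mat 1" f] that by simp
  have b_smooth: "\<exists>m. \<forall>\<gamma>\<in>Gam m. b \<gamma> f = 0" if f: "f \<in> rspace \<X>" for f
    using f
  proof (rule X_induct)
    show "\<exists>m. \<forall>\<gamma>\<in>Gam m. b \<gamma> 0 = 0" by (simp add: b_0)
  next
    fix f and x :: "'p mat" and a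
    assume f: "f \<in> rspace \<X>" and "\<exists>m. \<forall>\<gamma>\<in>Gam m. b \<gamma> f = 0" and x: "x \<in> carrier SL2"
    then obtain m where m: "\<forall>\<gamma>\<in>Gam m. b \<gamma> f = 0" by blast
    obtain k where k: "\<forall>\<gamma>\<in>Gam k. act \<gamma> (K x) = K x" using X_smooth[OF KX[OF x]] by blast
    obtain n where n: "\<forall>\<gamma>\<in>Gam (Suc n). c \<gamma> = 0" using c by (auto simp: Z1_iff)
    obtain l where l: "\<And>\<gamma>. \<gamma> \<in> Gam l \<Longrightarrow> adj x ** \<gamma> ** x \<in> Gam (Suc n)"
      using Gam_conj[OF x, of "Suc n"] by metis
    have "b \<gamma> (f + fscale a (act x charI)) = 0" if \<gamma>: "\<gamma> \<in> Gam (m + k + l)" for \<gamma>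
    proof -
      have G: "\<gamma> \<in> Gam m" "\<gamma> \<in> Gam k" "\<gamma> \<in> Gam l" by (rule Gam_mono[OF _ \<gamma>], simp)+
      have I: "adj x ** \<gamma> ** x \<in> iwahori" "c (adj x ** \<gamma> ** x) = 0"
        using n Gam_1_iwahori[OF l[OF G(3)]] l[OF G(3)] by blast+
      have "K (\<gamma> ** x) = K (x ** (adj x ** \<gamma> ** x))" using x by (simp add: matrix_mul_assoc[symmetric])
      also have "\<dots> = K x" unfolding K[OF x I(1)] I(2) by simp
      finally have "b \<gamma> (act x charI) = 0" using b_basis[OF Gam_SL2[OF \<gamma>] x] k G(2) by simp
      moreover have "b \<gamma> f = 0" using m G(1) by blast
      ultimately show ?thesis using f x by (simp add: b_add b_scale)
    qed
    then show "\<exists>m. \<forall>\<gamma>\<in>Gam m. b \<gamma> (f + fscale a (act x charI)) = 0" by blast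
  qed
  define M where "M = \<lparr>rspace = rspace \<X> \<times> rspace \<X>,
    rscal = (\<lambda>(a :: 'k) (f, f'). (fscale a f, fscale a f')),
    ract = (\<lambda>g (f, f'). (act g f + b g f', act g f'))\<rparr>"
  have M [simp]: "rspace M = rspace \<X> \<times> rspace \<X>" "rscal M a (f, f') = (fscale a f, fscale a f')"
    "ract M g (f, f') = (act g f + b g f', act g f')" for a f f' g
    by (simp_all add: M_def)
  define E where "E = \<lparr>emid = M, eincl = (\<lambda>f. (f, 0)), eproj = snd\<rparr>"
  have Es [simp]: "emid E = M" "eincl E f = (f, 0)" "eproj E = snd" for f
    by (simp_all add: E_def)
  have vs: "vector_space (rscal M)"
    by unfold_locales (auto simp: fscale_add fscale_add_left fscale_fscale)
  have "smooth_rep M"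
  proof (rule smooth_repI[OF vs])
    show "0 \<in> rspace M" by (simp add: zero_prod_def)
  next
    fix v v' assume "v \<in> rspace M" "v' \<in> rspace M" then show "v + v' \<in> rspace M" by auto
  next
    fix a v assume "v \<in> rspace M" then show "rscal M a v \<in> rspace M" by auto
  next
    fix g :: "'p mat" and v assume "g \<in> carrier SL2" "v \<in> rspace M" then show "ract M g v \<in> rspace M" by (auto simp: b_X)
  next
    fix g :: "'p mat" and v v' assume "g \<in> carrier SL2" "v \<in> rspace M" "v' \<in> rspace M"
    then show "ract M g (v + v') = ract M g v + ract M g v'" by (auto simp: act_add b_add)
  next
    fix g :: "'p mat" and a v assume "g \<in> carrier SL2" "v \<in> rspace M"
    then show "ract M g (rscal M a v) = rscal M a (ract M g v)" by (auto simp: act_fscale b_scale fscale_add)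
  next
    fix v assume "v \<in> rspace M" then show "ract M (mat 1) v = v" by (auto simp: b_1)
  next
    fix g h :: "'p mat" and v assume "g \<in> carrier SL2" "h \<in> carrier SL2" "v \<in> rspace M"
    then show "ract M (g ** h) v = ract M g (ract M h v)" by (auto simp: act_mult b_mult act_add)
  next
    fix v assume "v \<in> rspace M"
    then obtain f f' where v: "v = (f, f')" "f \<in> rspace \<X>" "f' \<in> rspace \<X>" by auto
    obtain i where i: "\<forall>\<gamma>\<in>Gam i. act \<gamma> f = f" using X_smooth[OF v(2)] by blast
    obtain j where j: "\<forall>\<gamma>\<in>Gam j. act \<gamma> f' = f'" using X_smooth[OF v(3)] by blast
    obtain k where k: "\<forall>\<gamma>\<in>Gam k. b \<gamma> f' = 0" using b_smooth[OF v(3)] by blast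
    have "ract M \<gamma> v = v" if \<gamma>: "\<gamma> \<in> Gam (i + j + k)" for \<gamma>
    proof -
      have "\<gamma> \<in> Gam i" "\<gamma> \<in> Gam j" "\<gamma> \<in> Gam k" by (rule Gam_mono[OF _ \<gamma>], simp)+
      then show ?thesis using i j k by (simp add: v)
    qed
    then show "\<exists>m. \<forall>\<gamma>\<in>Gam m. ract M \<gamma> v = v" by blast
  qed
  moreover have "eincl E \<in> rep_hom \<X> M"
    by (auto simp: rep_hom_def ract_X b_0)
  moreover have "eproj E \<in> rep_hom M \<X>"
    by (auto simp: rep_hom_def ract_X)
  moreover have "inj_on (eincl E) (rspace \<X>)" by (rule inj_onI) simp
  moreover have "eproj E ` rspace M = rspace \<X>"
  proof (intro equalityI subsetI)
    fix f :: "'p mat \<Rightarrow> 'k" assume "f \<in> rspace \<X>"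
    then show "f \<in> eproj E ` rspace M" by (intro image_eqI[of _ _ "(0, f)"]) simp_all
  qed auto
  moreover have "eincl E ` rspace \<X> = {m \<in> rspace M. eproj E m = 0}" by auto
  ultimately have ext: "extension E" unfolding extension_def by simp
  have "ext_class E = coh_class (rspace \<X>) c"
  proof (rule ext_class_eq[OF ext, of "(K (mat 1), charI)"])
    show "(K (mat 1), charI) \<in> rspace (emid E)" by (simp add: KX)
    show "c g \<in> rspace \<X>" if "g \<in> iwahori" for g using Z1_in[OF c that] .
    show "eincl E (c g) = ract (emid E) g (K (mat 1), charI) - (K (mat 1), charI)" if g: "g \<in> iwahori" for g
    proof -
      have "b g (act (mat 1) charI) = K (g ** mat 1) - act g (K (mat 1))"
        by (rule b_basis) (simp_all add: iwahori_SL2[OF g])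
      moreover have "K (mat 1 ** g) = K (mat 1) + act (mat 1) (c g)" by (rule K[OF SL2_1 g])
      moreover have "act (mat 1 ** g) charI = (act (mat 1) charI :: 'p mat \<Rightarrow> 'k)" by (rule act_charI_iwahori[OF g])
      ultimately show ?thesis by simp
    qed
  qed simp
  then show ?thesis using ext by blast
qed

section \<open>The left action of Hecke operators on cocycles\<close>

lemma smooth_rep_lincomb:
  fixes V :: "('p::prime_card, 'k::field, 'v::ab_group_add) rep"
  assumes V: "smooth_rep V" and J: "finite J" "\<And>j. j \<in> J \<Longrightarrow> v j \<in> rspace V"
  shows "(\<Sum>j\<in>J. v j) \<in> rspace V" and "g \<in> carrier SL2 \<Longrightarrow> ract V g (\<Sum>j\<in>J. v j) = (\<Sum>j\<in>J. ract V g (v j))"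
proof -
  have r0: "ract V g 0 = 0" if "g \<in> carrier SL2" for g
    using smooth_rep_diff[OF V that smooth_rep_zero[OF V] smooth_rep_zero[OF V]] by simp
  define S where "S = (\<lambda>J. \<Sum>j\<in>J. v j)"
  have "S J \<in> rspace V \<and> (g \<in> carrier SL2 \<longrightarrow> ract V g (S J) = (\<Sum>j\<in>J. ract V g (v j)))"
    using J
  proof (induction J rule: finite_induct)
    case empty
    then show ?case using r0 smooth_rep_zero[OF V] by (simp add: S_def)
  next
    case (insert j J)
    then have "S (insert j J) = v j + S J" by (simp add: S_def)
    then show ?case using insert smooth_rep_plus[OF V] smooth_rep_add[OF V] by simp
  qed
  then show "(\<Sum>j\<in>J. v j) \<in> rspace V" "g \<in> carrier SL2 \<Longrightarrow> ract V g (\<Sum>j\<in>J. v j) = (\<Sum>j\<in>J. ract V g (v j))"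
    by (simp_all add: S_def)
qed

lemma additive_sum:
  fixes T :: "'v::ab_group_add \<Rightarrow> 'w::ab_group_add"
  assumes add: "\<And>v v'. v \<in> V \<Longrightarrow> v' \<in> V \<Longrightarrow> T (v + v') = T v + T v'" and V: "0 \<in> V" "\<And>v v'. v \<in> V \<Longrightarrow> v' \<in> V \<Longrightarrow> v + v' \<in> V"
    and J: "finite J" "\<And>j. j \<in> J \<Longrightarrow> v j \<in> V"
  shows "T (\<Sum>j\<in>J. v j) = (\<Sum>j\<in>J. T (v j))"
proof -
  have T0: "T 0 = 0" using add[OF V(1) V(1)] by simp
  define S where "S = (\<lambda>J. \<Sum>j\<in>J. v j)"
  define S' where "S' = (\<lambda>J. \<Sum>j\<in>J. T (v j))"
  have "S J \<in> V \<and> T (S J) = S' J"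
    using J
  proof (induction J rule: finite_induct)
    case empty
    then show ?case using T0 V(1) by (simp add: S_def S'_def)
  next
    case (insert j J)
    then have "S (insert j J) = v j + S J" "S' (insert j J) = T (v j) + S' J" by (simp_all add: S_def S'_def)
    then show ?case using insert V(2) add by simp
  qed
  then show ?thesis by (simp add: S_def S'_def)
qed

text \<open>If \<open>h char\<^sub>I\<close> is the combination of the \<open>y\<^sub>j char\<^sub>I\<close> with coefficients \<open>a\<^sub>j\<close> and \<open>m\<close> is a lift of
  \<open>char\<^sub>I\<close> to an extension, then the same combination of the \<open>y\<^sub>jm\<close> is a lift of \<open>h char\<^sub>I\<close>.  An
  element \<open>g \<in> I\<close> permutes the cosets \<open>y\<^sub>jI\<close>; \<open>\<rho>\<close> describes the inverse of this permutation.\<close>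

lemma hecke_act_coh_class:
  fixes c :: "'p::prime_card mat \<Rightarrow> 'p mat \<Rightarrow> 'k::field"
  assumes h: "h \<in> hecke" and c: "c \<in> Z1 (rspace \<X>)"
    and J: "finite J" and y: "\<And>j. j \<in> J \<Longrightarrow> y j \<in> carrier SL2"
    and hI: "h charI = (\<Sum>j\<in>J. fscale (a j) (act (y j) charI))"
    and bij: "\<And>g. g \<in> iwahori \<Longrightarrow> bij_betw (\<rho> g) J J"
    and yI: "\<And>g j. g \<in> iwahori \<Longrightarrow> j \<in> J \<Longrightarrow> adj (y j) ** g ** y (\<rho> g j) \<in> iwahori"
    and a: "\<And>g j. g \<in> iwahori \<Longrightarrow> j \<in> J \<Longrightarrow> a (\<rho> g j) = a j"
    and d: "\<And>g. d g = (\<Sum>j\<in>J. fscale (a j) (act (y j) (c (adj (y j) ** g ** y (\<rho> g j)))))"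
  shows "d \<in> Z1 (rspace \<X>)" and "h \<cdot> coh_class (rspace \<X>) c = coh_class (rspace \<X>) d"
proof -
  have dX: "d g \<in> rspace \<X>" if g: "g \<in> iwahori" for g
    unfolding d using Z1_in[OF c yI[OF g]] y by (intro X_sum X_fscale X_act) auto
  have main: "d \<in> Z1 (rspace \<X>) \<and> ext_class (pullback h E) = coh_class (rspace \<X>) d"
    if E: "extension E" and EC: "ext_class E = coh_class (rspace \<X>) c" for E :: "('p, 'k, 'v::ab_group_add) extn"
  proof -
    note sm = extension_smooth[OF E]
    obtain m where m: "m \<in> rspace (emid E)" "eproj E m = charI"
      and mc: "\<And>g. g \<in> iwahori \<Longrightarrow> eincl E (c g) = ract (emid E) g m - m"
      using ext_class_cocycle[OF E EC c] by metis
    let ?s = "rscal (emid E)" and ?r = "ract (emid E)"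
    interpret M: vector_space ?s by (rule smooth_rep_vector_space[OF sm])
    define m' where "m' = (\<Sum>j\<in>J. ?s (a j) (?r (y j) m))"
    have in1: "?s (a j) (?r (y j) m) \<in> rspace (emid E)" if "j \<in> J" for j
      using y[OF that] m(1) smooth_rep_rscal[OF sm] smooth_rep_closed[OF sm] by blast
    have m'_in: "m' \<in> rspace (emid E)" unfolding m'_def by (rule smooth_rep_lincomb(1)[OF sm J in1])
    have "eproj E m' = (\<Sum>j\<in>J. eproj E (?s (a j) (?r (y j) m)))"
      unfolding m'_def
      by (rule additive_sum[where V = "rspace (emid E)"])
        (use eproj_add[OF E] smooth_rep_zero[OF sm] smooth_rep_plus[OF sm] J in1 in blast)+
    also have "\<dots> = (\<Sum>j\<in>J. fscale (a j) (act (y j) charI))"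
      by (rule sum.cong[OF refl])
        (use y m smooth_rep_closed[OF sm] in \<open>simp add: eproj_scal[OF E] eproj_act[OF E]\<close>)
    finally have proj: "eproj E m' = h charI" unfolding hI .
    have key: "eincl E (d g) = ?r g m' - m'" if g: "g \<in> iwahori" for g
    proof -
      have gS: "g \<in> carrier SL2" by (rule iwahori_SL2[OF g])
      have \<rho>J: "\<rho> g j \<in> J" if "j \<in> J" for j using bij[OF g] that by (rule bij_betwE[rule_format])
      define i where "i = (\<lambda>j. adj (y j) ** g ** y (\<rho> g j))"
      have iI: "i j \<in> iwahori" if "j \<in> J" for j using yI[OF g that] by (simp add: i_def)
      have term_in: "fscale (a j) (act (y j) (c (i j))) \<in> rspace \<X>" if "j \<in> J" for j
        using Z1_in[OF c iI[OF that]] y[OF that] by auto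
      have dg: "d g = (\<Sum>j\<in>J. fscale (a j) (act (y j) (c (i j))))" by (simp add: d i_def)
      have "eincl E (d g) = (\<Sum>j\<in>J. eincl E (fscale (a j) (act (y j) (c (i j)))))"
        unfolding dg
        by (rule additive_sum[where V = "rspace \<X>"])
          (use eincl_add[OF E] X_add X_0 J term_in in blast)+
      also have "\<dots> = (\<Sum>j\<in>J. ?s (a j) (?r g (?r (y (\<rho> g j)) m)) - ?s (a j) (?r (y j) m))"
      proof (rule sum.cong[OF refl])
        fix j assume j: "j \<in> J"
        have cX: "c (i j) \<in> rspace \<X>" using Z1_in[OF c iI[OF j]] .
        have "eincl E (fscale (a j) (act (y j) (c (i j)))) = ?s (a j) (?r (y j) (?r (i j) m - m))"
          using cX y[OF j] mc[OF iI[OF j]] by (simp add: eincl_scal[OF E] eincl_act[OF E])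
        also have "?r (y j) (?r (i j) m - m) = ?r (y j ** i j) m - ?r (y j) m"
          using y[OF j] m(1) iwahori_SL2[OF iI[OF j]]
          by (simp add: smooth_rep_diff[OF sm] smooth_rep_closed[OF sm] smooth_rep_mult[OF sm])
        also have "y j ** i j = g ** y (\<rho> g j)"
          using y[OF j] by (simp add: i_def matrix_mul_assoc[symmetric])
        also have "?r (g ** y (\<rho> g j)) m = ?r g (?r (y (\<rho> g j)) m)"
          using y[OF \<rho>J[OF j]] gS m(1) by (simp add: smooth_rep_mult[OF sm])
        finally show "eincl E (fscale (a j) (act (y j) (c (i j)))) =
            ?s (a j) (?r g (?r (y (\<rho> g j)) m)) - ?s (a j) (?r (y j) m)"
          by (simp add: M.scale_right_diff_distrib)
      qed
      also have "\<dots> = (\<Sum>j\<in>J. ?s (a j) (?r g (?r (y (\<rho> g j)) m))) - m'"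
        by (simp add: sum_subtractf m'_def)
      also have "(\<Sum>j\<in>J. ?s (a j) (?r g (?r (y (\<rho> g j)) m))) = (\<Sum>j\<in>J. ?s (a (\<rho> g j)) (?r g (?r (y (\<rho> g j)) m)))"
        by (rule sum.cong[OF refl]) (simp add: a[OF g])
      also have "\<dots> = (\<Sum>j\<in>J. ?s (a j) (?r g (?r (y j) m)))"
        by (rule sum.reindex_bij_betw[OF bij[OF g]])
      also have "\<dots> = (\<Sum>j\<in>J. ?r g (?s (a j) (?r (y j) m)))"
        by (rule sum.cong[OF refl])
          (use y gS m(1) smooth_rep_closed[OF sm] in \<open>simp add: smooth_rep_scal[OF sm]\<close>)
      also have "\<dots> = ?r g m'"
        unfolding m'_def by (rule smooth_rep_lincomb(2)[OF sm J in1 gS, symmetric])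
      finally show ?thesis .
    qed
    note PE = pullback_extension[OF E h]
    have pm: "(m', charI) \<in> rspace (emid (pullback h E))" using m'_in proj by simp
    have pc: "eincl (pullback h E) (d g) = ract (emid (pullback h E)) g (m', charI) - (m', charI)"
      if g: "g \<in> iwahori" for g
    proof -
      have "act (mat 1 ** g) charI = (act (mat 1) charI :: 'p mat \<Rightarrow> 'k)" by (rule act_charI_iwahori[OF g])
      then show ?thesis using key[OF g] iwahori_SL2[OF g] by (simp add: ract_X)
    qed
    have "d \<in> Z1 (rspace \<X>)" by (rule extension_cocycle[OF PE pm dX pc])
    moreover have "ext_class (pullback h E) = coh_class (rspace \<X>) d"
      by (rule ext_class_eq[OF PE pm _ dX pc]) simp
    ultimately show ?thesis by blast
  qed
  obtain E :: "('p, 'k, ('p mat \<Rightarrow> 'k) \<times> ('p mat \<Rightarrow> 'k)) extn"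
    where E: "extension E" "ext_class E = coh_class (rspace \<X>) c"
    using extension_exists[OF c] by blast
  show "d \<in> Z1 (rspace \<X>)" using main[OF E] by blast
  show "h \<cdot> coh_class (rspace \<X>) c = coh_class (rspace \<X>) d"
    unfolding hecke_act_def
  proof (rule the_equality)
    show "\<exists>E :: ('p, 'k, ('p mat \<Rightarrow> 'k) \<times> ('p mat \<Rightarrow> 'k)) extn. extension E \<and>
        ext_class E = coh_class (rspace \<X>) c \<and> ext_class (pullback h E) = coh_class (rspace \<X>) d"
      using E main[OF E] by blast
    fix \<beta> :: "('p, 'k) coh"
    assume "\<exists>E :: ('p, 'k, ('p mat \<Rightarrow> 'k) \<times> ('p mat \<Rightarrow> 'k)) extn. extension E \<and>
        ext_class E = coh_class (rspace \<X>) c \<and> ext_class (pullback h E) = \<beta>"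
    then show "\<beta> = coh_class (rspace \<X>) d" using main by blast
  qed
qed

subsection \<open>The operators \<open>\<tau>\<close>\<close>

text \<open>Frobenius reciprocity: \<open>x char\<^sub>I \<mapsto> x\<phi>\<close> is well defined, because \<open>\<phi>\<close> is fixed by \<open>I\<close>, and extends linearly
  to \<open>\<X>\<close>.\<close>

lemma hecke_exists:
  assumes \<phi>: "\<phi> \<in> rspace \<X>" and inv: "\<And>i. i \<in> iwahori \<Longrightarrow> act i \<phi> = \<phi>"
  shows "\<exists>h\<in>hecke. h charI = \<phi>"
proof
  define h where "h = (\<lambda>f. if f \<in> rspace \<X> then lin (\<lambda>x. act x \<phi>) f else 0)"
  have basis: "h (act x charI) = act x \<phi>" if x: "x \<in> carrier SL2" for x
  proof -
    have "lin (\<lambda>x. act x \<phi>) (act x charI) = act x \<phi>"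
      by (rule lin_basis[OF x]) (simp add: act_mult inv)
    then show ?thesis using x by (simp add: h_def)
  qed
  have lin: "linear_on_X h" by (auto simp: linear_on_X_def h_def lin_add lin_fscale)
  show "h \<in> hecke"
  proof (rule heckeI[OF _ lin])
    show "h f \<in> rspace \<X>" if "f \<in> rspace \<X>" for f
      using that \<phi> by (auto simp: h_def intro!: lin_X)
    show "h f = 0" if "f \<notin> rspace \<X>" for f using that by (simp add: h_def)
    show "h (act g f) = act g (h f)" if g: "g \<in> carrier SL2" and f: "f \<in> rspace \<X>" for g f
    proof (rule linear_on_X_eqI[OF _ _ f, of "\<lambda>f. h (act g f)" "\<lambda>f. act g (h f)"])
      show "linear_on_X (\<lambda>f. h (act g f))" "linear_on_X (\<lambda>f. act g (h f))"
        using lin g by (auto simp: linear_on_X_def act_add act_fscale)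
      fix x :: "'a mat" assume x: "x \<in> carrier SL2"
      have "h (act (g ** x) charI) = act (g ** x) \<phi>" using g x by (intro basis) auto
      then show "h (act g (act x charI)) = act g (h (act x charI))" using x by (simp add: basis act_mult)
    qed
  qed
  show "h charI = \<phi>" using basis[OF SL2_1] by simp
qed

lemma tau_eq:
  assumes \<phi>: "(indicator (IwI w) :: 'p::prime_card mat \<Rightarrow> 'k::field) \<in> rspace \<X>"
    and inv: "\<And>i. i \<in> iwahori \<Longrightarrow> act i (indicator (IwI w)) = (indicator (IwI w) :: 'p mat \<Rightarrow> 'k)"
  shows "\<tau> w \<in> (hecke :: ('p, 'k) endo set)" and "\<tau> w charI = (indicator (IwI w) :: 'p mat \<Rightarrow> 'k)"
proof -
  have "\<exists>!h. h \<in> (hecke :: ('p, 'k) endo set) \<and> h charI = indicator (IwI w)"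
    using hecke_exists[OF \<phi> inv] hecke_eqI by (metis (no_types, lifting))
  from theI'[OF this] show "\<tau> w \<in> (hecke :: ('p, 'k) endo set)" "\<tau> w charI = (indicator (IwI w) :: 'p mat \<Rightarrow> 'k)"
    unfolding tau_def by blast+
qed

lemma hecke_lincomb:
  assumes h: "\<And>j. j \<in> J \<Longrightarrow> h j \<in> hecke"
  shows "(\<Sum>j\<in>J. (\<lambda>f. fscale (a j) (h j f))) \<in> hecke"
proof -
  have eq: "(\<Sum>j\<in>J. (\<lambda>f. fscale (a j) (h j f))) f = (\<Sum>j\<in>J. fscale (a j) (h j f))" for f
    by (induction J rule: infinite_finite_induct) simp_all
  show ?thesis
  proof (rule heckeI)
    show "(\<Sum>j\<in>J. (\<lambda>f. fscale (a j) (h j f))) f \<in> rspace \<X>" if "f \<in> rspace \<X>" for f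
      unfolding eq using hecke_in[OF h that] by (intro X_sum X_fscale)
    show "linear_on_X (\<Sum>j\<in>J. (\<lambda>f. fscale (a j) (h j f)))"
      unfolding linear_on_X_def eq using hecke_linear[OF h]
      by (auto simp: linear_on_X_def fscale_add sum.distrib[symmetric] fscale_sum fscale_fscale mult.commute intro!: sum.cong)
    show "(\<Sum>j\<in>J. (\<lambda>f. fscale (a j) (h j f))) (act g f) = act g ((\<Sum>j\<in>J. (\<lambda>f. fscale (a j) (h j f))) f)"
      if "g \<in> carrier SL2" "f \<in> rspace \<X>" for g f
      unfolding eq act_sum by (rule sum.cong[OF refl]) (simp add: hecke_act_commute[OF h that] act_fscale)
    show "(\<Sum>j\<in>J. (\<lambda>f. fscale (a j) (h j f))) f = 0" if "f \<notin> rspace \<X>" for f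
      unfolding eq by (rule sum.neutral) (simp add: hecke_outside[OF h that])
  qed
qed


section \<open>The normalizer of the torus\<close>

lemma mt_torus_iff: "mt e a b c d \<in> torus \<longleftrightarrow> b = 0 \<and> c = 0 \<and> a * d = 1"
  by (auto simp: torus_def SL2_iff mt_def mult.commute)

lemma mt_torus0_iff: "mt e a b c d \<in> torus0 \<longleftrightarrow> b = 0 \<and> c = 0 \<and> a \<in> pideal 0 \<and> d \<in> pideal 0 \<and> a * d = 1"
  unfolding pideal_0_iff by (auto simp: torus0_def SL2_iff mt_def mult.commute)

lemma mt_torus1_iff: "mt e a b c d \<in> torus1 \<longleftrightarrow> b = 0 \<and> c = 0 \<and> a - 1 \<in> pideal 1 \<and> d - 1 \<in> pideal 1 \<and> a * d = 1"
  unfolding near_1_iff by (auto simp: torus1_def SL2_iff mt_def mult.commute)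

text \<open>The level of a monomial matrix is a signed length: its absolute value is the length, and its
  sign tells which of the two reflections shortens it.  In the coordinates \<open>e = False\<close>, multiplication by
  \<open>s\<^sub>0\<close> maps level \<open>l\<close> to \<open>1 - l\<close>, and multiplication by \<open>s\<^sub>1\<close> maps it to \<open>- 1 - l\<close>; the other coordinates reverse
  the sign.\<close>

definition level :: "bool \<Rightarrow> 'p::prime_card mat \<Rightarrow> int \<Rightarrow> bool" where
  "level e n l \<longleftrightarrow> (\<exists>k u. punit u \<and>
     (l = 2 * k \<and> n = mt e (pQ powi k * u) 0 0 (inverse (pQ powi k * u)) \<or>
      l = 2 * k + 1 \<and> n = mt e 0 (pQ powi k * u) (- inverse (pQ powi k * u)) 0))"

lemma level_cases:
  assumes "level e n l"
  obtains k u x where "punit u" "x = pQ powi k * u" "x \<noteq> 0" "l = 2 * k" "n = mt e x 0 0 (inverse x)"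
  | k u x where "punit u" "x = pQ powi k * u" "x \<noteq> 0" "l = 2 * k + 1" "n = mt e 0 x (- inverse x) 0"
proof -
  obtain k u where u: "punit u" and *: "l = 2 * k \<and> n = mt e (pQ powi k * u) 0 0 (inverse (pQ powi k * u)) \<or>
      l = 2 * k + 1 \<and> n = mt e 0 (pQ powi k * u) (- inverse (pQ powi k * u)) 0"
    using assms unfolding level_def by blast
  have "pQ powi k * u \<noteq> 0" using punit_neq_0[OF u] by simp
  then show ?thesis using * that(1)[OF u refl] that(2)[OF u refl] by blast
qed

lemma level_diagI: "x = pQ powi k * u \<Longrightarrow> punit u \<Longrightarrow> l = 2 * k \<Longrightarrow> y = inverse x \<Longrightarrow> level e (mt e x 0 0 y) l"
  unfolding level_def by blast

lemma level_antidiagI: "x = pQ powi k * u \<Longrightarrow> punit u \<Longrightarrow> l = 2 * k + 1 \<Longrightarrow> y = - inverse x \<Longrightarrow> level e (mt e 0 x y 0) l"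
  unfolding level_def by blast

lemma level_SL2: "level e n l \<Longrightarrow> n \<in> carrier SL2"
proof (erule level_cases)
  fix x assume "x \<noteq> 0" "n = mt e x 0 0 (inverse x)"
  then show ?thesis by (simp add: SL2_iff)
next
  fix x assume "x \<noteq> 0" "n = mt e 0 x (- inverse x) 0"
  then show ?thesis by (simp add: SL2_iff)
qed

lemma level_unique: "level e n l \<Longrightarrow> level e n l' \<Longrightarrow> l = l'"
proof (elim level_cases)
  fix k u x j v y
  assume "punit u" "x = pQ powi k * u" "l = 2 * k" "n = mt e x 0 0 (inverse x)"
    "punit v" "y = pQ powi j * v" "l' = 2 * j" "n = mt e y 0 0 (inverse y)"
  then show ?thesis using punit_factor_unique[of u v k j] by simp
next
  fix k u x j v y
  assume "punit u" "x = pQ powi k * u" "l = 2 * k + 1" "n = mt e 0 x (- inverse x) 0"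
    "punit v" "y = pQ powi j * v" "l' = 2 * j + 1" "n = mt e 0 y (- inverse y) 0"
  then show ?thesis using punit_factor_unique[of u v k j] by simp
qed simp_all

lemma powi_punit_mult: "(pQ powi k * u) * (pQ powi j * v) = pQ powi (k + j) * (u * v)"
  by (simp add: power_int_add mult_ac)

lemma powi_punit_divide: "(pQ powi k * u) * inverse (pQ powi j * v) = pQ powi (k - j) * (u / v)"
  by (simp add: power_int_diff divide_inverse)

lemma powi_punit_inverse: "inverse (pQ powi k * u) = pQ powi (- k) * inverse u"
  by (simp add: power_int_minus)

lemma level_mult:
  assumes "level e m l" "level e n l'"
  shows "level e (m ** n) (if even l then l + l' else l - l')"
  using assms
proof (elim level_cases)
  fix k u x j v y
  assume *: "punit u" "x = pQ powi k * u" "x \<noteq> 0" "l = 2 * k" "m = mt e x 0 0 (inverse x)"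
    "punit v" "y = pQ powi j * v" "y \<noteq> 0" "l' = 2 * j" "n = mt e y 0 0 (inverse y)"
  have mn: "m ** n = mt e (x * y) 0 0 (inverse x * inverse y)" by (simp add: *(5,10) mt_mult)
  show ?thesis unfolding mn
  proof (rule level_diagI)
    show "x * y = pQ powi (k + j) * (u * v)" unfolding *(2,7) by (rule powi_punit_mult)
  qed (simp_all add: *(1,4,6,9) punit_mult)
next
  fix k u x j v y
  assume *: "punit u" "x = pQ powi k * u" "x \<noteq> 0" "l = 2 * k" "m = mt e x 0 0 (inverse x)"
    "punit v" "y = pQ powi j * v" "y \<noteq> 0" "l' = 2 * j + 1" "n = mt e 0 y (- inverse y) 0"
  have mn: "m ** n = mt e 0 (x * y) (- (inverse x * inverse y)) 0" by (simp add: *(5,10) mt_mult)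
  show ?thesis unfolding mn
  proof (rule level_antidiagI)
    show "x * y = pQ powi (k + j) * (u * v)" unfolding *(2,7) by (rule powi_punit_mult)
  qed (simp_all add: *(1,4,6,9) punit_mult)
next
  fix k u x j v y
  assume *: "punit u" "x = pQ powi k * u" "x \<noteq> 0" "l = 2 * k + 1" "m = mt e 0 x (- inverse x) 0"
    "punit v" "y = pQ powi j * v" "y \<noteq> 0" "l' = 2 * j" "n = mt e y 0 0 (inverse y)"
  have mn: "m ** n = mt e 0 (x * inverse y) (- (inverse x * y)) 0" by (simp add: *(5,10) mt_mult)
  show ?thesis unfolding mn
  proof (rule level_antidiagI)
    show "x * inverse y = pQ powi (k - j) * (u / v)" unfolding *(2,7) by (rule powi_punit_divide)
    show "- (inverse x * y) = - inverse (x * inverse y)" by simp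
  qed (simp_all add: *(1,4,6,9) punit_divide)
next
  fix k u x j v y
  assume *: "punit u" "x = pQ powi k * u" "x \<noteq> 0" "l = 2 * k + 1" "m = mt e 0 x (- inverse x) 0"
    "punit v" "y = pQ powi j * v" "y \<noteq> 0" "l' = 2 * j + 1" "n = mt e 0 y (- inverse y) 0"
  have mn: "m ** n = mt e (- (x * inverse y)) 0 0 (- (inverse x * y))" by (simp add: *(5,10) mt_mult)
  show ?thesis unfolding mn
  proof (rule level_diagI)
    have "x * inverse y = pQ powi (k - j) * (u / v)" unfolding *(2,7) by (rule powi_punit_divide)
    then show "- (x * inverse y) = pQ powi (k - j) * - (u / v)" by simp
    show "- (inverse x * y) = inverse (- (x * inverse y))" by simp
  qed (simp_all add: *(1,4,6,9) punit_divide)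
qed

lemma level_flip: "level e n l \<Longrightarrow> level (\<not> e) n (- l)"
proof (elim level_cases)
  fix k u x
  assume *: "punit u" "x = pQ powi k * u" "x \<noteq> 0" "l = 2 * k" "n = mt e x 0 0 (inverse x)"
  have n: "n = mt (\<not> e) (inverse x) 0 0 x" by (cases e) (simp_all add: *(5) mt_def)
  show ?thesis unfolding n
  proof (rule level_diagI)
    show "inverse x = pQ powi (- k) * inverse u" unfolding *(2) by (rule powi_punit_inverse)
  qed (simp_all add: * punit_inverse)
next
  fix k u x
  assume *: "punit u" "x = pQ powi k * u" "x \<noteq> 0" "l = 2 * k + 1" "n = mt e 0 x (- inverse x) 0"
  have n: "n = mt (\<not> e) 0 (- inverse x / pQ) (pQ * x) 0"
    by (cases e) (simp_all add: *(5) mt_def)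
  show ?thesis unfolding n
  proof (rule level_antidiagI)
    show "- inverse x / pQ = pQ powi (- k - 1) * - inverse u"
      unfolding *(2) by (simp add: power_int_minus power_int_diff divide_inverse)
    show "pQ * x = - inverse (- inverse x / pQ)" using *(3) by (simp add: field_simps)
  qed (simp_all add: *(1,4) punit_inverse)
qed

lemma level_True_iff: "level True n l \<longleftrightarrow> level False n (- l)"
  using level_flip[of True n l] level_flip[of False n "- l"] by auto

lemma level_torus0_iff: "level e t 0 \<longleftrightarrow> t \<in> torus0"
proof
  assume "level e t 0"
  then show "t \<in> torus0"
  proof (rule level_cases)
    fix k u x
    assume *: "punit u" "x = pQ powi k * u" "x \<noteq> 0" "0 = 2 * k" "t = mt e x 0 0 (inverse x)"
    then show ?thesis by (simp add: mt_torus0_iff punit_iff)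
  qed presburger
next
  assume t: "t \<in> torus0"
  obtain a b c d where tt: "t = mt e a b c d" by (rule mt_cases)
  have ad: "a * d = 1" "b = 0" "c = 0" "a \<in> pideal 0" "d \<in> pideal 0" using t by (auto simp: tt mt_torus0_iff)
  then have "d = inverse a" by (simp add: inverse_unique)
  then have "punit a" using ad by (auto simp: punit_iff)
  then show "level e t 0" unfolding tt ad(2,3) using \<open>d = inverse a\<close>
    by (intro level_diagI[where k = 0 and u = a]) simp_all
qed

lemma torus1_torus0: "t \<in> torus1 \<Longrightarrow> t \<in> torus0"
  by (cases t rule: mt_cases[where e = False]) (auto simp: mt_torus1_iff mt_torus0_iff punit_near_1 punit_def dest!: punit_near_1)

lemma torus1_iwahori: "t \<in> torus1 \<Longrightarrow> t \<in> iwahori"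
  by (cases t rule: mt_cases[where e = False]) (auto simp: mt_torus1_iff mt_iwahori_iff)

lemma level_1: "level e (mat 1) 0"
  unfolding level_torus0_iff mt_1[of False] mt_torus0_iff by simp

lemma torus1_1: "mat 1 \<in> torus1"
  unfolding mt_1[of False] mt_torus1_iff by simp

lemma torus1_adj: "adj t \<in> torus1 \<longleftrightarrow> t \<in> torus1"
  by (cases t rule: mt_cases[where e = False]) (auto simp: mt_torus1_iff mult.commute)

lemma torus1_mult: "t \<in> torus1 \<Longrightarrow> t' \<in> torus1 \<Longrightarrow> t ** t' \<in> torus1"
proof -
  assume t: "t \<in> torus1" and t': "t' \<in> torus1"
  obtain a b c d where tt: "t = mt False a b c d" by (rule mt_cases)
  obtain a' b' c' d' where tt': "t' = mt False a' b' c' d'" by (rule mt_cases)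
  have 1: "a - 1 \<in> pideal 1" "d - 1 \<in> pideal 1" "a * d = 1" "b = 0" "c = 0"
    and 2: "a' - 1 \<in> pideal 1" "d' - 1 \<in> pideal 1" "a' * d' = 1" "b' = 0" "c' = 0"
    using t t' by (simp_all add: tt tt' mt_torus1_iff)
  have "a * a' * (d * d') = (a * d) * (a' * d')" by (simp only: mult_ac)
  also have "\<dots> = 1" unfolding 1(3) 2(3) by simp
  finally show ?thesis using 1 2 by (simp add: tt tt' mt_mult mt_torus1_iff near_1_mult)
qed

lemma level_torus0_left: "t \<in> torus0 \<Longrightarrow> level e n l \<Longrightarrow> level e (t ** n) l"
  using level_mult[of e t 0 n l] by (simp add: level_torus0_iff)

definition srefl :: "bool \<Rightarrow> 'p::prime_card mat" where
  "srefl e = mt e 0 1 (- 1) 0"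

lemma s0_srefl: "s0 = srefl False" and s1_srefl: "s1 = srefl True"
  by (simp_all add: s0_def s1_def srefl_def mt_def divide_inverse)

lemma level_srefl: "level e (srefl e) 1"
  unfolding srefl_def by (rule level_antidiagI[where k = 0 and u = 1]) simp_all

lemma level_srefl_mult: "level e n l \<Longrightarrow> level e (srefl e ** n) (1 - l)"
  using level_mult[OF level_srefl] by fastforce

lemma srefl_SL2 [simp]: "srefl e \<in> carrier SL2"
  by (rule level_SL2[OF level_srefl])

lemma level_adj: "level e n l \<Longrightarrow> level e (adj n) (if even l then - l else l)"
proof (erule level_cases)
  fix k u x
  assume *: "punit u" "x = pQ powi k * u" "x \<noteq> 0" "l = 2 * k" "n = mt e x 0 0 (inverse x)"
  have n: "adj n = mt e (inverse x) 0 0 x" by (simp add: *(5))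
  show ?thesis unfolding n
  proof (rule level_diagI)
    show "inverse x = pQ powi (- k) * inverse u" unfolding *(2) by (rule powi_punit_inverse)
  qed (simp_all add: *(1,4) punit_inverse)
next
  fix k u x
  assume *: "punit u" "x = pQ powi k * u" "x \<noteq> 0" "l = 2 * k + 1" "n = mt e 0 x (- inverse x) 0"
  have n: "adj n = mt e 0 (- x) (inverse x) 0" by (simp add: *(5))
  show ?thesis unfolding n
  proof (rule level_antidiagI)
    show "- x = pQ powi k * - u" unfolding *(2) by simp
  qed (simp_all add: *(1,4))
qed

lemma level_conj_torus:
  assumes "level e n l"
  shows "t \<in> torus1 \<Longrightarrow> adj n ** t ** n \<in> torus1" and "t \<in> torus0 \<Longrightarrow> adj n ** t ** n \<in> torus0"
    and "t \<in> torus \<Longrightarrow> adj n ** t ** n \<in> torus"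
proof -
  have conj: "adj n ** mt e a 0 0 d ** n = mt e a 0 0 d \<or> adj n ** mt e a 0 0 d ** n = mt e d 0 0 a" for a d
    using assms
  proof (rule level_cases)
    fix x assume x: "x \<noteq> 0" "n = mt e x 0 0 (inverse x)"
    then have "adj n ** mt e a 0 0 d ** n = mt e a 0 0 d" by (simp add: mt_mult)
    then show ?thesis ..
  next
    fix x assume x: "x \<noteq> 0" "n = mt e 0 x (- inverse x) 0"
    then have "adj n ** mt e a 0 0 d ** n = mt e d 0 0 a" by (simp add: mt_mult)
    then show ?thesis ..
  qed
  obtain a b c d where t: "t = mt e a b c d" by (rule mt_cases)
  show "t \<in> torus1 \<Longrightarrow> adj n ** t ** n \<in> torus1"
    using conj[of a d] unfolding t by (auto simp: mt_torus1_iff mult.commute)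
  show "t \<in> torus0 \<Longrightarrow> adj n ** t ** n \<in> torus0"
    using conj[of a d] unfolding t by (auto simp: mt_torus0_iff mult.commute)
  show "t \<in> torus \<Longrightarrow> adj n ** t ** n \<in> torus"
    using conj[of a d] unfolding t by (auto simp: mt_torus_iff mult.commute)
qed

lemma level_conj_torus':
  assumes n: "level e n l"
  shows "t \<in> torus1 \<Longrightarrow> n ** t ** adj n \<in> torus1" and "t \<in> torus0 \<Longrightarrow> n ** t ** adj n \<in> torus0"
    and "t \<in> torus \<Longrightarrow> n ** t ** adj n \<in> torus"
  using level_conj_torus[OF level_adj[OF n], of t] by simp_all

text \<open>Up to units, conjugation with \<open>n\<close> multiplies the off-diagonal entries by opposite powers of \<open>p\<close>, and for
  odd \<open>l\<close> it also exchanges them; in both cases, the group \<open>nIn\<^sup>-\<^sup>1\<close> depends only on the level.\<close>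

lemma level_conj_iwahori_iff:
  assumes "level e n l"
  shows "adj n ** mt e a b c d ** n \<in> iwahori \<longleftrightarrow>
    a - 1 \<in> pideal 1 \<and> b \<in> pideal l \<and> c \<in> pideal (1 - l) \<and> d - 1 \<in> pideal 1 \<and> a * d - b * c = 1"
proof -
  have P: "x * (pQ powi k * u) * (pQ powi k * u) \<in> pideal j \<longleftrightarrow> x \<in> pideal (j - 2 * k)"
    if u: "punit u" for x u :: "'a padic" and k j
  proof -
    have "pQ powi (k + k) = pQ powi k * (pQ powi k :: 'a padic)" by (rule power_int_add) simp
    then have eq: "x * (pQ powi k * u) * (pQ powi k * u) = (u * u) * (pQ powi (k + k) * x)"
      by (simp only: mult_ac)
    show ?thesis unfolding eq punit_mult_pideal_iff[OF punit_mult[OF u u]] pideal_shift by simp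
  qed
  have P': "x * inverse (pQ powi k * u) * inverse (pQ powi k * u) \<in> pideal j \<longleftrightarrow> x \<in> pideal (j + 2 * k)"
    if u: "punit u" for x u :: "'a padic" and k j
    using P[OF punit_inverse[OF u], of x "- k" j] by (simp add: power_int_minus mult_ac)
  show ?thesis
    using assms
  proof (rule level_cases)
    fix k u x
    assume *: "punit u" "x = pQ powi k * u" "x \<noteq> 0" "l = 2 * k" "n = mt e x 0 0 (inverse x)"
    have n: "adj n ** mt e a b c d ** n = mt e a (b * inverse x * inverse x) (c * x * x) d"
      unfolding *(5) using *(3) by (simp add: mt_mult field_simps)
    have det: "b * inverse x * inverse x * (c * x * x) = b * c" using *(3) by (simp add: field_simps)
    show ?thesis
      unfolding n mt_iwahori_iff det using P[OF *(1), of c k 1] P'[OF *(1), of b k 0]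
      by (simp only: *(2,4) add_0)
  next
    fix k u x
    assume *: "punit u" "x = pQ powi k * u" "x \<noteq> 0" "l = 2 * k + 1" "n = mt e 0 x (- inverse x) 0"
    have n: "adj n ** mt e a b c d ** n = mt e d (- (c * x * x)) (- (b * inverse x * inverse x)) a"
      unfolding *(5) using *(3) by (simp add: mt_mult field_simps)
    have det: "- (c * x * x) * - (b * inverse x * inverse x) = b * c" using *(3) by (simp add: field_simps)
    have l: "1 + 2 * k = l" "0 - 2 * k = 1 - l" using *(4) by simp_all
    show ?thesis
      unfolding n mt_iwahori_iff det pideal_uminus_iff
      using P[OF *(1), of c k 0] P'[OF *(1), of b k 1] unfolding l *(2)[symmetric]
      by (auto simp: mult.commute)
  qed
qed

text \<open>The equation \<open>inj = n'\<close> means that \<open>i(nn'\<^sup>-\<^sup>1)\<close> lies in \<open>n'In'\<^sup>-\<^sup>1\<close>, whose elements have diagonal entries in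
  \<open>1 + p\<int>\<^sub>p\<close>.  As the same holds for \<open>i\<close>, the monomial matrix \<open>nn'\<^sup>-\<^sup>1\<close> must be diagonal, with entries in
  \<open>1 + p\<int>\<^sub>p\<close>.  So different elements of \<open>N(T)/T\<^sup>1\<close> have different double cosets.\<close>

lemma double_coset_unique:
  assumes n: "level e n l" and n': "level e n' l'" and i: "i \<in> iwahori" and j: "j \<in> iwahori"
    and eq: "i ** n ** j = n'"
  shows "n' ** adj n \<in> torus1"
proof -
  note S = level_SL2[OF n] level_SL2[OF n']
  define m where "m = n ** adj n'"
  obtain L where m: "level e m L" using level_mult[OF n level_adj[OF n']] unfolding m_def by blast
  obtain a b c d where ii: "i = mt e a b c d" by (rule mt_cases)
  have abcd: "a - 1 \<in> pideal 1" "b \<in> pideal 0" "c \<in> pideal 1" "d - 1 \<in> pideal 1" "a * d - b * c = 1"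
    using i by (auto simp: ii mt_iwahori_iff)
  have "adj n' ** (i ** m) ** n' = adj n' ** (i ** n ** j) ** adj j ** (adj n' ** n')"
    using iwahori_SL2[OF j] by (simp add: m_def matrix_mul_assoc[symmetric])
  also have "\<dots> = adj j" using S by (simp only: eq) (simp add: matrix_mul_assoc[symmetric])
  finally have im: "adj n' ** (i ** m) ** n' \<in> iwahori" using j by simp
  have "m \<in> torus1"
    using m
  proof (rule level_cases)
    fix k u x
    assume x0: "x \<noteq> 0" and m': "m = mt e x 0 0 (inverse x)"
    have "i ** m = mt e (a * x) (b * inverse x) (c * x) (d * inverse x)"
      by (simp add: ii m' mt_mult)
    then have ax: "a * x - 1 \<in> pideal 1" "d * inverse x - 1 \<in> pideal 1"
      using im by (simp_all add: level_conj_iwahori_iff[OF n'])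
    have near: "y - 1 \<in> pideal 1" if "z - 1 \<in> pideal 1" "z * y - 1 \<in> pideal 1" for y z :: "'a padic"
    proof -
      have "(z * y - 1) - (z - 1) \<in> pideal 1" using that by blast
      then have "z * (y - 1) \<in> pideal 1" by (simp add: algebra_simps)
      then show ?thesis using punit_mult_pideal_iff[OF punit_near_1[OF that(1)]] by blast
    qed
    show ?thesis using near[OF abcd(1) ax(1)] near[OF abcd(4) ax(2)] x0
      by (simp add: m' mt_torus1_iff)
  next
    fix k u x
    assume x0: "x \<noteq> 0" and m': "m = mt e 0 x (- inverse x) 0"
    have "i ** m = mt e (- (b * inverse x)) (a * x) (- (d * inverse x)) (c * x)"
      by (simp add: ii m' mt_mult)
    then have "- (b * inverse x) - 1 \<in> pideal 1" "c * x - 1 \<in> pideal 1"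
      using im by (simp_all add: level_conj_iwahori_iff[OF n'])
    then have "- (b * inverse x) * (c * x) - 1 \<in> pideal 1" by (rule near_1_mult)
    moreover have "- (b * inverse x) * (c * x) = - (b * c)" using x0 by (simp add: field_simps)
    ultimately have "- (b * c) - 1 \<in> pideal 1" by (simp only:)
    moreover have "b * c \<in> pideal 1" using pideal_mult[OF abcd(2,3)] by simp
    ultimately have "(- (b * c) - 1) + b * c \<in> pideal 1" by (rule pideal_add)
    then have "- (1 :: 'a padic) \<in> pideal 1" by simp
    then have False unfolding pideal_uminus_iff by simp
    then show ?thesis ..
  qed
  then have "adj m \<in> torus1" by (simp add: torus1_adj)
  then show ?thesis by (simp add: m_def adj_mult)
qed

subsection \<open>Cosets and lengths\<close>

lemma cls_eq: "cls n = {t ** n | t. t \<in> torus1}"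
  by (auto simp: cls_def r_coset_def)

lemma cls_self: "n \<in> cls n"
  unfolding cls_eq by (rule CollectI, rule exI[of _ "mat 1"]) (simp add: torus1_1)

text \<open>If \<open>n\<close> normalizes \<open>T\<close>, then it conjugates the diagonal matrix with entries \<open>p\<close> and \<open>p\<^sup>-\<^sup>1\<close> to a diagonal matrix.
  As \<open>p \<noteq> p\<^sup>-\<^sup>1\<close>, this forces a zero into each row of \<open>n\<close>.\<close>

lemma normalizer_torus_iff: "n \<in> normalizer SL2 torus \<longleftrightarrow> (\<exists>l. level False n l)"
proof
  assume "n \<in> normalizer SL2 torus"
  then have n: "n \<in> carrier SL2" and nT: "n <#\<^bsub>SL2\<^esub> torus #>\<^bsub>SL2\<^esub> (inv\<^bsub>SL2\<^esub> n) = torus"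
    by (auto simp: normalizer_def stabilizer_def torus_def)
  obtain a b c d where nn: "n = mat2 a b c d" by (rule mat2_cases)
  have det: "a * d - b * c = 1" using n by (simp add: nn SL2_iff)
  let ?t = "mat2 pQ 0 0 (inverse pQ) :: 'a mat"
  have "?t \<in> torus" using mt_torus_iff[of False pQ 0 0 "inverse pQ"] by (simp add: mt_def)
  then have "n ** ?t ** adj n \<in> n <#\<^bsub>SL2\<^esub> torus #>\<^bsub>SL2\<^esub> (inv\<^bsub>SL2\<^esub> n)"
    unfolding inv_SL2[OF n] by (force simp: r_coset_def l_coset_def)
  then have "n ** ?t ** adj n \<in> torus" unfolding nT .
  moreover have "n ** ?t ** adj n = mt False (a * pQ * d - b * inverse pQ * c) (b * inverse pQ * a - a * pQ * b)
      (c * pQ * d - d * inverse pQ * c) (d * inverse pQ * a - c * pQ * b)"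
    by (simp add: nn mat2_mult mt_def)
  ultimately have "b * inverse pQ * a - a * pQ * b = 0" "c * pQ * d - d * inverse pQ * c = 0"
    by (simp_all add: mt_torus_iff)
  then have *: "a * b * (inverse pQ - pQ) = 0" "c * d * (pQ - inverse pQ) = 0"
    by (simp_all add: algebra_simps)
  have "inverse pQ \<noteq> (pQ :: 'a padic)"
  proof
    assume "inverse pQ = (pQ :: 'a padic)"
    then have "pQ * pQ = (1 :: 'a padic)" by (metis pQ_neq_0 right_inverse)
    moreover have "pQ * pQ \<in> (pideal 1 :: 'a padic set)"
      using pideal_mult[of pQ 1 pQ 0] pQ_powi_pideal[of 1] by simp
    ultimately show False by simp
  qed
  then have ab: "a * b = 0" "c * d = 0" using * by auto
  show "\<exists>l. level False n l"
  proof (cases "b = 0")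
    case True
    then have ad: "a * d = 1" using det by simp
    then have "c = 0" using ab by auto
    have "a \<noteq> 0" using ad by auto
    then obtain k u where u: "punit u" "a = pQ powi k * u" using padic_factor by blast
    have "d = inverse a" using ad by (simp add: inverse_unique)
    then have "level False (mt False a 0 0 d) (2 * k)" using u by (intro level_diagI) simp_all
    then show ?thesis using True \<open>c = 0\<close> by (auto simp: nn mt_def)
  next
    case False
    then have a0: "a = 0" using ab by simp
    then have bc: "b * - c = 1" using det by simp
    then have "d = 0" using ab by auto
    obtain k u where u: "punit u" "b = pQ powi k * u" using padic_factor False by blast
    have "- c = inverse b" using bc inverse_unique by metis
    then have "c = - inverse b" by (metis minus_minus)
    then have "level False (mt False 0 b c 0) (2 * k + 1)" using u by (intro level_antidiagI) simp_all
    then show ?thesis using a0 \<open>d = 0\<close> by (auto simp: nn mt_def)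
  qed
next
  assume "\<exists>l. level False n l"
  then obtain l where l: "level False n l" ..
  have n: "n \<in> carrier SL2" by (rule level_SL2[OF l])
  have "n <#\<^bsub>SL2\<^esub> torus #>\<^bsub>SL2\<^esub> (inv\<^bsub>SL2\<^esub> n) = torus"
  proof (intro equalityI subsetI)
    fix x assume "x \<in> n <#\<^bsub>SL2\<^esub> torus #>\<^bsub>SL2\<^esub> (inv\<^bsub>SL2\<^esub> n)"
    then obtain t where "t \<in> torus" "x = n ** t ** adj n"
      unfolding inv_SL2[OF n] by (auto simp: r_coset_def l_coset_def)
    then show "x \<in> torus" using level_conj_torus'(3)[OF l] by simp
  next
    fix x :: "'a mat" assume x: "x \<in> torus"
    have "x = n ** (adj n ** x ** n) ** adj n" using n by (simp add: matrix_mul_assoc[symmetric])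
    moreover have "adj n ** x ** n \<in> torus" by (rule level_conj_torus(3)[OF l x])
    ultimately show "x \<in> n <#\<^bsub>SL2\<^esub> torus #>\<^bsub>SL2\<^esub> (inv\<^bsub>SL2\<^esub> n)"
      unfolding inv_SL2[OF n] by (auto simp: r_coset_def l_coset_def)
  qed
  moreover have "torus \<subseteq> carrier SL2" by (auto simp: torus_def)
  ultimately show "n \<in> normalizer SL2 torus" using n by (auto simp: normalizer_def stabilizer_def)
qed

lemma carrier_Wt_iff: "w \<in> carrier Wt \<longleftrightarrow> (\<exists>n l. level False n l \<and> w = cls n)"
proof -
  have "torus1 #>\<^bsub>SL2\<lparr>carrier := normalizer SL2 torus\<rparr>\<^esub> n = cls n" for n :: "'a mat"
    by (simp add: cls_def r_coset_def)
  then have "w \<in> carrier Wt \<longleftrightarrow> (\<exists>n\<in>normalizer SL2 torus. w = cls n)"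
    by (auto simp: Wt_def carrier_FactGroup)
  then show ?thesis using normalizer_torus_iff by blast
qed

lemma set_mult_normalizer [simp]: "A <#>\<^bsub>SL2\<lparr>carrier := N\<rparr>\<^esub> B = A <#>\<^bsub>SL2\<^esub> B"
  by (simp add: set_mult_def)

lemma set_mult_normalizer' [simp]: "(<#>\<^bsub>SL2\<lparr>carrier := N\<rparr>\<^esub>) = (<#>\<^bsub>SL2\<^esub>)"
  by (rule ext)+ simp

lemma set_mult_SL2: "A <#>\<^bsub>SL2\<^esub> B = {a ** b | a b. a \<in> A \<and> b \<in> B}"
  by (auto simp: set_mult_def)

lemma cls_mult:
  assumes m: "level e m l"
  shows "cls m \<otimes>\<^bsub>Wt\<^esub> cls n = cls (m ** n)"
proof -
  have "cls m <#>\<^bsub>SL2\<^esub> cls n = cls (m ** n)"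
  proof (intro equalityI subsetI)
    fix x assume "x \<in> cls m <#>\<^bsub>SL2\<^esub> cls n"
    then obtain t t' where t: "t \<in> torus1" "t' \<in> torus1" "x = t ** m ** (t' ** n)"
      unfolding set_mult_SL2 cls_eq by blast
    have "x = t ** (m ** t' ** adj m) ** (m ** n)"
      using level_SL2[OF m] by (simp add: t matrix_mul_assoc[symmetric])
    moreover have "t ** (m ** t' ** adj m) \<in> torus1"
    proof -
      have "m ** t' ** adj m \<in> torus1" by (rule level_conj_torus'(1)[OF m t(2)])
      then show ?thesis by (rule torus1_mult[OF t(1)])
    qed
    ultimately show "x \<in> cls (m ** n)" unfolding cls_eq by blast
  next
    fix x assume "x \<in> cls (m ** n)"
    then obtain t where "t \<in> torus1" "x = t ** m ** (mat 1 ** n)" unfolding cls_eq by (auto simp: matrix_mul_assoc)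
    then show "x \<in> cls m <#>\<^bsub>SL2\<^esub> cls n" unfolding set_mult_SL2 cls_eq using torus1_1 by blast
  qed
  then show ?thesis by (simp add: Wt_def)
qed

definition cls0 :: "'p::prime_card mat \<Rightarrow> 'p mat set" where
  "cls0 n = {t ** n | t. t \<in> torus0}"

lemma cls0_eq: "torus0 #>\<^bsub>SL2\<^esub> n = cls0 n"
  by (auto simp: cls0_def r_coset_def)

lemma torus0_1: "mat 1 \<in> torus0"
  using torus1_1 torus1_torus0 by blast

lemma torus0_mult: "t \<in> torus0 \<Longrightarrow> t' \<in> torus0 \<Longrightarrow> t ** t' \<in> torus0"
  using level_mult[of False t 0 t' 0] by (simp add: level_torus0_iff)

lemma cls0_mult:
  assumes m: "level e m l"
  shows "cls0 m <#>\<^bsub>SL2\<^esub> cls0 n = cls0 (m ** n)"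
proof (intro equalityI subsetI)
  fix x assume "x \<in> cls0 m <#>\<^bsub>SL2\<^esub> cls0 n"
  then obtain t t' where t: "t \<in> torus0" "t' \<in> torus0" "x = t ** m ** (t' ** n)"
    unfolding set_mult_SL2 cls0_def by blast
  have "x = t ** (m ** t' ** adj m) ** (m ** n)"
    using level_SL2[OF m] by (simp add: t matrix_mul_assoc[symmetric])
  moreover have "t ** (m ** t' ** adj m) \<in> torus0"
    by (rule torus0_mult[OF t(1) level_conj_torus'(2)[OF m t(2)]])
  ultimately show "x \<in> cls0 (m ** n)" unfolding cls0_def by blast
next
  fix x assume "x \<in> cls0 (m ** n)"
  then obtain t where "t \<in> torus0" "x = t ** m ** (mat 1 ** n)" unfolding cls0_def by (auto simp: matrix_mul_assoc)
  then show "x \<in> cls0 m <#>\<^bsub>SL2\<^esub> cls0 n" unfolding set_mult_SL2 cls0_def using torus0_1 by blast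
qed

lemma torus0_cls: "torus0 <#>\<^bsub>SL2\<^esub> cls n = cls0 n"
proof (intro equalityI subsetI)
  fix x assume "x \<in> torus0 <#>\<^bsub>SL2\<^esub> cls n"
  then obtain t t' where t: "t \<in> torus0" "t' \<in> torus1" "x = t ** (t' ** n)"
    unfolding set_mult_SL2 cls_eq by blast
  then have "x = (t ** t') ** n" "t ** t' \<in> torus0" by (simp_all add: matrix_mul_assoc torus0_mult torus1_torus0)
  then show "x \<in> cls0 n" unfolding cls0_def by blast
next
  fix x assume "x \<in> cls0 n"
  then obtain t where "t \<in> torus0" "x = t ** (mat 1 ** n)" unfolding cls0_def by auto
  then show "x \<in> torus0 <#>\<^bsub>SL2\<^esub> cls n" unfolding set_mult_SL2 cls_eq using torus1_1 by blast
qed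

lemma cls0_level:
  assumes "cls0 m = cls0 n" "level False m l" "level False n l'"
  shows "l = l'"
proof -
  have "n \<in> cls0 n" unfolding cls0_def
    by (rule CollectI, rule exI[of _ "mat 1"]) (simp add: torus0_1)
  then have "n \<in> cls0 m" by (simp only: assms(1))
  then obtain t where "t \<in> torus0" "n = t ** m" unfolding cls0_def by blast
  then show ?thesis using level_torus0_left[OF _ assms(2)] level_unique assms(3) by blast
qed

lemma level_s0: "level False n l \<Longrightarrow> level False (s0 ** n) (1 - l)"
  unfolding s0_srefl by (rule level_srefl_mult)

lemma level_s1: "level False n l \<Longrightarrow> level False (s1 ** n) (- 1 - l)"
  unfolding s1_srefl using level_srefl_mult[of True n "- l"] by (simp add: level_True_iff)

text \<open>A product of \<open>k\<close> reflections has level at most \<open>k\<close> in absolute value, since each factor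
  changes the absolute value by one; conversely, \<open>s\<^sub>0\<close> lowers a positive level and \<open>s\<^sub>1\<close> raises a negative one.\<close>

lemma len_cls:
  assumes n: "level False n l"
  shows "len (cls n) = nat \<bar>l\<bar>"
proof -
  let ?S = "{cls0 s0, cls0 s1} :: 'a mat set set"
  let ?prod = "\<lambda>ss. foldr (\<lambda>s v. s <#>\<^bsub>SL2\<^esub> v) ss (torus0 :: 'a mat set)"
  have one: "torus0 = cls0 (mat 1 :: 'a mat)" by (simp add: cls0_def)
  have len: "len (cls n) = (LEAST k. \<exists>ss. length ss = k \<and> set ss \<subseteq> ?S \<and> ?prod ss = cls0 n)"
    unfolding len_def cls0_eq torus0_cls by (simp add: W0_def)
  have ls: "level False (s0 :: 'a mat) 1" "level False (s1 :: 'a mat) (- 1)"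
    using level_srefl[of False] level_srefl[of True] by (simp_all add: s0_srefl s1_srefl level_True_iff)
  have bound: "\<exists>m l'. ?prod ss = cls0 m \<and> level False m l' \<and> \<bar>l'\<bar> \<le> int (length ss)"
    if "set ss \<subseteq> ?S" for ss
    using that
  proof (induction ss)
    case Nil
    then show ?case using one level_1 by (metis abs_zero foldr_Nil id_apply of_nat_0 list.size(3) order_refl)
  next
    case (Cons s ss)
    then obtain m l' where m: "?prod ss = cls0 m" "level False m l'" "\<bar>l'\<bar> \<le> int (length ss)" by auto
    consider "s = cls0 s0" | "s = cls0 s1" using Cons.prems by auto
    then show ?case
    proof cases
      case 1
      then have "?prod (s # ss) = cls0 (s0 ** m)" using m(1) cls0_mult[OF ls(1)] by simp
      then show ?thesis using level_s0[OF m(2)] m(3) by (intro exI[of _ "s0 ** m"] exI[of _ "1 - l'"]) simp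
    next
      case 2
      then have "?prod (s # ss) = cls0 (s1 ** m)" using m(1) cls0_mult[OF ls(2)] by simp
      then show ?thesis using level_s1[OF m(2)] m(3) by (intro exI[of _ "s1 ** m"] exI[of _ "- 1 - l'"]) simp
    qed
  qed
  have word: "\<exists>ss. length ss = nat \<bar>l\<bar> \<and> set ss \<subseteq> ?S \<and> ?prod ss = cls0 n" if "level False n l" for n l
    using that
  proof (induction "nat \<bar>l\<bar>" arbitrary: n l)
    case 0
    then have "n \<in> torus0" using level_torus0_iff[of False n] by simp
    have "cls0 n = torus0"
    proof (intro equalityI subsetI)
      show "x \<in> torus0" if "x \<in> cls0 n" for x
        using that torus0_mult[OF _ \<open>n \<in> torus0\<close>] unfolding cls0_def by blast
      show "x \<in> cls0 n" if "x \<in> torus0" for x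
      proof -
        have "adj n \<in> torus0" using level_adj[of False n 0] \<open>n \<in> torus0\<close> by (simp add: level_torus0_iff)
        then have "x ** adj n \<in> torus0" by (rule torus0_mult[OF that])
        moreover have "x = (x ** adj n) ** n" using level_SL2[OF 0(2)] by simp
        ultimately show ?thesis unfolding cls0_def by blast
      qed
    qed
    then show ?case using 0 by (intro exI[of _ "[]"]) simp
  next
    case (Suc k)
    show ?case
    proof (cases "l > 0")
      case True
      have ad: "level False (adj s0 ** n) (1 - l)"
        using level_mult[OF level_adj[OF ls(1)] Suc.prems] by simp
      have "k = nat \<bar>1 - l\<bar>" using Suc.hyps(2) True by simp
      from Suc.hyps(1)[OF this ad] this obtain ss where ss: "length ss = k" "set ss \<subseteq> ?S" "?prod ss = cls0 (adj s0 ** n)" by auto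
      have "?prod (cls0 s0 # ss) = cls0 n" using ss(3) cls0_mult[OF ls(1)] level_SL2[OF ls(1)] by simp
      then show ?thesis using ss Suc.hyps(2) by (intro exI[of _ "cls0 s0 # ss"]) simp
    next
      case False
      have ad: "level False (adj s1 ** n) (- 1 - l)"
        using level_mult[OF level_adj[OF ls(2)] Suc.prems] by simp
      have "k = nat \<bar>- 1 - l\<bar>" using Suc.hyps(2) False by simp
      from Suc.hyps(1)[OF this ad] this obtain ss where ss: "length ss = k" "set ss \<subseteq> ?S" "?prod ss = cls0 (adj s1 ** n)" by auto
      have "?prod (cls0 s1 # ss) = cls0 n" using ss(3) cls0_mult[OF ls(2)] level_SL2[OF ls(2)] by simp
      then show ?thesis using ss Suc.hyps(2) by (intro exI[of _ "cls0 s1 # ss"]) simp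
    qed
  qed
  show ?thesis
    unfolding len
  proof (rule Least_equality)
    show "\<exists>ss. length ss = nat \<bar>l\<bar> \<and> set ss \<subseteq> ?S \<and> ?prod ss = cls0 n" by (rule word[OF n])
    fix k assume "\<exists>ss. length ss = k \<and> set ss \<subseteq> ?S \<and> ?prod ss = cls0 n"
    then obtain ss where ss: "length ss = k" "set ss \<subseteq> ?S" "?prod ss = cls0 n" by blast
    obtain m l' where m: "?prod ss = cls0 m" "level False m l'" "\<bar>l'\<bar> \<le> int (length ss)" using bound[OF ss(2)] by blast
    have "cls0 m = cls0 n" using m(1) ss(3) by simp
    then have "l' = l" by (rule cls0_level[OF _ m(2) n])
    then show "nat \<bar>l\<bar> \<le> k" using m(3) ss(1) by simp
  qed
qed

lemma cls_Wt0_iff: "level False n l \<Longrightarrow> cls n \<in> Wt0 \<longleftrightarrow> l \<le> 0"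
proof -
  assume n: "level False n l"
  have "cls s0 \<otimes>\<^bsub>Wt\<^esub> cls n = cls (s0 ** n)"
    using cls_mult[OF level_srefl[of False]] by (simp add: s0_srefl)
  then have "len (cls s0 \<otimes>\<^bsub>Wt\<^esub> cls n) = nat \<bar>1 - l\<bar>" using len_cls[OF level_s0[OF n]] by simp
  moreover have "cls n \<in> carrier Wt" using n carrier_Wt_iff by blast
  ultimately show ?thesis using len_cls[OF n] by (auto simp: Wt0_def)
qed

lemma cls_Wt1_iff: "level False n l \<Longrightarrow> cls n \<in> Wt1 \<longleftrightarrow> l \<ge> 0"
proof -
  assume n: "level False n l"
  have "cls s1 \<otimes>\<^bsub>Wt\<^esub> cls n = cls (s1 ** n)"
    using cls_mult[OF level_srefl[of True]] by (simp add: s1_srefl)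
  then have "len (cls s1 \<otimes>\<^bsub>Wt\<^esub> cls n) = nat \<bar>- 1 - l\<bar>" using len_cls[OF level_s1[OF n]] by simp
  moreover have "cls n \<in> carrier Wt" using n carrier_Wt_iff by blast
  ultimately show ?thesis using len_cls[OF n] by (auto simp: Wt1_def)
qed

subsection \<open>Stabilizers and double cosets\<close>

definition stab :: "'p::prime_card mat \<Rightarrow> 'p mat set" where
  "stab n = {g \<in> iwahori. adj n ** g ** n \<in> iwahori}"

lemma mt_stab_iff:
  assumes "level e n l"
  shows "mt e a b c d \<in> stab n \<longleftrightarrow>
    a - 1 \<in> pideal 1 \<and> b \<in> pideal (max 0 l) \<and> c \<in> pideal (max 1 (1 - l)) \<and> d - 1 \<in> pideal 1 \<and> a * d - b * c = 1"
proof -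
  have "x \<in> pideal (max i j) \<longleftrightarrow> x \<in> pideal i \<and> x \<in> pideal j" for x :: "'a padic" and i j
  proof
    assume x: "x \<in> pideal (max i j)"
    show "x \<in> pideal i \<and> x \<in> pideal j" by (intro conjI pideal_mono[OF _ x]) simp_all
  qed (simp add: max_def)
  then show ?thesis
    unfolding stab_def mem_Collect_eq level_conj_iwahori_iff[OF assms] mt_iwahori_iff by blast
qed

lemma stab_iwahori: "g \<in> stab n \<Longrightarrow> g \<in> iwahori"
  by (simp add: stab_def)

lemma stab_conj: "g \<in> stab n \<Longrightarrow> adj n ** g ** n \<in> iwahori"
  by (simp add: stab_def)

lemma stab_mult: "n \<in> carrier SL2 \<Longrightarrow> g \<in> stab n \<Longrightarrow> h \<in> stab n \<Longrightarrow> g ** h \<in> stab n"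
proof -
  assume n: "n \<in> carrier SL2" and g: "g \<in> stab n" and h: "h \<in> stab n"
  have "adj n ** (g ** h) ** n = (adj n ** g ** n) ** (adj n ** h ** n)"
    using n by (simp add: matrix_mul_assoc[symmetric])
  then show ?thesis using g h by (simp add: stab_def)
qed

lemma stab_adj: "g \<in> stab n \<Longrightarrow> adj g \<in> stab n"
proof -
  assume g: "g \<in> stab n"
  have "adj n ** adj g ** n = adj (adj n ** g ** n)" by (simp add: adj_mult matrix_mul_assoc)
  then show ?thesis using g by (simp add: stab_def)
qed

lemma torus1_stab: "level e n l \<Longrightarrow> t \<in> torus1 \<Longrightarrow> t \<in> stab n"
  by (simp add: stab_def torus1_iwahori level_conj_torus(1))

lemma Iw_cls:
  assumes n: "level e n l"
  shows "Iw (cls n) = stab n"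
proof (intro equalityI subsetI)
  note S = level_SL2[OF n]
  fix g assume "g \<in> Iw (cls n)"
  then obtain m h where g': "g \<in> iwahori" "m \<in> cls n" "h \<in> iwahori"
      "g = m \<otimes>\<^bsub>SL2\<^esub> h \<otimes>\<^bsub>SL2\<^esub> inv\<^bsub>SL2\<^esub> m"
    unfolding Iw_def by blast
  then obtain t where t: "t \<in> torus1" "m = t ** n" unfolding cls_eq by blast
  have "m \<in> carrier SL2" using S iwahori_SL2[OF torus1_iwahori[OF t(1)]] t(2) by simp
  then have g: "g \<in> iwahori" "t \<in> torus1" "h \<in> iwahori" "g = (t ** n) ** h ** adj (t ** n)"
    using g' t by simp_all
  have "adj n ** g ** n = (adj n ** t ** n) ** h ** adj (adj n ** t ** n)"
    using S by (simp add: g(4) adj_mult matrix_mul_assoc[symmetric])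
  moreover have "adj n ** t ** n \<in> iwahori" using level_conj_torus(1)[OF n g(2)] torus1_iwahori by blast
  ultimately show "g \<in> stab n" using g(1,3) by (simp add: stab_def)
next
  note S = level_SL2[OF n]
  fix g assume g: "g \<in> stab n"
  have "g = n ** (adj n ** g ** n) ** adj n" using S by (simp add: matrix_mul_assoc[symmetric])
  then have "g = n \<otimes>\<^bsub>SL2\<^esub> (adj n ** g ** n) \<otimes>\<^bsub>SL2\<^esub> inv\<^bsub>SL2\<^esub> n" using S by simp
  then show "g \<in> Iw (cls n)" using g cls_self[of n] unfolding Iw_def stab_def by blast
qed

lemma IwI_cls: "IwI (cls n) = {i ** n ** j | i j. i \<in> iwahori \<and> j \<in> iwahori}"
proof (intro equalityI subsetI)
  fix x assume "x \<in> IwI (cls n)"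
  then obtain i t j where x: "x = i ** (t ** n) ** j" "i \<in> iwahori" "t \<in> torus1" "j \<in> iwahori"
    unfolding IwI_def set_mult_SL2 cls_eq by blast
  then have "x = (i ** t) ** n ** j" "i ** t \<in> iwahori" by (simp_all add: matrix_mul_assoc torus1_iwahori)
  then show "x \<in> {i ** n ** j | i j. i \<in> iwahori \<and> j \<in> iwahori}" using x by blast
next
  fix x assume "x \<in> {i ** n ** j | i j. i \<in> iwahori \<and> j \<in> iwahori}"
  then show "x \<in> IwI (cls n)" unfolding IwI_def set_mult_SL2 using cls_self[of n] by blast
qed

lemma X_stab: "f \<in> rspace \<X> \<Longrightarrow> n \<in> carrier SL2 \<Longrightarrow> g \<in> stab n \<Longrightarrow> f (g ** n) = f n"
proof -
  assume f: "f \<in> rspace \<X>" and n: "n \<in> carrier SL2" and g: "g \<in> stab n"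
  have "g ** n = n ** (adj n ** g ** n)" using n by (simp add: matrix_mul_assoc[symmetric])
  then show ?thesis using X_right[OF f stab_conj[OF g], of n] by simp
qed


section \<open>Shapiro's lemma\<close>

text \<open>By the cocycle relation, \<open>c(i\<^sup>-\<^sup>1)(n)\<close> depends only on the coset \<open>inI\<close> if the values at \<open>n\<close> vanish on
  \<open>I \<inter> nIn\<^sup>-\<^sup>1\<close>.  The function on \<open>G/I\<close> that is defined in this way has the coboundary \<open>c\<close>.  For a single
  \<open>n\<close>, this is the injectivity in Shapiro's lemma; a union of several double cosets occurs when products
  with Hecke operators are compared.\<close>

lemma coboundary_criterion:
  fixes c :: "'p::prime_card mat \<Rightarrow> 'p mat \<Rightarrow> 'k::field"
  assumes c: "c \<in> Z1 (rspace \<X>)"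
    and S: "\<And>n. n \<in> S \<Longrightarrow> \<exists>l. level False n l"
    and supp: "\<And>g y. g \<in> iwahori \<Longrightarrow> c g y \<noteq> 0 \<Longrightarrow> \<exists>n\<in>S. \<exists>i\<in>iwahori. \<exists>j\<in>iwahori. y = i ** n ** j"
    and van: "\<And>n g. n \<in> S \<Longrightarrow> g \<in> stab n \<Longrightarrow> c g n = 0"
  shows "\<exists>f\<in>rspace \<X>. (\<forall>g\<in>iwahori. c g = act g f - f) \<and> (\<forall>y. f y \<noteq> 0 \<longrightarrow> (\<exists>g\<in>iwahori. c g y \<noteq> 0))"
proof -
  note cX = Z1_in[OF c]
  have S': "n \<in> carrier SL2" if "n \<in> S" for n using S[OF that] level_SL2 by blast
  have well: "c (adj i) n = c (adj i') n'"
    if n: "n \<in> S" and n': "n' \<in> S" and i: "i \<in> iwahori" "i' \<in> iwahori" and j: "j \<in> iwahori" "j' \<in> iwahori"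
      and eq: "i ** n ** j = i' ** n' ** j'" for n n' i i' j j'
  proof -
    obtain l where l: "level False n l" using S[OF n] by blast
    obtain l' where l': "level False n' l'" using S[OF n'] by blast
    note SL = S'[OF n] S'[OF n'] iwahori_SL2[OF i(1)] iwahori_SL2[OF i(2)] iwahori_SL2[OF j(1)] iwahori_SL2[OF j(2)]
    have "(adj i' ** i) ** n ** (j ** adj j') = adj i' ** (i ** n ** j) ** adj j'" by (simp add: matrix_mul_assoc)
    also have "\<dots> = n'" unfolding eq using SL by (simp add: matrix_mul_assoc[symmetric])
    finally have "n' ** adj n \<in> torus1"
      using i j by (intro double_coset_unique[OF l l']) auto
    moreover define t where "t = n' ** adj n"
    ultimately have t: "t \<in> torus1" by simp
    have n't: "n' = t ** n" using SL by (simp add: t_def)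
    have ts: "t \<in> stab n" by (rule torus1_stab[OF l t])
    note tS = iwahori_SL2[OF stab_iwahori[OF ts]]
    define g where "g = adj i ** i' ** t"
    have "adj n ** g ** n = adj (i ** n) ** (i' ** n' ** j') ** adj j'"
      using SL by (simp add: g_def n't adj_mult matrix_mul_assoc[symmetric])
    also have "\<dots> = j ** adj j'"
      unfolding eq[symmetric] using SL by (simp add: adj_mult matrix_mul_assoc[symmetric])
    finally have gs: "g \<in> stab n"
      using i j stab_iwahori[OF ts] by (simp add: stab_def g_def)
    have ig: "i ** g = i' ** t" using SL by (simp add: g_def matrix_mul_assoc[symmetric])
    have "c (adj i') n' = act (adj t) (c (adj i')) n" by (simp add: act_apply n't)
    also have "act (adj t) (c (adj i')) = c (adj t ** adj i') - c (adj t)"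
      using Z1_mult[OF c, of "adj t" "adj i'"] i stab_iwahori[OF ts] by simp
    also have "adj t ** adj i' = adj g ** adj i" unfolding adj_mult[symmetric] ig ..
    also have "c (adj g ** adj i) = c (adj g) + act (adj g) (c (adj i))"
      using Z1_mult[OF c, of "adj g" "adj i"] i stab_iwahori[OF gs] by simp
    finally have "c (adj i') n' = c (adj g) n + c (adj i) (g ** n) - c (adj t) n"
      by (simp add: act_apply)
    also have "c (adj g) n = 0" using van[OF n stab_adj[OF gs]] .
    also have "c (adj t) n = 0" using van[OF n stab_adj[OF ts]] .
    also have "c (adj i) (g ** n) = c (adj i) n" using X_stab[OF cX SL(1) gs] i by simp
    finally show ?thesis by simp
  qed
  \<comment> \<open>\<open>good y (n, i)\<close>: the point \<open>y\<close> lies in \<open>inI\<close>, where \<open>n \<in> S\<close> and \<open>i \<in> I\<close>.\<close>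
  define good where "good = (\<lambda>y (n, i). n \<in> S \<and> i \<in> iwahori \<and> (\<exists>j\<in>iwahori. y = i ** n ** j))"
  define f where "f = (\<lambda>y. if \<exists>p. good y p then case (SOME p. good y p) of (n, i) \<Rightarrow> c (adj i) n else 0)"
  have f_eq: "f (i ** n ** j) = c (adj i) n" if "n \<in> S" "i \<in> iwahori" "j \<in> iwahori" for n i j
  proof -
    have ex: "\<exists>p. good (i ** n ** j) p" using that by (auto simp: good_def)
    obtain n' i' where p: "(SOME p. good (i ** n ** j) p) = (n', i')" by fastforce
    have "good (i ** n ** j) (n', i')" using someI_ex[OF ex] unfolding p .
    then obtain j' where "n' \<in> S" "i' \<in> iwahori" "j' \<in> iwahori" "i ** n ** j = i' ** n' ** j'" by (auto simp: good_def)
    then have "c (adj i') n' = c (adj i) n" using well[OF that(1) _ that(2) _ that(3)] by metis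
    then show ?thesis using ex p by (simp add: f_def)
  qed
  have f_cases: "f y = 0 \<and> \<not> (\<exists>p. good y p) \<or> (\<exists>n i j. n \<in> S \<and> i \<in> iwahori \<and> j \<in> iwahori \<and> y = i ** n ** j)" for y
    by (auto simp: f_def good_def)
  have f_supp: "\<exists>g\<in>iwahori. c g y \<noteq> 0" if fy: "f y \<noteq> 0" for y
  proof -
    obtain n i j where y: "n \<in> S" "i \<in> iwahori" "j \<in> iwahori" "y = i ** n ** j" using f_cases[of y] fy by blast
    then have "c (adj i) n \<noteq> 0" using f_eq fy by simp
    then have "c i (i ** n) \<noteq> 0" using Z1_adj[OF c y(2)] by (simp add: act_apply)
    then have "c i y \<noteq> 0" using X_right[OF cX[OF y(2)] y(3)] y(4) by simp
    then show ?thesis using y(2) by blast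
  qed
  have "f \<in> rspace \<X>"
  proof -
    \<comment> \<open>A continuous cocycle on the compact group \<open>I\<close> takes finitely many values; so \<open>f\<close> has compact support.\<close>
    obtain m where m: "\<forall>\<gamma>\<in>Gam (Suc m). c \<gamma> = 0" using c by (auto simp: Z1_iff)
    obtain R :: "'p mat set" where R: "finite R" "R \<subseteq> iwahori" "\<And>g. g \<in> iwahori \<Longrightarrow> \<exists>r\<in>R. adj r ** g \<in> Gam (Suc m)"
      using iwahori_finite_Gam[of "Suc m"] by metis
    have cR: "\<exists>r\<in>R. c g = c r" if g: "g \<in> iwahori" for g
    proof -
      obtain r where r: "r \<in> R" "adj r ** g \<in> Gam (Suc m)" using R(3)[OF g] by blast
      have rI: "r \<in> iwahori" using r R by blast
      have "c (r ** (adj r ** g)) = c r + act r (c (adj r ** g))"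
        by (rule Z1_mult[OF c rI Gam_1_iwahori[OF r(2)]])
      then have "c g = c r" using m r(2) iwahori_SL2[OF rI] by simp
      then show ?thesis using r by blast
    qed
    have "\<exists>F. finite F \<and> F \<subseteq> carrier SL2 \<and> (\<forall>y. c r y \<noteq> 0 \<longrightarrow> (\<exists>x\<in>F. adj x ** y \<in> iwahori))" if "r \<in> R" for r
      using X_finite[OF cX] that R(2) by blast
    then obtain F where F: "\<And>r. r \<in> R \<Longrightarrow> finite (F r)" "\<And>r. r \<in> R \<Longrightarrow> F r \<subseteq> carrier SL2"
      "\<And>r y. r \<in> R \<Longrightarrow> c r y \<noteq> 0 \<Longrightarrow> \<exists>x\<in>F r. adj x ** y \<in> iwahori" by metis
    show ?thesis
    proof (rule XI[of _ "\<Union>r\<in>R. F r"])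
      show "f y = 0" if "y \<notin> carrier SL2" for y
      proof (rule ccontr)
        assume "f y \<noteq> 0"
        then obtain g where "g \<in> iwahori" "c g y \<noteq> 0" using f_supp by blast
        then show False using X_zero[OF cX] that by blast
      qed
      show "f (y ** j) = f y" if j: "j \<in> iwahori" for y j
      proof -
        note jS = iwahori_SL2[OF j]
        have "f (y ** j) = f y" if "n \<in> S" "i \<in> iwahori" "j' \<in> iwahori" "y = i ** n ** j'" for n i j'
        proof -
          have "y ** j = i ** n ** (j' ** j)" by (simp add: that(4) matrix_mul_assoc)
          then show ?thesis using f_eq[OF that(1,2)] that(3,4) j by simp
        qed
        moreover have "f (y ** j) = f y" if "f y = 0" "\<not> (\<exists>p. good y p)"
        proof (rule disjE[OF f_cases[of "y ** j"]])
          assume "\<exists>n i j'. n \<in> S \<and> i \<in> iwahori \<and> j' \<in> iwahori \<and> y ** j = i ** n ** j'"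
          then obtain n i j' where *: "n \<in> S" "i \<in> iwahori" "j' \<in> iwahori" "y ** j = i ** n ** j'" by blast
          have "y = i ** n ** (j' ** adj j)" using jS *(4)[symmetric] by (simp add: matrix_mul_assoc)
          then have "good y (n, i)" using * j by (auto simp: good_def)
          then show ?thesis using that by blast
        qed (use that in simp)
        ultimately show ?thesis using f_cases[of y] by blast
      qed
      show "\<exists>r\<in>\<Union>r\<in>R. F r. adj r ** y \<in> iwahori" if y: "f y \<noteq> 0" for y
      proof -
        obtain g where g: "g \<in> iwahori" "c g y \<noteq> 0" using f_supp[OF y] by blast
        obtain r where r: "r \<in> R" "c g = c r" using cR[OF g(1)] by blast
        then have "\<exists>x\<in>F r. adj x ** y \<in> iwahori" using F(3) g(2) by simp
        then show ?thesis using r(1) by blast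
      qed
    qed (use R(1) F(1,2) in auto)
  qed
  moreover have "c g = act g f - f" if g: "g \<in> iwahori" for g
  proof
    fix y
    note gS = iwahori_SL2[OF g]
    show "c g y = (act g f - f) y"
    proof (rule disjE[OF f_cases[of y]])
      assume "\<exists>n i j. n \<in> S \<and> i \<in> iwahori \<and> j \<in> iwahori \<and> y = i ** n ** j"
      then obtain n i j where y: "n \<in> S" "i \<in> iwahori" "j \<in> iwahori" "y = i ** n ** j" by blast
      have "adj g ** y = (adj g ** i) ** n ** j" by (simp add: y(4) matrix_mul_assoc)
      moreover have "f ((adj g ** i) ** n ** j) = c (adj (adj g ** i)) n"
        using y g by (intro f_eq) auto
      ultimately have "f (adj g ** y) = c (adj i ** g) n" by (simp add: adj_mult)
      also have "\<dots> = c (adj i) n + c g (i ** n)"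
        using Z1_mult[OF c, of "adj i" g] y(2) g by (simp add: act_apply)
      finally have "f (adj g ** y) - f y = c g (i ** n)" using f_eq[OF y(1-3)] y(4) by simp
      also have "\<dots> = c g y" using X_right[OF cX[OF g] y(3)] y(4) by simp
      finally show ?thesis by (simp add: act_apply)
    next
      assume f0: "f y = 0 \<and> \<not> (\<exists>p. good y p)"
      have "c g y = 0"
      proof (rule ccontr)
        assume "c g y \<noteq> 0"
        then obtain n i j where "n \<in> S" "i \<in> iwahori" "j \<in> iwahori" "y = i ** n ** j" using supp[OF g] by blast
        then have "good y (n, i)" by (auto simp: good_def)
        then show False using f0 by blast
      qed
      moreover have "f (adj g ** y) = 0"
      proof (rule disjE[OF f_cases[of "adj g ** y"]])
        assume "\<exists>n i j. n \<in> S \<and> i \<in> iwahori \<and> j \<in> iwahori \<and> adj g ** y = i ** n ** j"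
        then obtain n i j where *: "n \<in> S" "i \<in> iwahori" "j \<in> iwahori" "adj g ** y = i ** n ** j" by blast
        have "y = g ** (adj g ** y)" using gS by simp
        also have "\<dots> = (g ** i) ** n ** j" by (simp add: *(4) matrix_mul_assoc)
        finally have "good y (n, g ** i)" using * g by (auto simp: good_def)
        then show ?thesis using f0 by blast
      qed simp
      ultimately show ?thesis using f0 by (simp add: act_apply)
    qed
  qed
  ultimately show ?thesis using f_supp by blast
qed

lemma shapiro_injective:
  assumes n: "level e n l" and c: "c \<in> Z1 (Xw (cls n))" and d: "d \<in> Z1 (Xw (cls n))"
    and eq: "\<And>g. g \<in> stab n \<Longrightarrow> c g n = d g n"
  shows "coh_class (Xw (cls n)) c = coh_class (Xw (cls n)) d"
proof -
  have n': "\<exists>l. level False n l" using n level_True_iff by (cases e) auto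
  have dc: "d - c \<in> Z1 (Xw (cls n))" by (rule Z1_diff[OF submodule_Xw d c])
  have supp: "y \<in> IwI (cls n)" if "g \<in> iwahori" "(d - c) g y \<noteq> 0" for g y
    using Z1_in[OF dc that(1)] that(2) by (auto simp: Xw_def)
  obtain f where f: "f \<in> rspace \<X>" "\<forall>g\<in>iwahori. (d - c) g = act g f - f"
      "\<forall>y. f y \<noteq> 0 \<longrightarrow> (\<exists>g\<in>iwahori. (d - c) g y \<noteq> 0)"
  proof -
    have "\<exists>f\<in>rspace \<X>. (\<forall>g\<in>iwahori. (d - c) g = act g f - f) \<and> (\<forall>y. f y \<noteq> 0 \<longrightarrow> (\<exists>g\<in>iwahori. (d - c) g y \<noteq> 0))"
    proof (rule coboundary_criterion[OF Z1_Xw[OF dc], of "{n}"])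
      show "\<exists>m\<in>{n}. \<exists>i\<in>iwahori. \<exists>j\<in>iwahori. y = i ** m ** j" if "g \<in> iwahori" "(d - c) g y \<noteq> 0" for g y
        using supp[OF that] unfolding IwI_cls by blast
      show "(d - c) g m = 0" if "m \<in> {n}" "g \<in> stab m" for m g using that eq by simp
    qed (use n' in blast)
    then show ?thesis using that by blast
  qed
  have "f \<in> Xw (cls n)" using f(1,3) supp unfolding Xw_def by blast
  then have "(c, d) \<in> cohomologous (Xw (cls n))"
  proof (rule cohomologousI[OF submodule_Xw c])
    fix g :: "'a mat" assume "g \<in> iwahori"
    then have "(d - c) g = act g f - f" using f(2) by blast
    then show "d g = c g + (act g f - f)" by (simp add: algebra_simps)
  qed
  then show ?thesis by (rule coh_class_eqI[OF submodule_Xw])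
qed

text \<open>A homomorphism \<open>\<phi>\<close> on \<open>I \<inter> nIn\<^sup>-\<^sup>1\<close> extends to a function \<open>\<kappa>\<close> on \<open>I\<close> with
  \<open>\<kappa>(ih) = \<kappa>(i) + \<phi>(h)\<close>, and \<open>g \<mapsto> (in \<mapsto> \<kappa>(i) - \<kappa>(g\<^sup>-\<^sup>1i))\<close> is a cocycle that restricts to \<open>\<phi>\<close>.\<close>

lemma shapiro_surjective:
  fixes \<phi> :: "'p::prime_card mat \<Rightarrow> 'k::field"
  assumes n: "n \<in> carrier SL2"
    and hom: "\<And>g h. g \<in> stab n \<Longrightarrow> h \<in> stab n \<Longrightarrow> \<phi> (g ** h) = \<phi> g + \<phi> h"
    and cont: "\<And>\<gamma>. \<gamma> \<in> Gam m \<Longrightarrow> \<gamma> \<in> stab n \<Longrightarrow> \<phi> \<gamma> = 0"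
  shows "\<exists>c\<in>Z1 (Xw (cls n)). \<forall>g\<in>stab n. c g n = \<phi> g"
proof -
  \<comment> \<open>\<open>r\<close> chooses representatives of the cosets of \<open>I \<inter> nIn\<^sup>-\<^sup>1\<close> in \<open>I\<close>.\<close>
  define r where "r = (\<lambda>i. SOME x. x \<in> iwahori \<and> adj i ** x \<in> stab n)"
  have stab1: "mat 1 \<in> stab n" using n by (simp add: stab_def)
  have r: "r i \<in> iwahori \<and> adj i ** r i \<in> stab n" if "i \<in> iwahori" for i
    unfolding r_def by (rule someI[of _ i]) (use that stab1 iwahori_SL2[OF that] in simp)
  have r_cong: "r (i ** h) = r i" if i: "i \<in> iwahori" and h: "h \<in> stab n" for i h
  proof -
    have hS: "h \<in> carrier SL2" using iwahori_SL2[OF stab_iwahori[OF h]] .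
    have "adj (i ** h) ** x \<in> stab n \<longleftrightarrow> adj i ** x \<in> stab n" for x
    proof
      assume "adj (i ** h) ** x \<in> stab n"
      then have "h ** (adj (i ** h) ** x) \<in> stab n" by (rule stab_mult[OF n h])
      then show "adj i ** x \<in> stab n" using hS by (simp add: adj_mult matrix_mul_assoc[symmetric])
    next
      assume "adj i ** x \<in> stab n"
      then have "adj h ** (adj i ** x) \<in> stab n" by (rule stab_mult[OF n stab_adj[OF h]])
      then show "adj (i ** h) ** x \<in> stab n" by (simp add: adj_mult matrix_mul_assoc[symmetric])
    qed
    then show ?thesis by (simp add: r_def)
  qed
  define \<kappa> where "\<kappa> = (\<lambda>i. \<phi> (adj (r i) ** i))"
  have \<kappa>: "\<kappa> (i ** h) = \<kappa> i + \<phi> h" if i: "i \<in> iwahori" and h: "h \<in> stab n" for i h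
  proof -
    have "adj (r i) ** i \<in> stab n" using stab_adj[of "adj i ** r i"] r[OF i] by (simp add: adj_mult)
    then have "\<phi> (adj (r i) ** i ** h) = \<phi> (adj (r i) ** i) + \<phi> h" by (rule hom[OF _ h])
    then show ?thesis by (simp add: \<kappa>_def r_cong[OF i h] matrix_mul_assoc)
  qed
  have "\<phi> (mat 1) + \<phi> (mat 1) = \<phi> (mat 1) + 0" using hom[OF stab1 stab1] by simp
  then have \<phi>1: "\<phi> (mat 1) = 0" by (rule add_left_imp_eq)
  have \<phi>adj: "\<phi> (adj g) = - \<phi> g" if g: "g \<in> stab n" for g
  proof -
    have "\<phi> (adj g ** g) = \<phi> (adj g) + \<phi> g" by (rule hom[OF stab_adj[OF g] g])
    then show ?thesis using \<phi>1 iwahori_SL2[OF stab_iwahori[OF g]] by (simp add: eq_neg_iff_add_eq_0)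
  qed
  define good where "good = (\<lambda>y i. i \<in> iwahori \<and> (\<exists>j\<in>iwahori. y = i ** n ** j))"
  define c where "c = (\<lambda>g y. if \<exists>i. good y i then \<kappa> (SOME i. good y i) - \<kappa> (adj g ** (SOME i. good y i)) else 0)"
  have good_diff: "adj i ** i' \<in> stab n" if gy: "good y i" "good y i'" for y i i'
  proof -
    obtain j j' where j: "i \<in> iwahori" "j \<in> iwahori" "i' \<in> iwahori" "j' \<in> iwahori" "y = i ** n ** j" "i ** n ** j = i' ** n ** j'"
      using gy unfolding good_def by metis
    note SL = iwahori_SL2[OF j(1)] iwahori_SL2[OF j(2)] iwahori_SL2[OF j(3)] iwahori_SL2[OF j(4)]
    have "adj n ** (adj i ** i') ** n = adj (i ** n) ** (i' ** n ** j') ** adj j'"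
      using SL by (simp add: adj_mult matrix_mul_assoc[symmetric])
    also have "\<dots> = j ** adj j'"
      unfolding j(6)[symmetric] using SL n by (simp add: adj_mult matrix_mul_assoc[symmetric])
    finally show ?thesis using j by (simp add: stab_def)
  qed
  have c_good: "c g y = \<kappa> i - \<kappa> (adj g ** i)" if g: "g \<in> iwahori" and y: "good y i" for g y i
  proof -
    define i' where "i' = (SOME i. good y i)"
    have i': "good y i'" unfolding i'_def using y by (rule someI)
    define h where "h = adj i ** i'"
    have h: "h \<in> stab n" unfolding h_def by (rule good_diff[OF y i'])
    have iI: "i \<in> iwahori" using y by (simp add: good_def)
    have i'h: "i' = i ** h" using iwahori_SL2[OF iI] by (simp add: h_def)
    have "\<kappa> (adj g ** i') = \<kappa> (adj g ** i) + \<phi> h"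
      using \<kappa>[of "adj g ** i" h] g iI h by (simp add: i'h matrix_mul_assoc)
    moreover have "\<kappa> i' = \<kappa> i + \<phi> h" unfolding i'h by (rule \<kappa>[OF iI h])
    moreover have "c g y = \<kappa> i' - \<kappa> (adj g ** i')" using y by (auto simp: c_def i'_def)
    ultimately show ?thesis by simp
  qed
  have c_bad: "c g y = 0" if "\<not> (\<exists>i. good y i)" for g y
    unfolding c_def using that by (simp only: if_False)
  have good_left: "good (adj g ** y) i \<longleftrightarrow> good y (g ** i)" if g: "g \<in> iwahori" for g y i
  proof
    note gS = iwahori_SL2[OF g]
    assume "good (adj g ** y) i"
    then obtain j where j: "i \<in> iwahori" "j \<in> iwahori" "adj g ** y = i ** n ** j" by (auto simp: good_def)
    have "y = g ** (adj g ** y)" using gS by simp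
    then have "y = (g ** i) ** n ** j" using j(3) by (simp add: matrix_mul_assoc)
    then show "good y (g ** i)" using j g by (auto simp: good_def)
  next
    note gS = iwahori_SL2[OF g]
    assume "good y (g ** i)"
    then obtain j where j: "g ** i \<in> iwahori" "j \<in> iwahori" "y = (g ** i) ** n ** j" by (auto simp: good_def)
    then have "i \<in> iwahori" using iwahori_cancel[OF g] by simp
    moreover have "adj g ** y = i ** n ** j" using gS by (simp add: j(3) matrix_mul_assoc[symmetric])
    ultimately show "good (adj g ** y) i" using j(2) by (auto simp: good_def)
  qed
  have good_right: "good (y ** j) i \<longleftrightarrow> good y i" if j: "j \<in> iwahori" for y j i
  proof
    note jS = iwahori_SL2[OF j]
    assume "good (y ** j) i"
    then obtain j' where j': "i \<in> iwahori" "j' \<in> iwahori" "y ** j = i ** n ** j'" by (auto simp: good_def)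
    have "y = i ** n ** (j' ** adj j)" using jS j'(3)[symmetric] by (simp add: matrix_mul_assoc)
    then show "good y i" using j j' by (auto simp: good_def)
  next
    assume "good y i"
    then obtain j' where j': "i \<in> iwahori" "j' \<in> iwahori" "y = i ** n ** j'" by (auto simp: good_def)
    have "y ** j = i ** n ** (j' ** j)" by (simp add: j'(3) matrix_mul_assoc)
    then show "good (y ** j) i" using j j' by (auto simp: good_def)
  qed
  obtain m0 where m0: "\<And>\<gamma>. \<gamma> \<in> Gam m0 \<Longrightarrow> adj n ** \<gamma> ** n \<in> Gam (Suc 0)"
    using Gam_conj[OF n, of "Suc 0"] by metis
  have Gam_stab: "\<gamma> \<in> stab n" if "\<gamma> \<in> Gam (Suc (m0 + m))" for \<gamma>
    unfolding stab_def using Gam_1_iwahori[OF that] Gam_1_iwahori[OF m0[OF Gam_mono[OF _ that]]] by simp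
  have cX: "c g \<in> Xw (cls n)" if g: "g \<in> iwahori" for g
  proof -
    obtain R :: "'p mat set" where R: "finite R" "R \<subseteq> iwahori" "\<And>g. g \<in> iwahori \<Longrightarrow> \<exists>r\<in>R. adj r ** g \<in> Gam (Suc (m0 + m))"
      using iwahori_finite_Gam[of "Suc (m0 + m)"] by metis
    have goodS: "y \<in> carrier SL2" if "good y i" for y i
      using that n by (auto simp: good_def iwahori_SL2)
    have "c g \<in> rspace \<X>"
    proof (rule XI[of _ "(\<lambda>r. r ** n) ` R"])
      show "c g y = 0" if "y \<notin> carrier SL2" for y
        using c_bad[of y] goodS that by blast
      show "c g (y ** j) = c g y" if j: "j \<in> iwahori" for y j
        unfolding c_def good_right[OF j] ..
      show "\<exists>x\<in>(\<lambda>r. r ** n) ` R. adj x ** y \<in> iwahori" if "c g y \<noteq> 0" for y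
      proof -
        obtain i j where y: "i \<in> iwahori" "j \<in> iwahori" "y = i ** n ** j"
          using c_bad[of y g] \<open>c g y \<noteq> 0\<close> by (auto simp: good_def)
        obtain x where x: "x \<in> R" "adj x ** i \<in> Gam (Suc (m0 + m))" using R(3)[OF y(1)] by blast
        have "adj (x ** n) ** y = (adj n ** (adj x ** i) ** n) ** j"
          by (simp add: y(3) adj_mult matrix_mul_assoc)
        then have "adj (x ** n) ** y \<in> iwahori" using stab_conj[OF Gam_stab[OF x(2)]] y(2) by simp
        then show ?thesis using x(1) by blast
      qed
    qed (use R n iwahori_SL2 in auto)
    moreover have "y \<in> IwI (cls n)" if "c g y \<noteq> 0" for y
      using c_bad[of y g] that unfolding IwI_cls good_def by blast
    ultimately show ?thesis by (simp add: Xw_def)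
  qed
  have "c \<in> Z1 (Xw (cls n))"
    unfolding Z1_iff
  proof (intro conjI ballI)
    show "c g \<in> Xw (cls n)" if "g \<in> iwahori" for g by (rule cX[OF that])
    show "\<exists>m. \<forall>\<gamma>\<in>Gam (Suc m). c \<gamma> = 0"
    proof (intro exI ballI ext)
      fix \<gamma> y :: "'p mat" assume \<gamma>: "\<gamma> \<in> Gam (Suc (m0 + m))"
      have \<gamma>I: "\<gamma> \<in> iwahori" by (rule Gam_1_iwahori[OF \<gamma>])
      show "c \<gamma> y = 0 y"
      proof (cases "\<exists>i. good y i")
        case True
        then obtain i where i: "good y i" ..
        then have iI: "i \<in> iwahori" by (simp add: good_def)
        define h where "h = adj i ** \<gamma> ** i"
        have hG: "h \<in> Gam (Suc (m0 + m))" unfolding h_def by (rule Gam_conj_iwahori[OF iI \<gamma>])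
        have h: "h \<in> stab n" by (rule Gam_stab[OF hG])
        have "adj \<gamma> ** i = i ** adj h"
          using iwahori_SL2[OF iI] by (simp add: h_def adj_mult matrix_mul_assoc[symmetric])
        then have "\<kappa> (adj \<gamma> ** i) = \<kappa> i + \<phi> (adj h)" using \<kappa>[OF iI stab_adj[OF h]] by simp
        moreover have "\<phi> h = 0" by (rule cont[OF Gam_mono[OF _ hG] h]) simp
        ultimately show ?thesis using c_good[OF \<gamma>I i] \<phi>adj[OF h] by simp
      qed (simp add: c_bad)
    qed
    show "c (g ** h) = c g + act g (c h)" if g: "g \<in> iwahori" and h: "h \<in> iwahori" for g h
    proof
      fix y
      show "c (g ** h) y = (c g + act g (c h)) y"
      proof (cases "\<exists>i. good y i")
        case True
        then obtain i where i: "good y i" ..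
        have "good (adj g ** y) (adj g ** i)" unfolding good_left[OF g] using i iwahori_SL2[OF g] by simp
        then show ?thesis using c_good[OF g i] c_good[OF h] c_good[OF iwahori_mult[OF g h] i]
          by (simp add: act_apply adj_mult matrix_mul_assoc)
      next
        case False
        then have "\<not> (\<exists>i. good (adj g ** y) i)" using good_left[OF g] by blast
        then show ?thesis using False by (simp add: c_bad act_apply)
      qed
    qed
  qed
  moreover have "c g n = \<phi> g" if g: "g \<in> stab n" for g
  proof -
    have "good n (mat 1)" by (auto simp: good_def intro: bexI[of _ "mat 1"])
    then have "c g n = \<kappa> (mat 1) - \<kappa> (adj g)" using c_good[OF stab_iwahori[OF g]] by simp
    also have "\<kappa> (adj g) = \<kappa> (mat 1) + \<phi> (adj g)" using \<kappa>[OF iwahori_1 stab_adj[OF g]] by simp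
    finally show ?thesis using \<phi>adj[OF g] by simp
  qed
  ultimately show ?thesis by blast
qed


section \<open>Triples\<close>

text \<open>A homomorphism from \<open>\<int>\<^sub>p/p\<int>\<^sub>p\<close> to \<open>k\<close> is a multiple of the reduction map; \<open>\<kappa>m\<close>, \<open>\<kappa>0\<close> and \<open>\<kappa>p\<close> are the
  factors for the three components of a triple at the class of \<open>n\<close>, in the coordinates \<open>e\<close>.  The exponents
  are those in the description of \<open>I \<inter> nIn\<^sup>-\<^sup>1\<close>: the upper right entry is divisible by \<open>p\<close> to the power
  \<open>max 0 l\<close>, and the lower left one by \<open>p\<close> to the power \<open>max 1 (1 - l)\<close>.\<close>

definition triple_cocycle ::
  "bool \<Rightarrow> 'p::prime_card mat \<Rightarrow> int \<Rightarrow> 'k::field \<Rightarrow> 'k \<Rightarrow> 'k \<Rightarrow> ('p mat \<Rightarrow> 'p mat \<Rightarrow> 'k) \<Rightarrow> bool" where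
  "triple_cocycle e n l \<kappa>m \<kappa>0 \<kappa>p c \<longleftrightarrow> level e n l \<and> c \<in> Z1 (Xw (cls n)) \<and>
     (\<forall>A B C D. mt e A B C D \<in> stab n \<longrightarrow>
        c (mt e A B C D) n = \<kappa>m * residue (pQ powi (- max 1 (1 - l)) * C) + \<kappa>0 * residue ((A - 1) / pQ) +
          \<kappa>p * residue (pQ powi (- max 0 l) * B))"

lemma triple_cocycle_Z1: "triple_cocycle e n l \<kappa>m \<kappa>0 \<kappa>p c \<Longrightarrow> c \<in> Z1 (Xw (cls n))"
  by (simp add: triple_cocycle_def)

lemma triple_cocycle_level: "triple_cocycle e n l \<kappa>m \<kappa>0 \<kappa>p c \<Longrightarrow> level e n l"
  by (simp add: triple_cocycle_def)

lemma triple_cocycle_eval: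
  "triple_cocycle e n l \<kappa>m \<kappa>0 \<kappa>p c \<Longrightarrow> mt e A B C D \<in> stab n \<Longrightarrow>
    c (mt e A B C D) n = \<kappa>m * residue (pQ powi (- max 1 (1 - l)) * C) + \<kappa>0 * residue ((A - 1) / pQ) +
          \<kappa>p * residue (pQ powi (- max 0 l) * B)"
  by (simp add: triple_cocycle_def)

lemma divide_p_pideal [simp]: "x / pQ \<in> pideal k \<longleftrightarrow> x \<in> pideal (k + 1)"
  using pideal_shift[of "- 1" x k] by (simp add: power_int_minus divide_inverse mult.commute)

lemma mult_p_pideal [simp]: "pQ * x \<in> pideal k \<longleftrightarrow> x \<in> pideal (k - 1)"
  using pideal_shift[of 1 x k] by simp

text \<open>For \<open>l \<noteq> 0\<close>, this makes the diagonal entries of elements of \<open>I \<inter> nIn\<^sup>-\<^sup>1\<close> multiplicative, and inverse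
  to each other, modulo \<open>p\<^sup>2\<close>.\<close>

lemma off_diagonal_product:
  assumes "B \<in> pideal (max 0 l)" "C \<in> pideal (max 1 (1 - l))"
  shows "B * C \<in> pideal (1 + \<bar>l\<bar>)"
  by (rule pideal_mult_le[OF assms]) (simp add: max_def)

context
  assumes char: "CHAR('k::field) = CARD('p::prime_card)"
begin

lemma residue_diagonal:
  assumes n: "level e n l" and g: "mt e A B C D \<in> stab (n :: 'p mat)" and l: "l \<noteq> 0"
  shows "residue ((D - 1) / pQ) = (- residue ((A - 1) / pQ) :: 'k)"
proof -
  have *: "A - 1 \<in> pideal 1" "B \<in> pideal (max 0 l)" "C \<in> pideal (max 1 (1 - l))" "D - 1 \<in> pideal 1" "A * D - B * C = 1"
    using g unfolding mt_stab_iff[OF n] by auto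
  have BC: "B * C \<in> pideal 2" by (rule pideal_mono[OF _ off_diagonal_product[OF *(2,3)]]) (use l in simp)
  have AD: "(A - 1) * (D - 1) \<in> pideal 2" using pideal_mult[OF *(1,4)] by simp
  have "(D - 1) - - (A - 1) = (A * D - B * C - 1) + B * C - (A - 1) * (D - 1)" by (simp add: algebra_simps)
  also have "\<dots> = B * C - (A - 1) * (D - 1)" unfolding *(5) by simp
  finally have "(D - 1) - - (A - 1) \<in> pideal 2" using BC AD by auto
  then have "((D - 1) - - (A - 1)) / pQ \<in> pideal 1" by simp
  then have "(D - 1) / pQ - - ((A - 1) / pQ) \<in> pideal 1" by (simp add: diff_divide_distrib add_divide_distrib)
  moreover have A: "(A - 1) / pQ \<in> pideal 0" using *(1) by simp
  ultimately have "residue ((D - 1) / pQ) = (residue (- ((A - 1) / pQ)) :: 'k)"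
    by (intro residue_cong[OF char]) auto
  also have "\<dots> = - residue ((A - 1) / pQ)" by (rule residue_uminus[OF char A])
  finally show ?thesis .
qed

text \<open>The other coordinates exchange the two off-diagonal entries, up to powers of \<open>p\<close>, and the two diagonal ones, which for
  \<open>l \<noteq> 0\<close> are inverse to each other modulo \<open>p\<^sup>2\<close>; this gives the sign of \<open>\<kappa>0\<close>.\<close>

lemma triple_cocycle_flip:
  assumes "triple_cocycle e n l \<kappa>m \<kappa>0 \<kappa>p (c :: 'p mat \<Rightarrow> 'p mat \<Rightarrow> 'k)" and l: "l \<noteq> 0 \<or> \<kappa>0 = 0"
  shows "triple_cocycle (\<not> e) n (- l) \<kappa>p (- \<kappa>0) \<kappa>m c"
  unfolding triple_cocycle_def
proof (intro conjI allI impI)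
  note n = triple_cocycle_level[OF assms(1)]
  show nT: "level (\<not> e) n (- l)" using level_flip[OF n] .
  show "c \<in> Z1 (Xw (cls n))" by (rule triple_cocycle_Z1[OF assms(1)])
  fix A B C D assume g: "mt (\<not> e) A B C D \<in> stab n"
  have eq: "mt (\<not> e) A B C D = mt e D (C / pQ) (pQ * B) A" by (cases e) (simp_all add: mt_def)
  have m: "- max 1 (1 - l) + 1 = - max 0 (- l)" "- max 0 l - 1 = - max 1 (1 - - l)" by (simp_all add: max_def)
  have "pQ powi (- max 1 (1 - l) + 1) = pQ powi (- max 1 (1 - l)) * (pQ :: 'p padic)"
    by (subst power_int_add) simp_all
  then have "pQ powi (- max 1 (1 - l)) * (pQ * B) = pQ powi (- max 1 (1 - l) + 1) * B"
    by (simp only: mult.assoc)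
  then have 1: "pQ powi (- max 1 (1 - l)) * (pQ * B) = pQ powi (- max 0 (- l)) * B" unfolding m .
  have "pQ powi (- max 0 l) * (C / pQ) = pQ powi (- max 0 l - 1) * C"
    by (simp add: power_int_diff)
  then have 2: "pQ powi (- max 0 l) * (C / pQ) = pQ powi (- max 1 (1 - - l)) * C" unfolding m .
  have 3: "\<kappa>0 * residue ((D - 1) / pQ) = - \<kappa>0 * residue ((A - 1) / pQ)"
    using l residue_diagonal[OF nT g] by auto
  show "c (mt (\<not> e) A B C D) n = \<kappa>p * residue (pQ powi (- max 1 (1 - - l)) * C) + - \<kappa>0 * residue ((A - 1) / pQ) +
          \<kappa>m * residue (pQ powi (- max 0 (- l)) * B)"
    using triple_cocycle_eval[OF assms(1), of D "C / pQ" "pQ * B" A] g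
    unfolding eq[symmetric] 1 2 3 by simp
qed

lemma residue_near_1: "A - 1 \<in> pideal 1 \<Longrightarrow> residue (A :: 'p padic) = (1 :: 'k)"
  using residue_cong[OF char, of A 1] residue_1[OF char] by simp

lemma residue_mult_near_1:
  "x \<in> pideal 0 \<Longrightarrow> A - 1 \<in> pideal 1 \<Longrightarrow> residue (x * A :: 'p padic) = (residue x :: 'k)"
  using residue_mult[OF char, of x A] residue_near_1[of A] punit_near_1[of A] by (simp add: punit_def)

lemma pideal_normalize: "x \<in> pideal k \<Longrightarrow> pQ powi (- k) * x \<in> pideal 0"
  by (simp add: pideal_shift)

text \<open>The prescribed values are a homomorphism on \<open>I \<inter> nIn\<^sup>-\<^sup>1\<close>: modulo \<open>p\<close>, the normalized off-diagonal entries
  are additive because the diagonal entries are congruent to \<open>1\<close>, and for \<open>l \<noteq> 0\<close> the diagonal entries are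
  multiplicative modulo \<open>p\<^sup>2\<close>.  As they vanish on a congruence subgroup, Shapiro's lemma applies.\<close>

lemma triple_cocycle_exists:
  assumes n: "level e (n :: 'p mat) l" and l: "l \<noteq> 0 \<or> \<kappa>0 = (0 :: 'k)"
  shows "\<exists>c :: 'p mat \<Rightarrow> 'p mat \<Rightarrow> 'k. triple_cocycle e n l \<kappa>m \<kappa>0 \<kappa>p c"
proof -
  let ?i = "max 0 l" and ?j = "max 1 (1 - l)"
  define F where "F = (\<lambda>(A :: 'p padic) (B :: 'p padic) (C :: 'p padic). \<kappa>m * residue (pQ powi (- ?j) * C) + \<kappa>0 * residue ((A - 1) / pQ) +
          \<kappa>p * residue (pQ powi (- ?i) * B))"
  define \<phi> where "\<phi> = (\<lambda>g. THE v. \<exists>A B C D. g = mt e A B C D \<and> v = F A B C)"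
  have \<phi>: "\<phi> (mt e A B C D) = F A B C" for A B C D
    unfolding \<phi>_def by (rule the_equality) auto
  have hom: "\<phi> (g ** h) = \<phi> g + \<phi> h" if g: "g \<in> stab n" and h: "h \<in> stab n" for g h
  proof -
    obtain A B C D where gg: "g = mt e A B C D" by (rule mt_cases)
    obtain A' B' C' D' where hh: "h = mt e A' B' C' D'" by (rule mt_cases)
    have 1: "A - 1 \<in> pideal 1" "B \<in> pideal ?i" "C \<in> pideal ?j" "D - 1 \<in> pideal 1"
      and 2: "A' - 1 \<in> pideal 1" "B' \<in> pideal ?i" "C' \<in> pideal ?j" "D' - 1 \<in> pideal 1"
      using g h unfolding gg hh mt_stab_iff[OF n] by auto
    note B = pideal_normalize[OF 1(2)] and C = pideal_normalize[OF 1(3)]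
      and B' = pideal_normalize[OF 2(2)] and C' = pideal_normalize[OF 2(3)]
    have U: "x \<in> pideal 0" if "x - 1 \<in> pideal 1" for x :: "'p padic"
      using punit_near_1[OF that] by (simp add: punit_def)
    have "pQ powi (- ?j) * (C * A' + D * C') = (pQ powi (- ?j) * C) * A' + (pQ powi (- ?j) * C') * D"
      by (simp add: algebra_simps)
    then have rC: "residue (pQ powi (- ?j) * (C * A' + D * C')) = (residue (pQ powi (- ?j) * C) + residue (pQ powi (- ?j) * C') :: 'k)"
      using residue_add[OF char pideal_mult[OF C U[OF 2(1)], simplified] pideal_mult[OF C' U[OF 1(4)], simplified]]
        residue_mult_near_1[OF C 2(1)] residue_mult_near_1[OF C' 1(4)] by (simp only:)
    have "pQ powi (- ?i) * (A * B' + B * D') = (pQ powi (- ?i) * B') * A + (pQ powi (- ?i) * B) * D'"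
      by (simp add: algebra_simps)
    then have rB: "residue (pQ powi (- ?i) * (A * B' + B * D')) = (residue (pQ powi (- ?i) * B') + residue (pQ powi (- ?i) * B) :: 'k)"
      using residue_add[OF char pideal_mult[OF B' U[OF 1(1)], simplified] pideal_mult[OF B U[OF 2(4)], simplified]]
        residue_mult_near_1[OF B' 1(1)] residue_mult_near_1[OF B 2(4)] by (simp only:)
    have rA: "\<kappa>0 * residue ((A * A' + B * C' - 1) / pQ) = \<kappa>0 * residue ((A - 1) / pQ) + \<kappa>0 * residue ((A' - 1) / pQ)"
    proof (cases "\<kappa>0 = 0")
      case False
      then have "l \<noteq> 0" using l by simp
      have BC: "B * C' \<in> pideal 2" by (rule pideal_mono[OF _ off_diagonal_product[OF 1(2) 2(3)]]) (use \<open>l \<noteq> 0\<close> in simp)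
      have a: "(A - 1) / pQ \<in> pideal 0" "(A' - 1) / pQ \<in> pideal 0" using 1(1) 2(1) by simp_all
      have aA: "(A - 1) / pQ * A' \<in> pideal 0" by (rule pideal_mult_le[OF a(1) U[OF 2(1)]]) simp
      have "(A * A' + B * C' - 1) / pQ - ((A - 1) / pQ * A' + (A' - 1) / pQ) = B * C' / pQ"
        by (simp add: field_simps)
      also have "\<dots> \<in> pideal 1" using BC by simp
      finally have "residue ((A * A' + B * C' - 1) / pQ) = (residue ((A - 1) / pQ * A' + (A' - 1) / pQ) :: 'k)"
        by (rule residue_cong[OF char _ pideal_add[OF aA a(2)]])
      also have "\<dots> = residue ((A - 1) / pQ) + residue ((A' - 1) / pQ)"
        unfolding residue_add[OF char aA a(2)] residue_mult_near_1[OF a(1) 2(1)] ..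
      finally show ?thesis by (simp add: distrib_left)
    qed simp
    show ?thesis unfolding gg hh mt_mult \<phi> F_def rC rB rA by (simp add: algebra_simps)
  qed
  have cont: "\<phi> \<gamma> = 0" if \<gamma>: "\<gamma> \<in> Gam (nat \<bar>l\<bar> + 3)" for \<gamma>
  proof -
    obtain a b c d where gg: "\<gamma> = mat2 a b c d" by (rule mat2_cases)
    have G: "a - 1 \<in> pideal (\<bar>l\<bar> + 3)" "b \<in> pideal (\<bar>l\<bar> + 3)" "c \<in> pideal (\<bar>l\<bar> + 3)" "d - 1 \<in> pideal (\<bar>l\<bar> + 3)"
      using \<gamma> by (auto simp: gg Gam_def mcong_def forall_2 mat_1)
    have le: "a - 1 \<in> pideal (\<bar>l\<bar> + 2)" "b \<in> pideal (\<bar>l\<bar> + 2)" "c \<in> pideal (\<bar>l\<bar> + 2)" "d - 1 \<in> pideal (\<bar>l\<bar> + 2)"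
        "b \<in> pideal (\<bar>l\<bar> + 1)" "c \<in> pideal (\<bar>l\<bar> + 3)"
      by (rule pideal_mono[OF _ G(1)], simp, rule pideal_mono[OF _ G(2)], simp, rule pideal_mono[OF _ G(3)], simp,
          rule pideal_mono[OF _ G(4)], simp, rule pideal_mono[OF _ G(2)], simp, rule G(3))
    have "\<exists>A B C D. \<gamma> = mt e A B C D \<and> A - 1 \<in> pideal (\<bar>l\<bar> + 2) \<and> B \<in> pideal (\<bar>l\<bar> + 2) \<and> C \<in> pideal (\<bar>l\<bar> + 2)"
    proof (cases e)
      case False
      show ?thesis
        by (rule exI[of _ a], rule exI[of _ b], rule exI[of _ c], rule exI[of _ d])
          (use False le in \<open>auto simp: gg mt_def add.commute\<close>)
    next
      case True
      show ?thesis
        by (rule exI[of _ d], rule exI[of _ "c / pQ"], rule exI[of _ "pQ * b"], rule exI[of _ a])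
          (use True le in \<open>auto simp: gg mt_def add.commute\<close>)
    qed
    then obtain A B C D where g: "\<gamma> = mt e A B C D" and 1: "A - 1 \<in> pideal (\<bar>l\<bar> + 2)" "B \<in> pideal (\<bar>l\<bar> + 2)" "C \<in> pideal (\<bar>l\<bar> + 2)"
      by blast
    have "pQ powi (- ?j) * C \<in> pideal 1" "(A - 1) / pQ \<in> pideal 1" "pQ powi (- ?i) * B \<in> pideal 1"
      unfolding pideal_shift divide_p_pideal
      by (rule pideal_mono[OF _ 1(3)], simp, rule pideal_mono[OF _ 1(1)], simp, rule pideal_mono[OF _ 1(2)], simp)
    then show ?thesis unfolding g \<phi> F_def by (simp add: residue_eq_0[OF char])
  qed
  obtain c :: "'p mat \<Rightarrow> 'p mat \<Rightarrow> 'k" where c: "c \<in> Z1 (Xw (cls n))" "\<forall>g\<in>stab n. c g n = \<phi> g"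
    using shapiro_surjective[OF level_SL2[OF n] hom cont] by blast
  have "triple_cocycle e n l \<kappa>m \<kappa>0 \<kappa>p c"
    unfolding triple_cocycle_def using n c \<phi> by (simp add: F_def)
  then show ?thesis by (intro exI[where P = "triple_cocycle e n l \<kappa>m \<kappa>0 \<kappa>p"])
qed

lemma Sh_coh_class:
  assumes n: "level e n l" and c: "c \<in> Z1 (Xw (cls (n :: 'p mat)) :: ('p mat \<Rightarrow> 'k) set)" and g: "g \<in> stab n"
  shows "Sh (cls n) (coh_class (Xw (cls n)) c) g = c g n"
proof -
  note S = level_SL2[OF n]
  have val: "the_elem (d g ` cls n) = c g n" if d: "d \<in> coh_class (Xw (cls n)) c" and g: "g \<in> stab n" for d g
  proof -
    have dZ: "d \<in> Z1 (Xw (cls n))" using d by (auto simp: cohomologous_iff)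
    obtain f where f: "f \<in> Xw (cls n)" "\<forall>g\<in>iwahori. d g = c g + (act g f - f)" using d by (auto simp: cohomologous_iff)
    note gI = stab_iwahori[OF g]
    have "d g (t ** n) = d g n" if "t \<in> torus1" for t
      by (rule X_stab[OF Xw_X[OF Z1_in[OF dZ gI]] S torus1_stab[OF n that]])
    then have "d g ` cls n = {d g n}" using cls_self[of n] unfolding cls_eq by force
    moreover have "act g f n = f n"
      unfolding act_apply by (rule X_stab[OF Xw_X[OF f(1)] S stab_adj[OF g]])
    then have "d g n = c g n" using f(2) gI by simp
    ultimately show ?thesis by simp
  qed
  have "(\<lambda>c. \<lambda>g\<in>Iw (cls n). the_elem (c g ` cls n)) ` coh_class (Xw (cls n)) c = {\<lambda>g\<in>stab n. c g n}"
  proof (intro equalityI subsetI)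
    fix F assume "F \<in> (\<lambda>c. \<lambda>g\<in>Iw (cls n). the_elem (c g ` cls n)) ` coh_class (Xw (cls n)) c"
    then obtain d where d: "d \<in> coh_class (Xw (cls n)) c" "F = (\<lambda>g\<in>stab n. the_elem (d g ` cls n))"
      unfolding Iw_cls[OF n] by (rule imageE)
    have "F = (\<lambda>g\<in>stab n. c g n)" unfolding d(2) by (rule restrict_ext) (rule val[OF d(1)])
    then show "F \<in> {\<lambda>g\<in>stab n. c g n}" by simp
  next
    fix F assume "F \<in> {\<lambda>g\<in>stab n. c g n}"
    then have F: "F = (\<lambda>g\<in>stab n. c g n)" by simp
    have cc: "c \<in> coh_class (Xw (cls n)) c" by (rule coh_class_self[OF submodule_Xw c])
    have "F = (\<lambda>g\<in>Iw (cls n). the_elem (c g ` cls n))"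
      unfolding F Iw_cls[OF n] by (rule restrict_ext) (rule val[OF cc, symmetric])
    then show "F \<in> (\<lambda>c. \<lambda>g\<in>Iw (cls n). the_elem (c g ` cls n)) ` coh_class (Xw (cls n)) c"
      using cc by (rule image_eqI)
  qed
  then show ?thesis using g by (simp add: Sh_def)
qed

text \<open>The class that is described in the definition of a triple exists because \<open>c\<close> represents it, and it is unique by the
  injectivity in Shapiro's lemma.\<close>

lemma triple_eq:
  assumes cm: "cm \<in> Hom_add" and c0: "c0 \<in> Hom_mult" and cp: "cp \<in> Hom_add"
    and c: "triple_cocycle False n l (cm 1) (c0 (1 + pZ)) (cp 1) (c :: 'p mat \<Rightarrow> 'p mat \<Rightarrow> 'k)"
  shows "triple cm c0 cp (cls n) = coh_class (rspace \<X>) c"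
proof -
  note n = triple_cocycle_level[OF c] and cZ = triple_cocycle_Z1[OF c]
  let ?w = "cls n" and ?v = "\<lambda>x y z. cm z + c0 (1 + pZ * x) + cp y"
  have len: "len ?w = nat \<bar>l\<bar>" by (rule len_cls[OF n])
  note W = cls_Wt0_iff[OF n] cls_Wt1_iff[OF n]
  have red: "?v x y z = cm 1 * red z + c0 (1 + pZ) * red x + cp 1 * red y" for x y z
    using Hom_add_red[OF char cm, of z] Hom_mult_red[OF char c0, of x] Hom_add_red[OF char cp, of y] by simp
  define A where "A = (\<lambda>x. of_Zp (1 + pZ * x) :: 'p padic)"
  have A': "of_Zp (1 + pZ * x) = A x" for x by (simp add: A_def)
  have A: "(A x - 1) / pQ = of_Zp x" for x by (simp add: A_def of_Zp_add of_Zp_mult of_Zp_of_nat)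
  have ex: "\<exists>x y z t. g = mat2 (A x) (of_Zp (pZ ^ nat (max 0 l) * y)) (of_Zp (pZ ^ nat (max 1 (1 - l)) * z)) (A t)" if "g \<in> stab n" for g
  proof -
    obtain a b c d where gg: "g = mt False a b c d" by (rule mt_cases)
    have *: "a - 1 \<in> pideal 1" "b \<in> pideal (int (nat (max 0 l)))" "c \<in> pideal (int (nat (max 1 (1 - l))))" "d - 1 \<in> pideal 1"
      using that unfolding gg mt_stab_iff[OF n] by auto
    obtain x where x: "a = A x" using *(1) unfolding near_1_iff A_def by blast
    obtain t where t: "d = A t" using *(4) unfolding near_1_iff A_def by blast
    obtain y where y: "b = of_Zp (pZ ^ nat (max 0 l) * y)" using *(2) unfolding pideal_of_nat_iff by blast
    obtain z where z: "c = of_Zp (pZ ^ nat (max 1 (1 - l)) * z)" using *(3) unfolding pideal_of_nat_iff by blast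
    show ?thesis using x y z t unfolding gg by (auto simp: mt_def)
  qed
  have val: "c (mat2 (A x) (of_Zp (pZ ^ nat (max 0 l) * y)) (of_Zp (pZ ^ nat (max 1 (1 - l)) * z)) (A t)) n = ?v x y z"
    if g: "mat2 (A x) (of_Zp (pZ ^ nat (max 0 l) * y)) (of_Zp (pZ ^ nat (max 1 (1 - l)) * z)) (A t) \<in> stab n" for x y z t
  proof -
    have P: "pQ powi (- m) * of_Zp (pZ ^ nat m * y) = of_Zp y" if "m \<ge> 0" for m and y :: "'p padic_int"
    proof -
      have "of_Zp (pZ ^ nat m) = (pQ powi m :: 'p padic)" using that by (simp add: of_Zp_power of_Zp_of_nat power_int_def)
      then show ?thesis by (simp add: of_Zp_mult power_int_minus mult.assoc[symmetric])
    qed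
    show ?thesis
      using triple_cocycle_eval[OF c, of "A x" _ _ "A t"] g unfolding red
      by (simp add: mt_def A P)
  qed
  have neg: "nat (max 0 l) = 0" "nat (max 1 (1 - l)) = nat \<bar>l\<bar> + 1" if "l \<le> 0"
    using that by simp_all
  have pos: "nat (max 0 l) = nat \<bar>l\<bar>" "nat (max 1 (1 - l)) = 1" if "0 \<le> l"
    using that by simp_all
  have "(THE \<alpha>. \<alpha> \<in> h1 ?w \<and>
     (\<forall>x y z t.
        let g = mat2 (of_Zp (1 + pZ * x)) (of_Zp y)
                     (of_Zp (pZ ^ (len ?w + 1) * z)) (of_Zp (1 + pZ * t))
        in ?w \<in> Wt0 \<and> g \<in> Iw ?w \<longrightarrow> Sh ?w \<alpha> g = ?v x y z) \<and>
     (\<forall>x y z t.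
        let g = mat2 (of_Zp (1 + pZ * x)) (of_Zp (pZ ^ len ?w * y))
                     (of_Zp (pZ * z)) (of_Zp (1 + pZ * t))
        in ?w \<in> Wt1 \<and> g \<in> Iw ?w \<longrightarrow> Sh ?w \<alpha> g = ?v x y z)) = coh_class (Xw ?w) c"
    unfolding Let_def Iw_cls[OF n] W len A'
  proof (rule the_equality)
    show "coh_class (Xw ?w) c \<in> h1 ?w \<and>
      (\<forall>x y z t. l \<le> 0 \<and> mat2 (A x) (of_Zp y) (of_Zp (pZ ^ (nat \<bar>l\<bar> + 1) * z)) (A t) \<in> stab n \<longrightarrow>
         Sh ?w (coh_class (Xw ?w) c) (mat2 (A x) (of_Zp y) (of_Zp (pZ ^ (nat \<bar>l\<bar> + 1) * z)) (A t)) = ?v x y z) \<and>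
      (\<forall>x y z t. 0 \<le> l \<and> mat2 (A x) (of_Zp (pZ ^ nat \<bar>l\<bar> * y)) (of_Zp (pZ * z)) (A t) \<in> stab n \<longrightarrow>
         Sh ?w (coh_class (Xw ?w) c) (mat2 (A x) (of_Zp (pZ ^ nat \<bar>l\<bar> * y)) (of_Zp (pZ * z)) (A t)) = ?v x y z)"
    proof (intro conjI allI impI)
      show "coh_class (Xw ?w) c \<in> h1 ?w" unfolding h1_def by (rule coh_class_H1[OF cZ])
    next
      fix x y z t
      assume g: "l \<le> 0 \<and> mat2 (A x) (of_Zp y) (of_Zp (pZ ^ (nat \<bar>l\<bar> + 1) * z)) (A t) \<in> stab n"
      show "Sh ?w (coh_class (Xw ?w) c) (mat2 (A x) (of_Zp y) (of_Zp (pZ ^ (nat \<bar>l\<bar> + 1) * z)) (A t)) = ?v x y z"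
        unfolding Sh_coh_class[OF n cZ conjunct2[OF g]]
        using val[of x y z t] unfolding neg[OF conjunct1[OF g]] power_0 mult_1_left using g by blast
    next
      fix x y z t
      assume g: "0 \<le> l \<and> mat2 (A x) (of_Zp (pZ ^ nat \<bar>l\<bar> * y)) (of_Zp (pZ * z)) (A t) \<in> stab n"
      show "Sh ?w (coh_class (Xw ?w) c) (mat2 (A x) (of_Zp (pZ ^ nat \<bar>l\<bar> * y)) (of_Zp (pZ * z)) (A t)) = ?v x y z"
        unfolding Sh_coh_class[OF n cZ conjunct2[OF g]]
        using val[of x y z t] unfolding pos[OF conjunct1[OF g]] power_one_right using g by blast
    qed
    fix \<alpha> assume \<alpha>: "\<alpha> \<in> h1 ?w \<and>
      (\<forall>x y z t. l \<le> 0 \<and> mat2 (A x) (of_Zp y) (of_Zp (pZ ^ (nat \<bar>l\<bar> + 1) * z)) (A t) \<in> stab n \<longrightarrow>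
         Sh ?w \<alpha> (mat2 (A x) (of_Zp y) (of_Zp (pZ ^ (nat \<bar>l\<bar> + 1) * z)) (A t)) = ?v x y z) \<and>
      (\<forall>x y z t. 0 \<le> l \<and> mat2 (A x) (of_Zp (pZ ^ nat \<bar>l\<bar> * y)) (of_Zp (pZ * z)) (A t) \<in> stab n \<longrightarrow>
         Sh ?w \<alpha> (mat2 (A x) (of_Zp (pZ ^ nat \<bar>l\<bar> * y)) (of_Zp (pZ * z)) (A t)) = ?v x y z)"
    then obtain d where d: "d \<in> Z1 (Xw ?w)" "\<alpha> = coh_class (Xw ?w) d" using H1_cases unfolding h1_def by blast
    have "c g n = d g n" if g: "g \<in> stab n" for g
    proof -
      obtain x y z t where gg: "g = mat2 (A x) (of_Zp (pZ ^ nat (max 0 l) * y)) (of_Zp (pZ ^ nat (max 1 (1 - l)) * z)) (A t)"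
        using ex[OF g] by blast
      have "Sh ?w \<alpha> g = ?v x y z"
      proof (cases "l \<le> 0")
        case True
        then have "g = mat2 (A x) (of_Zp y) (of_Zp (pZ ^ (nat \<bar>l\<bar> + 1) * z)) (A t)"
          using gg unfolding neg[OF True] power_0 mult_1_left by blast
        then show ?thesis using \<alpha> True g by blast
      next
        case False
        then have l0: "0 \<le> l" by simp
        then have "g = mat2 (A x) (of_Zp (pZ ^ nat \<bar>l\<bar> * y)) (of_Zp (pZ * z)) (A t)"
          using gg unfolding pos[OF l0] power_one_right by blast
        then show ?thesis using \<alpha> l0 g by blast
      qed
      moreover have "Sh ?w \<alpha> g = d g n" unfolding d(2) by (rule Sh_coh_class[OF n d(1) g])
      moreover have "c g n = ?v x y z" using val g unfolding gg by blast
      ultimately show ?thesis by simp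
    qed
    then show "\<alpha> = coh_class (Xw ?w) c" unfolding d(2) by (intro shapiro_injective[OF n d(1) cZ]) simp
  qed
  then show ?thesis unfolding triple_def by (simp only: h1_to_E1_coh_class[OF cZ])
qed

end


section \<open>The operators of the two reflections and of \<open>\<Omega>\<close>\<close>

lemma IwI_left: "i \<in> iwahori \<Longrightarrow> i ** y \<in> IwI (cls n) \<longleftrightarrow> y \<in> IwI (cls n)"
proof -
  have *: "i ** y \<in> IwI (cls n)" if i: "i \<in> iwahori" and y: "y \<in> IwI (cls n)" for i y :: "'a mat"
  proof -
    obtain i' j where "i' \<in> iwahori" "j \<in> iwahori" "y = i' ** n ** j" using y unfolding IwI_cls by blast
    then have "i ** y = (i ** i') ** n ** j" "i ** i' \<in> iwahori" "j \<in> iwahori"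
      using i by (simp_all add: matrix_mul_assoc)
    then show ?thesis unfolding IwI_cls by blast
  qed
  assume i: "i \<in> iwahori"
  show ?thesis using *[OF i, of y] *[of "adj i" "i ** y"] i iwahori_SL2[OF i] by auto
qed

lemma IwI_right: "j \<in> iwahori \<Longrightarrow> y ** j \<in> IwI (cls n) \<longleftrightarrow> y \<in> IwI (cls n)"
proof -
  have *: "y ** j \<in> IwI (cls n)" if j: "j \<in> iwahori" and y: "y \<in> IwI (cls n)" for j y :: "'a mat"
  proof -
    obtain i j' where "i \<in> iwahori" "j' \<in> iwahori" "y = i ** n ** j'" using y unfolding IwI_cls by blast
    then have "y ** j = i ** n ** (j' ** j)" "i \<in> iwahori" "j' ** j \<in> iwahori"
      using j by (simp_all add: matrix_mul_assoc)
    then show ?thesis unfolding IwI_cls by blast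
  qed
  assume j: "j \<in> iwahori"
  show ?thesis using *[OF j, of y] *[of "adj j" "y ** j"] j iwahori_SL2[OF j] by auto
qed

lemma IwI_self: "n \<in> IwI (cls n)"
  unfolding IwI_cls using iwahori_1 matrix_mul_lid matrix_mul_rid by (metis (mono_tags, lifting) mem_Collect_eq)

lemma IwI_unique:
  assumes "level e n l" "level e m l'" "m \<in> IwI (cls n)"
  shows "m ** adj n \<in> torus1"
  using assms(3) double_coset_unique[OF assms(1,2)] unfolding IwI_cls by blast

text \<open>Left translation by \<open>I\<close> permutes the cosets in \<open>InI\<close>; so the characteristic function of \<open>InI\<close> is the image of
  \<open>char\<^sub>I\<close> under an endomorphism.\<close>

lemma tau_cosets:
  fixes n :: "'p::prime_card mat"
  assumes J: "finite J" and y: "\<And>j. j \<in> J \<Longrightarrow> y j \<in> carrier SL2"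
    and cover: "\<And>x. x \<in> IwI (cls n) \<Longrightarrow> \<exists>j\<in>J. adj (y j) ** x \<in> iwahori"
    and sub: "\<And>j. j \<in> J \<Longrightarrow> y j \<in> IwI (cls n)"
    and disj: "\<And>j j'. j \<in> J \<Longrightarrow> j' \<in> J \<Longrightarrow> adj (y j) ** y j' \<in> iwahori \<Longrightarrow> j = j'"
  shows "\<tau> (cls n) \<in> (hecke :: ('p, 'k::field) endo set)"
    and "\<tau> (cls n) charI = (\<Sum>j\<in>J. act (y j) charI :: 'p mat \<Rightarrow> 'k)"
proof -
  have eq: "indicator (IwI (cls n)) = (\<Sum>j\<in>J. act (y j) charI :: 'p mat \<Rightarrow> 'k)"
  proof
    fix x
    show "indicator (IwI (cls n)) x = ((\<Sum>j\<in>J. act (y j) charI) x :: 'k)"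
    proof (cases "x \<in> IwI (cls n)")
      case True
      then obtain i where i: "i \<in> J" "adj (y i) ** x \<in> iwahori" using cover by blast
      have "act (y j) charI x = (if j = i then 1 else 0 :: 'k)" if j: "j \<in> J" for j
      proof -
        have "adj (y j) ** x \<in> iwahori \<longleftrightarrow> j = i"
        proof
          assume jx: "adj (y j) ** x \<in> iwahori"
          have xS: "x \<in> carrier SL2" using iwahori_SL2[OF i(2)] y[OF i(1)] SL2_mult_iff[of "adj (y i)" x] by simp
          have "(adj (y j) ** x) ** adj (adj (y i) ** x) = adj (y j) ** y i"
            using xS by (simp add: adj_mult matrix_mul_assoc[symmetric])
          then have "adj (y j) ** y i \<in> iwahori" using iwahori_mult[OF jx] i(2) iwahori_adj[of "adj (y i) ** x"] by metis
          then show "j = i" by (rule disj[OF j i(1)])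
        qed (use i in simp)
        then show ?thesis by (simp add: act_apply charI_apply)
      qed
      then have "(\<Sum>j\<in>J. act (y j) charI x :: 'k) = (\<Sum>j\<in>J. if j = i then 1 else 0 :: 'k)" by (rule sum.cong[OF refl])
      also have "\<dots> = 1" using J i(1) by simp
      finally show ?thesis using True by (simp add: sum_fun_apply)
    next
      case False
      have "act (y j) charI x = (0 :: 'k)" if j: "j \<in> J" for j
      proof -
        have "adj (y j) ** x \<notin> iwahori"
        proof
          assume "adj (y j) ** x \<in> iwahori"
          then have "y j ** (adj (y j) ** x) \<in> IwI (cls n)" using sub[OF j] by (simp only: IwI_right)
          then show False using False y[OF j] by simp
        qed
        then show ?thesis by (simp add: act_apply charI_apply)
      qed
      then show ?thesis using False by (simp add: sum_fun_apply)
    qed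
  qed
  have X: "(indicator (IwI (cls n)) :: 'p mat \<Rightarrow> 'k) \<in> rspace \<X>"
    unfolding eq by (rule X_sum) (use y in simp)
  have inv: "act i (indicator (IwI (cls n))) = (indicator (IwI (cls n)) :: 'p mat \<Rightarrow> 'k)" if "i \<in> iwahori" for i
    using IwI_left[of "adj i"] that by (simp add: act_def indicator_def fun_eq_iff)
  show "\<tau> (cls n) \<in> (hecke :: ('p, 'k::field) endo set)"
    and "\<tau> (cls n) charI = (\<Sum>j\<in>J. act (y j) charI :: 'p mat \<Rightarrow> 'k)"
    using tau_eq[OF X inv] eq by simp_all
qed

definition low :: "bool \<Rightarrow> 'p::prime_card padic \<Rightarrow> 'p mat" where "low e r = mt e 1 0 r 1"
definition upp :: "bool \<Rightarrow> 'p::prime_card padic \<Rightarrow> 'p mat" where "upp e r = mt e 1 r 0 1"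

text \<open>Representatives of the cosets in \<open>IsI\<close>, and of the classes in \<open>\<Omega>\<close>.\<close>

definition srep :: "bool \<Rightarrow> nat \<Rightarrow> 'p::prime_card mat" where "srep e a = mt e (- of_nat a) 1 (- 1) 0"
definition om :: "bool \<Rightarrow> 'p::prime_card padic_int \<Rightarrow> 'p mat" where "om e q = mt e (inverse (of_Zp q)) 0 0 (of_Zp q)"

lemma srep_SL2 [simp]: "srep e a \<in> carrier SL2"
  by (simp add: srep_def SL2_iff)

lemma srep_eq: "srep e a = upp e (of_nat a) ** srefl e"
  by (simp add: srep_def upp_def srefl_def mt_mult)

lemma upp_iwahori: "r \<in> pideal 0 \<Longrightarrow> upp e r \<in> iwahori"
  by (simp add: upp_def mt_iwahori_iff)

lemma low_iwahori: "low e r \<in> iwahori \<longleftrightarrow> r \<in> pideal 1"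
  by (simp add: low_def mt_iwahori_iff)

lemma of_nat_pideal_diff:
  assumes "a < CARD('p::prime_card)" "b < CARD('p)"
  shows "(of_nat a - of_nat b :: 'p padic) \<in> pideal 1 \<longleftrightarrow> a = b"
proof -
  have "(of_nat a - of_nat b :: 'p padic) = of_Zp (of_nat a - of_nat b)" by (simp add: of_Zp_diff of_Zp_of_nat)
  then have "(of_nat a - of_nat b :: 'p padic) \<in> pideal 1 \<longleftrightarrow> pZ dvd (of_nat a - of_nat b :: 'p padic_int)"
    by (auto simp: pideal_1_iff dvd_def)
  then show ?thesis using of_nat_dvd_diff_iff[OF assms] by simp
qed

lemma pideal_residue:
  assumes "x \<in> pideal 0"
  shows "\<exists>a<CARD('p). (x :: 'p::prime_card padic) - of_nat a \<in> pideal 1"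
proof -
  obtain y where y: "x = of_Zp y" using assms by (auto simp: pideal_0_iff)
  obtain a z where "a < CARD('p)" "y = of_nat a + pZ * z" using padic_int_residue by blast
  then have "a < CARD('p)" "x - of_nat a = of_Zp (pZ * z)" by (simp_all add: y of_Zp_add of_Zp_of_nat)
  then show ?thesis unfolding pideal_1_iff by blast
qed

lemma srep_cover:
  assumes "x \<in> IwI (cls (srefl e :: 'p::prime_card mat))"
  shows "\<exists>a<CARD('p). adj (srep e a) ** x \<in> iwahori"
proof -
  obtain i j where x: "x = i ** srefl e ** j" "i \<in> iwahori" "j \<in> iwahori" using assms unfolding IwI_cls by blast
  obtain A B C D where i: "i = mt e A B C D" by (rule mt_cases)
  have *: "A - 1 \<in> pideal 1" "B \<in> pideal 0" "C \<in> pideal 1" "D - 1 \<in> pideal 1" "A * D - B * C = 1"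
    using x(2) by (auto simp: i mt_iwahori_iff)
  have D: "punit D" by (rule punit_near_1[OF *(4)])
  have "B * inverse D \<in> pideal 0" by (rule pideal_mult_le[OF *(2)]) (use punit_inverse[OF D] in \<open>auto simp: punit_def\<close>)
  then obtain a where a: "a < CARD('p)" "B * inverse D - of_nat a \<in> pideal 1" using pideal_residue by blast
  have "D * (B * inverse D - of_nat a) = B - of_nat a * D" using punit_neq_0[OF D] by (simp add: field_simps)
  then have 1: "B - of_nat a * D \<in> pideal 1" using a(2) punit_mult_pideal_iff[OF D, of "B * inverse D - of_nat a" 1] by simp
  have "of_nat a * C \<in> pideal 1" by (rule pideal_mult_le[OF pideal_of_nat *(3)]) simp
  then have "(A - 1) - of_nat a * C \<in> pideal 1" using *(1) by blast
  then have 2: "A - of_nat a * C - 1 \<in> pideal 1" by (simp add: algebra_simps)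
  have eq: "adj (srep e a) ** i ** srefl e = mt e D (- C) (- (B - of_nat a * D)) (A - of_nat a * C)"
    by (simp add: srep_def srefl_def i mt_mult)
  have "D * (A - of_nat a * C) - - C * - (B - of_nat a * D) = A * D - B * C" by (simp add: algebra_simps)
  then have det: "D * (A - of_nat a * C) - - C * - (B - of_nat a * D) = 1" unfolding *(5) .
  have "C \<in> pideal 0" using *(3) by (rule pideal_mono[rotated]) simp
  then have "adj (srep e a) ** i ** srefl e \<in> iwahori"
    unfolding eq mt_iwahori_iff pideal_uminus_iff using 1 2 *(4) det by blast
  then have "adj (srep e a) ** i ** srefl e ** j \<in> iwahori" using x(3) by simp
  then show ?thesis using a(1) by (auto simp: x(1) matrix_mul_assoc)
qed

lemma srep_disjoint:
  assumes "a < CARD('p::prime_card)" "b < CARD('p)" "adj (srep e a) ** (srep e b :: 'p mat) \<in> iwahori"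
  shows "a = b"
proof -
  have "adj (srep e a) ** (srep e b :: 'p mat) = mt e 1 0 (of_nat a - of_nat b) 1"
    by (simp add: srep_def mt_mult)
  then show ?thesis using assms by (simp add: mt_iwahori_iff of_nat_pideal_diff)
qed

lemma srep_IwI: "srep e a \<in> IwI (cls (srefl e))"
  unfolding srep_eq IwI_left[OF upp_iwahori[OF pideal_of_nat]] by (rule IwI_self)

lemma tau_srefl:
  "\<tau> (cls (srefl e :: 'p mat)) \<in> (hecke :: ('p::prime_card, 'k::field) endo set)"
  "\<tau> (cls (srefl e :: 'p mat)) charI = (\<Sum>a<CARD('p). act (srep e a) charI :: 'p mat \<Rightarrow> 'k)"
proof -
  have cover: "\<exists>a\<in>{..<CARD('p)}. adj (srep e a) ** x \<in> iwahori" if "x \<in> IwI (cls (srefl e :: 'p mat))" for x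
    using srep_cover[OF that] by blast
  have disj: "a = b" if "a \<in> {..<CARD('p)}" "b \<in> {..<CARD('p)}" "adj (srep e a) ** (srep e b :: 'p mat) \<in> iwahori" for a b
    using srep_disjoint[of a b e] that by simp
  note * = tau_cosets[of "{..<CARD('p)}" "srep e" "srefl e :: 'p mat", OF finite_lessThan srep_SL2 cover srep_IwI disj]
  show "\<tau> (cls (srefl e :: 'p mat)) \<in> (hecke :: ('p::prime_card, 'k::field) endo set)"
    "\<tau> (cls (srefl e :: 'p mat)) charI = (\<Sum>a<CARD('p). act (srep e a) charI :: 'p mat \<Rightarrow> 'k)"
    using * by blast+
qed

lemma of_Zp_root: "q \<in> roots_of_unity \<Longrightarrow> punit (of_Zp q)"
  using roots_of_unity_unit by (simp add: punit_of_Zp)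

lemma om_torus0: "q \<in> roots_of_unity \<Longrightarrow> om e q \<in> torus0"
  using of_Zp_root[of q] by (simp add: om_def mt_torus0_iff punit_iff)

lemma om_level: "q \<in> roots_of_unity \<Longrightarrow> level e' (om e q) 0"
  by (simp add: level_torus0_iff om_torus0)

lemma om_SL2 [simp]: "q \<in> roots_of_unity \<Longrightarrow> om e q \<in> carrier SL2"
  using level_SL2[OF om_level] .

lemma om_conj_iwahori: "q \<in> roots_of_unity \<Longrightarrow> adj (om e q) ** g ** om e q \<in> iwahori \<longleftrightarrow> g \<in> iwahori"
  by (cases g rule: mt_cases[where e = e]) (simp add: level_conj_iwahori_iff[OF om_level] mt_iwahori_iff)

lemma tau_om:
  assumes q: "q \<in> roots_of_unity"
  shows "\<tau> (cls (om e q :: 'p mat)) \<in> (hecke :: ('p::prime_card, 'k::field) endo set)"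
    and "\<tau> (cls (om e q :: 'p mat)) charI = (act (om e q) charI :: 'p mat \<Rightarrow> 'k)"
proof -
  have "adj (om e q) ** x \<in> iwahori" if x: "x \<in> IwI (cls (om e q))" for x :: "'p mat"
  proof -
    obtain i j where "x = i ** om e q ** j" "i \<in> iwahori" "j \<in> iwahori" using x unfolding IwI_cls by blast
    then show ?thesis using om_conj_iwahori[OF q, of e i] by (simp add: matrix_mul_assoc)
  qed
  then show "\<tau> (cls (om e q :: 'p mat)) \<in> (hecke :: ('p, 'k::field) endo set)"
    and "\<tau> (cls (om e q :: 'p mat)) charI = (act (om e q) charI :: 'p mat \<Rightarrow> 'k)"
    using tau_cosets[of "{()}" "\<lambda>_. om e q" "om e q :: 'p mat"] q IwI_self[of "om e q"] by simp_all
qed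

subsection \<open>Their action on cocycles\<close>

text \<open>The inverse of the permutation of the cosets in \<open>IsI\<close> by \<open>g\<close>.\<close>

definition srho :: "bool \<Rightarrow> 'p::prime_card mat \<Rightarrow> nat \<Rightarrow> nat" where
  "srho e g a = (SOME b. b < CARD('p) \<and> adj (srep e a) ** g ** srep e b \<in> iwahori)"

lemma srho:
  assumes "g \<in> iwahori"
  shows "srho e g a < CARD('p)" "adj (srep e a) ** g ** srep e (srho e g a) \<in> (iwahori :: 'p::prime_card mat set)"
proof -
  have "adj g ** srep e a \<in> IwI (cls (srefl e))" using IwI_left[of "adj g"] assms srep_IwI by simp
  then obtain b where b: "b < CARD('p)" "adj (srep e b) ** (adj g ** srep e a) \<in> iwahori" using srep_cover by blast
  have "adj (srep e a) ** g ** srep e b = adj (adj (srep e b) ** (adj g ** srep e a))"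
    by (simp add: adj_mult matrix_mul_assoc)
  then have "adj (srep e a) ** g ** srep e b \<in> iwahori" using b(2) by simp
  then have "\<exists>b. b < CARD('p) \<and> adj (srep e a) ** g ** srep e b \<in> iwahori" using b(1) by blast
  from someI_ex[OF this] show "srho e g a < CARD('p)" "adj (srep e a) ** g ** srep e (srho e g a) \<in> iwahori"
    unfolding srho_def by blast+
qed

lemma srho_eqI:
  assumes g: "g \<in> iwahori" and b: "b < CARD('p)" and gb: "adj (srep e a) ** g ** srep e b \<in> (iwahori :: 'p::prime_card mat set)"
  shows "srho e g a = b"
proof (rule srep_disjoint[OF srho(1)[OF g] b])
  have "adj (srep e (srho e g a)) ** srep e b = adj (adj (srep e a) ** g ** srep e (srho e g a)) ** (adj (srep e a) ** g ** srep e b)"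
    using iwahori_SL2[OF g] by (simp add: adj_mult matrix_mul_assoc[symmetric])
  moreover have "adj (adj (srep e a) ** g ** srep e (srho e g a)) \<in> iwahori"
    using srho(2)[OF g, of e a] by (simp only: iwahori_adj)
  ultimately show "adj (srep e (srho e g a)) ** (srep e b :: 'p mat) \<in> iwahori" using gb by (simp only: iwahori_mult)
qed

lemma srho_bij:
  assumes g: "g \<in> (iwahori :: 'p::prime_card mat set)"
  shows "bij_betw (srho e g) {..<CARD('p)} {..<CARD('p)}"
proof -
  have "inj_on (srho e g) {..<CARD('p)}"
  proof (rule inj_onI)
    fix a b assume a: "a \<in> {..<CARD('p)}" and b: "b \<in> {..<CARD('p)}" and eq: "srho e g a = srho e g b"
    have "adj (srep e a) ** srep e b = (adj (srep e a) ** g ** srep e (srho e g a)) ** adj (adj (srep e b) ** g ** srep e (srho e g b))"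
      using iwahori_SL2[OF g] by (simp add: eq adj_mult matrix_mul_assoc[symmetric])
    moreover have "adj (adj (srep e b) ** g ** srep e (srho e g b)) \<in> iwahori"
      using srho(2)[OF g, of e b] by (simp only: iwahori_adj)
    ultimately have "adj (srep e a) ** (srep e b :: 'p mat) \<in> iwahori"
      using srho(2)[OF g, of e a] by (simp only: iwahori_mult)
    then show "a = b" using a b srep_disjoint by blast
  qed
  moreover have "srho e g ` {..<CARD('p)} \<subseteq> {..<CARD('p)}" using srho(1)[OF g] by blast
  ultimately show ?thesis by (simp add: bij_betw_def endo_inj_surj)
qed

definition tau_cocycle :: "bool \<Rightarrow> ('p::prime_card mat \<Rightarrow> 'p mat \<Rightarrow> 'k::field) \<Rightarrow> ('p mat \<Rightarrow> 'p mat \<Rightarrow> 'k)" where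
  "tau_cocycle e c = (\<lambda>g. \<Sum>a<CARD('p). act (srep e a) (c (adj (srep e a) ** g ** srep e (srho e g a))))"

lemma tau_srefl_act:
  fixes c :: "'p::prime_card mat \<Rightarrow> 'p mat \<Rightarrow> 'k::field"
  assumes c: "c \<in> Z1 (rspace \<X>)"
  shows "tau_cocycle e c \<in> Z1 (rspace \<X>)"
    and "\<tau> (cls (srefl e)) \<cdot> coh_class (rspace \<X>) c = coh_class (rspace \<X>) (tau_cocycle e c)"
proof -
  note * = hecke_act_coh_class[OF tau_srefl(1)[of e] c, of "{..<CARD('p)}" "srep e" "\<lambda>_. 1" "srho e" "tau_cocycle e c"]
  show "tau_cocycle e c \<in> Z1 (rspace \<X>)"
    by (rule *(1)) (simp_all add: tau_srefl(2) tau_cocycle_def srho srho_bij)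
  show "\<tau> (cls (srefl e)) \<cdot> coh_class (rspace \<X>) c = coh_class (rspace \<X>) (tau_cocycle e c)"
    by (rule *(2)) (simp_all add: tau_srefl(2) tau_cocycle_def srho srho_bij)
qed

definition e_cocycle :: "bool \<Rightarrow> int \<Rightarrow> ('p::prime_card mat \<Rightarrow> 'p mat \<Rightarrow> 'k::field) \<Rightarrow> ('p mat \<Rightarrow> 'p mat \<Rightarrow> 'k)" where
  "e_cocycle e m c = (\<lambda>g. \<Sum>q\<in>roots_of_unity. fscale (- (red q powi (- m))) (act (om e q) (c (adj (om e q) ** g ** om e q))))"

context
  assumes char: "CHAR('k::field) = CARD('p::prime_card)"
begin

lemma e_id_False:
  "(e_id m :: ('p, 'k) endo) = (\<Sum>q\<in>roots_of_unity. (\<lambda>f. fscale (- (red q powi (- m))) (\<tau> (cls (om False q)) f)))"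
proof -
  have term_eq: "- (\<lambda>f. rscal \<X> (of_nat u powi (- m)) (\<tau> (omega u) f)) =
      (\<lambda>f. fscale (- (red (teich u :: 'p padic_int) powi (- m))) (\<tau> (cls (om False (teich u :: 'p padic_int))) f) :: 'p mat \<Rightarrow> 'k)"
    if u: "u \<in> {1..<CARD('p)}" for u
  proof -
    have "red (teich u - of_nat u :: 'p padic_int) = (0 :: 'k)" by (rule red_eq_0[OF char teich(2)[OF u]])
    then have "(of_nat u :: 'k) = red (teich u :: 'p padic_int)" by (simp add: red_diff[OF char] red_of_nat[OF char])
    moreover have "omega u = cls (om False (teich u :: 'p padic_int))" by (simp add: omega_def om_def mt_def)
    ultimately show ?thesis by (simp add: fun_eq_iff fscale_def)
  qed
  have "(e_id m :: ('p, 'k) endo) = (\<Sum>u\<in>{1..<CARD('p)}. - (\<lambda>f. rscal \<X> (of_nat u powi (- m)) (\<tau> (omega u) f)))"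
    unfolding e_id_def by (rule sum_negf[symmetric])
  also have "\<dots> = (\<Sum>u\<in>{1..<CARD('p)}. (\<lambda>f. fscale (- (red (teich u :: 'p padic_int) powi (- m))) (\<tau> (cls (om False (teich u))) f)))"
    by (rule sum.cong[OF refl term_eq])
  also have "\<dots> = (\<Sum>q\<in>roots_of_unity. (\<lambda>f. fscale (- (red q powi (- m))) (\<tau> (cls (om False q)) f)))"
    by (rule sum.reindex_bij_betw[OF teich_bij])
  finally show ?thesis .
qed

text \<open>In the coordinates \<open>e = True\<close>, the class \<open>\<omega>\<^sub>u\<close> is represented by the inverse of the matrix that represents it
  for \<open>e = False\<close>, so that the sign of the exponent changes.\<close>

lemma e_id_charI:
  "(e_id m :: ('p, 'k) endo) \<in> hecke"
  "(e_id (if e then - m else m) :: ('p, 'k) endo) charI =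
     (\<Sum>q\<in>roots_of_unity. fscale (- (red q powi (- m))) (act (om e q) charI))"
proof -
  show "(e_id m :: ('p, 'k) endo) \<in> hecke"
    unfolding e_id_False by (rule hecke_lincomb) (rule tau_om(1))
  have sum_apply: "(\<Sum>q\<in>Q. F q) f = (\<Sum>q\<in>Q. F q f)" for F :: "'p padic_int \<Rightarrow> ('p, 'k) endo" and f Q
    by (induction Q rule: infinite_finite_induct) simp_all
  have F: "(e_id m :: ('p, 'k) endo) charI = (\<Sum>q\<in>roots_of_unity. fscale (- (red q powi (- m))) (act (om False q) charI))" for m
    unfolding e_id_False sum_apply by (rule sum.cong[OF refl]) (simp add: tau_om(2))
  show "(e_id (if e then - m else m) :: ('p, 'k) endo) charI =
     (\<Sum>q\<in>roots_of_unity. fscale (- (red q powi (- m))) (act (om e q) charI))"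
  proof (cases e)
    case True
    define rinv where "rinv = (\<lambda>q :: 'p padic_int. q ^ (CARD('p) - 2))"
    have Suc: "Suc (CARD('p) - 2) = CARD('p) - 1" using p_gt_1[where 'p='p] by simp
    have rinv: "q * rinv q = 1" if "q \<in> roots_of_unity" for q
    proof -
      have "q * rinv q = q ^ Suc (CARD('p) - 2)" by (simp add: rinv_def)
      then show ?thesis unfolding Suc using that by (simp add: roots_of_unity_def)
    qed
    have inv_in: "rinv q \<in> roots_of_unity" if "q \<in> roots_of_unity" for q
    proof -
      have "rinv q ^ (CARD('p) - 1) = (q ^ (CARD('p) - 1)) ^ (CARD('p) - 2)"
        unfolding rinv_def power_mult[symmetric] by (simp only: mult.commute)
      then show ?thesis using that by (simp add: roots_of_unity_def)
    qed
    have inv_inv: "rinv (rinv q) = q" if "q \<in> roots_of_unity" for q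
    proof -
      have "rinv (rinv q) = (q * rinv q) * rinv (rinv q)" using rinv[OF that] by simp
      also have "\<dots> = q * (rinv q * rinv (rinv q))" by (simp only: mult.assoc)
      finally show ?thesis using rinv[OF inv_in[OF that]] by simp
    qed
    have bij: "bij_betw rinv roots_of_unity roots_of_unity"
      by (rule bij_betw_byWitness[where f' = rinv]) (use inv_inv inv_in in auto)
    have 1: "red (rinv q) powi m = (red q powi (- m) :: 'k)" if q: "q \<in> roots_of_unity" for q
    proof -
      have "red q * red (rinv q) = (1 :: 'k)" using rinv[OF q] by (simp add: red_mult[OF char, symmetric] red_1[OF char])
      then have "red (rinv q) = (inverse (red q) :: 'k)" by (rule inverse_unique[symmetric])
      then show ?thesis by (simp add: power_int_minus power_int_inverse)
    qed
    have 2: "om False (rinv q) = om True q" if q: "q \<in> roots_of_unity" for q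
    proof -
      have "of_Zp q * of_Zp (rinv q) = (1 :: 'p padic)" using rinv[OF q] by (simp add: of_Zp_mult[symmetric])
      then have "of_Zp (rinv q) = (inverse (of_Zp q) :: 'p padic)" by (rule inverse_unique[symmetric])
      then show ?thesis by (simp add: om_def mt_def)
    qed
    have "(e_id (- m) :: ('p, 'k) endo) charI = (\<Sum>q\<in>roots_of_unity. fscale (- (red q powi m)) (act (om False q) charI))"
      unfolding F by simp
    also have "\<dots> = (\<Sum>q\<in>roots_of_unity. fscale (- (red (rinv q) powi m)) (act (om False (rinv q)) charI))"
      by (rule sum.reindex_bij_betw[OF bij, symmetric])
    also have "\<dots> = (\<Sum>q\<in>roots_of_unity. fscale (- (red q powi (- m))) (act (om True q) charI))"
      by (rule sum.cong[OF refl]) (simp add: 1 2)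
    finally show ?thesis using True by simp
  qed (simp add: F)
qed

lemma e_id_act:
  assumes c: "(c :: 'p mat \<Rightarrow> 'p mat \<Rightarrow> 'k) \<in> Z1 (rspace \<X>)"
  shows "e_cocycle e m c \<in> Z1 (rspace \<X>)"
    and "e_id (if e then - m else m) \<cdot> coh_class (rspace \<X>) c = coh_class (rspace \<X>) (e_cocycle e m c)"
proof -
  note * = hecke_act_coh_class[OF e_id_charI(1)[of "if e then - m else m"] c finite_roots_of_unity, of "om e"
      "\<lambda>q. - (red q powi (- m))" "\<lambda>_ q. q" "e_cocycle e m c", OF _ e_id_charI(2)]
  have b: "bij_betw (\<lambda>q. q) A A" for A :: "'p padic_int set" by (simp add: bij_betw_def)
  have conj: "adj (om e q) ** g ** om e q \<in> iwahori" if "g \<in> iwahori" "q \<in> roots_of_unity" for g :: "'p mat" and q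
    using om_conj_iwahori[OF that(2)] that(1) by simp
  show "e_cocycle e m c \<in> Z1 (rspace \<X>)"
    by (rule *(1)) (simp_all add: e_cocycle_def b conj)
  show "e_id (if e then - m else m) \<cdot> coh_class (rspace \<X>) c = coh_class (rspace \<X>) (e_cocycle e m c)"
    by (rule *(2)) (simp_all add: e_cocycle_def b conj)
qed

end


section \<open>The values of the products\<close>

subsection \<open>Products of double cosets\<close>

lemma conj_right: "n \<in> carrier SL2 \<Longrightarrow> x ** n = n ** (adj n ** x ** n)"
  by (simp add: matrix_mul_assoc)

text \<open>Both sides of \<open>hi = i(i\<^sup>-\<^sup>1hi)\<close> are expanded by the cocycle relation and evaluated at \<open>in\<close>; the terms with \<open>c(i)\<close>
  agree, because \<open>h\<close> fixes the coset \<open>inI\<close>.\<close>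

lemma Z1_conj_eval:
  assumes c: "c \<in> Z1 (rspace \<X>)" and i: "i \<in> iwahori" and h: "h \<in> iwahori"
    and n: "n \<in> carrier SL2" and k: "adj i ** h ** i \<in> stab n"
  shows "c h (i ** n) = c (adj i ** h ** i) n"
proof -
  define k where "k = adj i ** h ** i"
  note S = iwahori_SL2[OF i] iwahori_SL2[OF h]
  have ks: "k \<in> stab n" using assms(5) by (simp add: k_def)
  have ik: "i ** k = h ** i" using S by (simp add: k_def matrix_mul_assoc[symmetric])
  have "c h + act h (c i) = c i + act i (c k)"
    using Z1_mult[OF c h i] Z1_mult[OF c i stab_iwahori[OF ks]] ik by simp
  then have "(c h + act h (c i)) (i ** n) = (c i + act i (c k)) (i ** n)" by (rule fun_cong)
  then have eq: "c h (i ** n) + c i (adj h ** (i ** n)) = c i (i ** n) + c k n"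
    using S by (simp add: act_apply)
  have "adj h ** i = i ** adj k" using S by (simp add: k_def adj_mult matrix_mul_assoc)
  then have "adj h ** (i ** n) = i ** (adj k ** n)" by (simp add: matrix_mul_assoc)
  also have "\<dots> = (i ** n) ** (adj n ** adj k ** n)" using conj_right[OF n, of "adj k"] by (simp add: matrix_mul_assoc)
  finally have "c i (adj h ** (i ** n)) = c i (i ** n)"
    using X_right[OF Z1_in[OF c i] stab_conj[OF stab_adj[OF ks]]] by simp
  then show ?thesis using eq by (simp add: k_def)
qed

lemma Z1_Xw_support: "c \<in> Z1 (Xw w) \<Longrightarrow> g \<in> iwahori \<Longrightarrow> y \<notin> IwI w \<Longrightarrow> c g y = 0"
proof -
  assume "c \<in> Z1 (Xw w)" "g \<in> iwahori" and y: "y \<notin> IwI w"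
  then have "c g \<in> Xw w" using Z1_in by blast
  then show ?thesis using y by (auto simp: Xw_def)
qed

lemma IwI_level:
  assumes n: "level e n l" and m: "level e m l'" and "m \<in> IwI (cls n)"
  shows "l = l'"
proof -
  have "m ** adj n \<in> torus0" using IwI_unique[OF assms] torus1_torus0 by blast
  then have "level e ((m ** adj n) ** n) l" by (rule level_torus0_left[OF _ n])
  then show ?thesis using level_unique[OF m] level_SL2[OF n] by simp
qed

lemma level_om: "q \<in> roots_of_unity \<Longrightarrow> level e n l \<Longrightarrow> level e (om e q ** n) l"
  by (rule level_torus0_left[OF om_torus0])

text \<open>The Bruhat decomposition of a lower triangular unipotent matrix with a unit \<open>r\<close> as its entry.\<close>

lemma low_decomp:
  assumes r: "punit r"
  shows "low e r = upp e (inverse r) ** mt e 0 (- inverse r) r 0 ** upp e (inverse r)"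
    and "level e (mt e 0 (- inverse r) r 0) 1"
proof -
  have r0: "r \<noteq> 0" by (rule punit_neq_0[OF r])
  show "low e r = upp e (inverse r) ** mt e 0 (- inverse r) r 0 ** upp e (inverse r)"
    using r0 by (simp add: low_def upp_def mt_mult)
  show "level e (mt e 0 (- inverse r) r 0) 1"
    by (rule level_antidiagI[where k = 0 and u = "- inverse r"]) (use r0 punit_inverse[OF r] in simp_all)
qed

lemma upp_conj_iwahori: "level e n l \<Longrightarrow> l \<le> 0 \<Longrightarrow> r \<in> pideal 0 \<Longrightarrow> adj n ** upp e r ** n \<in> iwahori"
  unfolding upp_def level_conj_iwahori_iff using pideal_mono[of l 0 r] by simp

lemma low_conj_iwahori: "level e n l \<Longrightarrow> l \<ge> 1 \<Longrightarrow> r \<in> pideal 0 \<Longrightarrow> adj n ** low e r ** n \<in> iwahori"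
  unfolding low_def level_conj_iwahori_iff using pideal_mono[of "1 - l" 0 r] by simp

lemma punit_inverse_pideal: "punit r \<Longrightarrow> inverse r \<in> pideal 0"
  by (simp add: punit_iff)

lemma punit_pideal: "punit r \<Longrightarrow> r \<in> pideal 0"
  by (simp add: punit_iff)

lemma low_IwI:
  assumes n: "level e n l" and l: "l \<le> 0" and r: "punit r"
  shows "low e r ** n \<in> IwI (cls (mt e 0 (- inverse r) r 0 ** n))"
proof -
  let ?M = "mt e 0 (- inverse r) r 0" and ?u = "upp e (inverse r)"
  have u: "inverse r \<in> pideal 0" by (rule punit_inverse_pideal[OF r])
  have "low e r ** n = ?u ** (?M ** n) ** (adj n ** ?u ** n)"
    using level_SL2[OF n] by (simp add: low_decomp(1)[OF r] matrix_mul_assoc[symmetric])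
  then show ?thesis
    using upp_iwahori[OF u, of e] upp_conj_iwahori[OF n l u] unfolding IwI_cls by blast
qed

text \<open>An element \<open>i\<close> of \<open>I\<close> with first row \<open>(A, B)\<close> is the product of a lower triangular matrix, which \<open>s\<close>
  conjugates into an upper triangular one in \<open>I\<close>, and of the upper triangular unipotent matrix with entry \<open>B/A\<close>, which
  \<open>s\<close> conjugates into \<open>low e r\<close> with \<open>r = - B/A\<close>.\<close>

lemma srep_mult_iwahori:
  fixes i :: "'p::prime_card mat"
  assumes i: "i \<in> iwahori"
  shows "\<exists>U\<in>iwahori. \<exists>r\<in>pideal 0. srep e a ** i = U ** low e r ** srefl e"
proof -
  obtain A B C D where ii: "i = mt e A B C D" by (rule mt_cases)
  have *: "A - 1 \<in> pideal 1" "B \<in> pideal 0" "C \<in> pideal 1" "D - 1 \<in> pideal 1" "A * D - B * C = 1"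
    using i by (auto simp: ii mt_iwahori_iff)
  note A = punit_near_1[OF *(1)] and A0 = punit_neq_0[OF punit_near_1[OF *(1)]]
  note Ai = punit_inverse_pideal[OF A] and A' = punit_pideal[OF A]
  define r where "r = - (B * inverse A)"
  define U where "U = mt e (D - C * B * inverse A) (of_nat a * A - C) 0 A"
  have r: "r \<in> pideal 0" unfolding r_def pideal_uminus_iff by (rule pideal_mult_le[OF *(2) Ai]) simp
  have CBA: "C * B * inverse A \<in> pideal 1" by (rule pideal_mult_le[OF pideal_mult[OF *(3,2)] Ai]) simp
  have C0: "C \<in> pideal 0" using *(3) by (rule pideal_mono[rotated]) simp
  have aA: "of_nat a * A \<in> pideal 0" by (rule pideal_mult_le[OF pideal_of_nat A']) simp
  have "D - 1 - C * B * inverse A \<in> pideal 1" using *(4) CBA by (rule pideal_diff)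
  then have 1: "D - C * B * inverse A - 1 \<in> pideal 1" by (simp add: algebra_simps)
  have "(D - C * B * inverse A) * A - (of_nat a * A - C) * 0 = A * D - B * C"
    using A0 by (simp add: algebra_simps)
  then have U: "U \<in> iwahori" unfolding U_def mt_iwahori_iff using 1 *(1,5) pideal_diff[OF aA C0] by simp
  have "U ** low e r ** srefl e = mt e (- (of_nat a * A - C)) (D - C * B * inverse A + (of_nat a * A - C) * r) (- A) (A * r)"
    by (simp add: U_def low_def srefl_def mt_mult)
  also have "D - C * B * inverse A + (of_nat a * A - C) * r = D - of_nat a * B"
    using A0 by (simp add: r_def algebra_simps)
  also have "A * r = - B" using A0 by (simp add: r_def)
  finally have "U ** low e r ** srefl e = srep e a ** i" by (simp add: ii srep_def mt_mult)
  then show ?thesis using U r by metis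
qed

text \<open>After \<open>srep_mult_iwahori\<close>, the factor \<open>low e r ** srefl e\<close> is \<open>srefl e\<close> times an upper triangular
  unipotent matrix, which \<open>n\<^sup>-\<^sup>1\<close> conjugates into \<open>I\<close>.\<close>

lemma srep_IwI_up:
  assumes n: "level e n l" and l: "l \<le> 0" and y: "y \<in> IwI (cls n)"
  shows "srep e a ** y \<in> IwI (cls (srefl e ** n))"
proof -
  obtain i j where y': "y = i ** n ** j" "i \<in> iwahori" "j \<in> iwahori" using y unfolding IwI_cls by blast
  obtain U r where U: "U \<in> iwahori" "r \<in> pideal 0" "srep e a ** i = U ** low e r ** srefl e"
    using srep_mult_iwahori[OF y'(2), of e a] by blast
  have r: "- r \<in> pideal 0" using U(2) by simp
  have "low e r ** srefl e = srefl e ** upp e (- r)" by (simp add: low_def srefl_def upp_def mt_mult)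
  then have "srep e a ** y = U ** (srefl e ** upp e (- r)) ** n ** j"
    using U(3) by (simp add: y'(1) matrix_mul_assoc) (simp add: matrix_mul_assoc[symmetric])
  also have "\<dots> = U ** ((srefl e ** n) ** (adj n ** upp e (- r) ** n)) ** j"
    using level_SL2[OF n] by (simp add: matrix_mul_assoc[symmetric])
  finally show ?thesis
    using U(1) y'(3) upp_conj_iwahori[OF n l r] by (simp only: IwI_left IwI_right IwI_self)
qed

text \<open>After \<open>srep_mult_iwahori\<close>, there are two cases: for \<open>r\<close> in \<open>p\<int>\<^sub>p\<close>, the matrix \<open>low e r\<close> lies in \<open>I\<close>, and for a unit \<open>r\<close>,
  its Bruhat decomposition leads to \<open>om e q\<close>, where \<open>q\<close> is the Teichmueller representative of \<open>r\<close>.\<close>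

lemma srep_IwI_down:
  fixes n :: "'p::prime_card mat"
  assumes n: "level e n l" and l: "l \<ge> 1" and y: "y \<in> IwI (cls n)"
  shows "srep e a ** y \<in> IwI (cls (srefl e ** n)) \<or> (\<exists>q\<in>roots_of_unity. srep e a ** y \<in> IwI (cls (om e q ** n)))"
proof -
  obtain i j where y': "y = i ** n ** j" "i \<in> iwahori" "j \<in> iwahori" using y unfolding IwI_cls by blast
  obtain U r where U: "U \<in> iwahori" "r \<in> pideal 0" "srep e a ** i = U ** low e r ** srefl e"
    using srep_mult_iwahori[OF y'(2), of e a] by blast
  define m where "m = srefl e ** n"
  have m: "level e m (1 - l)" unfolding m_def by (rule level_srefl_mult[OF n])
  have eq: "srep e a ** y = U ** (low e r ** m) ** j"
    using U(3) by (simp add: y'(1) m_def matrix_mul_assoc)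
  have red: "srep e a ** y \<in> IwI (cls x) \<longleftrightarrow> low e r ** m \<in> IwI (cls x)" for x
    unfolding eq IwI_right[OF y'(3)] IwI_left[OF U(1)] ..
  show ?thesis
  proof (cases "r \<in> pideal 1")
    case True
    then have "low e r ** m \<in> IwI (cls m)" using IwI_left[OF low_iwahori[THEN iffD2]] IwI_self by blast
    then show ?thesis unfolding red m_def by blast
  next
    case False
    then have r: "punit r" using U(2) by (simp add: punit_def)
    obtain x where x: "r = of_Zp x" using U(2) by (auto simp: pideal_0_iff)
    have "\<not> pZ dvd x" using r by (simp add: x punit_of_Zp)
    then obtain q where q: "q \<in> roots_of_unity" "pZ dvd x - q" using roots_of_unity_representative by blast
    have Q: "punit (of_Zp q)" by (rule of_Zp_root[OF q(1)])
    note Q0 = punit_neq_0[OF Q] and r0 = punit_neq_0[OF r]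
    have rq: "r - of_Zp q \<in> pideal 1"
      unfolding x of_Zp_diff[symmetric] pideal_1_iff using q(2) by (auto simp: dvd_def)
    define t where "t = mt e (of_Zp q * inverse r) 0 0 (r * inverse (of_Zp q))"
    have near: "y * inverse z - 1 \<in> pideal 1" if "punit z" "y - z \<in> pideal 1" for y z :: "'p padic"
    proof -
      have "y * inverse z - 1 = inverse z * (y - z)" using punit_neq_0[OF that(1)] by (simp add: algebra_simps)
      then show ?thesis using that(2) punit_mult_pideal_iff[OF punit_inverse[OF that(1)]] by simp
    qed
    have qr: "of_Zp q - r \<in> pideal 1" using pideal_uminus[OF rq] by simp
    have det: "of_Zp q * inverse r * (r * inverse (of_Zp q)) = 1" using Q0 r0 by (simp only: field_simps) simp
    have t: "t \<in> torus1"
      unfolding t_def mt_torus1_iff using near[OF r qr] near[OF Q rq] det by simp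
    have "mt e 0 (- inverse r) r 0 ** srefl e = om e q ** t"
      using Q0 r0 by (simp add: om_def t_def srefl_def mt_mult field_simps)
    then have "mt e 0 (- inverse r) r 0 ** m = om e q ** t ** n"
      by (simp only: m_def matrix_mul_assoc)
    also have "\<dots> = (om e q ** n) ** (adj n ** t ** n)"
      using level_SL2[OF n] by (simp add: matrix_mul_assoc[symmetric])
    finally have M: "mt e 0 (- inverse r) r 0 ** m = (om e q ** n) ** (adj n ** t ** n)" .
    have J: "adj n ** t ** n \<in> iwahori" using level_conj_torus(1)[OF n t] torus1_iwahori by blast
    have "low e r ** m \<in> IwI (cls (mt e 0 (- inverse r) r 0 ** m))"
      by (rule low_IwI[OF m _ r]) (use l in simp)
    then obtain i' j' where "low e r ** m = i' ** ((om e q ** n) ** (adj n ** t ** n)) ** j'" "i' \<in> iwahori" "j' \<in> iwahori"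
      unfolding IwI_cls M by blast
    then have "low e r ** m \<in> IwI (cls (om e q ** n))" using J by (simp only: IwI_left IwI_right IwI_self)
    then show ?thesis unfolding red using q(1) by blast
  qed
qed

lemma pideal_0_mult: "x \<in> pideal 0 \<Longrightarrow> y \<in> pideal 0 \<Longrightarrow> x * y \<in> pideal 0"
  using pideal_mult[of x 0 y 0] by simp

subsection \<open>The operator of a reflection\<close>

lemma tau_cocycle_apply:
  "tau_cocycle e c g y = (\<Sum>a<CARD('p). c (adj (srep e a) ** g ** srep e (srho e g a)) (adj (srep e a) ** y))"
  for c :: "'p::prime_card mat \<Rightarrow> 'p mat \<Rightarrow> 'k::field"
  by (simp add: tau_cocycle_def sum_fun_apply act_apply)

lemma tau_cocycle_support:
  fixes c :: "'p::prime_card mat \<Rightarrow> 'p mat \<Rightarrow> 'k::field"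
  assumes c: "c \<in> Z1 (Xw (cls n))" and g: "g \<in> iwahori" and y: "tau_cocycle e c g y \<noteq> 0"
  shows "\<exists>a. \<exists>x\<in>IwI (cls n). y = srep e a ** x"
proof -
  obtain a where a: "a < CARD('p)" "c (adj (srep e a) ** g ** srep e (srho e g a)) (adj (srep e a) ** y) \<noteq> 0"
    using y unfolding tau_cocycle_apply by (metis (no_types, lifting) lessThan_iff sum.neutral)
  have "adj (srep e a) ** y \<in> IwI (cls n)" using Z1_Xw_support[OF c srho(2)[OF g]] a(2) by blast
  moreover have "y = srep e a ** (adj (srep e a) ** y)" by simp
  ultimately show ?thesis by blast
qed

lemma srep_0: "srep e 0 = srefl e"
  by (simp add: srep_def srefl_def)

lemma adj_srep_srefl: "adj (srep e a) ** (srefl e ** n) = low e (of_nat a) ** n"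
  for n :: "'p::prime_card mat"
proof -
  have "adj (srep e a) ** srefl e = (low e (of_nat a) :: 'p mat)" by (simp add: srep_def srefl_def low_def mt_mult)
  then show ?thesis by (simp add: matrix_mul_assoc)
qed

lemma adj_srep_conj:
  "adj (srep e a) ** mt e A B C D ** srep e b =
     mt e (C * of_nat b + D) (- C) (- ((A - of_nat a * C) * of_nat b + B - of_nat a * D)) (A - of_nat a * C)"
  by (simp add: srep_def mt_mult algebra_simps)

text \<open>The group \<open>I\<close> permutes the cosets in \<open>IsI\<close> through its upper right entry modulo \<open>p\<close>, by translations of their
  numbers.\<close>

lemma srho_fixed:
  assumes g: "mt e A B C D \<in> iwahori" and B: "B \<in> pideal 1" and a: "a < CARD('p)"
  shows "srho e (mt e A B C D :: 'p::prime_card mat) a = a"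
proof (rule srho_eqI[OF g a])
  have *: "A - 1 \<in> pideal 1" "C \<in> pideal 1" "D - 1 \<in> pideal 1" "A * D - B * C = 1"
    using g by (auto simp: mt_iwahori_iff)
  have a0: "of_nat a \<in> (pideal 0 :: 'p padic set)" by simp
  have Ca: "of_nat a * C \<in> pideal 1" by (rule pideal_mult_le[OF a0 *(2)]) simp
  have 1: "C * of_nat a + D - 1 \<in> pideal 1" using pideal_add[OF Ca *(3)] by (simp add: algebra_simps)
  have 2: "A - of_nat a * C - 1 \<in> pideal 1" using pideal_diff[OF *(1) Ca] by (simp add: algebra_simps)
  have "of_nat a * (A - 1) \<in> pideal 1" "of_nat a * (of_nat a * C) \<in> pideal 1" "of_nat a * (D - 1) \<in> pideal 1"
    by (rule pideal_mult_le[OF a0 *(1)], simp, rule pideal_mult_le[OF a0 Ca], simp, rule pideal_mult_le[OF a0 *(3)], simp)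
  then have "of_nat a * (A - 1) - of_nat a * (of_nat a * C) + B - of_nat a * (D - 1) \<in> pideal 1"
    using B by (intro pideal_add pideal_diff)
  then have 3: "(A - of_nat a * C) * of_nat a + B - of_nat a * D \<in> pideal 1" by (simp add: algebra_simps)
  have "(C * of_nat a + D) * (A - of_nat a * C) - - C * - ((A - of_nat a * C) * of_nat a + B - of_nat a * D) = A * D - B * C"
    by (simp add: algebra_simps)
  then have det: "(C * of_nat a + D) * (A - of_nat a * C) - - C * - ((A - of_nat a * C) * of_nat a + B - of_nat a * D) = 1"
    unfolding *(4) .
  have "C \<in> pideal 0" using *(2) by (rule pideal_mono[rotated]) simp
  then show "adj (srep e a) ** mt e A B C D ** srep e a \<in> iwahori"
    unfolding adj_srep_conj mt_iwahori_iff pideal_uminus_iff using 1 2 3 det by blast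
qed

context
  assumes char: "CHAR('k::field) = CARD('p::prime_card)"
begin

text \<open>For \<open>a \<noteq> 0\<close>, the Bruhat decomposition of \<open>low e (of_nat a)\<close> shows that \<open>adj (srep e a) ** (srefl e ** n)\<close> lies
  in a double coset of level \<open>1 - l \<noteq> l\<close>; so only \<open>a = 0\<close> contributes to the value at \<open>sn\<close>.\<close>

lemma tau_cocycle_up:
  assumes c: "triple_cocycle e n l \<kappa>m \<kappa>0 \<kappa>p (c :: 'p mat \<Rightarrow> 'p mat \<Rightarrow> 'k)" and l: "l \<le> 0"
  shows "triple_cocycle e (srefl e ** n) (1 - l) 0 (- \<kappa>0) (- \<kappa>m) (tau_cocycle e c)"
  unfolding triple_cocycle_def
proof (intro conjI allI impI)
  note n = triple_cocycle_level[OF c] and cZ = triple_cocycle_Z1[OF c]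
  note S = level_SL2[OF n]
  show sn: "level e (srefl e ** n) (1 - l)" by (rule level_srefl_mult[OF n])
  have tZ: "tau_cocycle e c \<in> Z1 (rspace \<X>)" by (rule tau_srefl_act(1)[OF Z1_Xw[OF cZ]])
  show "tau_cocycle e c \<in> Z1 (Xw (cls (srefl e ** n)))"
  proof (rule Z1_subset[OF tZ])
    fix g :: "'p mat" assume g: "g \<in> iwahori"
    have "y \<in> IwI (cls (srefl e ** n))" if "tau_cocycle e c g y \<noteq> 0" for y
      using tau_cocycle_support[OF cZ g that] srep_IwI_up[OF n l] by blast
    then show "tau_cocycle e c g \<in> Xw (cls (srefl e ** n))" using Z1_in[OF tZ g] by (simp add: Xw_def)
  qed
  fix A B C D assume g: "mt e A B C D \<in> stab (srefl e ** n)"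
  have *: "A - 1 \<in> pideal 1" "B \<in> pideal (max 0 (1 - l))" "C \<in> pideal (max 1 (1 - (1 - l)))" "D - 1 \<in> pideal 1" "A * D - B * C = 1"
    using g unfolding mt_stab_iff[OF sn] by auto
  have m: "max 0 (1 - l) = 1 - l" "max 1 (1 - (1 - l)) = 1" "max 1 (1 - l) = 1 - l" "max 0 l = 0" using l by simp_all
  have B1: "B \<in> pideal 1" using *(2) unfolding m by (rule pideal_mono[rotated]) (use l in simp)
  have C0: "C \<in> pideal 0" using *(3) by (rule pideal_mono[rotated]) simp
  let ?g = "mt e A B C D" and ?k = "mt e D (- C) (- B) A"
  have k: "adj (srep e 0) ** ?g ** srep e (srho e ?g 0) = ?k"
    unfolding srho_fixed[OF stab_iwahori[OF g] B1 zero_less_card_finite] adj_srep_conj by simp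
  have kI: "?k \<in> stab n"
    unfolding mt_stab_iff[OF n] m pideal_uminus_iff using *(1,4,5) *(2)[unfolded m] C0 by (simp add: mult.commute)
  have "c (adj (srep e a) ** ?g ** srep e (srho e ?g a)) (adj (srep e a) ** (srefl e ** n)) = (if a = 0 then c ?k n else 0)"
    if a: "a < CARD('p)" for a
  proof (cases "a = 0")
    case True
    have "adj (srep e 0) ** (srefl e ** n) = n" by (simp add: srep_0)
    then show ?thesis using True k by simp
  next
    case False
    have r: "punit (of_nat a :: 'p padic)"
      using of_nat_pideal_diff[of a 0, where 'p='p] a False by (simp add: punit_def)
    have "low e (of_nat a) ** n \<notin> IwI (cls n)"
    proof
      assume low: "low e (of_nat a) ** n \<in> IwI (cls n)"
      let ?M = "mt e 0 (- inverse (of_nat a)) (of_nat a) 0"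
      have M: "level e (?M ** n) (1 - l)" using level_mult[OF low_decomp(2)[OF r] n] by simp
      obtain i j where ij: "low e (of_nat a) ** n = i ** (?M ** n) ** j" "i \<in> iwahori" "j \<in> iwahori"
        using low_IwI[OF n l r] unfolding IwI_cls by blast
      have "?M ** n \<in> IwI (cls n)" using low unfolding ij(1) IwI_right[OF ij(3)] IwI_left[OF ij(2)] .
      then have "l = 1 - l" by (rule IwI_level[OF n M])
      then show False by presburger
    qed
    then show ?thesis
      using False Z1_Xw_support[OF cZ srho(2)[OF stab_iwahori[OF g]]] by (simp add: adj_srep_srefl)
  qed
  then have "tau_cocycle e c ?g (srefl e ** n) = (\<Sum>a<CARD('p). if a = 0 then c ?k n else 0)"
    unfolding tau_cocycle_apply by (intro sum.cong[OF refl]) simp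
  also have "\<dots> = c ?k n" by simp
  also have "\<dots> = \<kappa>m * residue (pQ powi (- max 1 (1 - l)) * - B) + \<kappa>0 * residue ((D - 1) / pQ) + \<kappa>p * residue (pQ powi (- max 0 l) * - C)"
    by (rule triple_cocycle_eval[OF c kI])
  also have "residue (pQ powi (- max 0 l) * - C) = (0 :: 'k)"
    unfolding m by (rule residue_eq_0[OF char]) (use *(3)[unfolded m] in simp)
  also have "residue ((D - 1) / pQ) = (- residue ((A - 1) / pQ) :: 'k)"
    by (rule residue_diagonal[OF char sn g]) (use l in simp)
  also have "residue (pQ powi (- max 1 (1 - l)) * - B) = (- residue (pQ powi (- max 0 (1 - l)) * B) :: 'k)"
    unfolding m using residue_uminus[OF char pideal_normalize[OF char *(2)[unfolded m]]] by simp
  finally show "tau_cocycle e c ?g (srefl e ** n) =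
      0 * residue (pQ powi - max 1 (1 - (1 - l)) * C) + - \<kappa>0 * residue ((A - 1) / pQ) + - \<kappa>m * residue (pQ powi - max 0 (1 - l) * B)"
    by simp
qed

lemma sum_squares: "6 * (\<Sum>a<N. of_nat a * of_nat a) = of_nat N * (of_nat N - 1) * (2 * of_nat N - (1 :: 'k))"
  by (induction N) (simp_all add: algebra_simps)

lemma sum_linear: "2 * (\<Sum>a<N. of_nat a) = of_nat N * (of_nat N - (1 :: 'k))"
  by (induction N) (simp_all add: algebra_simps)

lemma of_nat_p: "of_nat CARD('p) = (0 :: 'k)"
  using of_nat_CHAR[where 'a='k] unfolding char .

lemma power_sums_zero:
  assumes "CARD('p) \<noteq> 2" "CARD('p) \<noteq> 3"
  shows "(\<Sum>a<CARD('p). of_nat a) = (0 :: 'k)" and "(\<Sum>a<CARD('p). of_nat a * of_nat a) = (0 :: 'k)"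
proof -
  have p: "prime CARD('p)" by (rule prime_card)
  have 2: "\<not> CARD('p) dvd 2" using p assms(1) by (metis primes_dvd_imp_eq two_is_prime_nat)
  have "prime (3 :: nat)" by simp
  then have 3: "\<not> CARD('p) dvd 3" using p assms(2) by (metis primes_dvd_imp_eq)
  have "\<not> CARD('p) dvd 2 * 3" using 2 3 p prime_dvd_mult_iff by blast
  then have "of_nat 2 \<noteq> (0 :: 'k)" "of_nat 6 \<noteq> (0 :: 'k)" using 2 unfolding of_nat_eq_0_iff_char_dvd char by simp_all
  then have "(2 :: 'k) \<noteq> 0" "(6 :: 'k) \<noteq> 0" by simp_all
  then show "(\<Sum>a<CARD('p). of_nat a) = (0 :: 'k)" and "(\<Sum>a<CARD('p). of_nat a * of_nat a) = (0 :: 'k)"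
    using sum_linear[of "CARD('p)"] sum_squares[of "CARD('p)"] by (simp_all add: of_nat_p)
qed

text \<open>All cosets contribute.  Let the argument map the coset with number \<open>b\<close> to the one with number \<open>a\<close>.  The
  contribution of \<open>a\<close> is a linear combination of \<open>1\<close>, \<open>a\<close>, \<open>b\<close>, \<open>ab\<close> and the carry \<open>(b + B - a)/p\<close>.  As \<open>a \<mapsto> b\<close> is a
  permutation, the sum of the carries is \<open>B\<close>.  As this permutation is a translation modulo \<open>p\<close>, the sums of
  the other terms are combinations of \<open>\<Sum>1\<close>, \<open>\<Sum>a\<close> and \<open>\<Sum>a\<^sup>2\<close>, which vanish for \<open>p \<noteq> 2, 3\<close>.\<close>

lemma tau_cocycle_down_srefl:
  assumes p: "CARD('p) \<noteq> 2" "CARD('p) \<noteq> 3"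
    and c: "triple_cocycle e n l \<kappa>m \<kappa>0 \<kappa>p (c :: 'p mat \<Rightarrow> 'p mat \<Rightarrow> 'k)" and l: "l \<ge> 1"
    and g: "mt e A B C D \<in> stab (srefl e ** n)"
  shows "tau_cocycle e c (mt e A B C D) (srefl e ** n) = - \<kappa>m * residue B"
proof -
  note n = triple_cocycle_level[OF c] and cZ = triple_cocycle_Z1[OF c]
  note S = level_SL2[OF n]
  have sn: "level e (srefl e ** n) (1 - l)" by (rule level_srefl_mult[OF n])
  have m: "max 0 (1 - l) = 0" "max 1 (1 - (1 - l)) = l" "max 1 (1 - l) = 1" "max 0 l = l" using l by simp_all
  have *: "A - 1 \<in> pideal 1" "B \<in> pideal 0" "C \<in> pideal l" "D - 1 \<in> pideal 1" "A * D - B * C = 1"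
    using g unfolding mt_stab_iff[OF sn] m by auto
  have C1: "C \<in> pideal 1" using *(3) by (rule pideal_mono[rotated]) (rule l)
  let ?g = "mt e A B C D"
  have gI: "?g \<in> iwahori" by (rule stab_iwahori[OF g])
  define b where "b = srho e ?g"
  define X where "X = (residue ((A - 1) / pQ) :: 'k)"
  define Z where "Z = (residue (C / pQ) :: 'k)"
  define W where "W = (residue ((D - 1) / pQ) :: 'k)"
  define R where "R = (\<lambda>a. (of_nat (b a) + B - of_nat a) / pQ :: 'p padic)"
  have Xin: "(A - 1) / pQ \<in> pideal 0" "C / pQ \<in> pideal 0" "(D - 1) / pQ \<in> pideal 0" using *(1,4) C1 by simp_all
  have h: "adj (srep e a) ** ?g ** srep e (b a) = mt e (C * of_nat (b a) + D) (- C) (- ((A - of_nat a * C) * of_nat (b a) + B - of_nat a * D)) (A - of_nat a * C)" for a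
    by (rule adj_srep_conj)
  have hI: "adj (srep e a) ** ?g ** srep e (b a) \<in> iwahori" for a unfolding b_def by (rule srho(2)[OF gI])
  have carry: "of_nat (b a) + B - of_nat a \<in> pideal 1" for a
  proof -
    have H: "(A - of_nat a * C) * of_nat (b a) + B - of_nat a * D \<in> pideal 1"
      using hI[of a] unfolding h mt_iwahori_iff pideal_uminus_iff by blast
    have H1: "of_nat (b a) * (A - 1) \<in> pideal 1" by (rule pideal_mult_le[OF pideal_of_nat *(1)]) simp
    have H2: "of_nat (a * b a) * C \<in> pideal 1" by (rule pideal_mult_le[OF pideal_of_nat C1]) simp
    have H3: "of_nat a * (D - 1) \<in> pideal 1" by (rule pideal_mult_le[OF pideal_of_nat *(4)]) simp
    have "(A - of_nat a * C) * of_nat (b a) + B - of_nat a * D - (of_nat (b a) * (A - 1) - of_nat (a * b a) * C - of_nat a * (D - 1)) \<in> pideal 1"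
      by (rule pideal_diff[OF H pideal_diff[OF pideal_diff[OF H1 H2] H3]])
    then show ?thesis by (simp add: algebra_simps)
  qed
  have Rin: "R a \<in> pideal 0" for a using carry[of a] by (simp add: R_def)
  have val: "c (adj (srep e a) ** ?g ** srep e (b a)) (adj (srep e a) ** (srefl e ** n)) =
      - \<kappa>m * (residue (R a) + of_nat (b a) * X - of_nat a * of_nat (b a) * Z - of_nat a * W)
      + \<kappa>0 * (of_nat (b a) * Z + W) - \<kappa>p * residue (pQ powi (- l) * C)" for a
  proof -
    let ?h = "adj (srep e a) ** ?g ** srep e (b a)"
    have "low e (of_nat a) ** n = n ** (adj n ** low e (of_nat a) ** n)" by (rule conj_right[OF S])
    then have e1: "c ?h (adj (srep e a) ** (srefl e ** n)) = c ?h n"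
      unfolding adj_srep_srefl
      using X_right[OF Z1_in[OF Z1_Xw[OF cZ] hI] low_conj_iwahori[OF n l pideal_of_nat]] by metis
    have "?h \<in> stab n"
      using hI[of a] *(3) unfolding h mt_stab_iff[OF n] mt_iwahori_iff m by simp
    then have e2: "c ?h n = \<kappa>m * residue (pQ powi (- max 1 (1 - l)) * - ((A - of_nat a * C) * of_nat (b a) + B - of_nat a * D))
        + \<kappa>0 * residue ((C * of_nat (b a) + D - 1) / pQ) + \<kappa>p * residue (pQ powi (- max 0 l) * - C)"
      unfolding h by (rule triple_cocycle_eval[OF c])
    have r1: "residue (pQ powi (- max 1 (1 - l)) * - ((A - of_nat a * C) * of_nat (b a) + B - of_nat a * D)) =
        - (residue (R a) + of_nat (b a) * X - of_nat a * of_nat (b a) * Z - of_nat a * W)"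
    proof -
      have "pQ powi (- max 1 (1 - l)) * - ((A - of_nat a * C) * of_nat (b a) + B - of_nat a * D) =
          - (R a + of_nat (b a) * ((A - 1) / pQ) - of_nat (a * b a) * (C / pQ) - of_nat a * ((D - 1) / pQ))"
        unfolding m R_def by (simp add: power_int_minus field_simps)
      moreover have "residue (- (r + of_nat i * x - of_nat j * z - of_nat k * w)) =
          (- (residue r + of_nat i * residue x - of_nat j * residue z - of_nat k * residue w) :: 'k)"
        if in0: "r \<in> pideal 0" "x \<in> pideal 0" "z \<in> pideal 0" "w \<in> pideal 0" for r x z w :: "'p padic" and i j k
        using in0 by (simp only: residue_uminus[OF char] residue_diff[OF char] residue_add[OF char] residue_mult[OF char]
            residue_of_nat[OF char] pideal_add pideal_diff pideal_0_mult pideal_of_nat)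
      note this[OF Rin Xin, of a "b a" "a * b a" a]
      ultimately show ?thesis by (simp only: X_def Z_def W_def of_nat_mult)
    qed
    have r2: "residue ((C * of_nat (b a) + D - 1) / pQ) = of_nat (b a) * Z + W"
    proof -
      have "(C * of_nat (b a) + D - 1) / pQ = of_nat (b a) * (C / pQ) + (D - 1) / pQ" by (simp add: field_simps)
      moreover have "of_nat (b a) * (C / pQ) \<in> pideal 0" by (rule pideal_mult_le[OF pideal_of_nat Xin(2)]) simp
      ultimately show ?thesis
        using Xin by (simp only: residue_add[OF char] residue_mult[OF char pideal_of_nat] residue_of_nat[OF char] Z_def W_def)
    qed
    have r3: "residue (pQ powi (- max 0 l) * - C) = (- residue (pQ powi (- l) * C) :: 'k)"
      unfolding m using residue_uminus[OF char pideal_normalize[OF char *(3)]] by simp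
    show ?thesis unfolding e1 e2 r1 r2 r3 by (simp add: algebra_simps)
  qed
  have bij: "bij_betw b {..<CARD('p)} {..<CARD('p)}" unfolding b_def by (rule srho_bij[OF gI])
  note zero = power_sums_zero[OF p]
  have Sb: "(\<Sum>a<CARD('p). of_nat (b a)) = (0 :: 'k)" using sum.reindex_bij_betw[OF bij, of "of_nat :: nat \<Rightarrow> 'k"] zero(1) by simp
  have bk: "of_nat (b a) = (of_nat a - residue B :: 'k)" for a
  proof -
    have "(of_nat (b a) :: 'p padic) - (of_nat a - B) \<in> pideal 1" using carry[of a] by (simp add: algebra_simps)
    then have "residue (of_nat (b a) :: 'p padic) = (residue (of_nat a - B) :: 'k)"
      by (rule residue_cong[OF char _ pideal_diff[OF pideal_of_nat *(2)]])
    then show ?thesis using residue_diff[OF char pideal_of_nat *(2)] by (simp add: residue_of_nat[OF char])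
  qed
  have Sab: "(\<Sum>a<CARD('p). of_nat a * of_nat (b a)) = (0 :: 'k)"
    unfolding bk right_diff_distrib sum_subtractf sum_distrib_right[symmetric] zero by simp
  have SR: "(\<Sum>a<CARD('p). residue (R a)) = (residue B :: 'k)"
  proof -
    have "(\<Sum>a<CARD('p). residue (R a)) = (residue (\<Sum>a<CARD('p). R a) :: 'k)"
      by (rule residue_sum[OF char, symmetric]) (use Rin in auto)
    also have "(\<Sum>a<CARD('p). R a) = ((\<Sum>a<CARD('p). of_nat (b a)) + (\<Sum>a<CARD('p). B) - (\<Sum>a<CARD('p). of_nat a)) / pQ"
      by (simp only: R_def sum_divide_distrib[symmetric] sum.distrib sum_subtractf)
    also have "\<dots> = B" using sum.reindex_bij_betw[OF bij, of "of_nat :: nat \<Rightarrow> 'p padic"] by simp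
    finally show ?thesis .
  qed
  have "tau_cocycle e c ?g (srefl e ** n) = (\<Sum>a<CARD('p). - \<kappa>m * (residue (R a) + of_nat (b a) * X - of_nat a * of_nat (b a) * Z - of_nat a * W)
      + \<kappa>0 * (of_nat (b a) * Z + W) - \<kappa>p * residue (pQ powi (- l) * C))"
    unfolding tau_cocycle_apply by (rule sum.cong[OF refl]) (simp only: val[unfolded b_def] b_def)
  also have "\<dots> = - \<kappa>m * ((\<Sum>a<CARD('p). residue (R a)) + (\<Sum>a<CARD('p). of_nat (b a)) * X - (\<Sum>a<CARD('p). of_nat a * of_nat (b a)) * Z - (\<Sum>a<CARD('p). of_nat a) * W)
      + \<kappa>0 * ((\<Sum>a<CARD('p). of_nat (b a)) * Z + of_nat CARD('p) * W) - \<kappa>p * (of_nat CARD('p) * residue (pQ powi (- l) * C))"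
    by (simp only: sum.distrib sum_subtractf sum_distrib_left[symmetric] sum_distrib_right[symmetric] sum_constant card_lessThan)
  also have "\<dots> = - \<kappa>m * residue B" unfolding SR Sb Sab zero of_nat_p by simp
  finally show ?thesis .
qed

end

subsection \<open>The idempotents\<close>

lemma e_cocycle_apply:
  "e_cocycle e m c g y = (\<Sum>q\<in>roots_of_unity. - (red q powi (- m)) * c (adj (om e q) ** g ** om e q) (adj (om e q) ** y))"
  for c :: "'p::prime_card mat \<Rightarrow> 'p mat \<Rightarrow> 'k::field"
  by (simp add: e_cocycle_def sum_fun_apply act_apply fscale_def)

lemma om_distinct:
  assumes n: "level e n l" and q: "q \<in> roots_of_unity" and q': "q' \<in> roots_of_unity"
    and *: "adj (om e q') ** (om e q ** n) \<in> IwI (cls n)"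
  shows "q' = (q :: 'p::prime_card padic_int)"
proof -
  let ?Q = "of_Zp q :: 'p padic" and ?Q' = "of_Zp q' :: 'p padic"
  have Q: "punit ?Q" "punit ?Q'" using q q' by (simp_all add: of_Zp_root)
  note Q0 = punit_neq_0[OF Q(1)] punit_neq_0[OF Q(2)]
  have "adj (om e q') \<in> torus0" using om_torus0[OF q', of e] level_adj[of e "om e q'" 0] by (simp add: level_torus0_iff)
  then have L: "level e (adj (om e q') ** (om e q ** n)) l" by (rule level_torus0_left[OF _ level_om[OF q n]])
  have "adj (om e q') ** (om e q ** n) ** adj n \<in> torus1" by (rule IwI_unique[OF n L *])
  moreover have "adj (om e q') ** (om e q ** n) ** adj n = adj (om e q') ** om e q"
    using level_SL2[OF n] by (simp add: matrix_mul_assoc[symmetric])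
  moreover have "adj (om e q') ** om e q = mt e (?Q' * inverse ?Q) 0 0 (inverse ?Q' * ?Q)"
    by (simp add: om_def mt_mult)
  ultimately have "?Q' * inverse ?Q - 1 \<in> pideal 1" by (simp add: mt_torus1_iff)
  then have "?Q * (?Q' * inverse ?Q - 1) \<in> pideal 1" using punit_mult_pideal_iff[OF Q(1)] by blast
  moreover have "?Q * (?Q' * inverse ?Q - 1) = of_Zp (q' - q)" using Q0 by (simp add: of_Zp_diff field_simps)
  ultimately have "pZ dvd q' - q" by (auto simp: pideal_1_iff dvd_def)
  then show ?thesis using q q' roots_of_unity_eqI[of q' q] unfolding roots_of_unity_def by blast
qed

lemma e_cocycle_support:
  fixes c :: "'p::prime_card mat \<Rightarrow> 'p mat \<Rightarrow> 'k::field"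
  assumes c: "c \<in> Z1 (Xw (cls n))" and g: "g \<in> iwahori" and y: "e_cocycle e m c g y \<noteq> 0"
  shows "\<exists>q\<in>roots_of_unity. y \<in> IwI (cls (om e q ** n))"
proof -
  obtain q where q: "q \<in> roots_of_unity" "c (adj (om e q) ** g ** om e q) (adj (om e q) ** y) \<noteq> 0"
    by (rule sum.not_neutral_contains_not_neutral[OF y[unfolded e_cocycle_apply]]) auto
  have S: "om e q \<in> carrier SL2" using q(1) by simp
  have "adj (om e q) ** g ** om e q \<in> iwahori" using om_conj_iwahori[OF q(1)] g by blast
  then have "adj (om e q) ** y \<in> IwI (cls n)" using Z1_Xw_support[OF c] q(2) by blast
  then obtain i j where ij: "adj (om e q) ** y = i ** n ** j" "i \<in> iwahori" "j \<in> iwahori" unfolding IwI_cls by blast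
  have "y = om e q ** (adj (om e q) ** y)" using S by simp
  also have "\<dots> = (om e q ** i ** adj (om e q)) ** (om e q ** n) ** j"
    unfolding ij(1) using S by (simp add: matrix_mul_assoc[symmetric])
  finally have y': "y = (om e q ** i ** adj (om e q)) ** (om e q ** n) ** j" .
  have "adj (om e q) ** (om e q ** i ** adj (om e q)) ** om e q = i" using S by (simp add: matrix_mul_assoc[symmetric])
  then have "om e q ** i ** adj (om e q) \<in> iwahori" using om_conj_iwahori[OF q(1)] ij(2) by metis
  then show ?thesis using y' ij(3) q(1) unfolding IwI_cls by blast
qed

text \<open>For \<open>\<omega>' \<noteq> \<omega>\<close> in \<open>\<Omega>\<close>, the translate \<open>\<omega>'\<^sup>-\<^sup>1\<omega>n\<close> is not in \<open>InI\<close>, so that only one term of the sum is left.\<close>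

lemma e_cocycle_om:
  fixes c :: "'p::prime_card mat \<Rightarrow> 'p mat \<Rightarrow> 'k::field"
  assumes n: "level e n l" and c: "c \<in> Z1 (Xw (cls n))" and g: "g \<in> iwahori" and q: "q \<in> roots_of_unity"
  shows "e_cocycle e m c g (om e q ** n) = - (red q powi (- m)) * c (adj (om e q) ** g ** om e q) n"
proof -
  have zero: "c (adj (om e q') ** g ** om e q') (adj (om e q') ** (om e q ** n)) = 0"
    if q': "q' \<in> roots_of_unity" "q' \<noteq> q" for q'
  proof (rule Z1_Xw_support[OF c])
    show "adj (om e q') ** g ** om e q' \<in> iwahori" using om_conj_iwahori[OF q'(1)] g by blast
    show "adj (om e q') ** (om e q ** n) \<notin> IwI (cls n)" using om_distinct[OF n q q'(1)] q'(2) by blast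
  qed
  have "e_cocycle e m c g (om e q ** n) =
      (\<Sum>q'\<in>roots_of_unity. if q' = q then - (red q powi (- m)) * c (adj (om e q) ** g ** om e q) n else 0)"
    unfolding e_cocycle_apply by (rule sum.cong[OF refl]) (use q zero in auto)
  then show ?thesis using q by (simp add: finite_roots_of_unity)
qed

lemma om_conj: "adj (om e q) ** mt e A B C D ** om e q =
    mt e A (of_Zp q * of_Zp q * B) (inverse (of_Zp q) * inverse (of_Zp q) * C) D" if "q \<in> roots_of_unity"
  using punit_neq_0[OF of_Zp_root[OF that]] by (simp add: om_def mt_mult field_simps)

context
  assumes char: "CHAR('k::field) = CARD('p::prime_card)"
begin

lemma residue_root: "q \<in> roots_of_unity \<Longrightarrow> residue (of_Zp q :: 'p padic) = (red q :: 'k)"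
  "q \<in> roots_of_unity \<Longrightarrow> residue (inverse (of_Zp q) :: 'p padic) = (inverse (red q) :: 'k)"
  using residue_inverse[OF char of_Zp_root] by simp_all

lemma e_cocycle_value:
  assumes c: "triple_cocycle e n l \<kappa>m \<kappa>0 \<kappa>p (c :: 'p mat \<Rightarrow> 'p mat \<Rightarrow> 'k)"
    and q: "q \<in> roots_of_unity" and g: "mt e A B C D \<in> stab (om e q ** n)"
  shows "e_cocycle e m c (mt e A B C D) (om e q ** n) = - (red q powi (- m)) *
    (\<kappa>m * (inverse (red q) * inverse (red q) * residue (pQ powi (- max 1 (1 - l)) * C)) + \<kappa>0 * residue ((A - 1) / pQ) +
      \<kappa>p * (red q * red q * residue (pQ powi (- max 0 l) * B)))"
proof -
  note n = triple_cocycle_level[OF c]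
  let ?Q = "of_Zp q :: 'p padic" and ?R = "inverse (of_Zp q) :: 'p padic"
  have Q: "punit ?Q" using q by (simp add: of_Zp_root)
  note QQ = punit_mult[OF Q Q] and RR = punit_mult[OF punit_inverse[OF Q] punit_inverse[OF Q]]
  note Q0 = punit_pideal[OF QQ] punit_pideal[OF RR] punit_pideal[OF Q] punit_inverse_pideal[OF Q]
  have *: "A - 1 \<in> pideal 1" "B \<in> pideal (max 0 l)" "C \<in> pideal (max 1 (1 - l))" "D - 1 \<in> pideal 1" "A * D - B * C = 1"
    using g unfolding mt_stab_iff[OF level_om[OF q n]] by auto
  have "?Q * ?Q * B * (?R * ?R * C) = (?Q * ?R) * (?Q * ?R) * B * C" by (simp only: mult_ac)
  moreover have "?Q * ?R = 1" using punit_neq_0[OF Q] by simp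
  ultimately have BC: "?Q * ?Q * B * (?R * ?R * C) = B * C" by simp
  have k: "mt e A (?Q * ?Q * B) (?R * ?R * C) D \<in> stab n"
    unfolding mt_stab_iff[OF n] punit_mult_pideal_iff[OF QQ] punit_mult_pideal_iff[OF RR] BC using * by blast
  have 1: "residue (pQ powi (- max 1 (1 - l)) * (?R * ?R * C)) = (inverse (red q) * inverse (red q) * residue (pQ powi (- max 1 (1 - l)) * C) :: 'k)"
  proof -
    have "pQ powi (- max 1 (1 - l)) * (?R * ?R * C) = ?R * ?R * (pQ powi (- max 1 (1 - l)) * C)" by (simp only: mult_ac)
    then show ?thesis
      by (simp only: residue_mult[OF char] Q0 pideal_normalize[OF char *(3)] residue_root[OF q])
  qed
  have 2: "residue (pQ powi (- max 0 l) * (?Q * ?Q * B)) = (red q * red q * residue (pQ powi (- max 0 l) * B) :: 'k)"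
  proof -
    have "pQ powi (- max 0 l) * (?Q * ?Q * B) = ?Q * ?Q * (pQ powi (- max 0 l) * B)" by (simp only: mult_ac)
    then show ?thesis
      by (simp only: residue_mult[OF char] Q0 pideal_normalize[OF char *(2)] residue_root[OF q])
  qed
  show ?thesis
    unfolding e_cocycle_om[OF n triple_cocycle_Z1[OF c] stab_iwahori[OF g] q] om_conj[OF q] triple_cocycle_eval[OF c k] 1 2 ..
qed

subsection \<open>The operator of a reflection that decreases the length\<close>

text \<open>For \<open>a \<noteq> 0\<close>, the matrix \<open>adj (srep e a) ** om e q\<close> is a product of triangular unipotent matrices and of a diagonal
  matrix, which lies in \<open>T\<^sup>1\<close> iff \<open>a\<close> is congruent to \<open>- q\<^sup>-\<^sup>1\<close>; so only this coset contributes.  Its contribution is the value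
  of \<open>c\<close> at the conjugate \<open>k\<close> of the argument by a lower triangular matrix that depends on
  \<open>r = 1/a\<close>, and \<open>r\<close> is congruent to \<open>- q\<close>.\<close>

lemma tau_cocycle_down_om:
  assumes c: "triple_cocycle e n l \<kappa>m \<kappa>0 \<kappa>p (c :: 'p mat \<Rightarrow> 'p mat \<Rightarrow> 'k)" and l: "l \<ge> 1"
    and q: "q \<in> roots_of_unity" and g: "mt e A B C D \<in> stab (om e q ** n)"
  defines "\<xi> \<equiv> red q" and "X \<equiv> residue ((A - 1) / pQ)" and "\<beta> \<equiv> residue (B / pQ)"
  shows "tau_cocycle e c (mt e A B C D) (om e q ** n) =
    \<kappa>m * (inverse \<xi> * inverse \<xi> * (residue (C / pQ) + 2 * \<xi> * X - \<xi> * \<xi> * \<beta>)) + \<kappa>0 * (X - \<xi> * \<beta>) +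
      \<kappa>p * (\<xi> * \<xi> * residue (pQ powi (- l) * B))"
proof -
  note n = triple_cocycle_level[OF c] and cZ = triple_cocycle_Z1[OF c]
  note S = level_SL2[OF n]
  let ?g = "mt e A B C D"
  have gI: "?g \<in> iwahori" by (rule stab_iwahori[OF g])
  have m: "max 0 l = l" "max 1 (1 - l) = 1" using l by simp_all
  have *: "A - 1 \<in> pideal 1" "B \<in> pideal l" "C \<in> pideal 1" "D - 1 \<in> pideal 1" "A * D - B * C = 1"
    using g unfolding mt_stab_iff[OF level_om[OF q n]] m by auto
  have B1: "B \<in> pideal 1" using *(2) by (rule pideal_mono[rotated]) (rule l)
  define Q where "Q = (of_Zp q :: 'p padic)"
  define R where "R = inverse Q"
  have Q: "punit Q" using q by (simp add: Q_def of_Zp_root)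
  have R: "punit R" unfolding R_def by (rule punit_inverse[OF Q])
  have QR: "Q * R = 1" using punit_neq_0[OF Q] by (simp add: R_def)
  have om: "om e q = mt e R 0 0 Q" by (simp add: om_def R_def Q_def)
  define M where "M = (\<lambda>b. mt e 0 (- Q) R (- (of_nat b * Q)))"
  have M: "adj (srep e b) ** (om e q ** n) = M b ** n" for b
  proof -
    have "adj (srep e b) ** om e q = M b" by (simp add: om srep_def M_def mt_mult)
    then show ?thesis by (simp only: matrix_mul_assoc)
  qed
  \<comment> \<open>The decomposition of \<open>M b\<close>: an upper unipotent, the diagonal matrix \<open>T b\<close>, and a lower unipotent factor, which \<open>n\<^sup>-\<^sup>1\<close> conjugates into \<open>I\<close>.\<close>
  define T where "T = (\<lambda>b. mt e (- (R * inverse (of_nat b))) 0 0 (- (of_nat b * Q)))"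
  have Mfact: "M b = upp e (inverse (of_nat b)) ** T b ** low e (- (R * R * inverse (of_nat b)))"
    if b: "punit (of_nat b :: 'p padic)" for b
    using punit_neq_0[OF b] punit_neq_0[OF Q] by (simp add: M_def T_def upp_def low_def mt_mult R_def field_simps)
  have L: "adj n ** low e (- (R * R * inverse (of_nat b))) ** n \<in> iwahori" if b: "punit (of_nat b :: 'p padic)" for b
    by (rule low_conj_iwahori[OF n l]) (use punit_pideal[OF punit_mult[OF punit_mult[OF R R] punit_inverse[OF b]]] in simp)
  have Mn: "M b ** n = upp e (inverse (of_nat b)) ** (T b ** n) ** (adj n ** low e (- (R * R * inverse (of_nat b))) ** n)"
    if b: "punit (of_nat b :: 'p padic)" for b
    unfolding Mfact[OF b] using S by (simp add: matrix_mul_assoc[symmetric])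
  have "- R \<in> pideal 0" using punit_pideal[OF R] by simp
  then obtain a where a: "a < CARD('p)" "- R - of_nat a \<in> pideal 1" using pideal_residue by blast
  have aR: "of_nat a - - R \<in> pideal 1" using pideal_uminus[OF a(2)] by simp
  have au: "punit (of_nat a :: 'p padic)" by (rule punit_cong[OF aR]) (simp add: R)
  have unique: "b = a" if b: "b < CARD('p)" and Mb: "M b ** n \<in> IwI (cls n)" for b
  proof -
    have b0: "b \<noteq> 0"
    proof
      assume "b = 0"
      then have "M b = mt e 0 (- Q) (inverse Q) 0" by (simp add: M_def R_def)
      then have "level e (M b) 1" using Q by (simp add: level_antidiagI[where k = 0 and u = "- Q"])
      then have "level e (M b ** n) (1 - l)" using level_mult[OF _ n, of "M b" 1] by simp
      then have "l = 1 - l" using IwI_level[OF n _ Mb] by blast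
      then show False by presburger
    qed
    have bu: "punit (of_nat b :: 'p padic)"
      using of_nat_pideal_diff[of b 0, where 'p='p] b b0 by (simp add: punit_def)
    have "T b ** n \<in> IwI (cls n)"
      using Mb unfolding Mn[OF bu] IwI_right[OF L[OF bu]] IwI_left[OF upp_iwahori[OF punit_inverse_pideal[OF bu]]] .
    moreover have "level e (T b) 0"
      unfolding T_def by (rule level_diagI[where k = 0 and u = "- (R * inverse (of_nat b))"])
        (use punit_mult[OF R punit_inverse[OF bu]] punit_neq_0[OF Q] in \<open>simp_all add: R_def\<close>)
    then have "level e (T b ** n) l" using level_mult[OF _ n, of "T b" 0] by simp
    ultimately have "T b ** n ** adj n \<in> torus1" using IwI_unique[OF n] by blast
    then have "T b \<in> torus1" using S by simp
    then have "- (of_nat b * Q) - 1 \<in> pideal 1" by (simp add: T_def mt_torus1_iff)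
    then have "R * (- (of_nat b * Q) - 1) \<in> pideal 1" using punit_mult_pideal_iff[OF R] by blast
    moreover have "R * (- (of_nat b * Q) - 1) = - R - of_nat b * (Q * R)" by (simp add: algebra_simps)
    ultimately have "- R - of_nat b \<in> pideal 1" by (simp add: QR)
    from pideal_diff[OF this a(2)] have "(of_nat a - of_nat b :: 'p padic) \<in> pideal 1" by simp
    then show ?thesis using of_nat_pideal_diff[OF a(1) b] by simp
  qed
  define r where "r = inverse (of_nat a :: 'p padic)"
  have ru: "punit r" unfolding r_def by (rule punit_inverse[OF au])
  have ra: "r * of_nat a = 1" using punit_neq_0[OF au] by (simp add: r_def)
  have rQ: "- Q - r \<in> pideal 1"
  proof -
    have "(Q * r) * (- R - of_nat a) = - (Q * R) * r - Q * (r * of_nat a)" by (simp add: algebra_simps)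
    also have "\<dots> = - Q - r" unfolding QR ra by simp
    finally show ?thesis using a(2) punit_mult_pideal_iff[OF punit_mult[OF Q ru]] by metis
  qed
  have \<rho>: "residue r = (- \<xi> :: 'k)"
  proof -
    have "residue (- Q) = (residue r :: 'k)" by (rule residue_cong[OF char rQ punit_pideal[OF ru]])
    moreover have "residue (- Q) = (- residue Q :: 'k)" by (rule residue_uminus[OF char punit_pideal[OF Q]])
    ultimately show ?thesis using residue_root(1)[OF q] by (simp add: Q_def \<xi>_def)
  qed
  define i where "i = upp e r ** T a"
  have iT: "T a \<in> iwahori"
  proof -
    have "of_nat a * (- Q - r) \<in> pideal 1" using punit_mult_pideal_iff[OF au] rQ by blast
    moreover have "of_nat a * (- Q - r) = - (of_nat a * Q) - r * of_nat a" by (simp add: algebra_simps)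
    ultimately have 1: "- (of_nat a * Q) - 1 \<in> pideal 1" unfolding ra by simp
    have "r * (- R - of_nat a) \<in> pideal 1" using punit_mult_pideal_iff[OF ru] a(2) by blast
    moreover have "r * (- R - of_nat a) = - (R * r) - r * of_nat a" by (simp add: algebra_simps)
    ultimately have 2: "- (R * r) - 1 \<in> pideal 1" unfolding ra by simp
    have "R * r * (of_nat a * Q) = (Q * R) * (r * of_nat a)" by (simp only: mult_ac)
    then have "R * r * (of_nat a * Q) = 1" unfolding QR ra by simp
    then show ?thesis using 1 2 by (simp add: T_def mt_iwahori_iff r_def[symmetric])
  qed
  have iI: "i \<in> iwahori" unfolding i_def using upp_iwahori[OF punit_pideal[OF ru]] iT by blast
  let ?h = "adj (srep e a) ** ?g ** srep e a"
  have fixed: "srho e ?g a = a" by (rule srho_fixed[OF gI B1 a(1)])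
  have hI: "?h \<in> iwahori" using srho(2)[OF gI, of e a] unfolding fixed .
  \<comment> \<open>The conjugate of the argument by \<open>srep e a ** i\<close>, which is lower triangular.\<close>
  define k where "k = mt e (A + r * B) (Q * Q * B) (R * R * (C + r * (D - A) - r * r * B)) (D - r * B)"
  have conj: "adj i ** ?h ** i = k"
  proof -
    have "srep e a ** i = mt e R 0 (R * r) Q"
      using ra by (simp add: i_def srep_def upp_def T_def mt_mult r_def[symmetric] algebra_simps)
    moreover have "adj i ** ?h ** i = adj (srep e a ** i) ** ?g ** (srep e a ** i)"
      by (simp add: adj_mult matrix_mul_assoc)
    moreover have "adj (mt e R 0 (R * r) Q) ** ?g ** mt e R 0 (R * r) Q =
        mt e (Q * R * (A + r * B)) (Q * Q * B) (R * R * (C + r * (D - A) - r * r * B)) (Q * R * (D - r * B))"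
      by (simp add: mt_mult algebra_simps)
    ultimately show ?thesis by (simp add: k_def QR)
  qed
  have r0: "r \<in> pideal 0" by (rule punit_pideal[OF ru])
  have rB: "r * B \<in> pideal 1" using punit_mult_pideal_iff[OF ru] B1 by blast
  have DA: "D - A \<in> pideal 1" using pideal_diff[OF *(4,1)] by simp
  have rDA: "r * (D - A) \<in> pideal 1" using punit_mult_pideal_iff[OF ru] DA by blast
  have rrB: "r * r * B \<in> pideal 1" using punit_mult_pideal_iff[OF punit_mult[OF ru ru]] B1 by blast
  have kS: "k \<in> stab n"
  proof -
    have "A - 1 + r * B \<in> pideal 1" "D - 1 - r * B \<in> pideal 1" "C + r * (D - A) - r * r * B \<in> pideal 1"
      using *(1,3,4) rB rDA rrB by blast+
    then have 1: "A + r * B - 1 \<in> pideal 1" "D - r * B - 1 \<in> pideal 1" "C + r * (D - A) - r * r * B \<in> pideal 1"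
      by (simp_all add: algebra_simps)
    have "(A + r * B) * (D - r * B) - Q * Q * B * (R * R * (C + r * (D - A) - r * r * B)) =
        (A + r * B) * (D - r * B) - (Q * R) * (Q * R) * B * (C + r * (D - A) - r * r * B)"
      by (simp only: mult_ac)
    also have "\<dots> = A * D - B * C" unfolding QR by (simp add: algebra_simps)
    finally have det: "(A + r * B) * (D - r * B) - Q * Q * B * (R * R * (C + r * (D - A) - r * r * B)) = 1"
      unfolding *(5) .
    show ?thesis
      unfolding k_def mt_stab_iff[OF n] m punit_mult_pideal_iff[OF punit_mult[OF Q Q]] punit_mult_pideal_iff[OF punit_mult[OF R R]]
      using 1 *(2) det by blast
  qed
  have "c (adj (srep e b) ** ?g ** srep e (srho e ?g b)) (adj (srep e b) ** (om e q ** n)) = (if b = a then c k n else 0)"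
    if b: "b < CARD('p)" for b
  proof (cases "b = a")
    case False
    then show ?thesis using unique[OF b] Z1_Xw_support[OF cZ srho(2)[OF gI]] by (auto simp: M)
  next
    case True
    have "c ?h (M a ** n) = c ?h (i ** n)"
      unfolding Mn[OF au] i_def r_def matrix_mul_assoc[of _ "T a" n]
      by (rule X_right[OF Z1_in[OF Z1_Xw[OF cZ] hI] L[OF au]])
    also have "\<dots> = c k n"
      using Z1_conj_eval[OF Z1_Xw[OF cZ] iI hI S] kS unfolding conj by blast
    finally show ?thesis using True by (simp add: M fixed)
  qed
  then have "tau_cocycle e c ?g (om e q ** n) = (\<Sum>b<CARD('p). if b = a then c k n else 0)"
    unfolding tau_cocycle_apply by (intro sum.cong[OF refl]) simp
  also have "\<dots> = c k n" using a(1) by simp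
  also have "\<dots> = \<kappa>m * residue (pQ powi (- max 1 (1 - l)) * (R * R * (C + r * (D - A) - r * r * B))) +
      \<kappa>0 * residue ((A + r * B - 1) / pQ) + \<kappa>p * residue (pQ powi (- max 0 l) * (Q * Q * B))"
    unfolding k_def by (rule triple_cocycle_eval[OF c]) (use kS in \<open>simp only: k_def\<close>)
  also have "residue (pQ powi (- max 1 (1 - l)) * (R * R * (C + r * (D - A) - r * r * B))) =
      inverse \<xi> * inverse \<xi> * (residue (C / pQ) + 2 * \<xi> * X - \<xi> * \<xi> * \<beta>)"
  proof -
    have "pQ powi (- max 1 (1 - l)) * (R * R * (C + r * (D - A) - r * r * B)) =
        R * R * (C / pQ + r * ((D - 1) / pQ - (A - 1) / pQ) - r * r * (B / pQ))"
      unfolding m by (simp add: power_int_minus field_simps)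
    moreover have "residue (R * R * (z + r * (w - x) - r * r * y)) =
        (residue R * residue R * (residue z + residue r * (residue w - residue x) - residue r * residue r * residue y) :: 'k)"
      if in0: "z \<in> pideal 0" "w \<in> pideal 0" "x \<in> pideal 0" "y \<in> pideal 0" for x y z w
      by (simp only: residue_diff[OF char] residue_add[OF char] residue_mult[OF char] in0
            pideal_add pideal_diff pideal_0_mult punit_pideal[OF R] punit_pideal[OF ru])
    note this[of "C / pQ" "(D - 1) / pQ" "(A - 1) / pQ" "B / pQ"]
    moreover have "residue ((D - 1) / pQ) = (- X :: 'k)"
      unfolding X_def by (rule residue_diagonal[OF char level_om[OF q n] g]) (use l in simp)
    moreover have "residue R = (inverse \<xi> :: 'k)" using residue_root(2)[OF q] by (simp add: R_def Q_def \<xi>_def)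
    moreover have "C / pQ \<in> pideal 0" "(D - 1) / pQ \<in> pideal 0" "(A - 1) / pQ \<in> pideal 0" "B / pQ \<in> pideal 0"
      using *(1,3,4) B1 by simp_all
    moreover have "inverse \<xi> * inverse \<xi> * (z + - \<xi> * (- X - X) - - \<xi> * - \<xi> * \<beta>) =
        inverse \<xi> * inverse \<xi> * (z + 2 * \<xi> * X - \<xi> * \<xi> * \<beta>)" for z
      by (simp add: algebra_simps)
    ultimately show ?thesis by (simp only: \<rho> X_def[symmetric] \<beta>_def[symmetric])
  qed
  also have "residue ((A + r * B - 1) / pQ) = X - \<xi> * \<beta>"
  proof -
    have "(A + r * B - 1) / pQ = (A - 1) / pQ + r * (B / pQ)" by (simp add: field_simps)
    moreover have "residue (x + r * y) = (residue x + residue r * residue y :: 'k)" if "x \<in> pideal 0" "y \<in> pideal 0" for x y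
      by (simp only: residue_add[OF char] residue_mult[OF char] that pideal_0_mult punit_pideal[OF ru])
    note this[of "(A - 1) / pQ" "B / pQ"]
    ultimately show ?thesis using *(1) B1 by (simp add: \<rho> X_def \<beta>_def)
  qed
  also have "residue (pQ powi (- max 0 l) * (Q * Q * B)) = \<xi> * \<xi> * residue (pQ powi (- l) * B)"
  proof -
    have "pQ powi (- max 0 l) * (Q * Q * B) = Q * Q * (pQ powi (- l) * B)" unfolding m by (simp only: mult_ac)
    moreover have "residue Q = (\<xi> :: 'k)" using residue_root(1)[OF q] by (simp add: Q_def \<xi>_def)
    ultimately show ?thesis
      by (simp only: residue_mult[OF char] pideal_0_mult punit_pideal[OF Q] pideal_normalize[OF char *(2)])
  qed
  finally show ?thesis .
qed

text \<open>Both cocycles are supported on \<open>IsnI\<close> and the \<open>I\<omega>nI\<close>, and they have the same values at \<open>sn\<close> and at the \<open>\<omega>n\<close>.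
  The first three terms of the sum vanish at \<open>sn\<close>, and the last one at the \<open>\<omega>n\<close>.  The conditions on \<open>l\<close> reflect that the upper right
  entry of the argument is divisible by \<open>p\<^sup>2\<close> unless \<open>l = 1\<close>.\<close>

lemma tau_down_cohomologous:
  assumes p: "CARD('p) \<noteq> 2" "CARD('p) \<noteq> 3"
    and c: "triple_cocycle e n l \<kappa>m \<kappa>0 \<kappa>p (c :: 'p mat \<Rightarrow> 'p mat \<Rightarrow> 'k)" and l: "l \<ge> 1"
    and c1: "triple_cocycle e n l (- \<kappa>m) (- \<kappa>0) (- \<kappa>p) c1"
    and c2: "triple_cocycle e n l 0 (- 2 * \<kappa>m) (if l = 1 then \<kappa>0 else 0) c2"
    and c3: "triple_cocycle e n l 0 0 (if l = 1 then \<kappa>m else 0) c3"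
    and c4: "triple_cocycle e (srefl e ** n) (1 - l) 0 0 (- \<kappa>m) c4"
  shows "(e_cocycle e 0 c1 + e_cocycle e 1 c2 + e_cocycle e 2 c3 + c4, tau_cocycle e c) \<in> cohomologous (rspace \<X>)"
proof -
  note n = triple_cocycle_level[OF c] and cZ = triple_cocycle_Z1[OF c]
  note Zi = triple_cocycle_Z1[OF c1] triple_cocycle_Z1[OF c2] triple_cocycle_Z1[OF c3] triple_cocycle_Z1[OF c4]
  note sn = level_srefl_mult[OF n]
  have m: "max 0 l = l" "max 1 (1 - l) = 1" "max 0 (1 - l) = 0" using l by simp_all
  define d where "d = e_cocycle e 0 c1 + e_cocycle e 1 c2 + e_cocycle e 2 c3 + c4"
  have dZ: "d \<in> Z1 (rspace \<X>)"
    unfolding d_def by (intro Z1_add submodule_X e_id_act(1)[OF char] Zi[THEN Z1_Xw])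
  have tZ: "tau_cocycle e c \<in> Z1 (rspace \<X>)" by (rule tau_srefl_act(1)[OF Z1_Xw[OF cZ]])
  define S where "S = insert (srefl e ** n) ((\<lambda>q. om e q ** n) ` roots_of_unity)"
  have lev: "\<exists>l. level False y l" if "y \<in> S" for y
  proof -
    have "\<exists>l. level e y l" using that sn level_om[OF _ n] unfolding S_def by blast
    then show ?thesis using level_True_iff by (cases e) auto
  qed
  have supp: "\<exists>x\<in>S. \<exists>i\<in>iwahori. \<exists>j\<in>iwahori. y = i ** x ** j"
    if g: "g \<in> iwahori" and y: "(tau_cocycle e c - d) g y \<noteq> 0" for g y
  proof -
    have "tau_cocycle e c g y \<noteq> 0 \<or> e_cocycle e 0 c1 g y \<noteq> 0 \<or> e_cocycle e 1 c2 g y \<noteq> 0 \<or> e_cocycle e 2 c3 g y \<noteq> 0 \<or> c4 g y \<noteq> 0"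
      using y by (auto simp: d_def)
    then have "\<exists>x\<in>S. y \<in> IwI (cls x)"
    proof (elim disjE)
      assume "tau_cocycle e c g y \<noteq> 0"
      then obtain a x where "x \<in> IwI (cls n)" "y = srep e a ** x" using tau_cocycle_support[OF cZ g] by blast
      then show ?thesis using srep_IwI_down[OF n l, of x a] by (auto simp: S_def)
    next
      assume "c4 g y \<noteq> 0"
      then have "y \<in> IwI (cls (srefl e ** n))" using Z1_Xw_support[OF Zi(4) g] by blast
      then show ?thesis by (auto simp: S_def)
    qed (auto simp: S_def dest!: e_cocycle_support[OF Zi(1) g] e_cocycle_support[OF Zi(2) g] e_cocycle_support[OF Zi(3) g])
    then show ?thesis unfolding IwI_cls by blast
  qed
  have van: "(tau_cocycle e c - d) g x = 0" if x: "x \<in> S" and g: "g \<in> stab x" for x g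
  proof -
    obtain A B C D where gg: "g = mt e A B C D" by (rule mt_cases)
    have diff: "l \<noteq> 1 - l" by presburger
    consider "x = srefl e ** n" | q where "q \<in> roots_of_unity" "x = om e q ** n" using x unfolding S_def by blast
    then show ?thesis
    proof cases
      case 1
      have zero: "e_cocycle e m c' g (srefl e ** n) = 0" if c': "c' \<in> Z1 (Xw (cls n))" for m and c' :: "'p mat \<Rightarrow> 'p mat \<Rightarrow> 'k"
      proof (rule ccontr)
        assume "e_cocycle e m c' g (srefl e ** n) \<noteq> 0"
        then obtain q where "q \<in> roots_of_unity" "srefl e ** n \<in> IwI (cls (om e q ** n))"
          using e_cocycle_support[OF c' stab_iwahori[OF g]] by blast
        then show False using IwI_level[OF level_om[OF _ n] sn] diff by blast
      qed
      note gs = g[unfolded 1 gg]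
      show ?thesis
        unfolding 1 using zero[OF Zi(1)] zero[OF Zi(2)] zero[OF Zi(3)]
          tau_cocycle_down_srefl[OF char p c l gs] triple_cocycle_eval[OF c4 gs] m
        by (simp add: d_def gg)
    next
      case 2
      note gs = g[unfolded 2(2) gg] and q = 2(1)
      have "om e q ** n \<notin> IwI (cls (srefl e ** n))" using IwI_level[OF sn level_om[OF q n]] diff by auto
      then have v4: "c4 g (om e q ** n) = 0" using Z1_Xw_support[OF Zi(4) stab_iwahori[OF g]] by blast
      have q0: "(red q :: 'k) \<noteq> 0" using residue_punit[OF char of_Zp_root[OF q]] by simp
      have *: "B \<in> pideal l" using gs unfolding mt_stab_iff[OF level_om[OF q n]] m by blast
      define x where "x = (red q :: 'k)"
      define Y where "Y = (residue (pQ powi (- l) * B) :: 'k)"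
      have \<beta>: "residue (B / pQ) = (if l = 1 then Y else 0 :: 'k)"
      proof (cases "l = 1")
        case True
        have "B / pQ = pQ powi (- 1) * B" by (simp add: power_int_minus divide_inverse)
        then show ?thesis using True by (simp add: Y_def)
      next
        case False
        then have "2 \<le> l" using l by simp
        from pideal_mono[OF this *] have "B / pQ \<in> pideal 1" by simp
        then show ?thesis using False residue_eq_0[OF char] by simp
      qed
      have Z: "pQ powi (- 1) * C = C / pQ" by (simp add: power_int_minus divide_inverse)
      have powers: "x powi (- 0) = 1" "x powi (- 1) = inverse x" "x powi (- 2) = inverse x * inverse x"
        by (simp_all add: power_int_minus power2_eq_square)
      have "(tau_cocycle e c - d) g (om e q ** n) = tau_cocycle e c g (om e q ** n) - (e_cocycle e 0 c1 g (om e q ** n) +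
          e_cocycle e 1 c2 g (om e q ** n) + e_cocycle e 2 c3 g (om e q ** n) + c4 g (om e q ** n))"
        by (simp add: d_def)
      also have "\<dots> = 0"
        unfolding v4 unfolding gg tau_cocycle_down_om[OF c l q gs]
          e_cocycle_value[OF c1 q gs] e_cocycle_value[OF c2 q gs] e_cocycle_value[OF c3 q gs]
        unfolding m \<beta> Z Y_def[symmetric] x_def[symmetric] powers
        by (cases "l = 1") (use q0 in \<open>simp_all add: x_def[symmetric] algebra_simps\<close>)
      finally show ?thesis unfolding 2(2) .
    qed
  qed
  have "\<exists>f\<in>rspace \<X>. (\<forall>g\<in>iwahori. (tau_cocycle e c - d) g = act g f - f) \<and>
      (\<forall>y. f y \<noteq> 0 \<longrightarrow> (\<exists>g\<in>iwahori. (tau_cocycle e c - d) g y \<noteq> 0))"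
    by (rule coboundary_criterion[OF Z1_diff[OF submodule_X tZ dZ] lev supp van])
  then obtain f where f: "f \<in> rspace \<X>" "\<forall>g\<in>iwahori. (tau_cocycle e c - d) g = act g f - f" by blast
  have "tau_cocycle e c g = d g + (act g f - f)" if g: "g \<in> iwahori" for g
  proof -
    have "tau_cocycle e c g - d g = act g f - f" using bspec[OF f(2) g] unfolding fun_diff_def .
    then show ?thesis by (simp only: diff_eq_eq add.commute)
  qed
  then show ?thesis unfolding d_def[symmetric] by (rule cohomologousI[OF submodule_X dZ f(1)])
qed

end


section \<open>The products with classes of triples\<close>

text \<open>The triple with components \<open>cm\<close>, \<open>c0\<close>, \<open>cp\<close> in the coordinates \<open>e\<close>.  The sign comes from the exchange of the
  two diagonal entries, which are inverse to each other.\<close>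

definition triple_at :: "bool \<Rightarrow> ('p::prime_card padic_int \<Rightarrow> 'k::field) \<Rightarrow> ('p padic_int \<Rightarrow> 'k) \<Rightarrow> ('p padic_int \<Rightarrow> 'k)
    \<Rightarrow> 'p mat set \<Rightarrow> ('p, 'k) coh" where
  "triple_at e cm c0 cp w = (if e then triple cp (- c0) cm w else triple cm c0 cp w)"

lemma Hom_add_0: "0 \<in> Hom_add" and Hom_mult_0: "0 \<in> Hom_mult"
  by (simp_all add: Hom_add_def Hom_mult_def)

lemma Hom_add_uminus: "c \<in> Hom_add \<Longrightarrow> - c \<in> Hom_add"
  by (simp add: Hom_add_def)

lemma Hom_mult_uminus: "c \<in> Hom_mult \<Longrightarrow> - c \<in> Hom_mult"
  by (simp add: Hom_mult_def)

lemma iota_eq: "\<iota> (1 + pZ * x) = (x :: 'p::prime_card padic_int)"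
  unfolding iota_def by (rule the_equality) simp_all

lemma Hom_mult_iota:
  assumes "c \<in> Hom_add"
  shows "(\<lambda>u. a * c (\<iota> u)) \<in> Hom_mult"
proof -
  have add: "c (x + y) = c x + c y" and p: "c (pZ * x) = 0" for x y using assms by (simp_all add: Hom_add_def)
  have 1: "a * c (\<iota> ((1 + pZ * x) * (1 + pZ * y))) = a * c (\<iota> (1 + pZ * x)) + a * c (\<iota> (1 + pZ * y))" for x y
  proof -
    have "(1 + pZ * x) * (1 + pZ * y) = 1 + pZ * (x + y + pZ * (x * y))" by (simp add: algebra_simps)
    then show ?thesis by (simp only: iota_eq add p) (simp add: algebra_simps)
  qed
  have 2: "a * c (\<iota> (1 + pZ ^ 2 * x)) = 0" for x
  proof -
    have "1 + pZ ^ 2 * x = 1 + pZ * (pZ * x)" by (simp add: power2_eq_square algebra_simps)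
    then show ?thesis by (simp only: iota_eq p) simp
  qed
  show ?thesis using 1 2 by (simp add: Hom_mult_def)
qed

lemma Hom_add_iota_inv:
  assumes "CHAR('k::field) = CARD('p::prime_card)" and "c \<in> (Hom_mult :: ('p padic_int \<Rightarrow> 'k) set)"
  shows "(\<lambda>x. c (\<iota>\<^sub>i\<^sub>n\<^sub>v x)) \<in> Hom_add"
  unfolding Hom_add_def iota_inv_def Hom_mult_red[OF assms]
  by (simp add: red_add[OF assms(1)] red_eq_0[OF assms(1)] distrib_left)

context
  assumes char: "CHAR('k::field) = CARD('p::prime_card)"
begin

lemma triple_at_eq:
  assumes "cm \<in> Hom_add" "c0 \<in> Hom_mult" "cp \<in> Hom_add"
    and c: "triple_cocycle e n l (cm 1) (c0 (1 + pZ)) (cp 1) (c :: 'p mat \<Rightarrow> 'p mat \<Rightarrow> 'k)"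
    and l: "l \<noteq> 0 \<or> c0 (1 + pZ) = 0"
  shows "triple_at e cm c0 cp (cls n) = coh_class (rspace \<X>) c"
proof (cases e)
  case True
  have "triple_cocycle False n (- l) (cp 1) ((- c0) (1 + pZ)) (cm 1) c"
    using triple_cocycle_flip[OF char c l] True by simp
  then have "triple cp (- c0) cm (cls n) = coh_class (rspace \<X>) c"
    using triple_eq[OF char assms(3) Hom_mult_uminus[OF assms(2)] assms(1)] by blast
  then show ?thesis using True by (simp add: triple_at_def)
next
  case False
  have "triple cm c0 cp (cls n) = coh_class (rspace \<X>) c"
    by (rule triple_eq[OF char assms(1-3)]) (use c False in simp)
  then show ?thesis using False by (simp add: triple_at_def)
qed

lemma tau_triple_up:
  assumes H: "cm \<in> Hom_add" "c0 \<in> Hom_mult" "cp \<in> Hom_add"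
    and n: "level e (n :: 'p mat) l" and l: "l \<le> 0" "l \<noteq> 0 \<or> c0 (1 + pZ) = (0 :: 'k)"
  shows "\<tau> (cls (srefl e)) \<cdot> triple_at e cm c0 cp (cls n) = triple_at e 0 (- c0) (- cm) (cls (srefl e) \<otimes>\<^bsub>Wt\<^esub> cls n)"
proof -
  let ?z = "0 :: 'p padic_int \<Rightarrow> 'k"
  obtain c :: "'p mat \<Rightarrow> 'p mat \<Rightarrow> 'k" where c: "triple_cocycle e n l (cm 1) (c0 (1 + pZ)) (cp 1) c"
    using triple_cocycle_exists[OF char n l(2)] by blast
  have "triple_cocycle e (srefl e ** n) (1 - l) (?z 1) ((- c0) (1 + pZ)) ((- cm) 1) (tau_cocycle e c)"
    using tau_cocycle_up[OF char c l(1)] by simp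
  then have "triple_at e 0 (- c0) (- cm) (cls (srefl e ** n)) = coh_class (rspace \<X>) (tau_cocycle e c)"
    by (rule triple_at_eq[OF Hom_add_0 Hom_mult_uminus[OF H(2)] Hom_add_uminus[OF H(1)]]) (use l in simp)
  then show ?thesis
    unfolding cls_mult[OF level_srefl] triple_at_eq[OF H c l(2)] tau_srefl_act(2)[OF Z1_Xw[OF triple_cocycle_Z1[OF c]]] by simp
qed

text \<open>The components \<open>b0\<close> and \<open>bm\<close> occur only for length \<open>1\<close>; for larger lengths, they are zero.\<close>

lemma tau_triple_down:
  assumes p: "CARD('p) \<noteq> 2" "CARD('p) \<noteq> 3"
    and H: "cm \<in> Hom_add" "c0 \<in> Hom_mult" "cp \<in> Hom_add"
    and n: "level e (n :: 'p mat) l" and l: "l \<ge> 1"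
    and b0: "b0 \<in> Hom_add" "b0 1 = (if l = 1 then c0 (1 + pZ) else 0)"
    and bm: "bm \<in> Hom_add" "bm 1 = (if l = 1 then cm 1 else (0 :: 'k))"
  shows "\<tau> (cls (srefl e)) \<cdot> triple_at e cm c0 cp (cls n) =
    e_id 0 \<cdot> triple_at e (- cm) (- c0) (- cp) (cls n)
    \<boxplus> e_id (if e then - 1 else 1) \<cdot> triple_at e 0 (\<lambda>u. - 2 * cm (\<iota> u)) b0 (cls n)
    \<boxplus> e_id (if e then - 2 else 2) \<cdot> triple_at e 0 0 bm (cls n)
    \<boxplus> triple_at e 0 0 (- cm) (cls (srefl e) \<otimes>\<^bsub>Wt\<^esub> cls n)"
proof -
  let ?z = "0 :: 'p padic_int \<Rightarrow> 'k"
  have l0: "l \<noteq> 0 \<or> \<kappa> = 0" for \<kappa> :: 'k using l by simp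
  note sn = level_srefl_mult[OF n]
  note N = Hom_add_uminus[OF H(1)] Hom_mult_uminus[OF H(2)] Hom_add_uminus[OF H(3)]
  define cz where "cz = (\<lambda>u. - 2 * cm (\<iota> u))"
  have cz: "cz \<in> Hom_mult" "cz (1 + pZ) = - 2 * cm 1"
    unfolding cz_def using Hom_mult_iota[OF H(1), of "- 2"] iota_eq[of "1 :: 'p padic_int"] by simp_all
  obtain c where c: "triple_cocycle e n l (cm 1) (c0 (1 + pZ)) (cp 1) c"
    using triple_cocycle_exists[OF char n l0] by blast
  obtain c1 where c1: "triple_cocycle e n l ((- cm) 1) ((- c0) (1 + pZ)) ((- cp) 1) c1"
    using triple_cocycle_exists[OF char n l0] by blast
  obtain c2 where c2: "triple_cocycle e n l (?z 1) (cz (1 + pZ)) (b0 1) c2"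
    using triple_cocycle_exists[OF char n l0] by blast
  obtain c3 where c3: "triple_cocycle e n l (?z 1) (?z (1 + pZ)) (bm 1) c3"
    using triple_cocycle_exists[OF char n l0] by blast
  obtain c4 where c4: "triple_cocycle e (srefl e ** n) (1 - l) (?z 1) (?z (1 + pZ)) ((- cm) 1) c4"
    using triple_cocycle_exists[OF char sn, of "?z (1 + pZ)"] by auto
  have "(e_cocycle e 0 c1 + e_cocycle e 1 c2 + e_cocycle e 2 c3 + c4, tau_cocycle e c) \<in> cohomologous (rspace \<X>)"
    by (rule tau_down_cohomologous[OF char p c l])
      (use c1 c2 c3 c4 b0(2) bm(2) cz(2) in \<open>simp_all only: zero_fun_apply uminus_apply\<close>)
  from coh_class_eqI[OF submodule_X this]
  have *: "coh_class (rspace \<X>) (tau_cocycle e c) = coh_class (rspace \<X>) (e_cocycle e 0 c1 + e_cocycle e 1 c2 + e_cocycle e 2 c3 + c4)" ..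
  note Z = Z1_Xw[OF triple_cocycle_Z1[OF c]] Z1_Xw[OF triple_cocycle_Z1[OF c1]] Z1_Xw[OF triple_cocycle_Z1[OF c2]]
    Z1_Xw[OF triple_cocycle_Z1[OF c3]] Z1_Xw[OF triple_cocycle_Z1[OF c4]]
  note t = triple_at_eq[OF H c l0] triple_at_eq[OF N c1 l0] triple_at_eq[OF Hom_add_0 cz(1) b0(1) c2 l0]
    triple_at_eq[OF Hom_add_0 Hom_mult_0 bm(1) c3 l0]
  have t4: "triple_at e 0 0 (- cm) (cls (srefl e ** n)) = coh_class (rspace \<X>) c4"
    by (rule triple_at_eq[OF Hom_add_0 Hom_mult_0 N(1) c4]) simp
  note E = e_id_act(1)[OF char]
  show ?thesis
    unfolding cz_def[symmetric] cls_mult[OF level_srefl] t t4 tau_srefl_act(2)[OF Z(1)] *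
    using e_id_act(2)[OF char Z(2), where e = e and m = 0, unfolded minus_zero if_cancel] e_id_act(2)[OF char Z(3), where e = e and m = 1]
      e_id_act(2)[OF char Z(4), where e = e and m = 2]
    by (simp add: E1_add_coh_class E Z Z1_add[OF submodule_X])
qed

text \<open>The term with \<open>bm = 0\<close> is the product of an idempotent with the zero class and disappears.\<close>

lemma tau_triple_down_long:
  assumes p: "CARD('p) \<noteq> 2" "CARD('p) \<noteq> 3"
    and H: "cm \<in> Hom_add" "c0 \<in> Hom_mult" "cp \<in> Hom_add"
    and n: "level e (n :: 'p mat) l" and l: "l \<ge> 2"
  shows "\<tau> (cls (srefl e)) \<cdot> triple_at e cm c0 cp (cls n) =
    e_id 0 \<cdot> triple_at e (- cm) (- c0) (- cp) (cls n)
    \<boxplus> e_id (if e then - 1 else 1) \<cdot> triple_at e 0 (\<lambda>u. - 2 * cm (\<iota> u)) (0 :: 'p padic_int \<Rightarrow> 'k) (cls n)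
    \<boxplus> triple_at e 0 0 (- cm) (cls (srefl e) \<otimes>\<^bsub>Wt\<^esub> cls n)"
proof -
  let ?z = "0 :: 'p padic_int \<Rightarrow> 'k"
  have l0: "l \<noteq> 0 \<or> \<kappa> = 0" for \<kappa> :: 'k using l by simp
  have zero: "triple_cocycle e n l (?z 1) (?z (1 + pZ)) (?z 1) (0 :: 'p mat \<Rightarrow> 'p mat \<Rightarrow> 'k)"
    using n Z1_0[OF submodule_Xw] by (simp add: triple_cocycle_def)
  have "e_cocycle e 2 0 = (0 :: 'p mat \<Rightarrow> 'p mat \<Rightarrow> 'k)"
    by (rule ext, rule ext) (simp add: e_cocycle_apply)
  moreover have "triple_at e 0 0 0 (cls n) = coh_class (rspace \<X>) (0 :: 'p mat \<Rightarrow> 'p mat \<Rightarrow> 'k)"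
    by (rule triple_at_eq[OF Hom_add_0 Hom_mult_0 Hom_add_0 zero l0])
  ultimately have 0: "e_id (if e then - 2 else 2) \<cdot> triple_at e 0 0 0 (cls n) = coh_class (rspace \<X>) (0 :: 'p mat \<Rightarrow> 'p mat \<Rightarrow> 'k)"
    using e_id_act(2)[OF char Z1_Xw[OF triple_cocycle_Z1[OF zero]], where e = e and m = 2] by simp
  define cz where "cz = (\<lambda>u. - 2 * cm (\<iota> u))"
  have N: "- cm \<in> Hom_add" "- c0 \<in> Hom_mult" "- cp \<in> Hom_add" "cz \<in> Hom_mult"
    using H by (simp_all only: cz_def Hom_add_uminus Hom_mult_uminus Hom_mult_iota)
  obtain c1 where c1: "triple_cocycle e n l ((- cm) 1) ((- c0) (1 + pZ)) ((- cp) 1) c1"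
    using triple_cocycle_exists[OF char n l0] by blast
  obtain c2 :: "'p mat \<Rightarrow> 'p mat \<Rightarrow> 'k" where c2: "triple_cocycle e n l (?z 1) (cz (1 + pZ)) (?z 1) c2"
    using triple_cocycle_exists[OF char n l0] by blast
  have "e_id 0 \<cdot> triple_at e (- cm) (- c0) (- cp) (cls n) = coh_class (rspace \<X>) (e_cocycle e 0 c1)"
    "e_id (if e then - 1 else 1) \<cdot> triple_at e 0 cz 0 (cls n) = coh_class (rspace \<X>) (e_cocycle e 1 c2)"
    unfolding triple_at_eq[OF N(1-3) c1 l0] triple_at_eq[OF Hom_add_0 N(4) Hom_add_0 c2 l0]
    using e_id_act(2)[OF char Z1_Xw[OF triple_cocycle_Z1[OF c1]], where e = e and m = 0, unfolded minus_zero if_cancel]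
      e_id_act(2)[OF char Z1_Xw[OF triple_cocycle_Z1[OF c2]], where e = e and m = 1] by simp_all
  moreover have "e_cocycle e 0 c1 \<in> Z1 (rspace \<X>)" "e_cocycle e 1 c2 \<in> Z1 (rspace \<X>)"
    by (rule e_id_act(1)[OF char Z1_Xw[OF triple_cocycle_Z1[OF c1]]], rule e_id_act(1)[OF char Z1_Xw[OF triple_cocycle_Z1[OF c2]]])
  ultimately show ?thesis
    unfolding cz_def[symmetric] using tau_triple_down[OF p H n, of 0 0, folded cz_def] l Hom_add_0 0
    by (simp add: E1_add_coh_class Z1_add[OF submodule_X] Z1_0[OF submodule_X])
qed

end

theorem proposition4p9:
  fixes cm c0 cp :: "'p::prime_card padic_int \<Rightarrow> 'k::field"
    and w \<omega> :: "'p mat set"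
  assumes "CARD('p) \<noteq> 2" and "CARD('p) \<noteq> 3"
    and "CHAR('k) = CARD('p)"
    and "w \<in> carrier Wt" and "\<omega> \<in> \<Omega>"
    and "cm \<in> Hom_add" and "c0 \<in> Hom_mult" and "cp \<in> Hom_add"
  shows
   "(w \<in> Wt0 \<and> len w \<ge> 1 \<longrightarrow>
       \<tau> (cls s0) \<cdot> triple cm c0 cp w = triple 0 (- c0) (- cm) (cls s0 \<otimes>\<^bsub>Wt\<^esub> w)) \<and>
    (w \<in> Wt1 \<and> len w \<ge> 2 \<longrightarrow>
       \<tau> (cls s0) \<cdot> triple cm c0 cp w =
         e_id 0 \<cdot> triple (- cm) (- c0) (- cp) w
         \<boxplus> e_id 1 \<cdot> triple 0 (\<lambda>u. - 2 * cm (\<iota> u)) 0 w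
         \<boxplus> triple 0 0 (- cm) (cls s0 \<otimes>\<^bsub>Wt\<^esub> w)) \<and>
    (w \<in> Wt1 \<and> len w = 1 \<longrightarrow>
       \<tau> (cls s0) \<cdot> triple cm c0 cp w =
         e_id 0 \<cdot> triple (- cm) (- c0) (- cp) w
         \<boxplus> e_id 1 \<cdot> triple 0 (\<lambda>u. - 2 * cm (\<iota> u)) (\<lambda>x. c0 (\<iota>\<^sub>i\<^sub>n\<^sub>v x)) w
         \<boxplus> e_id 2 \<cdot> triple 0 0 cm w
         \<boxplus> triple 0 0 (- cm) (cls s0 \<otimes>\<^bsub>Wt\<^esub> w)) \<and>
    (w \<in> Wt1 \<and> len w \<ge> 1 \<longrightarrow>
       \<tau> (cls s1) \<cdot> triple cm c0 cp w = triple (- cp) (- c0) 0 (cls s1 \<otimes>\<^bsub>Wt\<^esub> w)) \<and>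
    (w \<in> Wt0 \<and> len w \<ge> 2 \<longrightarrow>
       \<tau> (cls s1) \<cdot> triple cm c0 cp w =
         e_id 0 \<cdot> triple (- cm) (- c0) (- cp) w
         \<boxplus> e_id (- 1) \<cdot> triple 0 (\<lambda>u. 2 * cp (\<iota> u)) 0 w
         \<boxplus> triple (- cp) 0 0 (cls s1 \<otimes>\<^bsub>Wt\<^esub> w)) \<and>
    (w \<in> Wt0 \<and> len w = 1 \<longrightarrow>
       \<tau> (cls s1) \<cdot> triple cm c0 cp w =
         e_id 0 \<cdot> triple (- cm) (- c0) (- cp) w
         \<boxplus> e_id (- 1) \<cdot> triple (\<lambda>x. - c0 (\<iota>\<^sub>i\<^sub>n\<^sub>v x)) (\<lambda>u. 2 * cp (\<iota> u)) 0 w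
         \<boxplus> e_id (- 2) \<cdot> triple cp 0 0 w
         \<boxplus> triple (- cp) 0 0 (cls s1 \<otimes>\<^bsub>Wt\<^esub> w)) \<and>
    \<tau> (cls s0) \<cdot> triple cm 0 cp \<omega> = triple 0 0 (- cm) (cls s0 \<otimes>\<^bsub>Wt\<^esub> \<omega>) \<and>
    \<tau> (cls s1) \<cdot> triple cm 0 cp \<omega> = triple (- cp) 0 0 (cls s1 \<otimes>\<^bsub>Wt\<^esub> \<omega>)"
proof -
  note p = assms(1,2) and char = assms(3) and H = assms(6-8)
  note H' = H(3) Hom_mult_uminus[OF H(2)] H(1)
  obtain n l where n: "level False n l" and w: "w = cls n" using assms(4) carrier_Wt_iff by blast
  have n': "level True n (- l)" using n by (simp add: level_True_iff)
  note W = len_cls[OF n] cls_Wt0_iff[OF n] cls_Wt1_iff[OF n]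
  have iota: "- (\<lambda>u. - 2 * cp (\<iota> u)) = (\<lambda>u. 2 * cp (\<iota> u))" "- (\<lambda>x. c0 (\<iota>\<^sub>i\<^sub>n\<^sub>v x)) = (\<lambda>x. - c0 (\<iota>\<^sub>i\<^sub>n\<^sub>v x))"
    by (simp_all add: fun_eq_iff)
  note at = triple_at_def if_True if_False minus_minus minus_zero iota
  have s: "cls s0 = cls (srefl False)" "cls s1 = cls (srefl True)" by (simp_all only: s0_srefl s1_srefl)
  show ?thesis
    unfolding w s
  proof (intro conjI impI)
    assume "cls n \<in> Wt0 \<and> 1 \<le> len (cls n)"
    then have "l \<le> 0" "l \<noteq> 0 \<or> c0 (1 + pZ) = 0" using W by auto
    then show "\<tau> (cls (srefl False)) \<cdot> triple cm c0 cp (cls n) = triple 0 (- c0) (- cm) (cls (srefl False) \<otimes>\<^bsub>Wt\<^esub> cls n)"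
      using tau_triple_up[OF char H n] by (simp only: at)
  next
    assume "cls n \<in> Wt1 \<and> 2 \<le> len (cls n)"
    then have "l \<ge> 2" using W by auto
    then show "\<tau> (cls (srefl False)) \<cdot> triple cm c0 cp (cls n) =
         e_id 0 \<cdot> triple (- cm) (- c0) (- cp) (cls n)
         \<boxplus> e_id 1 \<cdot> triple 0 (\<lambda>u. - 2 * cm (\<iota> u)) 0 (cls n)
         \<boxplus> triple 0 0 (- cm) (cls (srefl False) \<otimes>\<^bsub>Wt\<^esub> cls n)"
      using tau_triple_down_long[OF char p H n] by (simp only: at)
  next
    assume "cls n \<in> Wt1 \<and> len (cls n) = 1"
    then have "l = 1" using W by auto
    then show "\<tau> (cls (srefl False)) \<cdot> triple cm c0 cp (cls n) =
         e_id 0 \<cdot> triple (- cm) (- c0) (- cp) (cls n)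
         \<boxplus> e_id 1 \<cdot> triple 0 (\<lambda>u. - 2 * cm (\<iota> u)) (\<lambda>x. c0 (\<iota>\<^sub>i\<^sub>n\<^sub>v x)) (cls n)
         \<boxplus> e_id 2 \<cdot> triple 0 0 cm (cls n)
         \<boxplus> triple 0 0 (- cm) (cls (srefl False) \<otimes>\<^bsub>Wt\<^esub> cls n)"
      using tau_triple_down[OF char p H n _ Hom_add_iota_inv[OF char H(2)] _ H(1)] by (simp add: at iota_inv_def)
  next
    assume "cls n \<in> Wt1 \<and> 1 \<le> len (cls n)"
    then have "- l \<le> 0" "- l \<noteq> 0 \<or> (- c0) (1 + pZ) = 0" using W by auto
    then show "\<tau> (cls (srefl True)) \<cdot> triple cm c0 cp (cls n) = triple (- cp) (- c0) 0 (cls (srefl True) \<otimes>\<^bsub>Wt\<^esub> cls n)"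
      using tau_triple_up[OF char H' n'] by (simp only: at)
  next
    assume "cls n \<in> Wt0 \<and> 2 \<le> len (cls n)"
    then have "- l \<ge> 2" using W by auto
    then show "\<tau> (cls (srefl True)) \<cdot> triple cm c0 cp (cls n) =
         e_id 0 \<cdot> triple (- cm) (- c0) (- cp) (cls n)
         \<boxplus> e_id (- 1) \<cdot> triple 0 (\<lambda>u. 2 * cp (\<iota> u)) 0 (cls n)
         \<boxplus> triple (- cp) 0 0 (cls (srefl True) \<otimes>\<^bsub>Wt\<^esub> cls n)"
      using tau_triple_down_long[OF char p H' n'] by (simp only: at)
  next
    assume "cls n \<in> Wt0 \<and> len (cls n) = 1"
    then have "- l = 1" using W by auto
    moreover have "(\<lambda>x. - c0 (\<iota>\<^sub>i\<^sub>n\<^sub>v x)) \<in> Hom_add" using Hom_add_iota_inv[OF char H'(2)] by simp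
    ultimately have "\<tau> (cls (srefl True)) \<cdot> triple_at True cp (- c0) cm (cls n) =
         e_id 0 \<cdot> triple_at True (- cp) (- (- c0)) (- cm) (cls n)
         \<boxplus> e_id (if True then - 1 else 1) \<cdot> triple_at True 0 (\<lambda>u. - 2 * cp (\<iota> u)) (\<lambda>x. - c0 (\<iota>\<^sub>i\<^sub>n\<^sub>v x)) (cls n)
         \<boxplus> e_id (if True then - 2 else 2) \<cdot> triple_at True 0 0 cp (cls n)
         \<boxplus> triple_at True 0 0 (- cp) (cls (srefl True) \<otimes>\<^bsub>Wt\<^esub> cls n)"
      by (intro tau_triple_down[OF char p H' n'] H'(1)) (simp_all add: iota_inv_def)
    then show "\<tau> (cls (srefl True)) \<cdot> triple cm c0 cp (cls n) =
         e_id 0 \<cdot> triple (- cm) (- c0) (- cp) (cls n)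
         \<boxplus> e_id (- 1) \<cdot> triple (\<lambda>x. - c0 (\<iota>\<^sub>i\<^sub>n\<^sub>v x)) (\<lambda>u. 2 * cp (\<iota> u)) 0 (cls n)
         \<boxplus> e_id (- 2) \<cdot> triple cp 0 0 (cls n)
         \<boxplus> triple (- cp) 0 0 (cls (srefl True) \<otimes>\<^bsub>Wt\<^esub> cls n)"
      by (simp only: at)
  next
    obtain t where t: "t \<in> torus0" "\<omega> = cls t" using assms(5) by (auto simp: \<Omega>_def)
    have t0: "level e t 0" for e using t(1) by (simp add: level_torus0_iff)
    have "triple_at False cm 0 cp \<omega> = triple cm 0 cp \<omega>" "triple_at True cp 0 cm \<omega> = triple cm 0 cp \<omega>"
      by (simp_all only: at)
    then show "\<tau> (cls (srefl False)) \<cdot> triple cm 0 cp \<omega> = triple 0 0 (- cm) (cls (srefl False) \<otimes>\<^bsub>Wt\<^esub> \<omega>)"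
      "\<tau> (cls (srefl True)) \<cdot> triple cm 0 cp \<omega> = triple (- cp) 0 0 (cls (srefl True) \<otimes>\<^bsub>Wt\<^esub> \<omega>)"
      using tau_triple_up[OF char H(1) Hom_mult_0 H(3) t0[of False]] tau_triple_up[OF char H(3) Hom_mult_0 H(1) t0[of True]]
      by (simp_all add: t(2) at)
  qed
qed

end
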